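(* Let $X$ be a smooth manifold of dimension $2n$, let $I \subseteq C^\infty(X)$ be a projective divisor ideal, and let $\pi$ be a Poisson structure on $X$ of $I$-divisor-type. Let $TX_I \to X$ be the ideal Lie algebroid associated to $I$, and assume that the dual bundle $TX_I^*$ admits, locally around every point of $X$, a basis of sections that are closed for the Lie algebroid differential $d_{TX_I}$. Then $\pi$ is of $TX_I$-type. Moreover, $\pi$ is of nondegenerate $TX_I$-type if and only if $I$ is standard, i.e. the divisor ideal of $TX_I$ satisfies $I_{TX_I} = I$.
   Context: Divisors. A divisor on $X$ is a pair $(U,\sigma)$ of a real line bundle $U \to X$ and a section $\sigma \in \Gamma(U)$ whose zero set is nowhere dense; its divisor ideal is $I_\sigma := \sigma(\Gamma(U^* )) \subseteq C^\infty(X)$. Equivalently, a divisor ideal is (the global sections of) a locally principal ideal sheaf in the sheaf of smooth functions whose local generators have nowhere dense zero sets. Projectivity. "Projective" for a module of sections always means locally finitely generated projective, i.e. it is isomorphic to $\Gamma(E)$ for some vector bundle $E$. Ideal Lie algebroid. For a divisor ideal $I$ put $\Gamma(TX)_I := \{V \in \Gamma(TX) : \mathcal{L}_V I \subseteq I\}$, an involutive submodule (understood at the level of sheaves of local sections). $I$ is called projective if $\Gamma(TX)_I$ is projective; then $TX_I \to X$ denotes the unique Lie algebroid with $\Gamma(TX_I) \cong \Gamma(TX)_I$, with anchor $\rho_{TX_I}: TX_I \to TX$ induced by the inclusion of sections and bracket the Lie bracket of vector fields. The anchor is an isomorphism on an open dense set, and $(\det(TX_I^* ) \otimes \det(TX),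 \det(\rho_{TX_I}))$ is a divisor, whose divisor ideal is denoted $I_{TX_I}$. Poisson structures. A Poisson structure $\pi$ on the $2n$-dimensional manifold $X$ is of $I$-divisor-type if $(\det(TX), \wedge^n \pi)$ is a divisor with divisor ideal equal to $I$. For a Lie algebroid $\mathcal{A} \to X$ with anchor $\rho_{\mathcal{A}}$, an $\mathcal{A}$-Poisson structure is $\pi_{\mathcal{A}} \in \Gamma(\wedge^2 \mathcal{A})$ with $[\pi_{\mathcal{A}}, \pi_{\mathcal{A}}]_{\mathcal{A}} = 0$ for the Schouten bracket. $\pi$ is of $\mathcal{A}$-type if there is an $\mathcal{A}$-Poisson structure $\pi_{\mathcal{A}}$ (an $\mathcal{A}$-lift) with $\rho_{\mathcal{A}}(\pi_{\mathcal{A}}) = \pi$, and of nondegenerate $\mathcal{A}$-type if there is such a lift for which $\pi_{\mathcal{A}}^\sharp: \mathcal{A}^* \to \mathcal{A}$ is an isomorphism. *)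

theory Defs
  imports "HOL-Analysis.Analysis" "HOL-Library.Function_Algebras"
begin

section \<open>Function spaces as real vector spaces\<close>

instantiation "fun" :: (type, real_vector) real_vector
begin

definition scaleR_fun :: "real \<Rightarrow> ('a \<Rightarrow> 'b) \<Rightarrow> 'a \<Rightarrow> 'b"
  where "scaleR_fun r f = (\<lambda>x. r *\<^sub>R f x)"

instance
  by standard
    (auto simp: scaleR_fun_def plus_fun_def fun_eq_iff scaleR_add_right scaleR_add_left)

end

text \<open>Ordered bases, given as lists.\<close>

definition basis_of :: "'e::real_vector list \<Rightarrow> 'e set \<Rightarrow> bool"
  where "basis_of vs S \<longleftrightarrow> distinct vs \<and> independent (set vs) \<and> span (set vs) = S"


section \<open>Smooth manifolds\<close>

primrec Ck_on :: "nat \<Rightarrow> 'a::euclidean_space set \<Rightarrow> ('a \<Rightarrow> 'b::real_normed_vector) \<Rightarrow> bool"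
  where
    "Ck_on 0 S f \<longleftrightarrow> continuous_on S f"
  | "Ck_on (Suc k) S f \<longleftrightarrow> f differentiable_on S \<and>
       (\<forall>v\<in>Basis. Ck_on k S (\<lambda>x. frechet_derivative f (at x) v))"

text \<open>Only used on open sets \<open>S\<close>.\<close>

definition smooth_on :: "'a::euclidean_space set \<Rightarrow> ('a \<Rightarrow> 'b::real_normed_vector) \<Rightarrow> bool"
  where "smooth_on S f \<longleftrightarrow> (\<forall>k. Ck_on k S f)"

type_synonym ('p, 'd) atlas = "('p set \<times> ('p \<Rightarrow> real ^ 'd)) set"

text \<open>A smooth structure on the whole space \<open>'p\<close>; the classes of \<open>'p\<close> provide the Hausdorff
  property and second countability. The dimension is \<open>CARD('d)\<close>. The atlas need not be maximal.\<close>

definition smooth_manifold ::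
  "('p::{t2_space, second_countable_topology}, 'd::finite) atlas \<Rightarrow> bool"
  where "smooth_manifold M \<longleftrightarrow>
    (\<Union>(U, \<phi>)\<in>M. U) = UNIV \<and>
    (\<forall>(U, \<phi>)\<in>M. open U \<and> open (\<phi> ` U) \<and> homeomorphism U (\<phi> ` U) \<phi> (inv_into U \<phi>)) \<and>
    (\<forall>(U, \<phi>)\<in>M. \<forall>(V, \<psi>)\<in>M. smooth_on (\<phi> ` (U \<inter> V)) (\<psi> \<circ> inv_into U \<phi>))"

definition smooth_fun ::
  "('p::topological_space, 'd::finite) atlas \<Rightarrow> 'p set \<Rightarrow> ('p \<Rightarrow> real) \<Rightarrow> bool"
  where "smooth_fun M U f \<longleftrightarrow> (\<forall>(V, \<phi>)\<in>M. smooth_on (\<phi> ` (U \<inter> V)) (f \<circ> inv_into V \<phi>))"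

definition smooth_near ::
  "('p::topological_space, 'd::finite) atlas \<Rightarrow> 'p \<Rightarrow> ('p \<Rightarrow> real) \<Rightarrow> bool"
  where "smooth_near M x f \<longleftrightarrow> (\<exists>U. open U \<and> x \<in> U \<and> smooth_fun M U f)"


section \<open>Vector bundles\<close>

text \<open>The fibres are subspaces of one vector space \<open>'e\<close>; fibres over distinct points are not
  identified with each other, i.e. the total space is \<open>Sigma UNIV (fibre E)\<close>. The smooth structure
  is given by a family of local frames (equivalently, local trivialisations) over open sets with
  smooth transition matrices. The rank may depend on the connected component. A section is a
  function on \<open>'p\<close>, of which only the values on the open set under consideration matter.\<close>

record ('p, 'e) vbundle =
  fibre :: "'p \<Rightarrow> 'e set"
  frames :: "('p set \<times> ('p \<Rightarrow> 'e) list) set"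

definition sections ::
  "('p::topological_space, 'd::finite) atlas \<Rightarrow> ('p, 'e::real_vector, 'z) vbundle_scheme
    \<Rightarrow> 'p set \<Rightarrow> ('p \<Rightarrow> 'e) set"
  where "sections M E U = {s. (\<forall>x\<in>U. s x \<in> fibre E x) \<and>
    (\<forall>(V, es)\<in>frames E. \<exists>c. (\<forall>i<length es. smooth_fun M (U \<inter> V) (c i)) \<and>
       (\<forall>x\<in>U \<inter> V. s x = (\<Sum>i<length es. c i x *\<^sub>R (es ! i) x)))}"

definition vector_bundle ::
  "('p::topological_space, 'd::finite) atlas \<Rightarrow> ('p, 'e::real_vector, 'z) vbundle_scheme \<Rightarrow> bool"
  where "vector_bundle M E \<longleftrightarrow>
    (\<Union>(U, es)\<in>frames E. U) = UNIV \<and>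
    (\<forall>(U, es)\<in>frames E. open U \<and> (\<forall>x\<in>U. basis_of (map (\<lambda>e. e x) es) (fibre E x)) \<and>
       set es \<subseteq> sections M E U)"

definition local_frame ::
  "('p::topological_space, 'd::finite) atlas \<Rightarrow> ('p, 'e::real_vector, 'z) vbundle_scheme
    \<Rightarrow> 'p set \<Rightarrow> ('p \<Rightarrow> 'e) list \<Rightarrow> bool"
  where "local_frame M E U es \<longleftrightarrow>
    set es \<subseteq> sections M E U \<and> (\<forall>x\<in>U. basis_of (map (\<lambda>e. e x) es) (fibre E x))"

definition line_bundle ::
  "('p::topological_space, 'd::finite) atlas \<Rightarrow> ('p, 'e::real_vector, 'z) vbundle_scheme \<Rightarrow> bool"
  where "line_bundle M L \<longleftrightarrow> vector_bundle M L \<and> (\<forall>(U, es)\<in>frames L. length es = 1)"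

subsection \<open>Constructions\<close>

text \<open>Maps defined on a fibre (linear maps, multilinear forms) are represented by functions that
  vanish outside their proper domain, so that equality of maps is equality of functions.\<close>

definition hom_fibre :: "'e::real_vector set \<Rightarrow> 'f::real_vector set \<Rightarrow> ('e \<Rightarrow> 'f) set"
  where "hom_fibre S T = {L. (\<forall>v\<in>S. L v \<in> T) \<and> (\<forall>v. v \<notin> S \<longrightarrow> L v = 0) \<and>
    (\<forall>v\<in>S. \<forall>w\<in>S. \<forall>a b. L (a *\<^sub>R v + b *\<^sub>R w) = a *\<^sub>R L v + b *\<^sub>R L w)}"

text \<open>The frame \<open>e\<^sub>i\<^sup>* \<otimes> f\<^sub>j\<close>, where \<open>representation\<close> computes the coordinates in a basis (and is \<open>0\<close>
  outside its span).\<close>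

definition hom_bundle ::
  "('p, 'e::real_vector, 'y) vbundle_scheme \<Rightarrow> ('p, 'f::real_vector, 'z) vbundle_scheme
    \<Rightarrow> ('p, 'e \<Rightarrow> 'f) vbundle"
  where "hom_bundle E F =
    \<lparr>fibre = (\<lambda>x. hom_fibre (fibre E x) (fibre F x)),
     frames = {(U \<inter> V,
         [\<lambda>x v. representation (set (map (\<lambda>e'. e' x) es)) v (e x) *\<^sub>R f x. e \<leftarrow> es, f \<leftarrow> fs]) |
       U V es fs. (U, es) \<in> frames E \<and> (V, fs) \<in> frames F}\<rparr>"

definition trivial_line :: "('p, real) vbundle"
  where "trivial_line = \<lparr>fibre = (\<lambda>x. UNIV), frames = {(UNIV, [\<lambda>x. 1])}\<rparr>"

definition dual_bundle ::
  "('p, 'e::real_vector, 'z) vbundle_scheme \<Rightarrow> ('p, 'e \<Rightarrow> real) vbundle"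
  where "dual_bundle E = hom_bundle E trivial_line"

text \<open>Exterior powers: elements of \<open>\<And>\<^sup>k E\<^sub>x\<close> are alternating \<open>k\<close>-linear forms on \<open>E\<^sub>x\<^sup>*\<close>, with
  arguments collected in a list. The wedge of vectors is normalised so that
  \<open>(v\<^sub>1 \<and> \<dots> \<and> v\<^sub>k)(\<xi>\<^sub>1, \<dots>, \<xi>\<^sub>k) = det (\<xi>\<^sub>j v\<^sub>i)\<close>.\<close>

definition ext_fibre :: "nat \<Rightarrow> 'e::real_vector set \<Rightarrow> (('e \<Rightarrow> real) list \<Rightarrow> real) set"
  where "ext_fibre k S = {w.
    (\<forall>\<xi>s. \<not> (length \<xi>s = k \<and> set \<xi>s \<subseteq> hom_fibre S UNIV) \<longrightarrow> w \<xi>s = 0) \<and>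
    (\<forall>\<xi>s. \<not> distinct \<xi>s \<longrightarrow> w \<xi>s = 0) \<and>
    (\<forall>\<xi>s i \<alpha> \<beta> a b. length \<xi>s = k \<and> set \<xi>s \<subseteq> hom_fibre S UNIV \<and> i < k \<and>
       \<alpha> \<in> hom_fibre S UNIV \<and> \<beta> \<in> hom_fibre S UNIV \<longrightarrow>
       w (\<xi>s[i := a *\<^sub>R \<alpha> + b *\<^sub>R \<beta>]) = a * w (\<xi>s[i := \<alpha>]) + b * w (\<xi>s[i := \<beta>]))}"

definition wedge ::
  "('p, 'e::real_vector, 'z) vbundle_scheme \<Rightarrow> ('p \<Rightarrow> 'e) list
    \<Rightarrow> 'p \<Rightarrow> ('e \<Rightarrow> real) list \<Rightarrow> real"
  where "wedge E es x \<xi>s =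
    (if length \<xi>s = length es \<and> set \<xi>s \<subseteq> fibre (dual_bundle E) x
     then \<Sum>p | p permutes {..<length es}.
            of_int (sign p) * (\<Prod>i<length es. (\<xi>s ! p i) ((es ! i) x))
     else 0)"

text \<open>The frame \<open>e\<^sub>i\<^sub>1 \<and> \<dots> \<and> e\<^sub>i\<^sub>k\<close> with \<open>i\<^sub>1 < \<dots> < i\<^sub>k\<close>.\<close>

definition ext_power ::
  "nat \<Rightarrow> ('p, 'e::real_vector, 'z) vbundle_scheme \<Rightarrow> ('p, ('e \<Rightarrow> real) list \<Rightarrow> real) vbundle"
  where "ext_power k E =
    \<lparr>fibre = (\<lambda>x. ext_fibre k (fibre E x)),
     frames = {(U, map (wedge E) (filter (\<lambda>fs. length fs = k) (subseqs es))) |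
       U es. (U, es) \<in> frames E}\<rparr>"

definition det_bundle ::
  "('p, 'e::real_vector, 'z) vbundle_scheme \<Rightarrow> ('p, ('e \<Rightarrow> real) list \<Rightarrow> real) vbundle"
  where "det_bundle E =
    \<lparr>fibre = (\<lambda>x. ext_fibre (dim (fibre E x)) (fibre E x)),
     frames = {(U, [wedge E es]) | U es. (U, es) \<in> frames E}\<rparr>"

text \<open>The map \<open>\<And>\<^sup>k E\<^sub>x \<rightarrow> \<And>\<^sup>k F\<^sub>x\<close> induced by a bundle map \<open>\<rho>\<close>, for all \<open>k\<close> at once; \<open>\<xi> \<circ> \<rho> x\<close> is the
  pullback of the covector \<open>\<xi>\<close>.\<close>

definition ext_map ::
  "('p, 'f::real_vector, 'z) vbundle_scheme \<Rightarrow> ('p \<Rightarrow> 'e::real_vector \<Rightarrow> 'f)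
    \<Rightarrow> 'p \<Rightarrow> (('e \<Rightarrow> real) list \<Rightarrow> real) \<Rightarrow> ('f \<Rightarrow> real) list \<Rightarrow> real"
  where "ext_map F \<rho> x w = (\<lambda>\<xi>s.
    if set \<xi>s \<subseteq> fibre (dual_bundle F) x then w (map (\<lambda>\<xi>. \<xi> \<circ> \<rho> x) \<xi>s) else 0)"

text \<open>The section \<open>det \<rho>\<close> of \<open>Hom(det E, det F) = det E\<^sup>* \<otimes> det F\<close>, for \<open>E\<close> and \<open>F\<close> of equal rank.\<close>

definition det_map ::
  "('p, 'e::real_vector, 'y) vbundle_scheme \<Rightarrow> ('p, 'f::real_vector, 'z) vbundle_scheme
    \<Rightarrow> ('p \<Rightarrow> 'e \<Rightarrow> 'f) \<Rightarrow> 'p \<Rightarrow> (('e \<Rightarrow> real) list \<Rightarrow> real) \<Rightarrow> ('f \<Rightarrow> real) list \<Rightarrow> real"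
  where "det_map E F \<rho> x w =
    (if w \<in> fibre (det_bundle E) x then ext_map F \<rho> x w else 0)"

text \<open>The power \<open>\<And>\<^sup>n \<pi>\<close> of a bivector field:
  \<open>(\<And>\<^sup>n \<pi>)(\<xi>\<^sub>0, \<dots>, \<xi>\<^sub>2\<^sub>n\<^sub>-\<^sub>1) = 2\<^sup>-\<^sup>n \<Sum>\<^sub>p sgn(p) \<pi>(\<xi>\<^sub>p\<^sub>0, \<xi>\<^sub>p\<^sub>1) \<dots> \<pi>(\<xi>\<^sub>p\<^sub>(\<^sub>2\<^sub>n\<^sub>-\<^sub>2\<^sub>), \<xi>\<^sub>p\<^sub>(\<^sub>2\<^sub>n\<^sub>-\<^sub>1\<^sub>))\<close>.\<close>

definition bivector_power ::
  "nat \<Rightarrow> ('p, 'e::real_vector, 'z) vbundle_scheme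
    \<Rightarrow> ('p \<Rightarrow> ('e \<Rightarrow> real) list \<Rightarrow> real) \<Rightarrow> 'p \<Rightarrow> ('e \<Rightarrow> real) list \<Rightarrow> real"
  where "bivector_power n E \<pi> x \<xi>s =
    (if length \<xi>s = 2 * n \<and> set \<xi>s \<subseteq> fibre (dual_bundle E) x
     then (\<Sum>p | p permutes {..<2 * n}.
             of_int (sign p) * (\<Prod>i<n. \<pi> x [\<xi>s ! p (2 * i), \<xi>s ! p (2 * i + 1)])) / 2 ^ n
     else 0)"


section \<open>The tangent bundle\<close>

text \<open>Tangent vectors at \<open>x\<close> are the derivations at \<open>x\<close> of the algebra of germs of smooth functions;
  a germ is represented by any function that is smooth near \<open>x\<close>. (The Leibniz rule with indicator
  functions of neighbourhoods shows that such a derivation only depends on the germ.)\<close>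

definition tangent_space ::
  "('p::topological_space, 'd::finite) atlas \<Rightarrow> 'p \<Rightarrow> (('p \<Rightarrow> real) \<Rightarrow> real) set"
  where "tangent_space M x = {v.
    (\<forall>f. \<not> smooth_near M x f \<longrightarrow> v f = 0) \<and>
    (\<forall>f g a b. smooth_near M x f \<and> smooth_near M x g \<longrightarrow>
       v (\<lambda>y. a * f y + b * g y) = a * v f + b * v g) \<and>
    (\<forall>f g. smooth_near M x f \<and> smooth_near M x g \<longrightarrow>
       v (\<lambda>y. f y * g y) = v f * g x + f x * v g)}"

definition coord_field ::
  "('p::topological_space, 'd::finite) atlas \<Rightarrow> 'p set \<Rightarrow> ('p \<Rightarrow> real ^ 'd)
    \<Rightarrow> 'd \<Rightarrow> 'p \<Rightarrow> ('p \<Rightarrow> real) \<Rightarrow> real"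
  where "coord_field M U \<phi> i x f =
    (if smooth_near M x f
     then frechet_derivative (f \<circ> inv_into U \<phi>) (at (\<phi> x)) (axis i 1) else 0)"

text \<open>The index type \<open>'d\<close> carries no order, so the coordinate frames are taken in every order.\<close>

definition tangent_bundle ::
  "('p::topological_space, 'd::finite) atlas \<Rightarrow> ('p, ('p \<Rightarrow> real) \<Rightarrow> real) vbundle"
  where "tangent_bundle M =
    \<lparr>fibre = tangent_space M,
     frames = {(U, map (coord_field M U \<phi>) js) |
       U \<phi> js. (U, \<phi>) \<in> M \<and> distinct js \<and> set js = UNIV}\<rparr>"

definition lie_bracket ::
  "('p::topological_space, 'd::finite) atlas \<Rightarrow> ('p \<Rightarrow> ('p \<Rightarrow> real) \<Rightarrow> real)
    \<Rightarrow> ('p \<Rightarrow> ('p \<Rightarrow> real) \<Rightarrow> real) \<Rightarrow> 'p \<Rightarrow> ('p \<Rightarrow> real) \<Rightarrow> real"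
  where "lie_bracket M V W x f =
    (if smooth_near M x f then V x (\<lambda>y. W y f) - W x (\<lambda>y. V y f) else 0)"


section \<open>Lie algebroids\<close>

record ('p, 'e) lie_algebroid = "('p, 'e) vbundle" +
  anchor :: "'p \<Rightarrow> 'e \<Rightarrow> ('p \<Rightarrow> real) \<Rightarrow> real"
  bracket :: "('p \<Rightarrow> 'e) \<Rightarrow> ('p \<Rightarrow> 'e) \<Rightarrow> 'p \<Rightarrow> 'e"

definition is_lie_algebroid ::
  "('p::topological_space, 'd::finite) atlas \<Rightarrow> ('p, 'e::real_vector) lie_algebroid \<Rightarrow> bool"
  where "is_lie_algebroid M A \<longleftrightarrow>
    vector_bundle M A \<and>
    anchor A \<in> sections M (hom_bundle A (tangent_bundle M)) UNIV \<and>
    (\<forall>a\<in>sections M A UNIV. \<forall>b\<in>sections M A UNIV.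
       bracket A a b \<in> sections M A UNIV \<and>
       bracket A a b = - bracket A b a \<and>
       (\<forall>c\<in>sections M A UNIV.
          (\<forall>r s. bracket A a (r *\<^sub>R b + s *\<^sub>R c) = r *\<^sub>R bracket A a b + s *\<^sub>R bracket A a c) \<and>
          bracket A a (bracket A b c) + bracket A b (bracket A c a)
            + bracket A c (bracket A a b) = 0) \<and>
       (\<forall>f. smooth_fun M UNIV f \<longrightarrow>
          bracket A a (\<lambda>x. f x *\<^sub>R b x) =
            (\<lambda>x. f x *\<^sub>R bracket A a b x + anchor A x (a x) f *\<^sub>R b x)))"

definition tangent_algebroid ::
  "('p::topological_space, 'd::finite) atlas \<Rightarrow> ('p, ('p \<Rightarrow> real) \<Rightarrow> real) lie_algebroid"
  where "tangent_algebroid M =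
    \<lparr>fibre = fibre (tangent_bundle M), frames = frames (tangent_bundle M),
     anchor = (\<lambda>x v. if v \<in> tangent_space M x then v else 0), bracket = lie_bracket M\<rparr>"

text \<open>The value at \<open>x\<close> of \<open>d\<^sub>A \<alpha> (a, b)\<close>, for a section \<open>\<alpha>\<close> of \<open>A\<^sup>*\<close> defined near \<open>x\<close>.\<close>

definition algebroid_d ::
  "('p, 'e::real_vector) lie_algebroid \<Rightarrow> ('p \<Rightarrow> 'e \<Rightarrow> real)
    \<Rightarrow> ('p \<Rightarrow> 'e) \<Rightarrow> ('p \<Rightarrow> 'e) \<Rightarrow> 'p \<Rightarrow> real"
  where "algebroid_d A \<alpha> a b x =
    anchor A x (a x) (\<lambda>y. \<alpha> y (b y)) - anchor A x (b x) (\<lambda>y. \<alpha> y (a y)) - \<alpha> x (bracket A a b x)"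

text \<open>The bracket is an operation on global sections; testing \<open>d\<^sub>A \<alpha>\<close> on global sections suffices,
  since their values exhaust every fibre.\<close>

definition closed_on ::
  "('p::topological_space, 'd::finite) atlas \<Rightarrow> ('p, 'e::real_vector) lie_algebroid
    \<Rightarrow> 'p set \<Rightarrow> ('p \<Rightarrow> 'e \<Rightarrow> real) \<Rightarrow> bool"
  where "closed_on M A U \<alpha> \<longleftrightarrow>
    (\<forall>a\<in>sections M A UNIV. \<forall>b\<in>sections M A UNIV. \<forall>x\<in>U. algebroid_d A \<alpha> a b x = 0)"

subsection \<open>Poisson structures\<close>

text \<open>\<open>P\<^sup>\<sharp> \<alpha>\<close>, characterised by \<open>\<beta> (P\<^sup>\<sharp> \<alpha>) = P (\<alpha>, \<beta>)\<close>.\<close>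

definition sharp ::
  "('p, 'e::real_vector, 'z) vbundle_scheme \<Rightarrow> ('p \<Rightarrow> ('e \<Rightarrow> real) list \<Rightarrow> real)
    \<Rightarrow> 'p \<Rightarrow> ('e \<Rightarrow> real) \<Rightarrow> 'e"
  where "sharp E P x \<alpha> =
    (THE a. a \<in> fibre E x \<and> (\<forall>\<beta>\<in>fibre (dual_bundle E) x. \<beta> a = P x [\<alpha>, \<beta>]))"

text \<open>The Schouten bracket of two bivectors, evaluated on sections of \<open>A\<^sup>*\<close>. In the convention
  \<open>[X\<^sub>1 \<and> X\<^sub>2, Y\<^sub>1 \<and> Y\<^sub>2] = \<Sum>\<^sub>i\<^sub>j (-1)\<^sup>i\<^sup>+\<^sup>j [X\<^sub>i, Y\<^sub>j] \<and> X\<^sub>3\<^sub>-\<^sub>i \<and> Y\<^sub>3\<^sub>-\<^sub>j\<close> one has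
  \<open>[P, Q](\<alpha>, \<beta>, \<gamma>) = \<Sum>\<^sub>c\<^sub>y\<^sub>c \<rho>(P\<^sup>\<sharp>\<alpha>) Q(\<beta>, \<gamma>) - d\<alpha>(P\<^sup>\<sharp>\<beta>, Q\<^sup>\<sharp>\<gamma>) + (P \<leftrightarrow> Q)\<close>; for
  \<open>A = TX\<close>, \<open>P = Q\<close> and exact \<open>\<alpha>, \<beta>, \<gamma>\<close> this is twice the Jacobiator of the bracket \<open>P(df, dg)\<close>.\<close>

definition schouten_half ::
  "('p, 'e::real_vector) lie_algebroid \<Rightarrow> ('p \<Rightarrow> ('e \<Rightarrow> real) list \<Rightarrow> real)
    \<Rightarrow> ('p \<Rightarrow> ('e \<Rightarrow> real) list \<Rightarrow> real)
    \<Rightarrow> ('p \<Rightarrow> 'e \<Rightarrow> real) \<Rightarrow> ('p \<Rightarrow> 'e \<Rightarrow> real) \<Rightarrow> ('p \<Rightarrow> 'e \<Rightarrow> real) \<Rightarrow> 'p \<Rightarrow> real"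
  where "schouten_half A P Q \<alpha> \<beta> \<gamma> x =
    anchor A x (sharp A P x (\<alpha> x)) (\<lambda>y. Q y [\<beta> y, \<gamma> y])
      - algebroid_d A \<alpha> (\<lambda>y. sharp A P y (\<beta> y)) (\<lambda>y. sharp A Q y (\<gamma> y)) x"

definition schouten ::
  "('p, 'e::real_vector) lie_algebroid \<Rightarrow> ('p \<Rightarrow> ('e \<Rightarrow> real) list \<Rightarrow> real)
    \<Rightarrow> ('p \<Rightarrow> ('e \<Rightarrow> real) list \<Rightarrow> real)
    \<Rightarrow> ('p \<Rightarrow> 'e \<Rightarrow> real) \<Rightarrow> ('p \<Rightarrow> 'e \<Rightarrow> real) \<Rightarrow> ('p \<Rightarrow> 'e \<Rightarrow> real) \<Rightarrow> 'p \<Rightarrow> real"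
  where "schouten A P Q \<alpha> \<beta> \<gamma> x =
    schouten_half A P Q \<alpha> \<beta> \<gamma> x + schouten_half A P Q \<beta> \<gamma> \<alpha> x + schouten_half A P Q \<gamma> \<alpha> \<beta> x +
    schouten_half A Q P \<alpha> \<beta> \<gamma> x + schouten_half A Q P \<beta> \<gamma> \<alpha> x + schouten_half A Q P \<gamma> \<alpha> \<beta> x"

definition poisson ::
  "('p::topological_space, 'd::finite) atlas \<Rightarrow> ('p, 'e::real_vector) lie_algebroid
    \<Rightarrow> ('p \<Rightarrow> ('e \<Rightarrow> real) list \<Rightarrow> real) \<Rightarrow> bool"
  where "poisson M A \<pi> \<longleftrightarrow>
    \<pi> \<in> sections M (ext_power 2 A) UNIV \<and>
    (\<forall>\<alpha>\<in>sections M (dual_bundle A) UNIV. \<forall>\<beta>\<in>sections M (dual_bundle A) UNIV.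
     \<forall>\<gamma>\<in>sections M (dual_bundle A) UNIV. \<forall>x. schouten A \<pi> \<pi> \<alpha> \<beta> \<gamma> x = 0)"

definition is_lift ::
  "('p::topological_space, 'd::finite) atlas \<Rightarrow> ('p, 'e::real_vector) lie_algebroid
    \<Rightarrow> ('p \<Rightarrow> ('e \<Rightarrow> real) list \<Rightarrow> real)
    \<Rightarrow> ('p \<Rightarrow> ((('p \<Rightarrow> real) \<Rightarrow> real) \<Rightarrow> real) list \<Rightarrow> real) \<Rightarrow> bool"
  where "is_lift M A \<pi>A \<pi> \<longleftrightarrow>
    poisson M A \<pi>A \<and> (\<forall>x. ext_map (tangent_bundle M) (anchor A) x (\<pi>A x) = \<pi> x)"

definition of_algebroid_type ::
  "('p::topological_space, 'd::finite) atlas \<Rightarrow> ('p, 'e::real_vector) lie_algebroid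
    \<Rightarrow> ('p \<Rightarrow> ((('p \<Rightarrow> real) \<Rightarrow> real) \<Rightarrow> real) list \<Rightarrow> real) \<Rightarrow> bool"
  where "of_algebroid_type M A \<pi> \<longleftrightarrow> (\<exists>\<pi>A. is_lift M A \<pi>A \<pi>)"

definition of_nondegenerate_algebroid_type ::
  "('p::topological_space, 'd::finite) atlas \<Rightarrow> ('p, 'e::real_vector) lie_algebroid
    \<Rightarrow> ('p \<Rightarrow> ((('p \<Rightarrow> real) \<Rightarrow> real) \<Rightarrow> real) list \<Rightarrow> real) \<Rightarrow> bool"
  where "of_nondegenerate_algebroid_type M A \<pi> \<longleftrightarrow>
    (\<exists>\<pi>A. is_lift M A \<pi>A \<pi> \<and>
       (\<forall>x. bij_betw (sharp A \<pi>A x) (fibre (dual_bundle A) x) (fibre A x)))"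


section \<open>Divisors\<close>

definition divisor ::
  "('p::topological_space, 'd::finite) atlas \<Rightarrow> ('p, 'l::real_vector, 'z) vbundle_scheme
    \<Rightarrow> ('p \<Rightarrow> 'l) \<Rightarrow> bool"
  where "divisor M L \<sigma> \<longleftrightarrow>
    line_bundle M L \<and> \<sigma> \<in> sections M L UNIV \<and> interior (closure {x. \<sigma> x = 0}) = {}"

definition divisor_ideal ::
  "('p::topological_space, 'd::finite) atlas \<Rightarrow> ('p, 'l::real_vector, 'z) vbundle_scheme
    \<Rightarrow> ('p \<Rightarrow> 'l) \<Rightarrow> ('p \<Rightarrow> real) set"
  where "divisor_ideal M L \<sigma> = (\<lambda>\<tau> x. \<tau> x (\<sigma> x)) ` sections M (dual_bundle L) UNIV"

text \<open>The type argument only says where the fibres of the line bundle live.\<close>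

definition is_divisor_ideal ::
  "'l::real_vector itself \<Rightarrow> ('p::topological_space, 'd::finite) atlas
    \<Rightarrow> ('p \<Rightarrow> real) set \<Rightarrow> bool"
  where "is_divisor_ideal (_ :: 'l itself) M I \<longleftrightarrow>
    (\<exists>(L :: ('p, 'l) vbundle) \<sigma>. divisor M L \<sigma> \<and> I = divisor_ideal M L \<sigma>)"

definition of_divisor_type ::
  "('p::topological_space, 'd::finite) atlas \<Rightarrow> nat \<Rightarrow> ('p \<Rightarrow> real) set
    \<Rightarrow> ('p \<Rightarrow> ((('p \<Rightarrow> real) \<Rightarrow> real) \<Rightarrow> real) list \<Rightarrow> real) \<Rightarrow> bool"
  where "of_divisor_type M n I \<pi> \<longleftrightarrow>
    divisor M (det_bundle (tangent_bundle M)) (bivector_power n (tangent_bundle M) \<pi>) \<and>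
    divisor_ideal M (det_bundle (tangent_bundle M)) (bivector_power n (tangent_bundle M) \<pi>) = I"

text \<open>The sheaf generated by an ideal of global functions.\<close>

definition ideal_sheaf ::
  "('p::topological_space, 'd::finite) atlas \<Rightarrow> ('p \<Rightarrow> real) set \<Rightarrow> 'p set \<Rightarrow> ('p \<Rightarrow> real) set"
  where "ideal_sheaf M I U = {f. smooth_fun M U f \<and>
    (\<forall>x\<in>U. \<exists>W g. open W \<and> x \<in> W \<and> g \<in> I \<and> (\<forall>y\<in>W. f y = g y))}"

text \<open>The vector fields \<open>V\<close> on \<open>U\<close> whose Lie derivative preserves the ideal sheaf.\<close>

definition ideal_vector_fields ::
  "('p::topological_space, 'd::finite) atlas \<Rightarrow> ('p \<Rightarrow> real) set \<Rightarrow> 'p set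
    \<Rightarrow> ('p \<Rightarrow> ('p \<Rightarrow> real) \<Rightarrow> real) set"
  where "ideal_vector_fields M I U = {V \<in> sections M (tangent_bundle M) U.
    \<forall>W f. open W \<and> W \<subseteq> U \<and> f \<in> ideal_sheaf M I W \<longrightarrow> (\<lambda>x. V x f) \<in> ideal_sheaf M I W}"

definition projective_module ::
  "'e::real_vector itself \<Rightarrow> ('p::topological_space, 'd::finite) atlas
    \<Rightarrow> ('p \<Rightarrow> 'v::real_vector) set \<Rightarrow> bool"
  where "projective_module (_ :: 'e itself) M S \<longleftrightarrow>
    (\<exists>(E :: ('p, 'e) vbundle) \<Phi>. vector_bundle M E \<and> bij_betw \<Phi> (sections M E UNIV) S \<and>
       (\<forall>s\<in>sections M E UNIV. \<forall>t\<in>sections M E UNIV. \<Phi> (s + t) = \<Phi> s + \<Phi> t) \<and>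
       (\<forall>s\<in>sections M E UNIV. \<forall>f. smooth_fun M UNIV f \<longrightarrow>
          \<Phi> (\<lambda>x. f x *\<^sub>R s x) = (\<lambda>x. f x *\<^sub>R \<Phi> s x)))"

definition projective_ideal ::
  "'e::real_vector itself \<Rightarrow> ('p::topological_space, 'd::finite) atlas
    \<Rightarrow> ('p \<Rightarrow> real) set \<Rightarrow> bool"
  where "projective_ideal T M I \<longleftrightarrow> projective_module T M (ideal_vector_fields M I UNIV)"

text \<open>\<open>A\<close> is the ideal Lie algebroid of \<open>I\<close>: on every open set, the anchor induces an isomorphism from
  the sections of \<open>A\<close> onto the vector fields preserving \<open>I\<close>, and the bracket is the Lie bracket.
  This determines \<open>A\<close> up to unique isomorphism.\<close>

definition ideal_lie_algebroid ::
  "('p::topological_space, 'd::finite) atlas \<Rightarrow> ('p \<Rightarrow> real) set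
    \<Rightarrow> ('p, 'e::real_vector) lie_algebroid \<Rightarrow> bool"
  where "ideal_lie_algebroid M I A \<longleftrightarrow>
    is_lie_algebroid M A \<and>
    (\<forall>U. open U \<longrightarrow>
       (\<forall>a\<in>sections M A U. (\<lambda>x. anchor A x (a x)) \<in> ideal_vector_fields M I U) \<and>
       (\<forall>a\<in>sections M A U. \<forall>b\<in>sections M A U.
          (\<forall>x\<in>U. anchor A x (a x) = anchor A x (b x)) \<longrightarrow> (\<forall>x\<in>U. a x = b x)) \<and>
       (\<forall>V\<in>ideal_vector_fields M I U. \<exists>a\<in>sections M A U. \<forall>x\<in>U. anchor A x (a x) = V x)) \<and>
    (\<forall>a\<in>sections M A UNIV. \<forall>b\<in>sections M A UNIV. \<forall>x.
       anchor A x (bracket A a b x) =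
         lie_bracket M (\<lambda>y. anchor A y (a y)) (\<lambda>y. anchor A y (b y)) x)"

text \<open>\<open>I\<^sub>A\<close>, the divisor ideal of \<open>(det A\<^sup>* \<otimes> det TX, det \<rho>\<^sub>A)\<close>.\<close>

definition algebroid_divisor_ideal ::
  "('p::topological_space, 'd::finite) atlas \<Rightarrow> ('p, 'e::real_vector) lie_algebroid
    \<Rightarrow> ('p \<Rightarrow> real) set"
  where "algebroid_divisor_ideal M A =
    divisor_ideal M (hom_bundle (det_bundle A) (det_bundle (tangent_bundle M)))
      (det_map A (tangent_bundle M) (anchor A))"

definition standard_ideal ::
  "('p::topological_space, 'd::finite) atlas \<Rightarrow> ('p \<Rightarrow> real) set
    \<Rightarrow> ('p, 'e::real_vector) lie_algebroid \<Rightarrow> bool"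
  where "standard_ideal M I A \<longleftrightarrow> algebroid_divisor_ideal M A = I"

end

theory Submission
  imports Defs
begin

text \<open>
  Write the top power of \<open>\<pi>\<close> in coordinates as \<open>f \<partial>\<^sub>1 \<and> \<dots> \<and> \<partial>\<^sub>2\<^sub>n\<close>, so that \<open>f\<close> locally generates \<open>I\<close>. If \<open>\<theta>\<close> is
  a closed one-form, then \<open>V = \<pi>\<^sup>\<sharp> \<theta>\<close> preserves \<open>\<pi>\<close>, hence \<open>V f = div(V) f\<close> and \<open>V\<close> preserves \<open>I\<close>.
  Applied to the coordinate differentials this lifts \<open>\<pi>\<^sup>\<sharp>\<close> to a map \<open>T\<^sup>*X \<rightarrow> A\<close>, whose dual sends a section
  \<open>\<alpha>\<close> of \<open>A\<^sup>*\<close> to a smooth vector field \<open>V\<^sub>\<alpha>\<close>. On the dense open set \<open>D\<close> off the closure of the degeneracy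
  locus, the anchor is invertible and \<open>V\<^sub>\<alpha> = \<pi>\<^sup>\<sharp>(\<alpha> \<circ> \<rho>\<^sup>-\<^sup>1)\<close>. For closed \<open>\<alpha>\<close> the field \<open>V\<^sub>\<alpha>\<close> therefore preserves
  \<open>\<pi>\<close> over \<open>D\<close>, by continuity everywhere, so it preserves \<open>I\<close> and lifts to \<open>A\<close>; closed local frames give the
  same for all \<open>\<alpha>\<close>. This defines \<open>\<pi>\<^sub>A\<close>, and all identities for it hold because they hold over \<open>D\<close>.

  For the second claim, \<open>\<And>\<^sup>n \<pi> = det(\<rho>) \<And>\<^sup>n \<pi>\<^sub>A\<close> reads \<open>f = g h\<close> in local frames, with \<open>g\<close> generating the ideal of
  \<open>A\<close>; so \<open>(f) = (g)\<close> iff \<open>h\<close> vanishes nowhere, i.e. iff \<open>\<pi>\<^sub>A\<close> is nondegenerate.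
\<close>

text \<open>Over \<open>D\<close> a closed \<alpha> corresponds to a closed one-form, but that form
  need not extend across the degeneracy locus, so V f = div(V) f cannot be read off from it there.
  What rescues the step is that the invariance of \<pi> in coordinates, V(\<pi>_ij) = \<Sum>k
  \<pi>_ik d_k V_j + \<pi>_kj d_k V_i, mentions only V and \<pi>. Both are smooth everywhere, so the
  identity passes to the closure, and linear algebra then gives V f = div(V) f: an endomorphism
  acting as a derivation multiplies the n-th power of a bivector by its trace. Passing from closed
  to arbitrary \<alpha> uses only equations V f = k f. They survive smooth linear combinations of
  fields; invariance of \<pi> does not. The bracket of \<open>A\<close>, closedness and the Poisson
  condition refer to global sections. Local sections are therefore extended by bump functions,
  whereas objects determined over \<open>D\<close> are glued by density, without partitions of
  unity. That h(x) \<noteq> 0 iff the lift is nondegenerate at x is the fact that a skew matrix is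
  invertible iff its Pfaffian is nonzero. It is proved by comparing symplectic bases at x and at a
  point of \<open>D\<close>, so no Pfaffian is evaluated.\<close>

section \<open>Smooth functions on open subsets of Euclidean space\<close>

lemma Ck_on_cong:
  assumes "open S" "\<And>x. x \<in> S \<Longrightarrow> f x = g x" "Ck_on k S f"
  shows "Ck_on k S g"
  using assms(2,3)
proof (induction k arbitrary: f g)
  case 0
  then show ?case using continuous_on_cong[of S S f g] by simp
next
  case (Suc k)
  have fd: "f differentiable (at x)" if "x \<in> S" for x
    using Suc.prems(2) that assms(1) differentiable_on_eq_differentiable_at by auto
  have eq: "frechet_derivative f (at x) = frechet_derivative g (at x)" if "x \<in> S" for x
    by (rule frechet_derivative_transform_within_open[OF fd[OF that] assms(1) that])
      (use Suc.prems(1) in auto)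
  have "g differentiable (at x)" if "x \<in> S" for x
    using fd[OF that] Suc.prems(1) has_derivative_transform_within_open[OF _ assms(1) that]
    unfolding differentiable_def by blast
  then have "g differentiable_on S"
    using assms(1) differentiable_on_eq_differentiable_at by blast
  moreover have "Ck_on k S (\<lambda>x. frechet_derivative g (at x) v)" if "v \<in> Basis" for v
    using Suc.IH[of "\<lambda>x. frechet_derivative f (at x) v"] Suc.prems(2) that eq by auto
  ultimately show ?case by simp
qed

lemma Ck_on_subset: "Ck_on k S f \<Longrightarrow> T \<subseteq> S \<Longrightarrow> Ck_on k T f"
  by (induction k arbitrary: f) (auto intro: continuous_on_subset differentiable_on_subset)

lemma Ck_on_SucD: "Ck_on (Suc k) S f \<Longrightarrow> Ck_on k S f"
  by (induction k arbitrary: f) (auto intro: differentiable_imp_continuous_on)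

lemma Ck_on_Suc_has_derivative:
  assumes "open S" "Ck_on (Suc k) S f" "x \<in> S"
  shows "(f has_derivative frechet_derivative f (at x)) (at x)"
proof -
  have "f differentiable (at x)"
    using assms differentiable_on_eq_differentiable_at[OF assms(1), of f] by auto
  then show ?thesis by (simp only: frechet_derivative_works)
qed

text \<open>\<open>Ck_on\<close> recurses through \<open>frechet_derivative\<close>, which is
  awkward to compute with. Supplying an explicit derivative instead turns each closure property
  below into an induction on \<open>k\<close> whose step is a differentiation rule.\<close>

lemma Ck_on_SucI:
  assumes "open S" "\<And>x. x \<in> S \<Longrightarrow> (f has_derivative f' x) (at x)"
    and "\<And>v. v \<in> Basis \<Longrightarrow> Ck_on k S (\<lambda>x. f' x v)"
  shows "Ck_on (Suc k) S f"
proof -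
  have "f differentiable_on S"
    unfolding differentiable_on_eq_differentiable_at[OF assms(1)]
    using assms(2) differentiable_def by blast
  moreover have "Ck_on k S (\<lambda>x. frechet_derivative f (at x) v)" if "v \<in> Basis" for v
  proof (rule Ck_on_cong[OF assms(1) _ assms(3)[OF that]])
    show "f' x v = frechet_derivative f (at x) v" if "x \<in> S" for x
      using frechet_derivative_at[OF assms(2)[OF that]] by simp
  qed
  ultimately show ?thesis by simp
qed

lemma Ck_on_local:
  assumes "open S" "\<And>x. x \<in> S \<Longrightarrow> \<exists>T. open T \<and> x \<in> T \<and> Ck_on k T f"
  shows "Ck_on k S f"
  using assms(2)
proof (induction k arbitrary: f)
  case 0
  show ?case
    unfolding Ck_on.simps
  proof (rule continuous_at_imp_continuous_on, rule ballI)
    fix x assume "x \<in> S"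
    then obtain T where "open T" "x \<in> T" "continuous_on T f" using 0[OF \<open>x \<in> S\<close>] by auto
    then show "isCont f x" by (simp add: continuous_on_eq_continuous_at)
  qed
next
  case (Suc k)
  have "f differentiable (at x)" if "x \<in> S" for x
    using Suc.prems[OF that] differentiable_on_eq_differentiable_at by auto
  moreover have "Ck_on k S (\<lambda>x. frechet_derivative f (at x) v)" if "v \<in> Basis" for v
    by (rule Suc.IH) (use Suc.prems that in fastforce)
  ultimately show ?case using assms(1) by (simp add: differentiable_on_eq_differentiable_at)
qed

lemma Ck_on_const: "open S \<Longrightarrow> Ck_on k S (\<lambda>x. c)"
proof (induction k arbitrary: c)
  case (Suc k)
  show ?case
    by (rule Ck_on_SucI[OF Suc.prems has_derivative_const]) (rule Suc.IH[OF Suc.prems])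
qed simp

lemma Ck_on_bounded_linear: "open S \<Longrightarrow> bounded_linear f \<Longrightarrow> Ck_on k S f"
proof (cases k)
  case (Suc k')
  assume "open S" "bounded_linear f"
  then show ?thesis unfolding Suc
    by (intro Ck_on_SucI[where f'="\<lambda>_. f"] Ck_on_const bounded_linear_imp_has_derivative)
qed (simp add: linear_continuous_on)

lemma Ck_on_add: "open S \<Longrightarrow> Ck_on k S f \<Longrightarrow> Ck_on k S g \<Longrightarrow> Ck_on k S (\<lambda>x. f x + g x)"
proof (induction k arbitrary: f g)
  case 0
  then show ?case by (auto intro: continuous_on_add)
next
  case (Suc k)
  show ?case
  proof (rule Ck_on_SucI[OF Suc.prems(1) has_derivative_add])
    show "Ck_on k S (\<lambda>x. frechet_derivative f (at x) v + frechet_derivative g (at x) v)"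
      if "v \<in> Basis" for v
      by (rule Suc.IH) (use Suc.prems that in auto)
  qed (rule Ck_on_Suc_has_derivative[OF Suc.prems(1)]; use Suc.prems in blast)+
qed

lemma Ck_on_inner_left:
  "open S \<Longrightarrow> Ck_on k S f \<Longrightarrow> Ck_on k S (\<lambda>x. f x \<bullet> b)"
proof (induction k arbitrary: f)
  case 0
  then show ?case by (auto intro: continuous_intros)
next
  case (Suc k)
  show ?case
  proof (rule Ck_on_SucI[OF Suc.prems(1) has_derivative_inner_left])
    show "Ck_on k S (\<lambda>x. frechet_derivative f (at x) v \<bullet> b)" if "v \<in> Basis" for v
      by (rule Suc.IH) (use Suc.prems that in auto)
  qed (rule Ck_on_Suc_has_derivative[OF Suc.prems(1)]; use Suc.prems in blast)
qed

lemma Ck_on_mult: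
  fixes f g :: "'a::euclidean_space \<Rightarrow> real"
  shows "open S \<Longrightarrow> Ck_on k S f \<Longrightarrow> Ck_on k S g \<Longrightarrow> Ck_on k S (\<lambda>x. f x * g x)"
proof (induction k arbitrary: f g)
  case 0
  then show ?case by (auto intro: continuous_on_mult)
next
  case (Suc k)
  show ?case
  proof (rule Ck_on_SucI[OF Suc.prems(1) has_derivative_mult])
    show "Ck_on k S (\<lambda>x. f x * frechet_derivative g (at x) v + frechet_derivative f (at x) v * g x)"
      if "v \<in> Basis" for v
      by (intro Ck_on_add Suc.IH Suc.prems(1) Ck_on_SucD[OF Suc.prems(2)] Ck_on_SucD[OF Suc.prems(3)])
        (use Suc.prems that in auto)
  qed (rule Ck_on_Suc_has_derivative[OF Suc.prems(1)]; use Suc.prems in blast)+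
qed

lemma Ck_on_sum:
  fixes f :: "'i \<Rightarrow> 'a::euclidean_space \<Rightarrow> real"
  assumes "open S" "\<And>i. i \<in> I \<Longrightarrow> Ck_on k S (f i)"
  shows "Ck_on k S (\<lambda>x. \<Sum>i\<in>I. f i x)"
proof (cases "finite I")
  case True
  then show ?thesis using assms(2)
    by (induction I) (auto intro: Ck_on_const Ck_on_add assms(1))
qed (auto intro: Ck_on_const assms(1))

lemma Ck_on_inverse:
  fixes f :: "'a::euclidean_space \<Rightarrow> real"
  shows "open S \<Longrightarrow> Ck_on k S f \<Longrightarrow> (\<And>x. x \<in> S \<Longrightarrow> f x \<noteq> 0) \<Longrightarrow> Ck_on k S (\<lambda>x. inverse (f x))"
proof (induction k)
  case 0
  then show ?case by (auto intro: continuous_on_inverse)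
next
  case (Suc k)
  show ?case
  proof (rule Ck_on_SucI[OF Suc.prems(1) Deriv.has_derivative_inverse])
    show "Ck_on k S (\<lambda>x. - (inverse (f x) * frechet_derivative f (at x) v * inverse (f x)))"
      if "v \<in> Basis" for v
    proof -
      have "Ck_on k S (\<lambda>x. (-1) * (inverse (f x) * frechet_derivative f (at x) v * inverse (f x)))"
        using Ck_on_SucD[OF Suc.prems(2)] Suc that
        by (intro Ck_on_mult Ck_on_const) auto
      then show ?thesis by simp
    qed
  qed (use Suc.prems(3) Ck_on_Suc_has_derivative[OF Suc.prems(1,2)] in blast)+
qed

lemma Ck_on_compose:
  fixes f :: "'a::euclidean_space \<Rightarrow> 'b::euclidean_space" and g :: "'b \<Rightarrow> real"
  shows "open S \<Longrightarrow> open T \<Longrightarrow> f ` S \<subseteq> T \<Longrightarrow> Ck_on k S f \<Longrightarrow> Ck_on k T g \<Longrightarrow> Ck_on k S (\<lambda>x. g (f x))"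
proof (induction k arbitrary: g)
  case 0
  then show ?case using continuous_on_compose2[of T g S f] by simp
next
  case (Suc k)
  have fd: "(f has_derivative frechet_derivative f (at x)) (at x)" if "x \<in> S" for x
    using Ck_on_Suc_has_derivative[OF Suc.prems(1,4) that] .
  have gd: "(g has_derivative frechet_derivative g (at (f x))) (at (f x))" if "x \<in> S" for x
    using Ck_on_Suc_has_derivative[OF Suc.prems(2,5)] Suc.prems(3) that by auto
  \<comment> \<open>The hypothesis on \<open>g\<close> controls its derivative only along basis
    vectors, while the vector fed to it varies with x. Expanding that vector in the basis separates
    the two dependencies into products.\<close>
  have eq: "(\<Sum>b\<in>Basis. (frechet_derivative f (at x) v \<bullet> b) * frechet_derivative g (at (f x)) b)
      = frechet_derivative g (at (f x)) (frechet_derivative f (at x) v)" if "x \<in> S" for x v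
  proof -
    interpret linear "frechet_derivative g (at (f x))"
      using gd[OF that] has_derivative_linear by blast
    have "frechet_derivative g (at (f x)) (frechet_derivative f (at x) v)
      = frechet_derivative g (at (f x)) (\<Sum>b\<in>Basis. (frechet_derivative f (at x) v \<bullet> b) *\<^sub>R b)"
      by (simp add: euclidean_representation)
    then show ?thesis by (simp add: sum scale)
  qed
  show ?case
  proof (rule Ck_on_SucI[OF Suc.prems(1)])
    show "((\<lambda>x. g (f x)) has_derivative
        (\<lambda>v. \<Sum>b\<in>Basis. (frechet_derivative f (at x) v \<bullet> b) * frechet_derivative g (at (f x)) b)) (at x)"
      if "x \<in> S" for x
      using diff_chain_at[OF fd[OF that] gd[OF that]] eq[OF that]
      by (simp add: o_def)
    show "Ck_on k S (\<lambda>x. \<Sum>b\<in>Basis. (frechet_derivative f (at x) v \<bullet> b) * frechet_derivative g (at (f x)) b)"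
      if "v \<in> Basis" for v
    proof (intro Ck_on_sum Ck_on_mult Ck_on_inner_left Suc.prems(1))
      show "Ck_on k S (\<lambda>x. frechet_derivative f (at x) v)" using Suc.prems that by auto
      show "Ck_on k S (\<lambda>x. frechet_derivative g (at (f x)) b)" if "b \<in> Basis" for b
        using Suc.IH[of "\<lambda>y. frechet_derivative g (at y) b"] Suc.prems that
          Ck_on_SucD[OF Suc.prems(4)] by auto
    qed
  qed
qed

lemma smooth_onI: "(\<And>k. Ck_on k S f) \<Longrightarrow> smooth_on S f"
  and smooth_onD: "smooth_on S f \<Longrightarrow> Ck_on k S f"
  by (auto simp: smooth_on_def)

lemma smooth_on_compose:
  fixes f :: "'a::euclidean_space \<Rightarrow> 'b::euclidean_space" and g :: "'b \<Rightarrow> real"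
  assumes "open S" "open T" "f ` S \<subseteq> T" "smooth_on S f" "smooth_on T g"
  shows "smooth_on S (\<lambda>x. g (f x))"
  by (rule smooth_onI Ck_on_compose[OF assms(1,2,3)] smooth_onD[OF assms(4)] smooth_onD[OF assms(5)])+

lemma smooth_on_frechet_derivative:
  "smooth_on S f \<Longrightarrow> v \<in> Basis \<Longrightarrow> smooth_on S (\<lambda>x. frechet_derivative f (at x) v)"
  unfolding smooth_on_def by (metis Ck_on.simps(2))

lemma smooth_on_has_derivative:
  assumes "open S" "smooth_on S f" "x \<in> S"
  shows "(f has_derivative frechet_derivative f (at x)) (at x)"
  using Ck_on_Suc_has_derivative[OF assms(1) smooth_onD[OF assms(2)] assms(3)] .

lemma smooth_on_cong:
  "open S \<Longrightarrow> (\<And>x. x \<in> S \<Longrightarrow> f x = g x) \<Longrightarrow> smooth_on S f \<longleftrightarrow> smooth_on S g"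
  unfolding smooth_on_def by (metis Ck_on_cong)

section \<open>A smooth bump function on Euclidean space\<close>

definition exp_inv :: "nat \<Rightarrow> real \<Rightarrow> real"
  where "exp_inv m t = (if t > 0 then exp (- inverse t) * inverse t ^ m else 0)"

text \<open>In s = 1/t this is the decay of s^m / exp s at infinity. The powers of 1/t are carried
  along because differentiating exp(-1/t) produces them: the span of the family
  \<open>exp_inv m\<close> is closed under differentiation.\<close>

lemma exp_inv_tendsto: "(exp_inv m \<longlongrightarrow> 0) (at 0)"
proof -
  have "((\<lambda>t. inverse t ^ m / exp (inverse t)) \<longlongrightarrow> (0::real)) (at_right 0)"
    by (rule filterlim_compose[OF tendsto_power_div_exp_0 filterlim_inverse_at_top_right])
  then have "(exp_inv m \<longlongrightarrow> 0) (at_right 0)"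
    by (rule Lim_transform_eventually)
      (auto simp: eventually_at_filter exp_inv_def exp_minus field_simps)
  moreover have "(exp_inv m \<longlongrightarrow> 0) (at_left 0)"
    by (rule tendsto_eventually) (auto simp: eventually_at_filter exp_inv_def)
  ultimately show ?thesis by (simp add: filterlim_split_at)
qed

lemma exp_inv_derivative:
  "(exp_inv m has_real_derivative exp_inv (m + 2) t - m * exp_inv (m + 1) t) (at t)"
proof -
  consider "t > 0" | "t < 0" | "t = 0" by linarith
  then show ?thesis
  proof cases
    case 1
    have "((\<lambda>t. exp (- inverse t) * inverse t ^ m) has_real_derivative
        exp (- inverse t) * inverse t ^ (m + 2) - m * (exp (- inverse t) * inverse t ^ (m + 1))) (at t)"
    proof (cases m)
      case 0
      then show ?thesis using 1
        by (auto intro!: derivative_eq_intros simp: field_simps power2_eq_square)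
    next
      case (Suc m')
      have i: "(inverse has_real_derivative - (inverse t * inverse t)) (at t)"
        using 1 by (auto intro!: derivative_eq_intros simp: power2_eq_square)
      have e: "((\<lambda>t. exp (- inverse t)) has_real_derivative exp (- inverse t) * (inverse t * inverse t)) (at t)"
        using DERIV_fun_exp[OF DERIV_minus[OF i]] by simp
      note DERIV_mult[OF e DERIV_power[OF i, of "Suc m'"]]
      then show ?thesis by (simp add: Suc power2_eq_square algebra_simps)
    qed
    then have "(exp_inv m has_real_derivative
        exp (- inverse t) * inverse t ^ (m + 2) - m * (exp (- inverse t) * inverse t ^ (m + 1))) (at t)"
      by (rule has_field_derivative_transform_within_open[of _ _ _ "{0<..}"])
        (use 1 in \<open>auto simp: exp_inv_def\<close>)
    then show ?thesis using 1 by (simp add: exp_inv_def)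
  next
    case 2
    have "(exp_inv m has_real_derivative 0) (at t)"
      by (rule has_field_derivative_transform_within_open[of "\<lambda>_. 0" _ _ "{..<0}"])
        (use 2 in \<open>auto simp: exp_inv_def\<close>)
    then show ?thesis using 2 by (simp add: exp_inv_def)
  next
    case 3
    \<comment> \<open>The difference quotient of \<open>exp_inv m\<close> at 0 is
      \<open>exp_inv (Suc m)\<close>, whose limit is already known.\<close>
    have "((\<lambda>h. (exp_inv m (0 + h) - exp_inv m 0) / h) \<longlongrightarrow> 0) (at 0)"
      by (rule Lim_transform_eventually[OF exp_inv_tendsto[of "Suc m"]])
        (auto simp: exp_inv_def field_simps)
    then have "(exp_inv m has_real_derivative 0) (at 0)"
      by (simp add: has_field_derivative_def DERIV_def flip: has_field_derivative_def)
    then show ?thesis using 3 by (simp add: exp_inv_def)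
  qed
qed

lemma smooth_on_exp_inv: "smooth_on UNIV (exp_inv m)"
proof (rule smooth_onI)
  fix k show "Ck_on k UNIV (exp_inv m)"
  proof (induction k arbitrary: m)
    case 0
    show ?case
      using exp_inv_derivative[THEN DERIV_isCont] by (simp add: continuous_at_imp_continuous_on)
  next
    case (Suc k)
    show ?case
    proof (rule Ck_on_SucI)
      show "(exp_inv m has_derivative (\<lambda>v. (exp_inv (m + 2) t + (- real m) * exp_inv (m + 1) t) * v)) (at t)" for t
        using exp_inv_derivative[of m t] by (simp add: has_field_derivative_def)
      show "Ck_on k UNIV (\<lambda>t. (exp_inv (m + 2) t + (- real m) * exp_inv (m + 1) t) * v)" for v
        by (intro Ck_on_mult Ck_on_add Ck_on_const Suc.IH) auto
    qed auto
  qed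
qed

lemma smooth_bump:
  fixes c :: "'a::euclidean_space"
  assumes "r > 0"
  obtains b :: "'a \<Rightarrow> real" where "smooth_on UNIV b"
    "\<And>z. z \<in> cball c r \<Longrightarrow> b z = 1" "\<And>z. z \<notin> ball c (2 * r) \<Longrightarrow> b z = 0"
proof -
  define q :: "'a \<Rightarrow> real" where "q z = (\<Sum>i\<in>Basis. (z \<bullet> i + - c \<bullet> i) * (z \<bullet> i + - c \<bullet> i))" for z
  have q: "q z = (dist c z)\<^sup>2" for z
    unfolding dist_norm power2_norm_eq_inner euclidean_inner[of "c - z" "c - z"] q_def
    by (simp add: algebra_simps)
  \<comment> \<open>\<open>f1\<close> is positive exactly inside the ball of radius 2r and
    \<open>f2\<close> exactly outside the closed ball of radius r. Hence the sum vanishes nowhere,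
    and f1 / (f1 + f2) is the bump.\<close>
  define f1 where "f1 z = exp_inv 0 (4 * r\<^sup>2 + (-1) * q z)" for z
  define f2 where "f2 z = exp_inv 0 (q z + - r\<^sup>2)" for z
  have sq: "Ck_on k UNIV q" for k
    unfolding q_def
    by (intro Ck_on_sum Ck_on_mult Ck_on_add Ck_on_const Ck_on_bounded_linear) (auto intro: bounded_linear_inner_left)
  have s1: "Ck_on k UNIV f1" for k
    unfolding f1_def
    by (intro Ck_on_compose[OF _ _ _ _ smooth_onD[OF smooth_on_exp_inv]] Ck_on_add Ck_on_mult Ck_on_const sq) auto
  have s2: "Ck_on k UNIV f2" for k
    unfolding f2_def
    by (intro Ck_on_compose[OF _ _ _ _ smooth_onD[OF smooth_on_exp_inv]] Ck_on_add Ck_on_mult Ck_on_const sq) auto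
  have nn: "f1 z \<ge> 0" "f2 z \<ge> 0" for z by (auto simp: f1_def f2_def exp_inv_def)
  have p1: "f1 z > 0 \<longleftrightarrow> dist c z < 2 * r" for z
  proof -
    have "f1 z > 0 \<longleftrightarrow> (dist c z)\<^sup>2 < (2 * r)\<^sup>2" by (auto simp: f1_def exp_inv_def q power_mult_distrib)
    also have "\<dots> \<longleftrightarrow> dist c z < 2 * r" using assms
      by (intro iffI; (elim power2_less_imp_less | elim power_strict_mono)) auto
    finally show ?thesis .
  qed
  have p2: "f2 z > 0 \<longleftrightarrow> r < dist c z" for z
  proof -
    have "f2 z > 0 \<longleftrightarrow> r\<^sup>2 < (dist c z)\<^sup>2" by (auto simp: f2_def exp_inv_def q)
    also have "\<dots> \<longleftrightarrow> r < dist c z" using assms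
      by (intro iffI; (elim power2_less_imp_less | elim power_strict_mono)) auto
    finally show ?thesis .
  qed
  have pos: "f1 z + f2 z \<noteq> 0" for z
  proof (cases "dist c z < 2 * r")
    case True then have "f1 z > 0" by (simp add: p1)
    then show ?thesis using nn(2)[of z] by linarith
  next
    case False then have "f2 z > 0" using assms by (simp add: p2)
    then show ?thesis using nn(1)[of z] by linarith
  qed
  show thesis
  proof
    show "smooth_on UNIV (\<lambda>z. f1 z * inverse (f1 z + f2 z))"
      by (intro smooth_onI Ck_on_mult Ck_on_inverse Ck_on_add s1 s2) (auto simp: pos)
    fix z
    show "f1 z * inverse (f1 z + f2 z) = 1" if "z \<in> cball c r"
    proof -
      have "f2 z = 0" using that p2[of z] nn(2)[of z] by (auto simp: not_less)
      then show ?thesis using pos[of z] by simp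
    qed
    show "f1 z * inverse (f1 z + f2 z) = 0" if "z \<notin> ball c (2 * r)"
    proof -
      have "f1 z = 0" using that p1[of z] nn(1)[of z] by (auto simp: not_less)
      then show ?thesis by simp
    qed
  qed
qed

section \<open>Smooth functions and tangent vectors on a manifold\<close>

locale manifold =
  fixes M :: "('p::{t2_space, second_countable_topology}, 'd::finite) atlas"
  assumes smooth_manifold: "smooth_manifold M"
begin

lemma chart_exists: obtains U \<phi> where "(U, \<phi>) \<in> M" "x \<in> U"
proof -
  have "x \<in> (\<Union>(U, \<phi>)\<in>M. U)" using smooth_manifold by (simp add: smooth_manifold_def)
  then show thesis using that by auto
qed

lemma
  assumes "(U, \<phi>) \<in> M"
  shows chart_open: "open U"
    and chart_homeo: "homeomorphism U (\<phi> ` U) \<phi> (inv_into U \<phi>)"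
    and chart_open_image: "open (\<phi> ` U)"
  using smooth_manifold assms by (auto simp: smooth_manifold_def)

lemma chart_inv: "(U, \<phi>) \<in> M \<Longrightarrow> y \<in> U \<Longrightarrow> inv_into U \<phi> (\<phi> y) = y"
  using chart_homeo homeomorphism_apply1 by metis

lemma chart_image_open:
  assumes "(U, \<phi>) \<in> M" "open W" "W \<subseteq> U"
  shows "open (\<phi> ` W)"
proof -
  have "openin (top_of_set U) W"
    using assms chart_open by (simp add: openin_open_eq)
  then have "openin (top_of_set (\<phi> ` U)) (\<phi> ` W)"
    using homeomorphism_imp_open_map[OF chart_homeo[OF assms(1)]] by blast
  then show ?thesis using chart_open_image[OF assms(1)] openin_open_trans by blast
qed

lemma smooth_transition:
  assumes "(U, \<phi>) \<in> M" "(V, \<psi>) \<in> M"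
  shows "smooth_on (\<phi> ` (U \<inter> V)) (\<psi> \<circ> inv_into U \<phi>)"
  using smooth_manifold assms by (fastforce simp: smooth_manifold_def)

lemma smooth_on_subset: "smooth_on S f \<Longrightarrow> T \<subseteq> S \<Longrightarrow> smooth_on T f"
  unfolding smooth_on_def by (blast intro: Ck_on_subset)

text \<open>\<open>smooth_fun\<close> quantifies over all charts; since transition maps are smooth,
  one chart containing \<open>W\<close> decides.\<close>

lemma smooth_fun_chartI:
  assumes U: "(U, \<phi>) \<in> M" and W: "open W" "W \<subseteq> U"
    and f: "smooth_on (\<phi> ` W) (f \<circ> inv_into U \<phi>)"
  shows "smooth_fun M W f"
  unfolding smooth_fun_def
proof clarify
  fix V \<psi> assume V: "(V, \<psi>) \<in> M"
  have o: "open (\<psi> ` (W \<inter> V))"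
    by (rule chart_image_open[OF V]) (use W chart_open[OF V] in auto)
  have "smooth_on (\<psi> ` (W \<inter> V)) (\<lambda>z. (f \<circ> inv_into U \<phi>) ((\<phi> \<circ> inv_into V \<psi>) z))"
  proof (rule smooth_on_compose[OF o chart_image_open[OF U W] _ _ f])
    show "(\<phi> \<circ> inv_into V \<psi>) ` \<psi> ` (W \<inter> V) \<subseteq> \<phi> ` W"
      using chart_inv[OF V] by auto
    show "smooth_on (\<psi> ` (W \<inter> V)) (\<phi> \<circ> inv_into V \<psi>)"
      by (rule smooth_on_subset[OF smooth_transition[OF V U]]) (use W in auto)
  qed
  then show "smooth_on (\<psi> ` (W \<inter> V)) (f \<circ> inv_into V \<psi>)"
    by (rule smooth_on_cong[OF o, THEN iffD1, rotated])
      (use chart_inv[OF V] chart_inv[OF U] W in \<open>auto simp: o_def subset_iff\<close>)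
qed

lemma smooth_fun_chartD:
  assumes "(U, \<phi>) \<in> M" "W \<subseteq> U" "smooth_fun M W f"
  shows "smooth_on (\<phi> ` W) (f \<circ> inv_into U \<phi>)"
proof -
  have "smooth_on (\<phi> ` (W \<inter> U)) (f \<circ> inv_into U \<phi>)"
    using assms by (auto simp: smooth_fun_def)
  then show ?thesis using assms(2) by (simp add: Int_absorb2)
qed

lemma smooth_fun_subset: "smooth_fun M U f \<Longrightarrow> W \<subseteq> U \<Longrightarrow> smooth_fun M W f"
  unfolding smooth_fun_def by (fast intro: smooth_on_subset)

lemma open_image_Int: "open W \<Longrightarrow> (V, \<psi>) \<in> M \<Longrightarrow> open (\<psi> ` (W \<inter> V))"
  using chart_image_open[of V \<psi> "W \<inter> V"] chart_open[of V \<psi>] by auto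

lemma smooth_fun_local:
  assumes "open W" "\<And>x. x \<in> W \<Longrightarrow> \<exists>W'. open W' \<and> x \<in> W' \<and> smooth_fun M W' f"
  shows "smooth_fun M W f"
  unfolding smooth_fun_def
proof (clarify, rule smooth_onI, rule Ck_on_local)
  fix V \<psi> k z assume V: "(V, \<psi>) \<in> M"
  show "open (\<psi> ` (W \<inter> V))" by (rule open_image_Int[OF assms(1) V])
  assume "z \<in> \<psi> ` (W \<inter> V)"
  then obtain x where x: "x \<in> W" "x \<in> V" "z = \<psi> x" by auto
  then obtain W' where W': "open W'" "x \<in> W'" "smooth_fun M W' f" using assms(2) by blast
  then show "\<exists>T. open T \<and> z \<in> T \<and> Ck_on k T (f \<circ> inv_into V \<psi>)"
    using V x open_image_Int[OF W'(1) V]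
    by (intro exI[of _ "\<psi> ` (W' \<inter> V)"]) (auto simp: smooth_fun_def smooth_on_def)
qed

lemma smooth_fun_cong:
  assumes "open W" "\<And>x. x \<in> W \<Longrightarrow> f x = g x" "smooth_fun M W f"
  shows "smooth_fun M W g"
  unfolding smooth_fun_def
proof clarify
  fix V \<psi> assume V: "(V, \<psi>) \<in> M"
  have "smooth_on (\<psi> ` (W \<inter> V)) (f \<circ> inv_into V \<psi>)" using V assms(3) by (auto simp: smooth_fun_def)
  then show "smooth_on (\<psi> ` (W \<inter> V)) (g \<circ> inv_into V \<psi>)"
    by (rule smooth_on_cong[OF open_image_Int[OF assms(1) V], THEN iffD1, rotated])
      (use chart_inv[OF V] assms(2) in auto)
qed

lemma smooth_fun_const: "open W \<Longrightarrow> smooth_fun M W (\<lambda>x. c)"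
  by (auto simp: smooth_fun_def o_def intro!: smooth_onI Ck_on_const open_image_Int)

lemma smooth_fun_add:
  "open W \<Longrightarrow> smooth_fun M W f \<Longrightarrow> smooth_fun M W g \<Longrightarrow> smooth_fun M W (\<lambda>x. f x + g x)"
  using Ck_on_add[OF open_image_Int] by (fastforce simp: smooth_fun_def smooth_on_def o_def)

lemma smooth_fun_mult:
  "open W \<Longrightarrow> smooth_fun M W f \<Longrightarrow> smooth_fun M W g \<Longrightarrow> smooth_fun M W (\<lambda>x. f x * g x)"
  using Ck_on_mult[OF open_image_Int] by (fastforce simp: smooth_fun_def smooth_on_def o_def)

lemma smooth_fun_inverse:
  assumes "open W" "smooth_fun M W f" "\<And>x. x \<in> W \<Longrightarrow> f x \<noteq> 0"
  shows "smooth_fun M W (\<lambda>x. inverse (f x))"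
  unfolding smooth_fun_def
proof clarify
  fix V \<psi> assume V: "(V, \<psi>) \<in> M"
  have s: "smooth_on (\<psi> ` (W \<inter> V)) (f \<circ> inv_into V \<psi>)" using V assms(2) by (auto simp: smooth_fun_def)
  have "(f \<circ> inv_into V \<psi>) z \<noteq> 0" if "z \<in> \<psi> ` (W \<inter> V)" for z
    using that chart_inv[OF V] assms(3) by auto
  from smooth_onI[OF Ck_on_inverse[OF open_image_Int[OF assms(1) V] smooth_onD[OF s] this]]
  show "smooth_on (\<psi> ` (W \<inter> V)) ((\<lambda>x. inverse (f x)) \<circ> inv_into V \<psi>)"
    by (simp add: o_def)
qed

lemma smooth_fun_minus: "open W \<Longrightarrow> smooth_fun M W f \<Longrightarrow> smooth_fun M W (\<lambda>x. - f x)"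
  using smooth_fun_mult[OF _ smooth_fun_const[of W "-1"], of f] by simp

lemma smooth_fun_diff:
  "open W \<Longrightarrow> smooth_fun M W f \<Longrightarrow> smooth_fun M W g \<Longrightarrow> smooth_fun M W (\<lambda>x. f x - g x)"
  using smooth_fun_add[OF _ _ smooth_fun_minus, of W f g] by simp

lemma smooth_fun_divide:
  "open W \<Longrightarrow> smooth_fun M W f \<Longrightarrow> smooth_fun M W g \<Longrightarrow> (\<And>x. x \<in> W \<Longrightarrow> g x \<noteq> 0)
    \<Longrightarrow> smooth_fun M W (\<lambda>x. f x / g x)"
  using smooth_fun_mult[OF _ _ smooth_fun_inverse, of W f g] by (simp add: divide_inverse)

lemma smooth_fun_sum:
  "open W \<Longrightarrow> (\<And>i. i \<in> J \<Longrightarrow> smooth_fun M W (f i)) \<Longrightarrow> smooth_fun M W (\<lambda>x. \<Sum>i\<in>J. f i x)"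
  by (induction J rule: infinite_finite_induct) (auto intro: smooth_fun_const smooth_fun_add)

lemma smooth_fun_prod:
  "open W \<Longrightarrow> (\<And>i. i \<in> J \<Longrightarrow> smooth_fun M W (f i)) \<Longrightarrow> smooth_fun M W (\<lambda>x. \<Prod>i\<in>J. f i x)"
  by (induction J rule: infinite_finite_induct) (auto intro: smooth_fun_const smooth_fun_mult)

lemma smooth_fun_continuous:
  assumes "open W" "smooth_fun M W f"
  shows "continuous_on W f"
proof (rule continuous_at_imp_continuous_on, rule ballI)
  fix x assume x: "x \<in> W"
  obtain U \<phi> where U: "(U, \<phi>) \<in> M" "x \<in> U" by (rule chart_exists)
  have o: "open (W \<inter> U)" using assms chart_open[OF U(1)] by blast
  have "continuous_on (\<phi> ` (W \<inter> U)) (f \<circ> inv_into U \<phi>)"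
    using smooth_onD[of _ _ 0] assms(2) U by (fastforce simp: smooth_fun_def)
  moreover have "continuous_on (W \<inter> U) \<phi>"
    using homeomorphism_cont1[OF chart_homeo[OF U(1)]] continuous_on_subset by blast
  ultimately have "continuous_on (W \<inter> U) ((f \<circ> inv_into U \<phi>) \<circ> \<phi>)"
    by (rule continuous_on_compose[rotated])
  then have "continuous_on (W \<inter> U) f"
    by (rule continuous_on_cong[THEN iffD1, rotated 2]) (use chart_inv[OF U(1)] in auto)
  then show "isCont f x" using o x U by (simp add: continuous_on_eq_continuous_at)
qed

text \<open>The set where f - g is nonzero is open by continuity, so if nonempty it would meet
  \<open>D\<close>. Every identity below that is first proved off the degeneracy locus becomes
  global through this lemma.\<close>

lemma smooth_fun_eq_dense:
  assumes "open W" "smooth_fun M W f" "smooth_fun M W g"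
    and "closure D = UNIV" "\<And>x. x \<in> W \<Longrightarrow> x \<in> D \<Longrightarrow> f x = g x" "x \<in> W"
  shows "f x = g x"
proof (rule ccontr)
  assume ne: "f x \<noteq> g x"
  have "continuous_on W (\<lambda>x. f x - g x)"
    by (rule smooth_fun_continuous[OF assms(1) smooth_fun_diff[OF assms(1-3)]])
  then have "open ((\<lambda>x. f x - g x) -` (- {0}) \<inter> W)"
    by (rule continuous_on_open_vimage[OF assms(1), THEN iffD1, rule_format]) auto
  moreover have "x \<in> (\<lambda>x. f x - g x) -` (- {0}) \<inter> W" using ne assms by auto
  ultimately have "((\<lambda>x. f x - g x) -` (- {0}) \<inter> W) \<inter> D \<noteq> {}"
    using open_Int_closure_eq_empty[of "(\<lambda>x. f x - g x) -` (- {0}) \<inter> W" D] assms(4) by blast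
  then show False using assms(5) by auto
qed

section \<open>Bump functions on the manifold and extension by zero\<close>

lemma smooth_bump_on:
  assumes "open W" "x \<in> W"
  obtains \<theta> W' K where "smooth_fun M UNIV \<theta>" "open W'" "x \<in> W'" "W' \<subseteq> W" "\<And>y. y \<in> W' \<Longrightarrow> \<theta> y = 1"
    "closed K" "K \<subseteq> W" "\<And>y. y \<notin> K \<Longrightarrow> \<theta> y = 0"
proof -
  obtain U \<phi> where U: "(U, \<phi>) \<in> M" "x \<in> U" by (rule chart_exists)
  have oW: "open (W \<inter> U)" using assms chart_open[OF U(1)] by blast
  have o: "open (\<phi> ` (W \<inter> U))" by (rule open_image_Int[OF assms(1) U(1)])
  have "\<phi> x \<in> \<phi> ` (W \<inter> U)" using assms U by auto
  then obtain e where e: "e > 0" "cball (\<phi> x) e \<subseteq> \<phi> ` (W \<inter> U)"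
    using o open_contains_cball by blast
  define r where "r = e / 2"
  have r: "r > 0" "cball (\<phi> x) (2 * r) \<subseteq> \<phi> ` (W \<inter> U)" using e by (auto simp: r_def)
  obtain b :: "real ^ 'd \<Rightarrow> real" where b: "smooth_on UNIV b"
    "\<And>z. z \<in> cball (\<phi> x) r \<Longrightarrow> b z = 1" "\<And>z. z \<notin> ball (\<phi> x) (2 * r) \<Longrightarrow> b z = 0"
    using smooth_bump[OF r(1)] by metis
  define \<theta> where "\<theta> y = (if y \<in> U then b (\<phi> y) else 0)" for y
  define K where "K = inv_into U \<phi> ` cball (\<phi> x) (2 * r)"
  define W' where "W' = \<phi> -` ball (\<phi> x) r \<inter> (W \<inter> U)"
  have K: "K \<subseteq> W \<inter> U" using r(2) chart_inv[OF U(1)] unfolding K_def by auto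
  \<comment> \<open>\<open>K\<close> is a compact subset of a Hausdorff space, hence closed in the
    whole manifold and not merely in the chart domain. This is what makes \<theta> smooth at
    boundary points of \<open>U\<close>, where it vanishes on a neighbourhood.\<close>
  have cK: "closed K"
  proof (rule compact_imp_closed)
    have "continuous_on (cball (\<phi> x) (2 * r)) (inv_into U \<phi>)"
      using homeomorphism_cont2[OF chart_homeo[OF U(1)]] r(2)
      by (metis continuous_on_subset Int_lower2 image_mono order_trans)
    then show "compact K" unfolding K_def by (intro compact_continuous_image compact_cball)
  qed
  have K0: "\<theta> y = 0" if "y \<notin> K" for y
  proof (cases "y \<in> U")
    case True
    have "\<phi> y \<notin> ball (\<phi> x) (2 * r)"
    proof
      assume "\<phi> y \<in> ball (\<phi> x) (2 * r)"
      then have "inv_into U \<phi> (\<phi> y) \<in> K" unfolding K_def by (intro imageI) auto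
      then show False using that chart_inv[OF U(1) True] by simp
    qed
    then show ?thesis using b(3) by (simp add: \<theta>_def)
  qed (simp add: \<theta>_def)
  have "smooth_fun M U \<theta>"
  proof (rule smooth_fun_chartI[OF U(1) chart_open[OF U(1)] order_refl])
    show "smooth_on (\<phi> ` U) (\<theta> \<circ> inv_into U \<phi>)"
      by (rule smooth_on_cong[OF chart_open_image[OF U(1)], THEN iffD1, OF _ smooth_on_subset[OF b(1)]])
        (use chart_inv[OF U(1)] in \<open>auto simp: \<theta>_def\<close>)
  qed
  moreover have "smooth_fun M (- K) \<theta>"
    by (rule smooth_fun_cong[OF _ _ smooth_fun_const[of _ 0]]) (use cK K0 in auto)
  ultimately have "\<exists>V. open V \<and> y \<in> V \<and> smooth_fun M V \<theta>" for y
    using cK K chart_open[OF U(1)] by (cases "y \<in> K") (blast, metis open_Compl ComplI)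
  then have "smooth_fun M UNIV \<theta>" by (intro smooth_fun_local) auto
  moreover have "open W'" unfolding W'_def
  proof (rule continuous_on_open_vimage[OF oW, THEN iffD1, rule_format])
    show "continuous_on (W \<inter> U) \<phi>"
      using homeomorphism_cont1[OF chart_homeo[OF U(1)]] continuous_on_subset by blast
  qed auto
  moreover have "x \<in> W'" "W' \<subseteq> W" "\<And>y. y \<in> W' \<Longrightarrow> \<theta> y = 1"
    using r assms U b(2) by (auto simp: W'_def \<theta>_def)
  ultimately show thesis using that cK K K0 by blast
qed

text \<open>Nothing is known about \<open>f\<close> outside \<open>W\<close>. The open sets
  \<open>W\<close> and \<open>- K\<close> cover everything: on the first the product is smooth, on
  the second it is 0.\<close>

lemma smooth_fun_extend_zero:
  assumes "smooth_fun M UNIV \<theta>" "closed K" "K \<subseteq> W" "open W" "\<And>y. y \<notin> K \<Longrightarrow> \<theta> y = 0"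
    and "open V" "smooth_fun M (W \<inter> V) f"
  shows "smooth_fun M V (\<lambda>y. \<theta> y * f y)"
proof (rule smooth_fun_local[OF assms(6)])
  fix x assume "x \<in> V"
  have "smooth_fun M (W \<inter> V) (\<lambda>y. \<theta> y * f y)"
    by (intro smooth_fun_mult smooth_fun_subset[OF assms(1)] assms(7)) (use assms in auto)
  moreover have "smooth_fun M (- K) (\<lambda>y. \<theta> y * f y)"
    by (rule smooth_fun_cong[OF _ _ smooth_fun_const[of _ 0]]) (use assms in auto)
  ultimately show "\<exists>W'. open W' \<and> x \<in> W' \<and> smooth_fun M W' (\<lambda>y. \<theta> y * f y)"
    using assms(2,3,4,6) \<open>x \<in> V\<close>
    by (cases "x \<in> K") (metis IntI open_Int subsetD, metis open_Compl ComplI)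
qed

section \<open>Germs of smooth functions\<close>

lemma smooth_nearI: "open W \<Longrightarrow> smooth_fun M W f \<Longrightarrow> x \<in> W \<Longrightarrow> smooth_near M x f"
  unfolding smooth_near_def by blast

lemma smooth_nearE:
  assumes "smooth_near M x f" "open V" "x \<in> V"
  obtains W where "open W" "x \<in> W" "W \<subseteq> V" "smooth_fun M W f"
proof -
  obtain W where W: "open W" "x \<in> W" "smooth_fun M W f" using assms(1) smooth_near_def by blast
  show thesis by (rule that[of "W \<inter> V"]) (use W assms in \<open>auto intro: smooth_fun_subset\<close>)
qed

lemma smooth_near_const: "smooth_near M x (\<lambda>y. c)"
  by (rule smooth_nearI[OF open_UNIV smooth_fun_const]) auto

lemma smooth_near_add:
  assumes "smooth_near M x f" "smooth_near M x g"
  shows "smooth_near M x (\<lambda>y. f y + g y)"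
proof -
  obtain W where W: "open W" "x \<in> W" "smooth_fun M W f" using assms(1) smooth_near_def by blast
  obtain V where V: "open V" "x \<in> V" "V \<subseteq> W" "smooth_fun M V g" by (rule smooth_nearE[OF assms(2) W(1,2)])
  show ?thesis by (rule smooth_nearI[OF V(1) smooth_fun_add[OF V(1) smooth_fun_subset[OF W(3)]]]) (use V in auto)
qed

lemma smooth_near_mult:
  assumes "smooth_near M x f" "smooth_near M x g"
  shows "smooth_near M x (\<lambda>y. f y * g y)"
proof -
  obtain W where W: "open W" "x \<in> W" "smooth_fun M W f" using assms(1) smooth_near_def by blast
  obtain V where V: "open V" "x \<in> V" "V \<subseteq> W" "smooth_fun M V g" by (rule smooth_nearE[OF assms(2) W(1,2)])
  show ?thesis by (rule smooth_nearI[OF V(1) smooth_fun_mult[OF V(1) smooth_fun_subset[OF W(3)]]]) (use V in auto)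
qed

lemma smooth_near_sum:
  "(\<And>i. i \<in> J \<Longrightarrow> smooth_near M x (f i)) \<Longrightarrow> smooth_near M x (\<lambda>y. \<Sum>i\<in>J. f i y)"
  by (induction J rule: infinite_finite_induct) (auto intro: smooth_near_const smooth_near_add)

lemma smooth_near_cong:
  assumes "smooth_near M x f" "open W" "x \<in> W" "\<And>y. y \<in> W \<Longrightarrow> f y = g y"
  shows "smooth_near M x g"
proof -
  obtain V where V: "open V" "x \<in> V" "V \<subseteq> W" "smooth_fun M V f" by (rule smooth_nearE[OF assms(1-3)])
  show ?thesis by (rule smooth_nearI[OF V(1) smooth_fun_cong[OF V(1) _ V(4)]]) (use V assms in auto)
qed

subsection \<open>Tangent vectors as derivations\<close>

lemma tangent_linear:
  "v \<in> tangent_space M x \<Longrightarrow> smooth_near M x f \<Longrightarrow> smooth_near M x g \<Longrightarrow>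
    v (\<lambda>y. a * f y + b * g y) = a * v f + b * v g"
  by (auto simp: tangent_space_def)

lemma tangent_add:
  "v \<in> tangent_space M x \<Longrightarrow> smooth_near M x f \<Longrightarrow> smooth_near M x g \<Longrightarrow>
    v (\<lambda>y. f y + g y) = v f + v g"
  using tangent_linear[of v x f g 1 1] by simp

lemma tangent_mult:
  "v \<in> tangent_space M x \<Longrightarrow> smooth_near M x f \<Longrightarrow> smooth_near M x g \<Longrightarrow>
    v (\<lambda>y. f y * g y) = v f * g x + f x * v g"
  by (auto simp: tangent_space_def)

lemma tangent_const:
  assumes "v \<in> tangent_space M x"
  shows "v (\<lambda>y. c) = 0"
proof -
  have 1: "v (\<lambda>y. 1) = 0" using tangent_mult[OF assms smooth_near_const smooth_near_const, of 1 1] by simp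
  show ?thesis using tangent_linear[OF assms smooth_near_const smooth_near_const, of c 1 0 1] 1 by simp
qed

lemma tangent_scale:
  "v \<in> tangent_space M x \<Longrightarrow> smooth_near M x f \<Longrightarrow> v (\<lambda>y. a * f y) = a * v f"
  using tangent_linear[of v x f f a 0] by simp

lemma tangent_minus:
  "v \<in> tangent_space M x \<Longrightarrow> smooth_near M x f \<Longrightarrow> v (\<lambda>y. - f y) = - v f"
  using tangent_linear[of v x f f "-1" 0] by simp

lemma tangent_sum:
  assumes "v \<in> tangent_space M x" "\<And>i. i \<in> J \<Longrightarrow> smooth_near M x (f i)"
  shows "v (\<lambda>y. \<Sum>i\<in>J. f i y) = (\<Sum>i\<in>J. v (f i))"
  using assms(2)
proof (induction J rule: infinite_finite_induct)
  case (insert i J)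
  then show ?case
    using tangent_add[OF assms(1), of "f i" "\<lambda>y. \<Sum>i\<in>J. f i y"] smooth_near_sum[of J x f] by auto
qed (use tangent_const[OF assms(1)] in auto)

text \<open>The indicator \<open>e\<close> of \<open>W\<close> is smooth near x. Since e e = e and
  e(x) = 1, the Leibniz rule gives v e = 2 v e, so v e = 0; applied to f e = g e it then gives v f =
  v g.\<close>

lemma tangent_cong:
  assumes v: "v \<in> tangent_space M x" and f: "smooth_near M x f"
    and W: "open W" "x \<in> W" and eq: "\<And>y. y \<in> W \<Longrightarrow> f y = g y"
  shows "v f = v g"
proof -
  have g: "smooth_near M x g" by (rule smooth_near_cong[OF f W eq])
  define e where "e y = (if y \<in> W then 1 else 0 :: real)" for y
  have e: "smooth_near M x e"
    by (rule smooth_near_cong[OF smooth_near_const W, of 1]) (simp add: e_def)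
  have "v (\<lambda>y. e y * e y) = v e * e x + e x * v e" by (rule tangent_mult[OF v e e])
  moreover have "(\<lambda>y. e y * e y) = e" by (auto simp: e_def)
  ultimately have e0: "v e = 0" using W by (simp add: e_def)
  have "(\<lambda>y. f y * e y) = (\<lambda>y. g y * e y)" using eq by (auto simp: e_def)
  then show ?thesis
    using tangent_mult[OF v f e] tangent_mult[OF v g e] e0 W by (simp add: e_def)
qed

lemma tangent_subspace: "subspace (tangent_space M x)"
  unfolding subspace_def
  by (auto simp: tangent_space_def scaleR_fun_def algebra_simps)

lemma coord_has_derivative:
  assumes "(U, \<phi>) \<in> M" "x \<in> U" "smooth_near M x f"
  shows "((f \<circ> inv_into U \<phi>) has_derivative frechet_derivative (f \<circ> inv_into U \<phi>) (at (\<phi> x))) (at (\<phi> x))"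
proof -
  obtain W where W: "open W" "x \<in> W" "W \<subseteq> U" "smooth_fun M W f"
    by (rule smooth_nearE[OF assms(3) chart_open[OF assms(1)] assms(2)])
  show ?thesis
    by (rule smooth_on_has_derivative[OF chart_image_open[OF assms(1) W(1,3)] smooth_fun_chartD[OF assms(1) W(3,4)]])
      (use W in auto)
qed

lemma coord_field_eq:
  assumes "(U, \<phi>) \<in> M" "x \<in> U" "smooth_near M x f"
    "((f \<circ> inv_into U \<phi>) has_derivative F) (at (\<phi> x))"
  shows "coord_field M U \<phi> i x f = F (axis i 1)"
  using assms frechet_derivative_at[OF assms(4)] by (simp add: coord_field_def)

lemma coord_field_tangent:
  assumes "(U, \<phi>) \<in> M" "x \<in> U"
  shows "coord_field M U \<phi> i x \<in> tangent_space M x"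
  unfolding tangent_space_def
proof (intro CollectI conjI allI impI; (elim conjE)?)
  fix f assume "\<not> smooth_near M x f"
  then show "coord_field M U \<phi> i x f = 0" by (simp add: coord_field_def)
next
  fix f g :: "'p \<Rightarrow> real" and a b assume f: "smooth_near M x f" and g: "smooth_near M x g"
  note df = coord_has_derivative[OF assms f] and dg = coord_has_derivative[OF assms g]
  have "((\<lambda>y. a * f y + b * g y) \<circ> inv_into U \<phi> has_derivative
      (\<lambda>h. a * frechet_derivative (f \<circ> inv_into U \<phi>) (at (\<phi> x)) h
         + b * frechet_derivative (g \<circ> inv_into U \<phi>) (at (\<phi> x)) h)) (at (\<phi> x))"
    using has_derivative_add[OF has_derivative_mult_right[OF df] has_derivative_mult_right[OF dg]]
    by (simp add: o_def)
  from coord_field_eq[OF assms _ this] coord_field_eq[OF assms f df] coord_field_eq[OF assms g dg]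
  show "coord_field M U \<phi> i x (\<lambda>y. a * f y + b * g y) = a * coord_field M U \<phi> i x f + b * coord_field M U \<phi> i x g"
    using f g by (simp add: smooth_near_add smooth_near_mult smooth_near_const)
next
  fix f g :: "'p \<Rightarrow> real" assume f: "smooth_near M x f" and g: "smooth_near M x g"
  note df = coord_has_derivative[OF assms f] and dg = coord_has_derivative[OF assms g]
  have "((\<lambda>y. f y * g y) \<circ> inv_into U \<phi> has_derivative
      (\<lambda>h. f x * frechet_derivative (g \<circ> inv_into U \<phi>) (at (\<phi> x)) h
         + frechet_derivative (f \<circ> inv_into U \<phi>) (at (\<phi> x)) h * g x)) (at (\<phi> x))"
    using has_derivative_mult[OF df dg] chart_inv[OF assms]
    by (simp add: o_def)
  from coord_field_eq[OF assms _ this] coord_field_eq[OF assms f df] coord_field_eq[OF assms g dg]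
  show "coord_field M U \<phi> i x (\<lambda>y. f y * g y) = coord_field M U \<phi> i x f * g x + f x * coord_field M U \<phi> i x g"
    using f g by (simp add: smooth_near_mult)
qed

lemma smooth_fun_coord_field:
  assumes "(U, \<phi>) \<in> M" "open W" "W \<subseteq> U" "smooth_fun M W f"
  shows "smooth_fun M W (\<lambda>y. coord_field M U \<phi> i y f)"
proof (rule smooth_fun_chartI[OF assms(1-3)])
  note o = chart_image_open[OF assms(1-3)]
  have "smooth_on (\<phi> ` W) (\<lambda>z. frechet_derivative (f \<circ> inv_into U \<phi>) (at z) (axis i 1))"
    by (rule smooth_on_frechet_derivative[OF smooth_fun_chartD[OF assms(1,3,4)]]) (simp add: axis_in_Basis_iff)
  then show "smooth_on (\<phi> ` W) ((\<lambda>y. coord_field M U \<phi> i y f) \<circ> inv_into U \<phi>)"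
    by (rule smooth_on_cong[OF o, THEN iffD1, rotated])
      (use chart_inv[OF assms(1)] assms in \<open>auto simp: coord_field_def subset_iff intro: smooth_nearI\<close>)
qed

lemma smooth_fun_coord:
  assumes "(U, \<phi>) \<in> M"
  shows "smooth_fun M U (\<lambda>y. \<phi> y $ i)"
proof (rule smooth_fun_chartI[OF assms chart_open[OF assms] order_refl])
  have "smooth_on (\<phi> ` U) (\<lambda>z. z $ i)"
    by (rule smooth_onI[OF Ck_on_bounded_linear[OF chart_open_image[OF assms] bounded_linear_vec_nth]])
  then show "smooth_on (\<phi> ` U) ((\<lambda>y. \<phi> y $ i) \<circ> inv_into U \<phi>)"
    by (rule smooth_on_cong[OF chart_open_image[OF assms], THEN iffD1, rotated])
      (use chart_inv[OF assms] in auto)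
qed

lemma coord_field_coord:
  assumes "(U, \<phi>) \<in> M" "x \<in> U"
  shows "coord_field M U \<phi> i x (\<lambda>y. \<phi> y $ j) = (if i = j then 1 else 0)"
proof -
  have "((\<lambda>z. z $ j) has_derivative (\<lambda>z. z $ j)) (at (\<phi> x))"
    by (rule bounded_linear_imp_has_derivative[OF bounded_linear_vec_nth])
  then have "((\<lambda>y. \<phi> y $ j) \<circ> inv_into U \<phi> has_derivative (\<lambda>z. z $ j)) (at (\<phi> x))"
    by (rule has_derivative_transform_within_open[OF _ chart_open_image[OF assms(1)]])
      (use assms chart_inv[OF assms(1)] in auto)
  from coord_field_eq[OF assms smooth_nearI[OF chart_open smooth_fun_coord] this]
  show ?thesis using assms by (auto simp: axis_def)
qed

end

section \<open>Multilinear algebra on a fibre\<close>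

abbreviation dual_fibre :: "'e::real_vector set \<Rightarrow> ('e \<Rightarrow> real) set"
  where "dual_fibre S \<equiv> hom_fibre S UNIV"

lemma sum_fun_apply: "(\<Sum>i\<in>J. f i) x = (\<Sum>i\<in>J. f i x)" for f :: "'i \<Rightarrow> 'a \<Rightarrow> 'b::comm_monoid_add"
  by (induction J rule: infinite_finite_induct) (auto simp: zero_fun_def plus_fun_def)

lemma basis_of_subspace: "basis_of vs S \<Longrightarrow> subspace S"
  unfolding basis_of_def by (metis subspace_span)

lemma basis_of_nth: "basis_of vs S \<Longrightarrow> i < length vs \<Longrightarrow> vs ! i \<in> S"
  unfolding basis_of_def by (metis nth_mem span_base)

lemma basis_of_dim: "basis_of vs S \<Longrightarrow> dim S = length vs"
  unfolding basis_of_def by (metis dim_eq_card_independent dim_span distinct_card)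

lemma hom_fibre_in: "L \<in> hom_fibre S T \<Longrightarrow> v \<in> S \<Longrightarrow> L v \<in> T"
  and hom_fibre_outside: "L \<in> hom_fibre S T \<Longrightarrow> v \<notin> S \<Longrightarrow> L v = 0"
  and hom_fibre_lin: "L \<in> hom_fibre S T \<Longrightarrow> v \<in> S \<Longrightarrow> w \<in> S \<Longrightarrow> L (a *\<^sub>R v + b *\<^sub>R w) = a *\<^sub>R L v + b *\<^sub>R L w"
  by (auto simp: hom_fibre_def)

lemma hom_fibre_zero: "L \<in> hom_fibre S T \<Longrightarrow> subspace S \<Longrightarrow> L 0 = 0"
  using hom_fibre_lin[of L S T 0 0 0 0] subspace_0 by fastforce

lemma hom_fibre_scale: "L \<in> hom_fibre S T \<Longrightarrow> v \<in> S \<Longrightarrow> L (a *\<^sub>R v) = a *\<^sub>R L v"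
  using hom_fibre_lin[of L S T v v a 0] by simp

lemma hom_fibre_add: "L \<in> hom_fibre S T \<Longrightarrow> v \<in> S \<Longrightarrow> w \<in> S \<Longrightarrow> L (v + w) = L v + L w"
  using hom_fibre_lin[of L S T v w 1 1] by simp

lemma hom_fibre_sum:
  assumes "L \<in> hom_fibre S T" "subspace S" "\<And>i. i \<in> J \<Longrightarrow> v i \<in> S"
  shows "L (\<Sum>i\<in>J. c i *\<^sub>R v i) = (\<Sum>i\<in>J. c i *\<^sub>R L (v i))"
  using assms(3)
proof (induction J rule: infinite_finite_induct)
  case (insert i J)
  have "(\<Sum>i\<in>J. c i *\<^sub>R v i) \<in> S" using insert.prems assms(2) by (intro subspace_sum subspace_scale) auto
  then show ?case using insert hom_fibre_lin[OF assms(1), of "v i" "\<Sum>i\<in>J. c i *\<^sub>R v i" "c i" 1] by simp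
qed (use hom_fibre_zero[OF assms(1,2)] in auto)

lemma subspace_hom_fibre: "subspace T \<Longrightarrow> subspace (hom_fibre S T)"
  unfolding subspace_def[of "hom_fibre S T"]
  by (auto simp: hom_fibre_def scaleR_fun_def plus_fun_def zero_fun_def subspace_0 subspace_add subspace_scale
      algebra_simps)

lemma subspace_dual_fibre: "subspace (dual_fibre S)"
  by (rule subspace_hom_fibre) simp

lemma dual_fibre_lin: "\<alpha> \<in> dual_fibre S \<Longrightarrow> \<beta> \<in> dual_fibre S \<Longrightarrow> a *\<^sub>R \<alpha> + b *\<^sub>R \<beta> \<in> dual_fibre S"
  by (intro subspace_add subspace_scale subspace_dual_fibre)

lemma dual_fibre_sum: "(\<And>i. i \<in> J \<Longrightarrow> \<alpha> i \<in> dual_fibre S) \<Longrightarrow> (\<Sum>i\<in>J. c i *\<^sub>R \<alpha> i) \<in> dual_fibre S"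
  by (intro subspace_sum subspace_scale subspace_dual_fibre)

text \<open>Coordinates are indexed by list position, so that dual frames are lists again. Outside
  the span \<open>representation\<close> is 0, hence each coordinate function lies in
  \<open>dual_fibre\<close> without any further truncation.\<close>

definition coord :: "'e::real_vector list \<Rightarrow> nat \<Rightarrow> 'e \<Rightarrow> real"
  where "coord vs i v = representation (set vs) v (vs ! i)"

context
  fixes vs :: "'e::real_vector list" and S
  assumes vs: "basis_of vs S"
begin

lemma coord_expand:
  assumes "v \<in> S"
  shows "(\<Sum>i<length vs. coord vs i v *\<^sub>R (vs ! i)) = v"
proof -
  have b: "independent (set vs)" "span (set vs) = S" "distinct vs" using vs by (auto simp: basis_of_def)
  have "(\<Sum>b\<in>set vs. representation (set vs) v b *\<^sub>R b) = v"
    by (rule real_vector.sum_representation_eq) (use b assms in auto)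
  moreover have "(\<Sum>b\<in>set vs. representation (set vs) v b *\<^sub>R b) = (\<Sum>i<length vs. coord vs i v *\<^sub>R (vs ! i))"
    unfolding coord_def
    by (rule sum.reindex_bij_betw[symmetric]) (use b(3) in \<open>simp add: bij_betw_nth lessThan_atLeast0\<close>)
  ultimately show ?thesis by simp
qed

lemma coord_nth: "i < length vs \<Longrightarrow> j < length vs \<Longrightarrow> coord vs i (vs ! j) = (if i = j then 1 else 0)"
  using vs real_vector.representation_basis[of "set vs" "vs ! j"]
  by (auto simp: coord_def basis_of_def nth_eq_iff_index_eq)

lemma coord_dual: "coord vs i \<in> dual_fibre S"
proof -
  have b: "independent (set vs)" "span (set vs) = S" using vs by (auto simp: basis_of_def)
  have "representation (set vs) (a *\<^sub>R v + c *\<^sub>R u) (vs ! i)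
      = a * representation (set vs) v (vs ! i) + c * representation (set vs) u (vs ! i)"
    if "v \<in> S" "u \<in> S" for v u a c
  proof -
    have sp: "v \<in> span (set vs)" "u \<in> span (set vs)" using that b by auto
    show ?thesis
      using fun_cong[OF real_vector.representation_add[OF b(1) span_scale[OF sp(2), of c] span_scale[OF sp(1), of a]], of "vs ! i"]
        fun_cong[OF real_vector.representation_scale[OF b(1) sp(1), of a], of "vs ! i"]
        fun_cong[OF real_vector.representation_scale[OF b(1) sp(2), of c], of "vs ! i"]
      by (simp add: add.commute)
  qed
  moreover have "representation (set vs) v (vs ! i) = 0" if "v \<notin> S" for v
    using that b(2) by (simp add: real_vector.representation_def)
  ultimately show ?thesis by (simp add: hom_fibre_def coord_def)
qed

lemma dual_expand:
  assumes "\<alpha> \<in> dual_fibre S"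
  shows "\<alpha> = (\<Sum>i<length vs. \<alpha> (vs ! i) *\<^sub>R coord vs i)"
proof
  fix v
  show "\<alpha> v = (\<Sum>i<length vs. \<alpha> (vs ! i) *\<^sub>R coord vs i) v"
  proof (cases "v \<in> S")
    case True
    have "\<alpha> v = \<alpha> (\<Sum>i<length vs. coord vs i v *\<^sub>R (vs ! i))" using coord_expand[OF True] by simp
    also have "\<dots> = (\<Sum>i<length vs. coord vs i v *\<^sub>R \<alpha> (vs ! i))"
      by (rule hom_fibre_sum[OF assms basis_of_subspace[OF vs]]) (use basis_of_nth[OF vs] in auto)
    finally show ?thesis by (simp add: sum_fun_apply scaleR_fun_def mult.commute)
  next
    case False
    then show ?thesis using hom_fibre_outside[OF assms] hom_fibre_outside[OF coord_dual]
      by (simp add: sum_fun_apply scaleR_fun_def)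
  qed
qed

lemma coord_basis_dual: "basis_of (map (coord vs) [0..<length vs]) (dual_fibre S)"
proof -
  have inj: "inj_on (coord vs) {0..<length vs}"
    using coord_nth by (intro inj_onI) (metis (full_types) atLeastLessThan_iff zero_neq_one)
  have ind: "independent (coord vs ` {0..<length vs})"
  proof (rule real_vector.independent_if_scalars_zero)
    fix f \<alpha> assume s: "(\<Sum>\<beta>\<in>coord vs ` {0..<length vs}. f \<beta> *\<^sub>R \<beta>) = 0" and "\<alpha> \<in> coord vs ` {0..<length vs}"
    then obtain i where i: "i < length vs" "\<alpha> = coord vs i" by auto
    have "(\<Sum>j\<in>{0..<length vs}. f (coord vs j) *\<^sub>R coord vs j) = 0"
      using s sum.reindex[OF inj, of "\<lambda>\<beta>. f \<beta> *\<^sub>R \<beta>"] by (simp add: o_def)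
    then have "(\<Sum>j\<in>{0..<length vs}. f (coord vs j) *\<^sub>R coord vs j) (vs ! i) = 0" by simp
    then have "(\<Sum>j\<in>{0..<length vs}. f (coord vs j) * (if j = i then 1 else 0)) = 0"
      using coord_nth i(1) by (simp add: sum_fun_apply scaleR_fun_def)
    then show "f \<alpha> = 0" using i by (simp add: if_distrib[of "\<lambda>c. _ * c"] cong: if_cong)
  qed simp
  have "span (coord vs ` {0..<length vs}) = dual_fibre S"
  proof
    show "span (coord vs ` {0..<length vs}) \<subseteq> dual_fibre S"
      by (rule span_minimal) (use coord_dual subspace_dual_fibre in auto)
    show "dual_fibre S \<subseteq> span (coord vs ` {0..<length vs})"
    proof
      fix \<alpha> assume "\<alpha> \<in> dual_fibre S"
      then have "\<alpha> = (\<Sum>i<length vs. \<alpha> (vs ! i) *\<^sub>R coord vs i)" by (rule dual_expand)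
      moreover have "\<dots> \<in> span (coord vs ` {0..<length vs})"
        by (intro span_sum span_scale span_base imageI) auto
      ultimately show "\<alpha> \<in> span (coord vs ` {0..<length vs})" by simp
    qed
  qed
  with inj ind show ?thesis by (simp add: basis_of_def distinct_map)
qed

end

subsection \<open>Alternating forms\<close>

lemma ext_fibre_outside: "w \<in> ext_fibre k S \<Longrightarrow> \<not> (length \<xi>s = k \<and> set \<xi>s \<subseteq> dual_fibre S) \<Longrightarrow> w \<xi>s = 0"
  and ext_fibre_distinct: "w \<in> ext_fibre k S \<Longrightarrow> \<not> distinct \<xi>s \<Longrightarrow> w \<xi>s = 0"
  by (auto simp: ext_fibre_def)

lemma ext_fibre_lin:
  "w \<in> ext_fibre k S \<Longrightarrow> length \<xi>s = k \<Longrightarrow> set \<xi>s \<subseteq> dual_fibre S \<Longrightarrow> i < k \<Longrightarrow>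
    \<alpha> \<in> dual_fibre S \<Longrightarrow> \<beta> \<in> dual_fibre S \<Longrightarrow>
    w (\<xi>s[i := a *\<^sub>R \<alpha> + b *\<^sub>R \<beta>]) = a * w (\<xi>s[i := \<alpha>]) + b * w (\<xi>s[i := \<beta>])"
  unfolding ext_fibre_def by blast

lemma subspace_ext_fibre: "subspace (ext_fibre k S)"
  unfolding subspace_def
  by (auto simp: ext_fibre_def scaleR_fun_def algebra_simps)

context
  fixes w :: "('e::real_vector \<Rightarrow> real) list \<Rightarrow> real" and k S
  assumes w: "w \<in> ext_fibre k S"
begin

lemma ext_fibre_sum:
  assumes "length \<xi>s = k" "set \<xi>s \<subseteq> dual_fibre S" "i < k" "\<And>j. j \<in> J \<Longrightarrow> \<eta> j \<in> dual_fibre S"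
  shows "w (\<xi>s[i := \<Sum>j\<in>J. c j *\<^sub>R \<eta> j]) = (\<Sum>j\<in>J. c j * w (\<xi>s[i := \<eta> j]))"
  using assms(4)
proof (induction J rule: infinite_finite_induct)
  case (insert j J)
  have "(\<Sum>j\<in>J. c j *\<^sub>R \<eta> j) \<in> dual_fibre S" by (rule dual_fibre_sum) (use insert in auto)
  then have 1: "w (\<xi>s[i := c j *\<^sub>R \<eta> j + 1 *\<^sub>R (\<Sum>j\<in>J. c j *\<^sub>R \<eta> j)])
      = c j * w (\<xi>s[i := \<eta> j]) + 1 * w (\<xi>s[i := \<Sum>j\<in>J. c j *\<^sub>R \<eta> j])"
    using insert by (intro ext_fibre_lin[OF w assms(1-3)]) auto
  have 2: "(\<Sum>j\<in>insert j J. c j *\<^sub>R \<eta> j) = c j *\<^sub>R \<eta> j + 1 *\<^sub>R (\<Sum>j\<in>J. c j *\<^sub>R \<eta> j)"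
    by (subst sum.insert[OF insert.hyps]) (simp only: scaleR_one)
  show ?case unfolding 2 1 using insert by simp
qed (use ext_fibre_lin[OF w assms(1-3), of 0 0 0 0] subspace_0[OF subspace_dual_fibre] in auto)

text \<open>Alternation is encoded in \<open>ext_fibre\<close> as vanishing on lists with
  repetitions. Antisymmetry follows by polarisation: insert the sum of the two arguments into both
  slots and expand.\<close>

lemma ext_fibre_swap:
  assumes "length \<xi>s = k" "set \<xi>s \<subseteq> dual_fibre S" "i < k" "j < k" "i \<noteq> j"
  shows "w (\<xi>s[i := \<xi>s ! j, j := \<xi>s ! i]) = - w \<xi>s"
proof -
  define u where "u \<alpha> \<beta> = w (\<xi>s[i := \<alpha>, j := \<beta>])" for \<alpha> \<beta>
  have D: "\<xi>s ! i \<in> dual_fibre S" "\<xi>s ! j \<in> dual_fibre S" using assms by auto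
  have S: "set (\<xi>s[m := \<alpha>]) \<subseteq> dual_fibre S" if "\<alpha> \<in> dual_fibre S" for m \<alpha>
    using that assms(2) set_update_subset_insert by fastforce
  have 1: "u \<alpha> (\<beta> + \<gamma>) = u \<alpha> \<beta> + u \<alpha> \<gamma>"
    if "\<alpha> \<in> dual_fibre S" "\<beta> \<in> dual_fibre S" "\<gamma> \<in> dual_fibre S" for \<alpha> \<beta> \<gamma>
    using ext_fibre_lin[OF w _ S[OF that(1), of i] assms(4) that(2,3), of 1 1] assms by (simp add: u_def)
  have 2: "u (\<beta> + \<gamma>) \<alpha> = u \<beta> \<alpha> + u \<gamma> \<alpha>"
    if "\<alpha> \<in> dual_fibre S" "\<beta> \<in> dual_fibre S" "\<gamma> \<in> dual_fibre S" for \<alpha> \<beta> \<gamma>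
    using ext_fibre_lin[OF w _ S[OF that(1), of j] assms(3) that(2,3), of 1 1] assms
    by (simp add: u_def list_update_swap)
  have 3: "u \<alpha> \<alpha> = 0" for \<alpha>
    unfolding u_def
  proof (rule ext_fibre_distinct[OF w])
    have "\<xi>s[i := \<alpha>, j := \<alpha>] ! i = \<xi>s[i := \<alpha>, j := \<alpha>] ! j" using assms by simp
    then show "\<not> distinct (\<xi>s[i := \<alpha>, j := \<alpha>])" using assms by (metis length_list_update nth_eq_iff_index_eq)
  qed
  have "u (\<xi>s ! i + \<xi>s ! j) (\<xi>s ! i + \<xi>s ! j) = 0" by (rule 3)
  then have "u (\<xi>s ! i) (\<xi>s ! j) + u (\<xi>s ! j) (\<xi>s ! i) = 0"
    unfolding 1[OF subspace_add[OF subspace_dual_fibre D] D] 2[OF D(1) D] 2[OF D(2) D] by (simp add: 3)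
  moreover have "u (\<xi>s ! i) (\<xi>s ! j) = w \<xi>s" by (simp add: u_def)
  ultimately show ?thesis by (simp add: u_def)
qed

text \<open>Expanding the arguments in \<open>\<epsilon>s\<close> slot by slot reaches a rearrangement of \<open>\<epsilon>s\<close>, which is then
  sorted by transpositions.\<close>

lemma ext_fibre_vanish:
  assumes \<epsilon>: "length \<epsilon>s = k" "set \<epsilon>s \<subseteq> dual_fibre S" "dual_fibre S \<subseteq> span (set \<epsilon>s)"
    and w0: "w \<epsilon>s = 0"
  shows "w = 0"
proof (rule ccontr)
  assume "w \<noteq> 0"
  then obtain \<xi>s where \<xi>: "w \<xi>s \<noteq> 0" by (auto simp: fun_eq_iff)
  then have \<xi>': "length \<xi>s = k" "set \<xi>s \<subseteq> dual_fibre S" using ext_fibre_outside[OF w] by blast+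
  have ex: "\<exists>c. \<alpha> = (\<Sum>j<k. c j *\<^sub>R (\<epsilon>s ! j))" if "\<alpha> \<in> dual_fibre S" for \<alpha>
  proof -
    have "\<alpha> \<in> span (set \<epsilon>s)" using that \<epsilon> by auto
    then show ?thesis
    proof (induction rule: span_induct_alt)
      case base
      show ?case by (rule exI[of _ "\<lambda>_. 0"]) simp
    next
      case (step c x y)
      then obtain d i where d: "y = (\<Sum>j<k. d j *\<^sub>R (\<epsilon>s ! j))" and i: "i < k" "x = \<epsilon>s ! i"
        using \<epsilon>(1) by (auto simp: in_set_conv_nth)
      have "(\<Sum>j<k. (if j = i then c else 0) *\<^sub>R (\<epsilon>s ! j)) = c *\<^sub>R (\<epsilon>s ! i)"
        using i(1) by (simp add: if_distrib[of "\<lambda>c. c *\<^sub>R _"] cong: if_cong)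
      then show ?case unfolding d i(2)
        by (intro exI[of _ "\<lambda>j. (if j = i then c else 0) + d j"]) (simp only: scaleR_add_left sum.distrib)
    qed
  qed
  have "\<exists>\<zeta>s. length \<zeta>s = k \<and> set \<zeta>s \<subseteq> dual_fibre S \<and> (\<forall>i<m. \<exists>j<k. \<zeta>s ! i = \<epsilon>s ! j) \<and> w \<zeta>s \<noteq> 0"
    if "m \<le> k" for m
    using that
  proof (induction m)
    case 0
    then show ?case using \<xi> \<xi>' by auto
  next
    case (Suc m)
    then obtain \<zeta>s where z: "length \<zeta>s = k" "set \<zeta>s \<subseteq> dual_fibre S" "\<forall>i<m. \<exists>j<k. \<zeta>s ! i = \<epsilon>s ! j" "w \<zeta>s \<noteq> 0"
      by auto
    have m: "m < k" using Suc.prems by simp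
    have "\<zeta>s ! m \<in> dual_fibre S" using z m by auto
    then obtain c where c: "\<zeta>s ! m = (\<Sum>j<k. c j *\<^sub>R (\<epsilon>s ! j))" using ex by blast
    have "w \<zeta>s = w (\<zeta>s[m := \<Sum>j<k. c j *\<^sub>R (\<epsilon>s ! j)])" by (simp flip: c)
    also have "\<dots> = (\<Sum>j<k. c j * w (\<zeta>s[m := \<epsilon>s ! j]))"
      by (rule ext_fibre_sum[OF z(1,2) m]) (use \<epsilon> in auto)
    finally have "(\<Sum>j<k. c j * w (\<zeta>s[m := \<epsilon>s ! j])) \<noteq> 0" using z(4) by simp
    then obtain j where j: "j < k" "w (\<zeta>s[m := \<epsilon>s ! j]) \<noteq> 0"
      by (metis (no_types, lifting) lessThan_iff mult_zero_right sum.neutral)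
    have "\<epsilon>s ! j \<in> dual_fibre S" using j \<epsilon> by auto
    then have "set (\<zeta>s[m := \<epsilon>s ! j]) \<subseteq> dual_fibre S"
      using z(2) set_update_subset_insert by fastforce
    moreover have "\<exists>j'<k. \<zeta>s[m := \<epsilon>s ! j] ! i = \<epsilon>s ! j'" if "i < Suc m" for i
      using that z(1,3) j(1) m by (cases "i = m") auto
    ultimately show ?case using z(1) j(2) by (intro exI[of _ "\<zeta>s[m := \<epsilon>s ! j]"]) auto
  qed
  from this[of k] obtain \<zeta>s where z: "length \<zeta>s = k" "\<forall>i<k. \<exists>j<k. \<zeta>s ! i = \<epsilon>s ! j" "w \<zeta>s \<noteq> 0" by auto
  then obtain l where l: "\<And>i. i < k \<Longrightarrow> l i < k \<and> \<zeta>s ! i = \<epsilon>s ! l i" by metis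
  have "\<exists>ls. length ls = k \<and> set ls \<subseteq> {..<k} \<and> (\<forall>i<m. ls ! i = i) \<and> w (map ((!) \<epsilon>s) ls) \<noteq> 0"
    if "m \<le> k" for m
    using that
  proof (induction m)
    case 0
    have "\<zeta>s = map ((!) \<epsilon>s) (map l [0..<k])" by (rule nth_equalityI) (use l z(1) in auto)
    then show ?case using z(3) l by (intro exI[of _ "map l [0..<k]"]) auto
  next
    case (Suc m)
    then obtain ls where ls: "length ls = k" "set ls \<subseteq> {..<k}" "\<forall>i<m. ls ! i = i" "w (map ((!) \<epsilon>s) ls) \<noteq> 0" by auto
    have m: "m < k" using Suc.prems by simp
    \<comment> \<open>A repetition would make \<open>w\<close> vanish, so \<open>ls\<close> is a
      permutation of the indices and \<open>m\<close> still occurs at some position j \<ge>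
      m.\<close>
    have "distinct ls" using ls(4) ext_fibre_distinct[OF w] by (metis distinct_map)
    then have "set ls = {..<k}" using ls(1,2) by (simp add: card_subset_eq distinct_card)
    then obtain j where j: "j < k" "ls ! j = m" using m ls(1) by (metis in_set_conv_nth lessThan_iff)
    then have "j \<ge> m" using ls(3) by (metis not_le less_irrefl)
    show ?case
    proof (cases "j = m")
      case True
      then show ?thesis using ls j by (intro exI[of _ ls]) (auto simp: less_Suc_eq)
    next
      case False
      define ls' where "ls' = ls[m := ls ! j, j := ls ! m]"
      have *: "set (map ((!) \<epsilon>s) ls) \<subseteq> dual_fibre S" using ls(2) \<epsilon>(1,2) by force
      have "map ((!) \<epsilon>s) ls' = (map ((!) \<epsilon>s) ls)[m := map ((!) \<epsilon>s) ls ! j, j := map ((!) \<epsilon>s) ls ! m]"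
        using ls(1) j m by (simp add: ls'_def map_update)
      then have "w (map ((!) \<epsilon>s) ls') = - w (map ((!) \<epsilon>s) ls)"
        using ext_fibre_swap[of "map ((!) \<epsilon>s) ls" m j] * ls(1) m j(1) False by simp
      moreover have "set ls' = set ls" unfolding ls'_def by (rule set_swap) (use ls j m in auto)
      moreover have "ls' ! i = i" if "i < Suc m" for i
        using that ls(1,3) j m \<open>j \<ge> m\<close> False by (cases "i = m") (auto simp: ls'_def)
      ultimately show ?thesis using ls by (intro exI[of _ ls']) (auto simp: ls'_def)
    qed
  qed
  from this[of k] obtain ls where ls: "length ls = k" "\<forall>i<k. ls ! i = i" "w (map ((!) \<epsilon>s) ls) \<noteq> 0" by auto
  have "ls = [0..<k]" by (rule nth_equalityI) (use ls in auto)
  then have "map ((!) \<epsilon>s) ls = \<epsilon>s" using \<epsilon>(1) map_nth by blast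
  then show False using ls(3) w0 by simp
qed

text \<open>All terms with j \<noteq> i repeat an argument and vanish. With arguments that span,
  this is Cramer's rule; summed over i, it makes a trace appear. Both uses occur below.\<close>

lemma ext_fibre_comb:
  assumes "length \<xi>s = k" "set \<xi>s \<subseteq> dual_fibre S" "i < k"
  shows "w (\<xi>s[i := \<Sum>j<k. c j *\<^sub>R (\<xi>s ! j)]) = c i * w \<xi>s"
proof -
  have "w (\<xi>s[i := \<Sum>j<k. c j *\<^sub>R (\<xi>s ! j)]) = (\<Sum>j<k. c j * w (\<xi>s[i := \<xi>s ! j]))"
    by (rule ext_fibre_sum[OF assms]) (use assms in auto)
  also have "\<dots> = (\<Sum>j<k. if j = i then c i * w \<xi>s else 0)"
  proof (rule sum.cong[OF refl])
    fix j assume j: "j \<in> {..<k}"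
    show "c j * w (\<xi>s[i := \<xi>s ! j]) = (if j = i then c i * w \<xi>s else 0)"
    proof (cases "j = i")
      case False
      have "\<xi>s[i := \<xi>s ! j] ! i = \<xi>s[i := \<xi>s ! j] ! j" using False assms j by simp
      then have "\<not> distinct (\<xi>s[i := \<xi>s ! j])"
        using False assms j by (metis length_list_update lessThan_iff nth_eq_iff_index_eq)
      then show ?thesis using False ext_fibre_distinct[OF w] by simp
    qed simp
  qed
  finally show ?thesis using assms(3) by simp
qed

end

text \<open>The shape shared by \<open>wedge\<close> and \<open>bivector_power\<close>, so that
  alternation and multilinearity are proved once for both.\<close>

definition alt_sum :: "nat \<Rightarrow> ((nat \<Rightarrow> 'v) \<Rightarrow> real) \<Rightarrow> 'v list \<Rightarrow> real"
  where "alt_sum k G \<xi>s = (\<Sum>p | p permutes {..<k}. of_int (sign p) * G (\<lambda>i. \<xi>s ! p i))"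

lemma alt_sum_in_ext_fibre:
  fixes G :: "(nat \<Rightarrow> 'e::real_vector \<Rightarrow> real) \<Rightarrow> real"
  assumes dep: "\<And>\<zeta> \<zeta>'. (\<And>j. j < k \<Longrightarrow> \<zeta> j = \<zeta>' j) \<Longrightarrow> G \<zeta> = G \<zeta>'"
    and lin: "\<And>\<zeta> i \<alpha> \<beta> a b. (\<And>j. j < k \<Longrightarrow> \<zeta> j \<in> dual_fibre S) \<Longrightarrow> i < k \<Longrightarrow> \<alpha> \<in> dual_fibre S \<Longrightarrow>
      \<beta> \<in> dual_fibre S \<Longrightarrow> G (\<zeta>(i := a *\<^sub>R \<alpha> + b *\<^sub>R \<beta>)) = a * G (\<zeta>(i := \<alpha>)) + b * G (\<zeta>(i := \<beta>))"
  shows "(\<lambda>\<xi>s. if length \<xi>s = k \<and> set \<xi>s \<subseteq> dual_fibre S then alt_sum k G \<xi>s * c else 0) \<in> ext_fibre k S"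
proof -
  have nd: "alt_sum k G \<xi>s = 0" if l: "length \<xi>s = k" and nd': "\<not> distinct \<xi>s" for \<xi>s
  proof -
    obtain a b where ab: "a < k" "b < k" "a \<noteq> b" "\<xi>s ! a = \<xi>s ! b"
      using l nd' unfolding distinct_conv_nth by metis
    \<comment> \<open>Composing with the transposition of two equal slots leaves each value of
      \<open>G\<close> unchanged and reverses each sign, so the sum equals its own negative.\<close>
    define t where "t = Transposition.transpose a b"
    have t: "t permutes {..<k}" unfolding t_def by (rule permutes_swap_id) (use ab in auto)
    have "alt_sum k G \<xi>s = (\<Sum>p | p permutes {..<k}. of_int (sign (t \<circ> p)) * G (\<lambda>i. \<xi>s ! (t \<circ> p) i))"
      unfolding alt_sum_def by (rule setum_permutations_compose_left[OF t])
    also have "\<dots> = (\<Sum>p | p permutes {..<k}. - (of_int (sign p) * G (\<lambda>i. \<xi>s ! p i)))"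
    proof (rule sum.cong[OF refl], clarify)
      fix p assume p: "p permutes {..<k}"
      have "sign (t \<circ> p) = - sign p"
        using sign_compose[of t p] t p ab(3) permutes_imp_permutation[of "{..<k}"]
        by (simp add: t_def sign_swap_id)
      moreover have "\<xi>s ! t j = \<xi>s ! j" for j using ab by (auto simp: t_def Transposition.transpose_def)
      ultimately show "of_int (sign (t \<circ> p)) * G (\<lambda>i. \<xi>s ! (t \<circ> p) i) = - (of_int (sign p) * G (\<lambda>i. \<xi>s ! p i))"
        by simp
    qed
    also have "\<dots> = - alt_sum k G \<xi>s" by (simp add: alt_sum_def sum_negf)
    finally show ?thesis by simp
  qed
  have li: "alt_sum k G (\<xi>s[i := a *\<^sub>R \<alpha> + b *\<^sub>R \<beta>]) = a * alt_sum k G (\<xi>s[i := \<alpha>]) + b * alt_sum k G (\<xi>s[i := \<beta>])"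
    if *: "length \<xi>s = k" "set \<xi>s \<subseteq> dual_fibre S" "i < k" "\<alpha> \<in> dual_fibre S" "\<beta> \<in> dual_fibre S" for \<xi>s i \<alpha> \<beta> a b
  proof -
    have "G (\<lambda>j. \<xi>s[i := a *\<^sub>R \<alpha> + b *\<^sub>R \<beta>] ! p j) = a * G (\<lambda>j. \<xi>s[i := \<alpha>] ! p j) + b * G (\<lambda>j. \<xi>s[i := \<beta>] ! p j)"
      if p: "p permutes {..<k}" for p
    proof -
      \<comment> \<open>The entry in list position i is read by \<open>G\<close> as its argument
        number \<open>inv p i\<close>; that is the argument in which linearity is invoked.\<close>
      have q: "inv p i < k" using permutes_in_image[OF permutes_inv[OF p], of i] *(3) by simp
      have e: "G (\<lambda>j. \<xi>s[i := \<gamma>] ! p j) = G ((\<lambda>j. \<xi>s ! p j)(inv p i := \<gamma>))" for \<gamma>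
        by (rule dep) (use * permutes_inverses[OF p] permutes_in_image[OF p] in
            \<open>auto simp: nth_list_update\<close>)
      have "\<xi>s ! p j \<in> dual_fibre S" if "j < k" for j
        using * permutes_in_image[OF p, of j] that by auto
      then show ?thesis unfolding e using lin[of "\<lambda>j. \<xi>s ! p j" "inv p i" \<alpha> \<beta> a b] q * by blast
    qed
    then show ?thesis
      by (simp add: alt_sum_def sum_distrib_left algebra_simps flip: sum.distrib)
  qed
  have up: "set (\<xi>s[i := \<alpha>]) \<subseteq> dual_fibre S" if "set \<xi>s \<subseteq> dual_fibre S" "\<alpha> \<in> dual_fibre S" for \<xi>s i \<alpha>
    using that set_update_subset_insert by fastforce
  show ?thesis
    unfolding ext_fibre_def
    by (auto simp: nd up dual_fibre_lin li algebra_simps)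
qed

text \<open>Any permutation other than the identity moves some i, and there the dual basis
  contributes a factor 0. Only the identity survives.\<close>

lemma alt_sum_prod_coord:
  assumes vs: "basis_of vs S" "length vs = k"
  shows "alt_sum k (\<lambda>\<zeta>. \<Prod>i<k. \<zeta> i (vs ! i)) (map (coord vs) [0..<k]) = 1"
proof -
  have "of_int (sign p) * (\<Prod>i<k. (map (coord vs) [0..<k] ! p i) (vs ! i)) = (if p = id then 1 else 0 :: real)"
    if p: "p permutes {..<k}" for p
  proof (cases "p = id")
    case True
    then show ?thesis using coord_nth[OF vs(1)] vs(2) by simp
  next
    case False
    then obtain i where i: "p i \<noteq> i" by (auto simp: fun_eq_iff)
    then have "i < k" using permutes_not_in[OF p, of i] by auto
    moreover from this have "p i < k" using permutes_in_image[OF p, of i] by simp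
    ultimately have "(map (coord vs) [0..<k] ! p i) (vs ! i) = 0" using coord_nth[OF vs(1)] vs(2) i by simp
    then show ?thesis using False \<open>i < k\<close> by (auto intro!: prod_zero)
  qed
  then have "alt_sum k (\<lambda>\<zeta>. \<Prod>i<k. \<zeta> i (vs ! i)) (map (coord vs) [0..<k]) =
      (\<Sum>p | p permutes {..<k}. if p = id then 1 else 0)"
    unfolding alt_sum_def by (intro sum.cong) auto
  also have "\<dots> = 1" by (simp add: finite_permutations permutes_id)
  finally show ?thesis .
qed

lemma fibre_dual: "fibre (dual_bundle E) x = dual_fibre (fibre E x)"
  by (simp add: dual_bundle_def hom_bundle_def trivial_line_def)

lemma wedge_alt_sum:
  "wedge E es x = (\<lambda>\<xi>s. if length \<xi>s = length es \<and> set \<xi>s \<subseteq> dual_fibre (fibre E x)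
     then alt_sum (length es) (\<lambda>\<zeta>. \<Prod>i<length es. \<zeta> i ((es ! i) x)) \<xi>s * 1 else 0)"
  by (auto simp: wedge_def fibre_dual alt_sum_def fun_eq_iff)

lemma wedge_in_ext_fibre: "set (map (\<lambda>e. e x) es) \<subseteq> fibre E x \<Longrightarrow> wedge E es x \<in> ext_fibre (length es) (fibre E x)"
  unfolding wedge_alt_sum
proof (rule alt_sum_in_ext_fibre)
  fix \<zeta> :: "nat \<Rightarrow> 'a \<Rightarrow> real" and i \<alpha> \<beta> and a b :: real assume i: "i < length es"
  have "(\<Prod>j<length es. (\<zeta>(i := \<gamma>)) j ((es ! j) x)) = \<gamma> ((es ! i) x) * (\<Prod>j\<in>{..<length es} - {i}. \<zeta> j ((es ! j) x))" for \<gamma>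
    using i by (subst prod.remove[of _ i]) auto
  then show "(\<Prod>j<length es. (\<zeta>(i := a *\<^sub>R \<alpha> + b *\<^sub>R \<beta>)) j ((es ! j) x)) =
      a * (\<Prod>j<length es. (\<zeta>(i := \<alpha>)) j ((es ! j) x)) + b * (\<Prod>j<length es. (\<zeta>(i := \<beta>)) j ((es ! j) x))"
    by (simp add: scaleR_fun_def algebra_simps)
qed auto

lemma bivector_power_alt_sum:
  "bivector_power n E P x = (\<lambda>\<xi>s. if length \<xi>s = 2 * n \<and> set \<xi>s \<subseteq> dual_fibre (fibre E x)
     then alt_sum (2 * n) (\<lambda>\<zeta>. \<Prod>i<n. P x [\<zeta> (2 * i), \<zeta> (2 * i + 1)]) \<xi>s * (1 / 2 ^ n) else 0)"
  by (auto simp: bivector_power_def fibre_dual alt_sum_def fun_eq_iff)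

lemma ext2_lin:
  assumes "P \<in> ext_fibre 2 S" "\<alpha> \<in> dual_fibre S" "\<beta> \<in> dual_fibre S" "\<gamma> \<in> dual_fibre S"
  shows "P [a *\<^sub>R \<alpha> + b *\<^sub>R \<beta>, \<gamma>] = a * P [\<alpha>, \<gamma>] + b * P [\<beta>, \<gamma>]"
    and "P [\<gamma>, a *\<^sub>R \<alpha> + b *\<^sub>R \<beta>] = a * P [\<gamma>, \<alpha>] + b * P [\<gamma>, \<beta>]"
  using ext_fibre_lin[OF assms(1), of "[\<alpha>, \<gamma>]" 0 \<alpha> \<beta> a b] ext_fibre_lin[OF assms(1), of "[\<gamma>, \<alpha>]" 1 \<alpha> \<beta> a b] assms
  by auto

lemma ext2_sum:
  assumes "P \<in> ext_fibre 2 S" "\<And>i. i \<in> J \<Longrightarrow> \<alpha> i \<in> dual_fibre S" "\<gamma> \<in> dual_fibre S"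
  shows "P [\<Sum>i\<in>J. c i *\<^sub>R \<alpha> i, \<gamma>] = (\<Sum>i\<in>J. c i * P [\<alpha> i, \<gamma>])"
    and "P [\<gamma>, \<Sum>i\<in>J. c i *\<^sub>R \<alpha> i] = (\<Sum>i\<in>J. c i * P [\<gamma>, \<alpha> i])"
  using ext_fibre_sum[OF assms(1), of "[\<gamma>, \<gamma>]" 0 J \<alpha> c] ext_fibre_sum[OF assms(1), of "[\<gamma>, \<gamma>]" 1 J \<alpha> c] assms
  by auto

lemma ext2_self: "P \<in> ext_fibre 2 S \<Longrightarrow> P [\<alpha>, \<alpha>] = 0"
  using ext_fibre_distinct[of P 2 S "[\<alpha>, \<alpha>]"] by simp

lemma ext2_skew:
  assumes "P \<in> ext_fibre 2 S"
  shows "P [\<alpha>, \<beta>] = - P [\<beta>, \<alpha>]"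
proof (cases "\<alpha> \<in> dual_fibre S \<and> \<beta> \<in> dual_fibre S")
  case True
  then show ?thesis using ext_fibre_swap[OF assms, of "[\<alpha>, \<beta>]" 0 1] by simp
next
  case False
  then show ?thesis using ext_fibre_outside[OF assms, of "[\<alpha>, \<beta>]"] ext_fibre_outside[OF assms, of "[\<beta>, \<alpha>]"] by auto
qed

lemma ext2I:
  assumes "\<And>\<xi>s. \<not> (length \<xi>s = 2 \<and> set \<xi>s \<subseteq> dual_fibre S) \<Longrightarrow> P \<xi>s = 0"
    and skew: "\<And>\<alpha> \<beta>. \<alpha> \<in> dual_fibre S \<Longrightarrow> \<beta> \<in> dual_fibre S \<Longrightarrow> P [\<alpha>, \<beta>] = - P [\<beta>, \<alpha>]"
    and lin: "\<And>\<alpha> \<beta> \<gamma> a b. \<alpha> \<in> dual_fibre S \<Longrightarrow> \<beta> \<in> dual_fibre S \<Longrightarrow> \<gamma> \<in> dual_fibre S \<Longrightarrow>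
      P [\<gamma>, a *\<^sub>R \<alpha> + b *\<^sub>R \<beta>] = a * P [\<gamma>, \<alpha>] + b * P [\<gamma>, \<beta>]"
  shows "P \<in> ext_fibre 2 S"
  unfolding ext_fibre_def
proof (intro CollectI conjI allI impI; (elim conjE)?)
  fix \<xi>s :: "('a \<Rightarrow> real) list" assume d: "\<not> distinct \<xi>s"
  show "P \<xi>s = 0"
  proof (cases "length \<xi>s = 2 \<and> set \<xi>s \<subseteq> dual_fibre S")
    case True
    then obtain \<alpha> \<beta> where "\<xi>s = [\<alpha>, \<beta>]" by (auto simp: numeral_2_eq_2 length_Suc_conv)
    then show ?thesis using d True skew[of \<alpha> \<alpha>] by auto
  qed (use assms(1) in blast)
next
  fix \<xi>s :: "('a \<Rightarrow> real) list" and i :: nat and \<alpha> \<beta> and a b :: real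
  assume l: "length \<xi>s = 2" and s: "set \<xi>s \<subseteq> dual_fibre S" and i: "i < 2"
    and ab: "\<alpha> \<in> dual_fibre S" "\<beta> \<in> dual_fibre S"
  obtain \<gamma> \<delta> where x: "\<xi>s = [\<gamma>, \<delta>]" using l by (auto simp: numeral_2_eq_2 length_Suc_conv)
  have g: "\<gamma> \<in> dual_fibre S" "\<delta> \<in> dual_fibre S" using s x by auto
  have L: "P [a *\<^sub>R \<alpha> + b *\<^sub>R \<beta>, \<delta>] = a * P [\<alpha>, \<delta>] + b * P [\<beta>, \<delta>]"
    using skew[OF dual_fibre_lin[OF ab] g(2), of a b] lin[OF ab g(2), of a b]
      skew[OF ab(1) g(2)] skew[OF ab(2) g(2)] by simp
  have "i = 0 \<or> i = 1" using i by auto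
  then show "P (\<xi>s[i := a *\<^sub>R \<alpha> + b *\<^sub>R \<beta>]) = a * P (\<xi>s[i := \<alpha>]) + b * P (\<xi>s[i := \<beta>])"
    using lin[OF ab g(1)] L x by auto
qed (use assms(1) in blast)

lemma bivector_power_in_ext_fibre:
  assumes P: "P x \<in> ext_fibre 2 (fibre E x)"
  shows "bivector_power n E P x \<in> ext_fibre (2 * n) (fibre E x)"
  unfolding bivector_power_alt_sum
proof (rule alt_sum_in_ext_fibre)
  fix \<zeta> \<zeta>' :: "nat \<Rightarrow> 'a \<Rightarrow> real" assume "\<And>j. j < 2 * n \<Longrightarrow> \<zeta> j = \<zeta>' j"
  then show "(\<Prod>i<n. P x [\<zeta> (2 * i), \<zeta> (2 * i + 1)]) = (\<Prod>i<n. P x [\<zeta>' (2 * i), \<zeta>' (2 * i + 1)])"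
    by (intro prod.cong) auto
next
  fix \<zeta> :: "nat \<Rightarrow> 'a \<Rightarrow> real" and i :: nat and \<alpha> \<beta> and a b :: real
  assume z: "\<And>j. j < 2 * n \<Longrightarrow> \<zeta> j \<in> dual_fibre (fibre E x)" and i: "i < 2 * n"
    and ab: "\<alpha> \<in> dual_fibre (fibre E x)" "\<beta> \<in> dual_fibre (fibre E x)"
  \<comment> \<open>Slot i occurs only in the factor with number i div 2. The product is therefore
    one bilinear factor times \<open>R\<close>, and \<open>R\<close> does not see the
    update.\<close>
  define q where "q = i div 2"
  have q: "q < n" using i by (auto simp: q_def)
  define R where "R = (\<Prod>j\<in>{..<n} - {q}. P x [\<zeta> (2 * j), \<zeta> (2 * j + 1)])"
  have R: "(\<Prod>j<n. P x [(\<zeta>(i := \<gamma>)) (2 * j), (\<zeta>(i := \<gamma>)) (2 * j + 1)])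
      = P x [(\<zeta>(i := \<gamma>)) (2 * q), (\<zeta>(i := \<gamma>)) (2 * q + 1)] * R" for \<gamma>
  proof -
    have "(\<Prod>j\<in>{..<n} - {q}. P x [(\<zeta>(i := \<gamma>)) (2 * j), (\<zeta>(i := \<gamma>)) (2 * j + 1)]) = R"
      unfolding R_def q_def by (rule prod.cong) auto
    then show ?thesis using q by (subst prod.remove[of _ q]) auto
  qed
  have zq: "\<zeta> (2 * q) \<in> dual_fibre (fibre E x)" "\<zeta> (2 * q + 1) \<in> dual_fibre (fibre E x)"
    using z q by auto
  have "i = 2 * q \<or> i = 2 * q + 1" by (auto simp: q_def)
  then show "(\<Prod>j<n. P x [(\<zeta>(i := a *\<^sub>R \<alpha> + b *\<^sub>R \<beta>)) (2 * j), (\<zeta>(i := a *\<^sub>R \<alpha> + b *\<^sub>R \<beta>)) (2 * j + 1)]) =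
      a * (\<Prod>j<n. P x [(\<zeta>(i := \<alpha>)) (2 * j), (\<zeta>(i := \<alpha>)) (2 * j + 1)]) +
      b * (\<Prod>j<n. P x [(\<zeta>(i := \<beta>)) (2 * j), (\<zeta>(i := \<beta>)) (2 * j + 1)])"
    unfolding R using ext2_lin[OF P ab zq(1)] ext2_lin[OF P ab zq(2)] by (auto simp: algebra_simps)
qed

lemma wedge_coord:
  assumes "basis_of (map (\<lambda>e. e x) es) (fibre E x)"
  shows "wedge E es x (map (coord (map (\<lambda>e. e x) es)) [0..<length es]) = 1"
proof -
  have "(\<lambda>\<zeta>. \<Prod>i<length es. \<zeta> i ((es ! i) x)) = (\<lambda>\<zeta>. \<Prod>i<length es. \<zeta> i (map (\<lambda>e. e x) es ! i) :: real)"
    by (intro ext prod.cong) auto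
  then show ?thesis unfolding wedge_alt_sum
    using alt_sum_prod_coord[OF assms, of "length es"] coord_dual[OF assms] by auto
qed

text \<open>The top exterior power is a line. The difference of both sides vanishes on the dual
  basis, whose elements span the dual space, so \<open>ext_fibre_vanish\<close> kills it.\<close>

lemma ext_top_eq_wedge:
  assumes b: "basis_of (map (\<lambda>e. e x) es) (fibre E x)" and w: "w \<in> ext_fibre (length es) (fibre E x)"
  shows "w = w (map (coord (map (\<lambda>e. e x) es)) [0..<length es]) *\<^sub>R wedge E es x"
proof -
  let ?\<epsilon> = "map (coord (map (\<lambda>e. e x) es)) [0..<length es]"
  define u where "u = w - w ?\<epsilon> *\<^sub>R wedge E es x"
  have "set (map (\<lambda>e. e x) es) \<subseteq> fibre E x"
    using b by (metis basis_of_def span_superset)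
  then have "u \<in> ext_fibre (length es) (fibre E x)"
    unfolding u_def by (intro subspace_diff subspace_scale subspace_ext_fibre w wedge_in_ext_fibre)
  moreover have "u ?\<epsilon> = 0" using wedge_coord[OF b] by (simp add: u_def scaleR_fun_def)
  moreover have "set ?\<epsilon> \<subseteq> dual_fibre (fibre E x)" using coord_dual[OF b] by auto
  moreover have "dual_fibre (fibre E x) \<subseteq> span (set ?\<epsilon>)"
    using coord_basis_dual[OF b] unfolding basis_of_def by simp
  ultimately have u0: "u = 0"
    using ext_fibre_vanish[of u "length es" "fibre E x" ?\<epsilon>] by simp
  show ?thesis using u0 unfolding u_def by (rule eq_iff_diff_eq_0[THEN iffD2])
qed

section \<open>Sections of vector bundles\<close>

definition coframe :: "('p \<Rightarrow> 'e::real_vector) list \<Rightarrow> nat \<Rightarrow> 'p \<Rightarrow> 'e \<Rightarrow> real"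
  where "coframe es i x = coord (map (\<lambda>e. e x) es) i"

lemma frames_dual:
  "frames (dual_bundle E) = {(U, map (coframe es) [0..<length es]) | U es. (U, es) \<in> frames E}"
proof -
  have "[\<lambda>x v. representation (set (map (\<lambda>e'. e' x) es)) v (e x) *\<^sub>R (f x :: real). e \<leftarrow> es, f \<leftarrow> [\<lambda>x. 1]]
      = map (coframe es) [0..<length es]" for es :: "('p \<Rightarrow> 'e::real_vector) list"
  proof -
    have "concat (map (\<lambda>e. map (\<lambda>f x v. representation (set (map (\<lambda>e'. e' x) es)) v (e x) *\<^sub>R (f x :: real)) [\<lambda>x. 1]) es)
        = map (\<lambda>e x v. representation (set (map (\<lambda>e'. e' x) es)) v (e x)) es"
      by (induction es rule: rev_induct) simp_all
    also have "\<dots> = map (coframe es) [0..<length es]"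
      by (rule nth_equalityI) (auto simp: coframe_def coord_def fun_eq_iff)
    finally show ?thesis .
  qed
  then show ?thesis by (auto simp: dual_bundle_def hom_bundle_def trivial_line_def)
qed

locale smooth_bundle = manifold M
  for M :: "('p::{t2_space, second_countable_topology}, 'd::finite) atlas" +
  fixes E :: "('p, 'e::real_vector, 'z) vbundle_scheme"
  assumes vector_bundle: "vector_bundle M E"
begin

lemma frame_open: "(V, es) \<in> frames E \<Longrightarrow> open V"
  and frame_basis: "(V, es) \<in> frames E \<Longrightarrow> x \<in> V \<Longrightarrow> basis_of (map (\<lambda>e. e x) es) (fibre E x)"
  and frame_section: "(V, es) \<in> frames E \<Longrightarrow> i < length es \<Longrightarrow> es ! i \<in> sections M E V"
  using vector_bundle unfolding vector_bundle_def by fastforce+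

lemma frame_exists: obtains V es where "(V, es) \<in> frames E" "x \<in> V"
proof -
  have "x \<in> (\<Union>(U, es)\<in>frames E. U)" using vector_bundle by (simp add: vector_bundle_def)
  then show thesis using that by auto
qed

lemma fibre_subspace: "subspace (fibre E x)"
  using frame_exists frame_basis basis_of_subspace by metis

lemma sections_fibre: "s \<in> sections M E U \<Longrightarrow> x \<in> U \<Longrightarrow> s x \<in> fibre E x"
  by (simp add: sections_def)

lemma coframe_dual: "(V, es) \<in> frames E \<Longrightarrow> x \<in> V \<Longrightarrow> coframe es i x \<in> dual_fibre (fibre E x)"
  unfolding coframe_def using coord_dual frame_basis by blast

lemma coframe_nth:
  "(V, es) \<in> frames E \<Longrightarrow> x \<in> V \<Longrightarrow> i < length es \<Longrightarrow> j < length es \<Longrightarrow>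
    coframe es i x ((es ! j) x) = (if i = j then 1 else 0)"
  unfolding coframe_def using coord_nth[OF frame_basis, of V es x i j] by simp

lemma frame_fibre: "(V, es) \<in> frames E \<Longrightarrow> x \<in> V \<Longrightarrow> i < length es \<Longrightarrow> (es ! i) x \<in> fibre E x"
  using frame_section sections_fibre by blast

lemma coframe_expand:
  "(V, es) \<in> frames E \<Longrightarrow> x \<in> V \<Longrightarrow> v \<in> fibre E x \<Longrightarrow> (\<Sum>i<length es. coframe es i x v *\<^sub>R (es ! i) x) = v"
  unfolding coframe_def using coord_expand[OF frame_basis, of V es x v] by simp

lemma coframe_sum:
  assumes "(V, es) \<in> frames E" "x \<in> V" "\<And>j. j \<in> J \<Longrightarrow> v j \<in> fibre E x"
  shows "coframe es i x (\<Sum>j\<in>J. c j *\<^sub>R v j) = (\<Sum>j\<in>J. c j * coframe es i x (v j))"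
  using hom_fibre_sum[OF coframe_dual[OF assms(1,2)] fibre_subspace, where J=J and v=v and c=c] assms(3) by simp

lemma dual_expand_frame:
  assumes "(V, es) \<in> frames E" "x \<in> V" "\<alpha> \<in> dual_fibre (fibre E x)"
  shows "\<alpha> = (\<Sum>i<length es. \<alpha> ((es ! i) x) *\<^sub>R coframe es i x)"
  using dual_expand[OF frame_basis[OF assms(1,2)] assms(3)] by (simp add: coframe_def)

text \<open>\<open>sections\<close> only asserts that smooth coefficients exist. Pairing with the
  coframe recovers them, so they are unique and given by a formula; all later smoothness proofs go
  through it.\<close>

lemma sections_iff:
  assumes "open U"
  shows "s \<in> sections M E U \<longleftrightarrow> (\<forall>x\<in>U. s x \<in> fibre E x) \<and>
    (\<forall>(V, es)\<in>frames E. \<forall>i<length es. smooth_fun M (U \<inter> V) (\<lambda>x. coframe es i x (s x)))"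
proof (intro iffI conjI; (elim conjE)?)
  assume s: "s \<in> sections M E U"
  show "\<forall>x\<in>U. s x \<in> fibre E x" using s by (simp add: sections_def)
  show "\<forall>(V, es)\<in>frames E. \<forall>i<length es. smooth_fun M (U \<inter> V) (\<lambda>x. coframe es i x (s x))"
  proof clarify
    fix V es i assume V: "(V, es) \<in> frames E" and i: "i < length es"
    obtain c :: "nat \<Rightarrow> 'p \<Rightarrow> real" where c: "\<forall>i<length es. smooth_fun M (U \<inter> V) (c i)"
      "\<forall>x\<in>U \<inter> V. s x = (\<Sum>i<length es. c i x *\<^sub>R (es ! i) x)"
      using s V by (fastforce simp: sections_def)
    have "c i x = coframe es i x (s x)" if x: "x \<in> U \<inter> V" for x
    proof -
      have "coframe es i x (s x) = (\<Sum>j<length es. c j x * coframe es i x ((es ! j) x))"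
        using c(2) x coframe_sum[OF V, where x=x and J="{..<length es}" and v="\<lambda>j. (es ! j) x" and i=i and c="\<lambda>j. c j x"]
          frame_fibre[OF V] by auto
      also have "\<dots> = (\<Sum>j<length es. if j = i then c i x else 0)"
        using x coframe_nth[OF V _ i] by (intro sum.cong) auto
      finally show ?thesis using i by simp
    qed
    then show "smooth_fun M (U \<inter> V) (\<lambda>x. coframe es i x (s x))"
      by (rule smooth_fun_cong[rotated]) (use c i assms frame_open[OF V] in auto)
  qed
next
  assume "\<forall>x\<in>U. s x \<in> fibre E x"
    and "\<forall>(V, es)\<in>frames E. \<forall>i<length es. smooth_fun M (U \<inter> V) (\<lambda>x. coframe es i x (s x))"
  then show "s \<in> sections M E U"
    unfolding sections_def by (force simp: coframe_expand intro!: exI[of _ "\<lambda>i x. coframe _ i x (s x)"])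
qed

lemma sections_coframe:
  assumes "open U" "s \<in> sections M E U" "(V, es) \<in> frames E" "i < length es"
  shows "smooth_fun M (U \<inter> V) (\<lambda>x. coframe es i x (s x))"
  using assms sections_iff by fast

text \<open>Membership in \<open>sections\<close> is tested against every frame. One frame near each
  point suffices, because the vectors of one frame have smooth coefficients in any other.\<close>

lemma sectionsI_local:
  assumes U: "open U" and f: "\<And>x. x \<in> U \<Longrightarrow> s x \<in> fibre E x"
    and loc: "\<And>x. x \<in> U \<Longrightarrow> \<exists>V es W. (V, es) \<in> frames E \<and> open W \<and> x \<in> W \<and> W \<subseteq> V \<and>
      (\<forall>i<length es. smooth_fun M W (\<lambda>y. coframe es i y (s y)))"
  shows "s \<in> sections M E U"
  unfolding sections_iff[OF U]
proof (intro conjI ballI f; clarify)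
  fix V' es' j assume V': "(V', es') \<in> frames E" and j: "j < length es'"
  show "smooth_fun M (U \<inter> V') (\<lambda>x. coframe es' j x (s x))"
  proof (rule smooth_fun_local)
    show "open (U \<inter> V')" using U frame_open[OF V'] by blast
    fix x assume x: "x \<in> U \<inter> V'"
    obtain V es W where W: "(V, es) \<in> frames E" "open W" "x \<in> W" "W \<subseteq> V"
      "\<forall>i<length es. smooth_fun M W (\<lambda>y. coframe es i y (s y))" using loc[of x] x by auto
    define W' where "W' = W \<inter> U \<inter> V'"
    have W': "open W'" using W U frame_open[OF V'] by (auto simp: W'_def)
    have "smooth_fun M W' (\<lambda>y. \<Sum>i<length es. coframe es i y (s y) * coframe es' j y ((es ! i) y))"
    proof (intro smooth_fun_sum smooth_fun_mult W')
      fix i assume i: "i \<in> {..<length es}"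
      show "smooth_fun M W' (\<lambda>y. coframe es i y (s y))"
        using W(5) i by (auto intro: smooth_fun_subset simp: W'_def)
      have "smooth_fun M (V \<inter> V') (\<lambda>y. coframe es' j y ((es ! i) y))"
        using sections_coframe[OF frame_open[OF W(1)] frame_section[OF W(1)] V' j] i by simp
      then show "smooth_fun M W' (\<lambda>y. coframe es' j y ((es ! i) y))"
        by (rule smooth_fun_subset) (use W in \<open>auto simp: W'_def\<close>)
    qed
    then have "smooth_fun M W' (\<lambda>y. coframe es' j y (s y))"
    proof (rule smooth_fun_cong[OF W', rotated])
      fix y assume y: "y \<in> W'"
      have "coframe es' j y (\<Sum>i<length es. coframe es i y (s y) *\<^sub>R (es ! i) y) =
          (\<Sum>i<length es. coframe es i y (s y) * coframe es' j y ((es ! i) y))"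
        by (rule coframe_sum[OF V']) (use y W frame_fibre[OF W(1)] in \<open>auto simp: W'_def\<close>)
      then show "(\<Sum>i<length es. coframe es i y (s y) * coframe es' j y ((es ! i) y)) = coframe es' j y (s y)"
        using coframe_expand[OF W(1), of y "s y"] f y W(4) by (auto simp: W'_def)
    qed
    then show "\<exists>W'. open W' \<and> x \<in> W' \<and> smooth_fun M W' (\<lambda>x. coframe es' j x (s x))"
      using W' x W(3) unfolding W'_def by blast
  qed
qed

lemma sections_local:
  assumes U: "open U" and loc: "\<And>x. x \<in> U \<Longrightarrow> \<exists>W. open W \<and> x \<in> W \<and> s \<in> sections M E W"
  shows "s \<in> sections M E U"
proof (rule sectionsI_local[OF U])
  fix x assume "x \<in> U"
  then obtain W where W: "open W" "x \<in> W" "s \<in> sections M E W" using loc by blast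
  then show "s x \<in> fibre E x" using sections_fibre by blast
  obtain V es where V: "(V, es) \<in> frames E" "x \<in> V" by (rule frame_exists)
  show "\<exists>V es W. (V, es) \<in> frames E \<and> open W \<and> x \<in> W \<and> W \<subseteq> V \<and>
      (\<forall>i<length es. smooth_fun M W (\<lambda>y. coframe es i y (s y)))"
    by (intro exI[of _ V] exI[of _ es] exI[of _ "W \<inter> V"])
      (use W V frame_open[OF V(1)] sections_coframe[OF W(1,3) V(1)] in auto)
qed

lemma sections_subset: "s \<in> sections M E U \<Longrightarrow> open U \<Longrightarrow> open W \<Longrightarrow> W \<subseteq> U \<Longrightarrow> s \<in> sections M E W"
  unfolding sections_iff by (fast intro: smooth_fun_subset)

lemma sections_cong:
  assumes "open U" "\<And>x. x \<in> U \<Longrightarrow> s x = t x" "s \<in> sections M E U"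
  shows "t \<in> sections M E U"
  using assms(3,2) unfolding sections_def by (auto 0 4)

lemma sections_add:
  assumes "open U" "s \<in> sections M E U" "t \<in> sections M E U"
  shows "(\<lambda>x. s x + t x) \<in> sections M E U"
  unfolding sections_iff[OF assms(1)]
proof (intro conjI ballI; clarify?)
  show "s x + t x \<in> fibre E x" if "x \<in> U" for x
    using that assms by (intro subspace_add fibre_subspace sections_fibre)
  fix V es i assume V: "(V, es) \<in> frames E" "i < length es"
  have o: "open (U \<inter> V)" using frame_open[OF V(1)] assms(1) by blast
  show "smooth_fun M (U \<inter> V) (\<lambda>x. coframe es i x (s x + t x))"
    by (rule smooth_fun_cong[OF o _ smooth_fun_add[OF o sections_coframe[OF assms(1,2) V] sections_coframe[OF assms(1,3) V]]])
      (use hom_fibre_add[OF coframe_dual[OF V(1)]] sections_fibre assms in auto)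
qed

lemma sections_scale:
  assumes "open U" "smooth_fun M U f" "s \<in> sections M E U"
  shows "(\<lambda>x. f x *\<^sub>R s x) \<in> sections M E U"
  unfolding sections_iff[OF assms(1)]
proof (intro conjI ballI; clarify?)
  show "f x *\<^sub>R s x \<in> fibre E x" if "x \<in> U" for x
    using that assms by (intro subspace_scale fibre_subspace sections_fibre)
  fix V es i assume V: "(V, es) \<in> frames E" "i < length es"
  have o: "open (U \<inter> V)" using frame_open[OF V(1)] assms(1) by blast
  show "smooth_fun M (U \<inter> V) (\<lambda>x. coframe es i x (f x *\<^sub>R s x))"
    by (rule smooth_fun_cong[OF o _ smooth_fun_mult[OF o smooth_fun_subset[OF assms(2)] sections_coframe[OF assms(1,3) V]]])
      (use hom_fibre_scale[OF coframe_dual[OF V(1)]] sections_fibre assms in auto)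
qed

lemma sections_zero:
  assumes "open U"
  shows "(\<lambda>x. 0) \<in> sections M E U"
  unfolding sections_iff[OF assms]
proof (intro conjI ballI subspace_0[OF fibre_subspace]; clarify)
  fix V es and i :: nat assume V: "(V, es) \<in> frames E"
  have o: "open (U \<inter> V)" using frame_open[OF V] assms by blast
  show "smooth_fun M (U \<inter> V) (\<lambda>x. coframe es i x 0)"
    by (rule smooth_fun_cong[OF o _ smooth_fun_const[OF o, of 0]])
      (use hom_fibre_zero[OF coframe_dual[OF V] fibre_subspace] in auto)
qed

lemma sections_sum:
  "open U \<Longrightarrow> (\<And>i. i \<in> J \<Longrightarrow> s i \<in> sections M E U) \<Longrightarrow> (\<lambda>x. \<Sum>i\<in>J. s i x) \<in> sections M E U"
  by (induction J rule: infinite_finite_induct) (auto intro: sections_zero sections_add)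

lemma sections_eq_dense:
  assumes "open W" "s \<in> sections M E W" "t \<in> sections M E W"
    and "closure D = UNIV" "\<And>x. x \<in> W \<Longrightarrow> x \<in> D \<Longrightarrow> s x = t x" "x \<in> W"
  shows "s x = t x"
proof -
  obtain V es where V: "(V, es) \<in> frames E" "x \<in> V" by (rule frame_exists)
  have "coframe es i x (s x) = coframe es i x (t x)" if i: "i < length es" for i
    by (rule smooth_fun_eq_dense[OF _ sections_coframe[OF assms(1,2) V(1) i] sections_coframe[OF assms(1,3) V(1) i] assms(4)])
      (use assms V frame_open in auto)
  then have "(\<Sum>i<length es. coframe es i x (s x) *\<^sub>R (es ! i) x) = (\<Sum>i<length es. coframe es i x (t x) *\<^sub>R (es ! i) x)"
    by simp
  then show ?thesis
    using coframe_expand[OF V sections_fibre[OF assms(2,6)]] coframe_expand[OF V sections_fibre[OF assms(3,6)]] by simp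
qed

text \<open>Brackets, closedness and the Poisson condition are phrased for global sections.
  Multiplying by a bump function replaces a local section by a global one with the same germ at
  x.\<close>

lemma section_extension:
  assumes "open W" "x \<in> W" "s \<in> sections M E W"
  obtains t W' where "t \<in> sections M E UNIV" "open W'" "x \<in> W'" "W' \<subseteq> W" "\<And>y. y \<in> W' \<Longrightarrow> t y = s y"
proof -
  obtain b W' K where b: "smooth_fun M UNIV b" "open W'" "x \<in> W'" "W' \<subseteq> W" "\<And>y. y \<in> W' \<Longrightarrow> b y = 1"
    "closed K" "K \<subseteq> W" "\<And>y. y \<notin> K \<Longrightarrow> b y = 0" by (rule smooth_bump_on[OF assms(1,2)]) blast
  have fib: "b y *\<^sub>R s y \<in> fibre E y" for y
  proof (cases "y \<in> K")
    case True
    then show ?thesis using b(7) sections_fibre[OF assms(3)] by (intro subspace_scale fibre_subspace) auto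
  qed (simp add: b(8) subspace_0[OF fibre_subspace])
  have "(\<lambda>y. b y *\<^sub>R s y) \<in> sections M E UNIV"
    unfolding sections_iff[OF open_UNIV]
  proof (intro conjI ballI; clarify?)
    fix V es i assume V: "(V, es) \<in> frames E" "i < length es"
    note o = frame_open[OF V(1)]
    have "smooth_fun M V (\<lambda>y. b y * coframe es i y (s y))"
      by (rule smooth_fun_extend_zero[OF b(1,6,7) assms(1) b(8) o sections_coframe[OF assms(1,3) V]])
    then show "smooth_fun M (UNIV \<inter> V) (\<lambda>y. coframe es i y (b y *\<^sub>R s y))"
      unfolding Int_UNIV_left
    proof (rule smooth_fun_cong[OF o, rotated])
      fix y assume y: "y \<in> V"
      show "b y * coframe es i y (s y) = coframe es i y (b y *\<^sub>R s y)"
      proof (cases "y \<in> K")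
        case True
        then show ?thesis using hom_fibre_scale[OF coframe_dual[OF V(1) y]] sections_fibre[OF assms(3)] b(7) by auto
      qed (simp add: b(8) hom_fibre_zero[OF coframe_dual[OF V(1) y] fibre_subspace])
    qed
  qed (use fib in auto)
  then show thesis using that[of "\<lambda>y. b y *\<^sub>R s y" W'] b by simp
qed

lemma section_through:
  assumes "v \<in> fibre E x"
  obtains s where "s \<in> sections M E UNIV" "s x = v"
proof -
  obtain V es where V: "(V, es) \<in> frames E" "x \<in> V" by (rule frame_exists)
  note o = frame_open[OF V(1)]
  have "(\<lambda>y. \<Sum>i<length es. coframe es i x v *\<^sub>R (es ! i) y) \<in> sections M E V"
    by (intro sections_sum sections_scale smooth_fun_const frame_section o V) auto
  then obtain t W' where "t \<in> sections M E UNIV" "x \<in> W'"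
    "\<And>y. y \<in> W' \<Longrightarrow> t y = (\<Sum>i<length es. coframe es i x v *\<^sub>R (es ! i) y)"
    by (rule section_extension[OF o V(2)]) blast
  then show thesis using that coframe_expand[OF V assms] by auto
qed

text \<open>Local solutions agree on \<open>D\<close> by uniqueness, hence on whole overlaps by
  density, so they patch together. The section is defined diagonally: its value at y is that of the
  solution chosen around y.\<close>

lemma sections_glue:
  assumes D: "closure D = UNIV"
    and loc: "\<And>x. \<exists>W s. open W \<and> x \<in> W \<and> s \<in> sections M E W \<and> (\<forall>y\<in>W \<inter> D. Q y (s y))"
    and uniq: "\<And>y v w. y \<in> D \<Longrightarrow> Q y v \<Longrightarrow> Q y w \<Longrightarrow> v = w"
  obtains s where "s \<in> sections M E UNIV" "\<And>y. y \<in> D \<Longrightarrow> Q y (s y)"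
proof -
  obtain W s where W: "\<And>x. open (W x)" "\<And>x. x \<in> W x" "\<And>x. s x \<in> sections M E (W x)"
    "\<And>x y. y \<in> W x \<Longrightarrow> y \<in> D \<Longrightarrow> Q y (s x y)"
    using loc by (metis IntI)
  have eq: "s x y = s y y" if "y \<in> W x" for x y
  proof (rule sections_eq_dense[of "W x \<inter> W y" "s x" "s y" D y])
    show "s x \<in> sections M E (W x \<inter> W y)" "s y \<in> sections M E (W x \<inter> W y)"
      by (auto intro: sections_subset[OF W(3) W(1)] W(1))
  qed (use D W that uniq in auto)
  have "(\<lambda>y. s y y) \<in> sections M E UNIV"
  proof (rule sections_local)
    fix x
    show "\<exists>V. open V \<and> x \<in> V \<and> (\<lambda>y. s y y) \<in> sections M E V"
      by (intro exI[of _ "W x"] conjI W(1,2) sections_cong[OF W(1) eq W(3)])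
  qed simp
  then show thesis using that[of "\<lambda>y. s y y"] W by blast
qed

subsection \<open>The dual bundle\<close>

lemma dual_frame_basis:
  assumes "(V, es) \<in> frames E" "x \<in> V"
  shows "basis_of (map (\<lambda>e. e x) (map (coframe es) [0..<length es])) (dual_fibre (fibre E x))"
  using coord_basis_dual[OF frame_basis[OF assms]] by (simp add: coframe_def o_def)

lemma coframe_dual_section:
  assumes V: "(V, es) \<in> frames E" and i: "i < length es"
  shows "coframe es i \<in> sections M (dual_bundle E) V"
  unfolding sections_def
proof (intro CollectI conjI ballI; clarify?)
  show "coframe es i x \<in> fibre (dual_bundle E) x" if "x \<in> V" for x
    using coframe_dual[OF V that] by (simp add: fibre_dual)
  fix V' fs assume "(V', fs) \<in> frames (dual_bundle E)"
  then obtain es' where V': "(V', es') \<in> frames E" and fs: "fs = map (coframe es') [0..<length es']"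
    by (auto simp: frames_dual)
  show "\<exists>c. (\<forall>i<length fs. smooth_fun M (V \<inter> V') (c i)) \<and>
      (\<forall>x\<in>V \<inter> V'. coframe es i x = (\<Sum>i<length fs. c i x *\<^sub>R (fs ! i) x))"
  proof (intro exI[of _ "\<lambda>j x. coframe es i x ((es' ! j) x)"] conjI allI impI ballI)
    show "smooth_fun M (V \<inter> V') (\<lambda>x. coframe es i x ((es' ! j) x))" if "j < length fs" for j
      using sections_coframe[OF frame_open[OF V'] frame_section[OF V'] V i, of j] that fs by (simp add: Int_commute)
    show "coframe es i x = (\<Sum>j<length fs. coframe es i x ((es' ! j) x) *\<^sub>R (fs ! j) x)" if "x \<in> V \<inter> V'" for x
      using dual_expand_frame[OF V' _ coframe_dual[OF V]] that fs by simp
  qed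
qed

lemma vector_bundle_dual: "vector_bundle M (dual_bundle E)"
  unfolding vector_bundle_def
proof (intro conjI ballI; clarify?)
  have "\<exists>V fs. (V, fs) \<in> frames (dual_bundle E) \<and> x \<in> V" for x
    by (rule frame_exists[of x]) (auto simp: frames_dual)
  then show "(\<Union>(U, es)\<in>frames (dual_bundle E). U) = UNIV" by fastforce
  fix V fs assume "(V, fs) \<in> frames (dual_bundle E)"
  then obtain es where V: "(V, es) \<in> frames E" and fs: "fs = map (coframe es) [0..<length es]"
    by (auto simp: frames_dual)
  show "open V \<and> (\<forall>x\<in>V. basis_of (map (\<lambda>e. e x) fs) (fibre (dual_bundle E) x)) \<and> set fs \<subseteq> sections M (dual_bundle E) V"
    using frame_open[OF V] dual_frame_basis[OF V] coframe_dual_section[OF V] by (auto simp: fs fibre_dual)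
qed

end

context smooth_bundle
begin

lemma bundle_dual: "smooth_bundle M (dual_bundle E)"
  by (intro smooth_bundle.intro manifold_axioms smooth_bundle_axioms.intro vector_bundle_dual)

text \<open>Double duality: the coordinates of a covector in the dual frame are its values on the
  frame. This is what lets \<open>dual_sections_iff\<close> test smoothness on frame
  vectors.\<close>

lemma coframe_coframe:
  assumes "(V, es) \<in> frames E" "x \<in> V" "\<alpha> \<in> dual_fibre (fibre E x)" "i < length es"
  shows "coframe (map (coframe es) [0..<length es]) i x \<alpha> = \<alpha> ((es ! i) x)"
proof -
  interpret d: smooth_bundle M "dual_bundle E" by (rule bundle_dual)
  let ?fs = "map (coframe es) [0..<length es]"
  have V': "(V, ?fs) \<in> frames (dual_bundle E)" using assms(1) by (auto simp: frames_dual)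
  have "coframe ?fs i x (\<Sum>j<length es. \<alpha> ((es ! j) x) *\<^sub>R coframe es j x) = (\<Sum>j<length es. \<alpha> ((es ! j) x) * coframe ?fs i x (coframe es j x))"
    by (rule d.coframe_sum[OF V' assms(2)]) (use coframe_dual[OF assms(1,2)] in \<open>auto simp: fibre_dual\<close>)
  also have "\<dots> = (\<Sum>j<length es. if j = i then \<alpha> ((es ! i) x) else 0)"
    using d.coframe_nth[OF V' assms(2), of i] assms(4) by (intro sum.cong) auto
  finally show ?thesis using dual_expand_frame[OF assms(1-3)] assms(4) by simp
qed

lemma dual_sections_iff:
  assumes "open U"
  shows "\<alpha> \<in> sections M (dual_bundle E) U \<longleftrightarrow> (\<forall>x\<in>U. \<alpha> x \<in> dual_fibre (fibre E x)) \<and>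
    (\<forall>(V, es)\<in>frames E. \<forall>i<length es. smooth_fun M (U \<inter> V) (\<lambda>x. \<alpha> x ((es ! i) x)))" (is "?L \<longleftrightarrow> ?F \<and> ?R")
proof -
  interpret d: smooth_bundle M "dual_bundle E" by (rule bundle_dual)
  have eq: "smooth_fun M (U \<inter> V) (\<lambda>x. coframe (map (coframe es) [0..<length es]) i x (\<alpha> x)) \<longleftrightarrow>
      smooth_fun M (U \<inter> V) (\<lambda>x. \<alpha> x ((es ! i) x))"
    if f: ?F and V: "(V, es) \<in> frames E" "i < length es" for V es i
  proof -
    have o: "open (U \<inter> V)" using assms frame_open[OF V(1)] by blast
    have e: "coframe (map (coframe es) [0..<length es]) i x (\<alpha> x) = \<alpha> x ((es ! i) x)" if "x \<in> U \<inter> V" for x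
      using coframe_coframe[OF V(1) _ _ V(2)] f that by auto
    show ?thesis
      using smooth_fun_cong[OF o, of "\<lambda>x. coframe (map (coframe es) [0..<length es]) i x (\<alpha> x)" "\<lambda>x. \<alpha> x ((es ! i) x)"]
        smooth_fun_cong[OF o, of "\<lambda>x. \<alpha> x ((es ! i) x)" "\<lambda>x. coframe (map (coframe es) [0..<length es]) i x (\<alpha> x)"] e
      by auto
  qed
  show ?thesis
  proof (cases ?F)
    case True
    have "(\<forall>(V, fs)\<in>frames (dual_bundle E). \<forall>i<length fs. smooth_fun M (U \<inter> V) (\<lambda>x. coframe fs i x (\<alpha> x))) \<longleftrightarrow> ?R"
      unfolding frames_dual using eq[OF True] by fastforce
    then show ?thesis using True unfolding d.sections_iff[OF assms] fibre_dual by blast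
  next
    case False
    then show ?thesis unfolding d.sections_iff[OF assms] fibre_dual by blast
  qed
qed

lemma dual_section_fibre: "\<alpha> \<in> sections M (dual_bundle E) U \<Longrightarrow> x \<in> U \<Longrightarrow> \<alpha> x \<in> dual_fibre (fibre E x)"
  by (simp add: sections_def fibre_dual)

lemma smooth_pairing:
  assumes U: "open U" and a: "\<alpha> \<in> sections M (dual_bundle E) U" and s: "s \<in> sections M E U"
  shows "smooth_fun M U (\<lambda>x. \<alpha> x (s x))"
proof (rule smooth_fun_local[OF U])
  fix x assume x: "x \<in> U"
  obtain V es where V: "(V, es) \<in> frames E" "x \<in> V" by (rule frame_exists)
  have o: "open (U \<inter> V)" using U frame_open[OF V(1)] by blast
  have "smooth_fun M (U \<inter> V) (\<lambda>y. \<Sum>i<length es. coframe es i y (s y) * \<alpha> y ((es ! i) y))"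
  proof (intro smooth_fun_sum smooth_fun_mult o)
    fix i assume "i \<in> {..<length es}"
    then show "smooth_fun M (U \<inter> V) (\<lambda>y. coframe es i y (s y))" "smooth_fun M (U \<inter> V) (\<lambda>y. \<alpha> y ((es ! i) y))"
      using sections_coframe[OF U s V(1)] a V(1) unfolding dual_sections_iff[OF U] by fast+
  qed
  then have "smooth_fun M (U \<inter> V) (\<lambda>y. \<alpha> y (s y))"
  proof (rule smooth_fun_cong[OF o, rotated])
    fix y assume y: "y \<in> U \<inter> V"
    have "\<alpha> y (\<Sum>i<length es. coframe es i y (s y) *\<^sub>R (es ! i) y) = (\<Sum>i<length es. coframe es i y (s y) *\<^sub>R \<alpha> y ((es ! i) y))"
      by (rule hom_fibre_sum[OF dual_section_fibre[OF a] fibre_subspace]) (use y frame_fibre[OF V(1)] in auto)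
    then show "(\<Sum>i<length es. coframe es i y (s y) * \<alpha> y ((es ! i) y)) = \<alpha> y (s y)"
      using coframe_expand[OF V(1), of y "s y"] sections_fibre[OF s] y by auto
  qed
  then show "\<exists>W'. open W' \<and> x \<in> W' \<and> smooth_fun M W' (\<lambda>y. \<alpha> y (s y))" using o x V by blast
qed

lemma dual_sectionsI_local:
  assumes U: "open U" and f: "\<And>x. x \<in> U \<Longrightarrow> \<alpha> x \<in> dual_fibre (fibre E x)"
    and loc: "\<And>x. x \<in> U \<Longrightarrow> \<exists>V es W. (V, es) \<in> frames E \<and> open W \<and> x \<in> W \<and> W \<subseteq> V \<and>
      (\<forall>i<length es. smooth_fun M W (\<lambda>y. \<alpha> y ((es ! i) y)))"
  shows "\<alpha> \<in> sections M (dual_bundle E) U"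
proof -
  interpret d: smooth_bundle M "dual_bundle E" by (rule bundle_dual)
  show ?thesis
  proof (rule d.sectionsI_local[OF U])
    show "\<alpha> x \<in> fibre (dual_bundle E) x" if "x \<in> U" for x using f[OF that] by (simp add: fibre_dual)
    fix x assume x: "x \<in> U"
    obtain V es W where W: "(V, es) \<in> frames E" "open W" "x \<in> W" "W \<subseteq> V"
      "\<forall>i<length es. smooth_fun M W (\<lambda>y. \<alpha> y ((es ! i) y))" using loc[OF x] by blast
    let ?fs = "map (coframe es) [0..<length es]"
    have oWU: "open (W \<inter> U)" using W(2) U by blast
    have "smooth_fun M (W \<inter> U) (\<lambda>y. coframe ?fs i y (\<alpha> y))" if i: "i < length ?fs" for i
    proof (rule smooth_fun_cong[OF oWU])
      show "smooth_fun M (W \<inter> U) (\<lambda>y. \<alpha> y ((es ! i) y))" using W(5) i by (auto intro: smooth_fun_subset)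
      show "\<alpha> y ((es ! i) y) = coframe ?fs i y (\<alpha> y)" if "y \<in> W \<inter> U" for y
        using coframe_coframe[OF W(1) _ f, of y i] that W(4) i by auto
    qed
    then show "\<exists>V es W. (V, es) \<in> frames (dual_bundle E) \<and> open W \<and> x \<in> W \<and> W \<subseteq> V \<and>
        (\<forall>i<length es. smooth_fun M W (\<lambda>y. coframe es i y (\<alpha> y)))"
      using W oWU x by (intro exI[of _ V] exI[of _ ?fs] exI[of _ "W \<inter> U"]) (auto simp: frames_dual)
  qed
qed

lemma smooth_wedge:
  assumes U: "open U" and "\<And>\<alpha>. \<alpha> \<in> set \<alpha>s \<Longrightarrow> \<alpha> \<in> sections M (dual_bundle E) U"
    and "\<And>s. s \<in> set ss \<Longrightarrow> s \<in> sections M E U" and "length \<alpha>s = length ss"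
  shows "smooth_fun M U (\<lambda>x. wedge E ss x (map (\<lambda>\<alpha>. \<alpha> x) \<alpha>s))"
proof -
  have "smooth_fun M U (\<lambda>x. \<Sum>p | p permutes {..<length ss}. of_int (sign p) * (\<Prod>i<length ss. (\<alpha>s ! p i) x ((ss ! i) x)))"
  proof (intro smooth_fun_sum smooth_fun_mult smooth_fun_prod smooth_fun_const U smooth_pairing[OF U])
    fix p i assume p: "p \<in> {p. p permutes {..<length ss}}" and i: "i \<in> {..<length ss}"
    then have "p i < length ss" using permutes_in_image[of p _ i] by auto
    then show "\<alpha>s ! p i \<in> sections M (dual_bundle E) U" "ss ! i \<in> sections M E U" using assms i by auto
  qed
  then show ?thesis
  proof (rule smooth_fun_cong[OF U, rotated])
    fix x assume x: "x \<in> U"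
    have "(\<Prod>i<length ss. (\<alpha>s ! p i) x ((ss ! i) x)) = (\<Prod>i<length ss. (map (\<lambda>\<alpha>. \<alpha> x) \<alpha>s ! p i) ((ss ! i) x))"
      if p: "p permutes {..<length ss}" for p
      by (rule prod.cong) (use permutes_in_image[OF p] assms(4) in auto)
    moreover have "set (map (\<lambda>\<alpha>. \<alpha> x) \<alpha>s) \<subseteq> dual_fibre (fibre E x)"
      using dual_section_fibre[OF assms(2) x] by auto
    ultimately show "(\<Sum>p | p permutes {..<length ss}. of_int (sign p) * (\<Prod>i<length ss. (\<alpha>s ! p i) x ((ss ! i) x))) =
        wedge E ss x (map (\<lambda>\<alpha>. \<alpha> x) \<alpha>s)"
      using assms(4) by (simp add: wedge_def fibre_dual)
  qed
qed

text \<open>Cramer's rule in the form \<open>w(\<alpha>\<^sub>1, \<dots>, \<alpha>, \<dots>, \<alpha>\<^sub>k) = c\<^sub>i w(\<alpha>\<^sub>1, \<dots>, \<alpha>\<^sub>k)\<close> for a top-degree \<open>w\<close>.\<close>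

lemma dual_local_frame_coeffs:
  assumes U: "open U" and fr: "local_frame M (dual_bundle E) U \<alpha>s" and a: "\<alpha> \<in> sections M (dual_bundle E) U"
  obtains c where "\<And>i. i < length \<alpha>s \<Longrightarrow> smooth_fun M U (c i)"
    "\<And>x. x \<in> U \<Longrightarrow> \<alpha> x = (\<Sum>i<length \<alpha>s. c i x *\<^sub>R (\<alpha>s ! i) x)"
proof -
  have bas: "basis_of (map (\<lambda>\<alpha>. \<alpha> x) \<alpha>s) (dual_fibre (fibre E x))" if "x \<in> U" for x
    using fr that by (simp add: local_frame_def fibre_dual)
  have sec: "\<beta> \<in> sections M (dual_bundle E) U" if "\<beta> \<in> set \<alpha>s" for \<beta> using fr that by (auto simp: local_frame_def)
  define c where "c i x = coord (map (\<lambda>\<alpha>. \<alpha> x) \<alpha>s) i (\<alpha> x)" for i x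
  have ex: "\<alpha> x = (\<Sum>i<length \<alpha>s. c i x *\<^sub>R (\<alpha>s ! i) x)" if "x \<in> U" for x
    using coord_expand[OF bas[OF that] dual_section_fibre[OF a that]] by (simp add: c_def)
  have "smooth_fun M U (c i)" if i: "i < length \<alpha>s" for i
  proof (rule smooth_fun_local[OF U])
    fix x assume x: "x \<in> U"
    obtain V es where V: "(V, es) \<in> frames E" "x \<in> V" by (rule frame_exists)
    let ?W = "U \<inter> V"
    have o: "open ?W" using U frame_open[OF V(1)] by blast
    have len: "length \<alpha>s = length es"
      using basis_of_dim[OF bas[OF x]] basis_of_dim[OF dual_frame_basis[OF V]] by simp
    define w1 where "w1 y = wedge E es y (map (\<lambda>\<alpha>. \<alpha> y) (\<alpha>s[i := \<alpha>]))" for y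
    define w2 where "w2 y = wedge E es y (map (\<lambda>\<alpha>. \<alpha> y) \<alpha>s)" for y
    have dsub: "\<beta> \<in> sections M (dual_bundle E) ?W" if "\<beta> \<in> sections M (dual_bundle E) U" for \<beta>
      using smooth_bundle.sections_subset[OF bundle_dual that U o] by auto
    have es: "s \<in> sections M E ?W" if "s \<in> set es" for s
      using that sections_subset[OF frame_section[OF V(1)] frame_open[OF V(1)] o] by (auto simp: in_set_conv_nth)
    have s1: "smooth_fun M ?W w1" unfolding w1_def
      by (rule smooth_wedge[OF o _ es]) (use dsub sec a len set_update_subset_insert in \<open>fastforce+\<close>)
    have s2: "smooth_fun M ?W w2" unfolding w2_def
      by (rule smooth_wedge[OF o _ es]) (use dsub sec len in auto)
    have wx: "wedge E es y \<in> ext_fibre (length es) (fibre E y)" if "y \<in> ?W" for y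
      by (rule wedge_in_ext_fibre) (use that frame_fibre[OF V(1)] in \<open>auto simp: in_set_conv_nth\<close>)
    have sub: "set (map (\<lambda>\<alpha>. \<alpha> y) \<alpha>s) \<subseteq> dual_fibre (fibre E y)" if "y \<in> ?W" for y
      using dual_section_fibre[OF sec] that by auto
    have e1: "w1 y = c i y * w2 y" if y: "y \<in> ?W" for y
    proof -
      have "map (\<lambda>\<alpha>. \<alpha> y) (\<alpha>s[i := \<alpha>]) = (map (\<lambda>\<alpha>. \<alpha> y) \<alpha>s)[i := \<Sum>j<length es. c j y *\<^sub>R (map (\<lambda>\<alpha>. \<alpha> y) \<alpha>s ! j)]"
        using ex[of y] y len by (simp add: map_update)
      then show ?thesis unfolding w1_def w2_def
        using ext_fibre_comb[OF wx[OF y] _ sub[OF y], of i "\<lambda>j. c j y"] i len by simp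
    qed
    \<comment> \<open>If the denominator vanished at y, the wedge would vanish on a list spanning
      the dual fibre, hence identically, against its value 1 on the coframe.\<close>
    have n2: "w2 y \<noteq> 0" if y: "y \<in> ?W" for y
    proof
      assume "w2 y = 0"
      then have "wedge E es y = 0"
        by (intro ext_fibre_vanish[OF wx[OF y] _ sub[OF y]])
          (use bas[of y] y len in \<open>auto simp: w2_def basis_of_def\<close>)
      then show False using wedge_coord[OF frame_basis[OF V(1), of y]] y by simp
    qed
    have "smooth_fun M ?W (\<lambda>y. w1 y / w2 y)" by (rule smooth_fun_divide[OF o s1 s2 n2])
    then have "smooth_fun M ?W (c i)"
      by (rule smooth_fun_cong[OF o, rotated]) (use e1 n2 in auto)
    then show "\<exists>W'. open W' \<and> x \<in> W' \<and> smooth_fun M W' (c i)" using o x V by blast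
  qed
  then show thesis using that ex by blast
qed

end

section \<open>Bivector fields and the tangent bundle\<close>

lemma permutations_lessThan_2: "{p. p permutes {..<2::nat}} = {id, Transposition.transpose 0 1}"
proof -
  have "{..<2::nat} = {0, 1}" by auto
  then show ?thesis by (auto simp: permutes_doubleton_iff)
qed

lemma wedge_pair:
  assumes "\<alpha> \<in> dual_fibre (fibre E x)" "\<beta> \<in> dual_fibre (fibre E x)"
  shows "wedge E [e, f] x [\<alpha>, \<beta>] = \<alpha> (e x) * \<beta> (f x) - \<beta> (e x) * \<alpha> (f x)"
proof -
  have ne: "id \<noteq> Transposition.transpose (0::nat) 1" by (metis id_apply transpose_apply_first zero_neq_one)
  have *: "{..<length [e, f]} = {..<2}" by simp
  show ?thesis
    using assms ne unfolding wedge_def fibre_dual * permutations_lessThan_2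
    by (simp add: sign_swap_id numeral_2_eq_2 lessThan_Suc sign_id)
qed

text \<open>The frames of \<open>ext_power\<close> are indexed by subsequences of a frame; those of
  length 2 are the pairs i < j. The induction splits them according to whether they contain the
  head.\<close>

lemma sum_list_filter_subseqs_pairs:
  "(\<Sum>fs\<leftarrow>filter (\<lambda>fs. length fs = 2) (subseqs es). g fs)
    = (\<Sum>i<length es. \<Sum>j\<in>{i<..<length es}. g [es ! i, es ! j])" for g :: "'a list \<Rightarrow> 'b::comm_monoid_add"
proof (induction es arbitrary: g)
  case (Cons e es)
  have one: "filter (\<lambda>fs. length fs = 1) (subseqs xs) = map (\<lambda>y. [y]) xs" for xs :: "'a list"
  proof (induction xs)
    case (Cons x xs)
    have zero: "filter (\<lambda>fs. fs = []) (subseqs xs) = [[]]" for xs :: "'a list"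
      by (induction xs) (auto simp: Let_def filter_map o_def)
    show ?case using Cons zero by (auto simp: Let_def filter_map o_def)
  qed simp
  have "(\<Sum>fs\<leftarrow>filter (\<lambda>fs. length fs = 2) (subseqs (e # es)). g fs)
      = (\<Sum>fs\<leftarrow>filter (\<lambda>fs. length fs = 1) (subseqs es). g (e # fs)) + (\<Sum>fs\<leftarrow>filter (\<lambda>fs. length fs = 2) (subseqs es). g fs)"
    by (simp add: Let_def filter_map o_def numeral_2_eq_2)
  also have "(\<Sum>fs\<leftarrow>filter (\<lambda>fs. length fs = 1) (subseqs es). g (e # fs)) = (\<Sum>j<length es. g [e, es ! j])"
    unfolding one by (simp add: o_def sum_list_sum_nth lessThan_atLeast0)
  also have "(\<Sum>j<length es. g [e, es ! j]) = (\<Sum>j\<in>{0<..<length (e # es)}. g [(e # es) ! 0, (e # es) ! j])"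
    by (rule sum.reindex_bij_witness[of _ "\<lambda>j. j - 1" Suc]) auto
  also have "(\<Sum>fs\<leftarrow>filter (\<lambda>fs. length fs = 2) (subseqs es). g fs)
      = (\<Sum>i<length es. \<Sum>j\<in>{Suc i<..<length (e # es)}. g [(e # es) ! Suc i, (e # es) ! j])"
    unfolding Cons.IH by (intro sum.cong refl sum.reindex_bij_witness[of _ "\<lambda>j. j - 1" Suc]) auto
  also have "(\<Sum>j\<in>{0<..<length (e # es)}. g [(e # es) ! 0, (e # es) ! j]) + \<dots>
      = (\<Sum>i<Suc (length es). \<Sum>j\<in>{i<..<length (e # es)}. g [(e # es) ! i, (e # es) ! j])"
    by (rule sum.lessThan_Suc_shift[symmetric])
  finally show ?case by (simp only: length_Cons)
qed simp

lemma sum_off_diagonal_pairs: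
  fixes a :: "nat \<Rightarrow> nat \<Rightarrow> 'b::comm_monoid_add"
  assumes "\<And>i. a i i = 0"
  shows "(\<Sum>i<n. \<Sum>j<n. a i j) = (\<Sum>i<n. \<Sum>j\<in>{i<..<n}. a i j + a j i)"
proof (induction n)
  case (Suc n)
  have *: "{i<..<Suc n} = insert n {i<..<n}" if "i < n" for i using that by auto
  have "(\<Sum>i<Suc n. \<Sum>j<Suc n. a i j) = (\<Sum>i<n. \<Sum>j<n. a i j) + (\<Sum>i<n. a i n) + (\<Sum>j<n. a n j)"
    by (simp add: sum.distrib assms add_ac)
  also have "\<dots> = (\<Sum>i<n. (\<Sum>j\<in>{i<..<n}. a i j + a j i) + (a i n + a n i))"
    unfolding Suc.IH by (simp add: sum.distrib add.assoc)
  also have "\<dots> = (\<Sum>i<n. \<Sum>j\<in>{i<..<Suc n}. a i j + a j i)"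
    by (rule sum.cong) (auto simp: * add.commute)
  also have "\<dots> = (\<Sum>i<Suc n. \<Sum>j\<in>{i<..<Suc n}. a i j + a j i)"
  proof -
    have "{n<..<Suc n} = {}" by auto
    then show ?thesis by simp
  qed
  finally show ?case .
qed simp

section \<open>Bivector fields as sections, and their sharp maps\<close>

context smooth_bundle
begin

lemma fibre_eqI:
  assumes "a \<in> fibre E x" "b \<in> fibre E x" "\<And>\<beta>. \<beta> \<in> dual_fibre (fibre E x) \<Longrightarrow> \<beta> a = \<beta> b"
  shows "a = b"
proof -
  obtain V es where V: "(V, es) \<in> frames E" "x \<in> V" by (rule frame_exists)
  have "(\<Sum>i<length es. coframe es i x a *\<^sub>R (es ! i) x) = (\<Sum>i<length es. coframe es i x b *\<^sub>R (es ! i) x)"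
    using assms(3)[OF coframe_dual[OF V]] by (intro sum.cong) auto
  then show ?thesis unfolding coframe_expand[OF V assms(1)] coframe_expand[OF V assms(2)] .
qed

lemma bivector_fibre: "P \<in> sections M (ext_power 2 E) U \<Longrightarrow> x \<in> U \<Longrightarrow> P x \<in> ext_fibre 2 (fibre E x)"
  by (simp add: sections_def ext_power_def)

lemma smooth_bivector:
  assumes U: "open U" and P: "P \<in> sections M (ext_power 2 E) U"
    and a: "\<alpha> \<in> sections M (dual_bundle E) U" and b: "\<beta> \<in> sections M (dual_bundle E) U"
  shows "smooth_fun M U (\<lambda>x. P x [\<alpha> x, \<beta> x])"
proof (rule smooth_fun_local[OF U])
  fix x assume x: "x \<in> U"
  obtain V es where V: "(V, es) \<in> frames E" "x \<in> V" by (rule frame_exists)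
  define L where "L = filter (\<lambda>fs. length fs = 2) (subseqs es)"
  have o: "open (U \<inter> V)" using U frame_open[OF V(1)] by blast
  have "(V, map (wedge E) L) \<in> frames (ext_power 2 E)" using V(1) by (auto simp: ext_power_def L_def)
  then obtain c where c: "\<forall>k<length L. smooth_fun M (U \<inter> V) (c k)"
    "\<forall>y\<in>U \<inter> V. P y = (\<Sum>k<length L. c k y *\<^sub>R (map (wedge E) L ! k) y)"
    using P unfolding sections_def by fastforce
  have "smooth_fun M (U \<inter> V) (\<lambda>y. \<Sum>k<length L. c k y * wedge E (L ! k) y (map (\<lambda>\<alpha>. \<alpha> y) [\<alpha>, \<beta>]))"
  proof (intro smooth_fun_sum smooth_fun_mult smooth_wedge o)
    fix k assume k: "k \<in> {..<length L}"
    show "smooth_fun M (U \<inter> V) (c k)" using c k by auto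
    have "L ! k \<in> set L" using k by simp
    then have Lk: "length (L ! k) = 2" "L ! k \<in> set (subseqs es)" by (auto simp: L_def)
    then show "length [\<alpha>, \<beta>] = length (L ! k)" by simp
    have "set (L ! k) \<subseteq> set es" using Lk(2) subseqs_powset[of es] by blast
    then have "s \<in> set es" if "s \<in> set (L ! k)" for s using that by blast
    then show "s \<in> sections M E (U \<inter> V)" if "s \<in> set (L ! k)" for s
      using that sections_subset[OF frame_section[OF V(1)] frame_open[OF V(1)] o Int_lower2] in_set_conv_nth[of s es] by blast
    show "\<gamma> \<in> sections M (dual_bundle E) (U \<inter> V)" if "\<gamma> \<in> set [\<alpha>, \<beta>]" for \<gamma>
      using that a b smooth_bundle.sections_subset[OF bundle_dual _ U o Int_lower1] by auto
  qed
  then have "smooth_fun M (U \<inter> V) (\<lambda>x. P x [\<alpha> x, \<beta> x])"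
    by (rule smooth_fun_cong[OF o, rotated]) (use c(2) in \<open>auto simp: sum_fun_apply scaleR_fun_def\<close>)
  then show "\<exists>W'. open W' \<and> x \<in> W' \<and> smooth_fun M W' (\<lambda>x. P x [\<alpha> x, \<beta> x])" using o x V by blast
qed

lemma bivector_sectionsI:
  assumes P: "\<And>x. x \<in> U \<Longrightarrow> P x \<in> ext_fibre 2 (fibre E x)"
    and sm: "\<And>V es i j. (V, es) \<in> frames E \<Longrightarrow> i < length es \<Longrightarrow> j < length es \<Longrightarrow>
      smooth_fun M (U \<inter> V) (\<lambda>x. P x [coframe es i x, coframe es j x])"
  shows "P \<in> sections M (ext_power 2 E) U"
  unfolding sections_def
proof (intro CollectI conjI ballI; clarify?)
  show "P x \<in> fibre (ext_power 2 E) x" if "x \<in> U" for x using P that by (simp add: ext_power_def)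
  fix V fs assume "(V, fs) \<in> frames (ext_power 2 E)"
  then obtain es where V: "(V, es) \<in> frames E"
    and fs: "fs = map (wedge E) (filter (\<lambda>fs. length fs = 2) (subseqs es))"
    by (auto simp: ext_power_def)
  define L where "L = filter (\<lambda>fs. length fs = 2) (subseqs es)"
  \<comment> \<open>The entries of \<open>L\<close> are lists of frame sections, not of indices.
    \<open>\<kappa>\<close> recovers the dual covector from the frame section itself, so the
    coefficient of a wedge of two frame sections is \<open>P\<close> on the two corresponding
    covectors.\<close>
  define \<kappa> where "\<kappa> x e v = representation (set (map (\<lambda>e'. e' x) es)) v (e x)" for x v and e :: "'p \<Rightarrow> 'e"
  have \<kappa>: "\<kappa> x (es ! i) = coframe es i x" if "i < length es" for i x
    using that by (simp add: \<kappa>_def coframe_def coord_def fun_eq_iff)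
  show "\<exists>c. (\<forall>i<length fs. smooth_fun M (U \<inter> V) (c i)) \<and>
      (\<forall>x\<in>U \<inter> V. P x = (\<Sum>i<length fs. c i x *\<^sub>R (fs ! i) x))"
  proof (intro exI[of _ "\<lambda>k x. P x (map (\<kappa> x) (L ! k))"] conjI allI impI ballI)
    fix k assume "k < length fs"
    then have k: "k < length L" by (simp add: fs L_def)
    then have "L ! k \<in> set L" by simp
    then have Lk: "length (L ! k) = 2" "L ! k \<in> set (subseqs es)" by (auto simp: L_def)
    then obtain e f where ef: "L ! k = [e, f]" by (auto simp: numeral_2_eq_2 length_Suc_conv)
    have "set (L ! k) \<subseteq> set es" using Lk(2) subseqs_powset[of es] by blast
    then obtain i j where ij: "i < length es" "j < length es" "e = es ! i" "f = es ! j"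
      unfolding ef by (auto simp: in_set_conv_nth)
    show "smooth_fun M (U \<inter> V) (\<lambda>x. P x (map (\<kappa> x) (L ! k)))"
      using sm[OF V ij(1,2)] by (simp add: ef ij \<kappa>)
  next
    fix x assume x: "x \<in> U \<inter> V"
    have Px: "P x \<in> ext_fibre 2 (fibre E x)" using P x by blast
    define c where "c i = coframe es i x" for i
    have cd: "c i \<in> dual_fibre (fibre E x)" for i unfolding c_def using coframe_dual[OF V] x by blast
    have ln: "length fs = length L" "\<And>k. k < length L \<Longrightarrow> fs ! k = wedge E (L ! k)" by (simp_all add: fs L_def)
    have main: "P x \<xi>s = (\<Sum>k<length L. P x (map (\<kappa> x) (L ! k)) * wedge E (L ! k) x \<xi>s)" for \<xi>s
    proof (cases "length \<xi>s = 2 \<and> set \<xi>s \<subseteq> dual_fibre (fibre E x)")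
      case True
      then obtain \<alpha> \<beta> where ab: "\<xi>s = [\<alpha>, \<beta>]" "\<alpha> \<in> dual_fibre (fibre E x)" "\<beta> \<in> dual_fibre (fibre E x)"
        by (auto simp: numeral_2_eq_2 length_Suc_conv)
      let ?a = "\<lambda>i. \<alpha> ((es ! i) x)" and ?b = "\<lambda>i. \<beta> ((es ! i) x)"
      have "P x [\<alpha>, \<beta>] = P x [\<Sum>i<length es. ?a i *\<^sub>R c i, \<Sum>j<length es. ?b j *\<^sub>R c j]"
        using dual_expand_frame[OF V _ ab(2)] dual_expand_frame[OF V _ ab(3)] x by (simp add: c_def)
      also have "\<dots> = (\<Sum>i<length es. ?a i * P x [c i, \<Sum>j<length es. ?b j *\<^sub>R c j])"
        by (rule ext2_sum[OF Px cd dual_fibre_sum[OF cd]])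
      also have "\<dots> = (\<Sum>i<length es. \<Sum>j<length es. ?a i * ?b j * P x [c i, c j])"
        by (subst ext2_sum(2)[OF Px cd cd]) (simp add: sum_distrib_left mult.assoc)
      also have "\<dots> = (\<Sum>i<length es. \<Sum>j\<in>{i<..<length es}. ?a i * ?b j * P x [c i, c j] + ?a j * ?b i * P x [c j, c i])"
        by (rule sum_off_diagonal_pairs) (simp add: ext2_self[OF Px])
      also have "\<dots> = (\<Sum>i<length es. \<Sum>j\<in>{i<..<length es}. P x (map (\<kappa> x) [es ! i, es ! j]) * wedge E [es ! i, es ! j] x [\<alpha>, \<beta>])"
      proof (intro sum.cong refl)
        fix i j assume "i \<in> {..<length es}" "j \<in> {i<..<length es}"
        then show "?a i * ?b j * P x [c i, c j] + ?a j * ?b i * P x [c j, c i]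
            = P x (map (\<kappa> x) [es ! i, es ! j]) * wedge E [es ! i, es ! j] x [\<alpha>, \<beta>]"
          using ext2_skew[OF Px, of "c j" "c i"] by (simp add: \<kappa> wedge_pair[OF ab(2,3)] c_def algebra_simps)
      qed
      also have "\<dots> = (\<Sum>fs\<leftarrow>L. P x (map (\<kappa> x) fs) * wedge E fs x [\<alpha>, \<beta>])"
        unfolding L_def by (rule sum_list_filter_subseqs_pairs[symmetric])
      also have "\<dots> = (\<Sum>k<length L. P x (map (\<kappa> x) (L ! k)) * wedge E (L ! k) x [\<alpha>, \<beta>])"
        by (simp add: sum_list_sum_nth lessThan_atLeast0)
      finally show ?thesis by (simp add: ab)
    next
      case False
      have "length (L ! k) = 2" if "k < length L" for k
        using nth_mem[OF that] by (simp add: L_def)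
      then have "wedge E (L ! k) x \<xi>s = 0" if "k < length L" for k
        using False that by (auto simp: wedge_def fibre_dual)
      then show ?thesis using ext_fibre_outside[OF Px False] by simp
    qed
    show "P x = (\<Sum>k<length fs. P x (map (\<kappa> x) (L ! k)) *\<^sub>R (fs ! k) x)"
    proof
      fix \<xi>s
      have "(\<Sum>k<length fs. P x (map (\<kappa> x) (L ! k)) *\<^sub>R (fs ! k) x) \<xi>s
          = (\<Sum>k<length L. P x (map (\<kappa> x) (L ! k)) * wedge E (L ! k) x \<xi>s)"
        using ln by (simp add: sum_fun_apply scaleR_fun_def)
      then show "P x \<xi>s = (\<Sum>k<length fs. P x (map (\<kappa> x) (L ! k)) *\<^sub>R (fs ! k) x) \<xi>s"
        by (simp only: main[of \<xi>s])
    qed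
  qed
qed

text \<open>\<open>sharp\<close> is a definite description; the required uniqueness holds because
  covectors separate the points of a fibre.\<close>

lemma sharp_eqI:
  assumes "a \<in> fibre E x" "\<And>\<beta>. \<beta> \<in> dual_fibre (fibre E x) \<Longrightarrow> \<beta> a = P x [\<alpha>, \<beta>]"
  shows "sharp E P x \<alpha> = a"
  unfolding sharp_def fibre_dual
proof (rule the_equality)
  show "a \<in> fibre E x \<and> (\<forall>\<beta>\<in>dual_fibre (fibre E x). \<beta> a = P x [\<alpha>, \<beta>])" using assms by blast
  show "b = a" if "b \<in> fibre E x \<and> (\<forall>\<beta>\<in>dual_fibre (fibre E x). \<beta> b = P x [\<alpha>, \<beta>])" for b
    by (rule fibre_eqI) (use that assms in auto)
qed

lemma frame_pairing:
  assumes P: "P x \<in> ext_fibre 2 (fibre E x)" and a: "\<alpha> \<in> dual_fibre (fibre E x)"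
    and V: "(V, es) \<in> frames E" "x \<in> V" and b: "\<beta> \<in> dual_fibre (fibre E x)"
  shows "\<beta> (\<Sum>i<length es. P x [\<alpha>, coframe es i x] *\<^sub>R (es ! i) x) = P x [\<alpha>, \<beta>]"
proof -
  have "\<beta> (\<Sum>i<length es. P x [\<alpha>, coframe es i x] *\<^sub>R (es ! i) x) = (\<Sum>i<length es. P x [\<alpha>, coframe es i x] *\<^sub>R \<beta> ((es ! i) x))"
    by (rule hom_fibre_sum[OF b fibre_subspace]) (use frame_fibre[OF V] in auto)
  also have "\<dots> = (\<Sum>i<length es. \<beta> ((es ! i) x) * P x [\<alpha>, coframe es i x])" by (simp add: mult.commute)
  also have "\<dots> = P x [\<alpha>, \<Sum>i<length es. \<beta> ((es ! i) x) *\<^sub>R coframe es i x]"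
    by (rule ext2_sum(2)[OF P _ a, symmetric]) (rule coframe_dual[OF V])
  also have "\<dots> = P x [\<alpha>, \<beta>]" using dual_expand_frame[OF V b] by simp
  finally show ?thesis .
qed

lemma sharp_frame:
  assumes P: "P x \<in> ext_fibre 2 (fibre E x)" and a: "\<alpha> \<in> dual_fibre (fibre E x)"
    and V: "(V, es) \<in> frames E" "x \<in> V"
  shows "sharp E P x \<alpha> = (\<Sum>i<length es. P x [\<alpha>, coframe es i x] *\<^sub>R (es ! i) x)"
proof (rule sharp_eqI)
  show "(\<Sum>i<length es. P x [\<alpha>, coframe es i x] *\<^sub>R (es ! i) x) \<in> fibre E x"
    by (intro subspace_sum subspace_scale fibre_subspace) (use frame_fibre[OF V] in auto)
qed (rule frame_pairing[where P=P and x=x, OF assms])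

lemma
  assumes P: "P x \<in> ext_fibre 2 (fibre E x)" and a: "\<alpha> \<in> dual_fibre (fibre E x)"
  shows sharp_fibre: "sharp E P x \<alpha> \<in> fibre E x"
    and sharp_pairing: "\<beta> \<in> dual_fibre (fibre E x) \<Longrightarrow> \<beta> (sharp E P x \<alpha>) = P x [\<alpha>, \<beta>]"
proof -
  obtain V es where V: "(V, es) \<in> frames E" "x \<in> V" by (rule frame_exists)
  show "sharp E P x \<alpha> \<in> fibre E x"
    unfolding sharp_frame[where P=P and x=x, OF P a V]
    by (intro subspace_sum subspace_scale fibre_subspace) (use frame_fibre[OF V] in auto)
  show "\<beta> (sharp E P x \<alpha>) = P x [\<alpha>, \<beta>]" if "\<beta> \<in> dual_fibre (fibre E x)"
    unfolding sharp_frame[where P=P and x=x, OF P a V] by (rule frame_pairing[where P=P and x=x, OF P a V that])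
qed

text \<open>Argued from the definition of \<open>sections\<close>: this avoids showing that
  \<open>ext_power 2 E\<close> is a vector bundle and allows any subset \<open>W\<close>.\<close>

lemma bivector_restrict:
  assumes P: "P \<in> sections M (ext_power 2 E) U" and W: "W \<subseteq> U"
  shows "P \<in> sections M (ext_power 2 E) W"
  unfolding sections_def
proof (intro CollectI conjI ballI; clarify?)
  show "P x \<in> fibre (ext_power 2 E) x" if "x \<in> W" for x using P W that by (auto simp: sections_def)
  fix V fs assume "(V, fs) \<in> frames (ext_power 2 E)"
  then obtain c where "\<forall>i<length fs. smooth_fun M (U \<inter> V) (c i)"
    "\<forall>x\<in>U \<inter> V. P x = (\<Sum>i<length fs. c i x *\<^sub>R (fs ! i) x)"
    using P unfolding sections_def by fast
  then show "\<exists>c. (\<forall>i<length fs. smooth_fun M (W \<inter> V) (c i)) \<and>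
      (\<forall>x\<in>W \<inter> V. P x = (\<Sum>i<length fs. c i x *\<^sub>R (fs ! i) x))"
    using W by (intro exI[of _ c]) (auto intro: smooth_fun_subset)
qed

lemma sharp_section:
  assumes U: "open U" and P: "P \<in> sections M (ext_power 2 E) U" and a: "\<alpha> \<in> sections M (dual_bundle E) U"
  shows "(\<lambda>x. sharp E P x (\<alpha> x)) \<in> sections M E U"
  unfolding sections_iff[OF U]
proof (intro conjI ballI; clarify?)
  show "sharp E P x (\<alpha> x) \<in> fibre E x" if "x \<in> U" for x
    by (rule sharp_fibre[where P=P and x=x, OF bivector_fibre[OF P that] dual_section_fibre[OF a that]])
  fix V es and i :: nat assume V: "(V, es) \<in> frames E" and i: "i < length es"
  have o: "open (U \<inter> V)" using U frame_open[OF V(1)] by blast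
  have P': "P \<in> sections M (ext_power 2 E) (U \<inter> V)"
    by (rule bivector_restrict[OF P]) simp
  have "smooth_fun M (U \<inter> V) (\<lambda>x. P x [\<alpha> x, coframe es i x])"
  proof (rule smooth_bivector[OF o P'])
    show "\<alpha> \<in> sections M (dual_bundle E) (U \<inter> V)" "coframe es i \<in> sections M (dual_bundle E) (U \<inter> V)"
      using a coframe_dual_section[OF V i] smooth_bundle.sections_subset[OF bundle_dual _ _ o] U frame_open[OF V] by auto
  qed
  then show "smooth_fun M (U \<inter> V) (\<lambda>x. coframe es i x (sharp E P x (\<alpha> x)))"
    by (rule smooth_fun_cong[OF o, rotated])
      (use sharp_pairing[where P=P, OF bivector_fibre[OF P] dual_section_fibre[OF a] coframe_dual[OF V]] in auto)
qed

end

subsection \<open>The tangent bundle\<close>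

lemma fibre_tangent: "fibre (tangent_bundle M) = tangent_space M"
  by (simp add: tangent_bundle_def)

text \<open>That the coordinate fields span the tangent spaces would follow from Hadamard's lemma; here it
  is read off the top exterior power: if \<open>\<partial>\<^sub>1 \<and> \<dots> \<and> \<partial>\<^sub>d\<close> is a nonzero element of
  \<open>\<And>\<^sup>k T\<^sub>x\<close> with \<open>k = dim T\<^sub>x\<close>, then \<open>k = d\<close>.\<close>

locale tangent_manifold = manifold M
  for M :: "('p::{t2_space, second_countable_topology}, 'd::finite) atlas" +
  assumes det_tangent_bundle: "vector_bundle M (det_bundle (tangent_bundle M))"
begin

lemma coord_fields_basis:
  assumes U: "(U, \<phi>) \<in> M" "x \<in> U" and js: "distinct js" "set js = (UNIV :: 'd set)"
  shows "basis_of (map (\<lambda>j. coord_field M U \<phi> j x) js) (tangent_space M x)"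
proof -
  let ?c = "\<lambda>j. coord_field M U \<phi> j x"
  let ?C = "?c ` UNIV"
  have inj: "inj ?c"
    by (rule injI) (metis coord_field_coord[OF U] zero_neq_one)
  have ind: "independent ?C"
  proof
    assume "dependent ?C"
    then obtain f v where s: "(\<Sum>v\<in>?C. f v *\<^sub>R v) = 0" and v: "v \<in> ?C" "f v \<noteq> 0"
      using real_vector.dependent_finite[of ?C] by auto
    then obtain i where i: "v = ?c i" by auto
    have "(\<Sum>j\<in>UNIV. f (?c j) *\<^sub>R ?c j) = 0"
      using s sum.reindex[OF inj, of "\<lambda>v. f v *\<^sub>R v"] by (simp add: o_def)
    then have "(\<Sum>j\<in>UNIV. f (?c j) *\<^sub>R ?c j) (\<lambda>y. \<phi> y $ i) = 0" by simp
    then have "(\<Sum>j\<in>UNIV. f (?c j) * ?c j (\<lambda>y. \<phi> y $ i)) = 0"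
      unfolding sum_fun_apply scaleR_fun_def by simp
    then have m1: "(\<Sum>j\<in>UNIV. f (?c j) * (if j = i then 1 else 0)) = 0"
      unfolding coord_field_coord[OF U] .
    have m2: "(\<Sum>j\<in>UNIV. g j * (if j = i then 1 else 0)) = g i" for g :: "'d \<Rightarrow> real"
      by (simp add: if_distrib[of "\<lambda>c. _ * c"] cong: if_cong)
    have "f (?c i) = 0" by (rule trans[OF m2[of "\<lambda>j. f (?c j)", symmetric] m1])
    then show False using v(2) unfolding i by simp
  qed
  have sub: "?C \<subseteq> tangent_space M x" using coord_field_tangent[OF U] by auto
  have card_js: "length js = CARD('d)" using js distinct_card by fastforce
  have card_C: "card ?C = CARD('d)" using card_image[OF inj] by simp
  let ?es = "map (coord_field M U \<phi>) js"
  have "(U, [wedge (tangent_bundle M) ?es]) \<in> frames (det_bundle (tangent_bundle M))"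
    using U js unfolding det_bundle_def tangent_bundle_def by auto
  then have "basis_of (map (\<lambda>e. e x) [wedge (tangent_bundle M) ?es]) (fibre (det_bundle (tangent_bundle M)) x)"
    using det_tangent_bundle U(2) unfolding vector_bundle_def by fastforce
  then have b: "independent {wedge (tangent_bundle M) ?es x}"
    "wedge (tangent_bundle M) ?es x \<in> ext_fibre (dim (tangent_space M x)) (tangent_space M x)"
    by (auto simp: basis_of_def det_bundle_def fibre_tangent intro: span_base)
  have "wedge (tangent_bundle M) ?es x \<noteq> 0" using b(1) real_vector.dependent_zero by force
  then obtain \<xi>s where "wedge (tangent_bundle M) ?es x \<xi>s \<noteq> 0" by (auto simp: fun_eq_iff)
  then have "length \<xi>s = dim (tangent_space M x)" "length \<xi>s = length ?es"
    using ext_fibre_outside[OF b(2)] by (blast, auto simp: wedge_def split: if_splits)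
  then have dim: "dim (tangent_space M x) = CARD('d)" using card_js by simp
  obtain B where B: "B \<subseteq> tangent_space M x" "independent B" "tangent_space M x \<subseteq> span B" "card B = CARD('d)"
    using real_vector.basis_exists[of "tangent_space M x"] dim by metis
  \<comment> \<open>An infinite set has \<open>card\<close> 0, whereas \<open>CARD('d)\<close> is
    positive.\<close>
  have fB: "finite B" using B(4) by (metis card.infinite zero_less_card_finite less_irrefl)
  have "tangent_space M x \<subseteq> span ?C"
  proof
    fix v assume v: "v \<in> tangent_space M x"
    show "v \<in> span ?C"
    proof (rule ccontr)
      assume nv: "v \<notin> span ?C"
      then have "independent (insert v ?C)" using ind real_vector.independent_insertI by blast
      moreover have "insert v ?C \<subseteq> span B" using v sub B(3) by auto
      ultimately have "card (insert v ?C) \<le> card B"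
        by (rule conjunct2[OF real_vector.independent_span_bound[OF fB]])
      moreover have "v \<notin> ?C" by (rule notI) (rule notE[OF nv span_base])
      ultimately show False using card_C B(4) by simp
    qed
  qed
  then have "span ?C = tangent_space M x"
    using span_minimal[OF sub tangent_subspace] by blast
  then show ?thesis using ind js inj by (auto simp: basis_of_def distinct_map inj_on_def)
qed

lemma tangent_frames_iff:
  "(U, es) \<in> frames (tangent_bundle M) \<longleftrightarrow> (\<exists>\<phi> js. (U, \<phi>) \<in> M \<and> distinct js \<and> set js = UNIV \<and> es = map (coord_field M U \<phi>) js)"
  by (auto simp: tangent_bundle_def)

text \<open>The coframe dual to the coordinate fields consists of the coordinate differentials:
  evaluate the expansion of \<open>v\<close> on a coordinate function, where all terms but one
  vanish.\<close>

lemma tangent_coframe: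
  assumes U: "(U, \<phi>) \<in> M" "x \<in> U" and js: "distinct js" "set js = (UNIV :: 'd set)"
    and v: "v \<in> tangent_space M x" and i: "i < length js"
  shows "coframe (map (coord_field M U \<phi>) js) i x v = v (\<lambda>y. \<phi> y $ (js ! i))"
proof -
  let ?vs = "map (\<lambda>j. coord_field M U \<phi> j x) js"
  note b = coord_fields_basis[OF U js]
  have "(\<Sum>k<length ?vs. coord ?vs k v *\<^sub>R (?vs ! k)) (\<lambda>y. \<phi> y $ (js ! i)) = v (\<lambda>y. \<phi> y $ (js ! i))"
    using coord_expand[OF b v] by simp
  moreover have "(\<Sum>k<length ?vs. coord ?vs k v *\<^sub>R (?vs ! k)) (\<lambda>y. \<phi> y $ (js ! i))
      = (\<Sum>k<length js. if k = i then coord ?vs k v else 0)"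
    using i js(1) by (simp add: sum_fun_apply scaleR_fun_def coord_field_coord[OF U] nth_eq_iff_index_eq
        if_distrib[of "\<lambda>c. _ * c"] cong: if_cong)
  ultimately show ?thesis using i by (simp add: coframe_def o_def)
qed

lemma vector_bundle_tangent: "vector_bundle M (tangent_bundle M)"
  unfolding vector_bundle_def
proof (intro conjI ballI; clarify?)
  obtain js where js: "distinct js" "set js = (UNIV :: 'd set)" using finite_distinct_list[OF finite] by blast
  have "\<exists>U es. (U, es) \<in> frames (tangent_bundle M) \<and> x \<in> U" for x
    by (rule chart_exists[of x]) (use js in \<open>auto simp: tangent_frames_iff\<close>)
  then show "(\<Union>(U, es)\<in>frames (tangent_bundle M). U) = UNIV" by fastforce
next
  fix U es assume "(U, es) \<in> frames (tangent_bundle M)"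
  then obtain \<phi> js where U: "(U, \<phi>) \<in> M" and js: "distinct js" "set js = (UNIV :: 'd set)"
    and es: "es = map (coord_field M U \<phi>) js" by (auto simp: tangent_frames_iff)
  have "coord_field M U \<phi> j \<in> sections M (tangent_bundle M) U" for j
    unfolding sections_def fibre_tangent
  proof (intro CollectI conjI ballI coord_field_tangent[OF U]; clarify?)
    fix V fs assume "(V, fs) \<in> frames (tangent_bundle M)"
    then obtain \<psi> ks where V: "(V, \<psi>) \<in> M" and ks: "distinct ks" "set ks = (UNIV :: 'd set)"
      and fs: "fs = map (coord_field M V \<psi>) ks" by (auto simp: tangent_frames_iff)
    let ?c = "\<lambda>i x. coord_field M U \<phi> j x (\<lambda>y. \<psi> y $ (ks ! i))"
    have o: "open (U \<inter> V)" using chart_open[OF U] chart_open[OF V] by blast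
    show "\<exists>c. (\<forall>i<length fs. smooth_fun M (U \<inter> V) (c i)) \<and>
        (\<forall>x\<in>U \<inter> V. coord_field M U \<phi> j x = (\<Sum>i<length fs. c i x *\<^sub>R (fs ! i) x))"
    proof (intro exI[of _ ?c] conjI allI impI ballI)
      show "smooth_fun M (U \<inter> V) (?c i)" for i
        by (rule smooth_fun_coord_field[OF U o _ smooth_fun_subset[OF smooth_fun_coord[OF V]]]) auto
      fix x assume x: "x \<in> U \<inter> V"
      then have v: "coord_field M U \<phi> j x \<in> tangent_space M x" using coord_field_tangent[OF U] by blast
      have "(\<Sum>i<length fs. coframe fs i x (coord_field M U \<phi> j x) *\<^sub>R (fs ! i) x) = coord_field M U \<phi> j x"
        using coord_expand[OF coord_fields_basis[OF V _ ks] v] x by (simp add: fs coframe_def o_def)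
      then show "coord_field M U \<phi> j x = (\<Sum>i<length fs. ?c i x *\<^sub>R (fs ! i) x)"
        using tangent_coframe[OF V _ ks v] x by (simp add: fs)
    qed
  qed
  then show "open U \<and> (\<forall>x\<in>U. basis_of (map (\<lambda>e. e x) es) (fibre (tangent_bundle M) x)) \<and>
      set es \<subseteq> sections M (tangent_bundle M) U"
    using chart_open[OF U] coord_fields_basis[OF U _ js] by (auto simp: es fibre_tangent o_def)
qed

end

sublocale tangent_manifold \<subseteq> T: smooth_bundle M "tangent_bundle M"
  by unfold_locales (rule vector_bundle_tangent)

context tangent_manifold
begin

text \<open>Hides the chart: from here on a tangent frame is used only through functions
  \<open>xs\<close> whose differentials form its coframe.\<close>

lemma tangent_frame_coords:
  assumes "(U, es) \<in> frames (tangent_bundle M)"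
  obtains xs where "length es = CARD('d)" "\<And>i. i < length es \<Longrightarrow> smooth_fun M U (xs i)"
    "\<And>i y v. i < length es \<Longrightarrow> y \<in> U \<Longrightarrow> v \<in> tangent_space M y \<Longrightarrow> coframe es i y v = v (xs i)"
proof -
  obtain \<phi> js where U: "(U, \<phi>) \<in> M" and js: "distinct js" "set js = (UNIV :: 'd set)"
    and es: "es = map (coord_field M U \<phi>) js" using assms by (auto simp: tangent_frames_iff)
  have "length es = CARD('d)" using js distinct_card[of js] by (simp add: es)
  then show thesis
    using that[of "\<lambda>i y. \<phi> y $ (js ! i)"] smooth_fun_coord[OF U] tangent_coframe[OF U _ js] by (simp add: es)
qed

lemma smooth_frame_field:
  assumes "(U, es) \<in> frames (tangent_bundle M)" "i < length es" "open W" "W \<subseteq> U" "smooth_fun M W f"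
  shows "smooth_fun M W (\<lambda>y. (es ! i) y f)"
proof -
  obtain \<phi> js where U: "(U, \<phi>) \<in> M" and es: "es = map (coord_field M U \<phi>) js"
    using assms by (auto simp: tangent_frames_iff)
  show ?thesis using smooth_fun_coord_field[OF U assms(3-5), of "js ! i"] assms(2) by (simp add: es)
qed

lemma vector_field_expand:
  assumes "(U, es) \<in> frames (tangent_bundle M)" "y \<in> U" "v \<in> tangent_space M y"
  shows "v f = (\<Sum>i<length es. coframe es i y v * (es ! i) y f)"
proof -
  have "(\<Sum>i<length es. coframe es i y v *\<^sub>R (es ! i) y) f = v f"
    using T.coframe_expand[OF assms(1,2), of v] assms(3) by (simp add: fibre_tangent)
  then show ?thesis by (simp add: sum_fun_apply scaleR_fun_def)
qed

lemma smooth_vector_field: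
  assumes W: "open W" and V: "V \<in> sections M (tangent_bundle M) W" and f: "smooth_fun M W f"
  shows "smooth_fun M W (\<lambda>y. V y f)"
proof (rule smooth_fun_local[OF W])
  fix x assume x: "x \<in> W"
  obtain U es where U: "(U, es) \<in> frames (tangent_bundle M)" "x \<in> U" by (rule T.frame_exists)
  have o: "open (W \<inter> U)" using W T.frame_open[OF U(1)] by blast
  have "smooth_fun M (W \<inter> U) (\<lambda>y. \<Sum>i<length es. coframe es i y (V y) * (es ! i) y f)"
    by (intro smooth_fun_sum smooth_fun_mult o T.sections_coframe[OF W V U(1)] smooth_frame_field[OF U(1)] smooth_fun_subset[OF f])
      auto
  then have "smooth_fun M (W \<inter> U) (\<lambda>y. V y f)"
    by (rule smooth_fun_cong[OF o, rotated])
      (use vector_field_expand[OF U(1)] T.sections_fibre[OF V] in \<open>auto simp: fibre_tangent\<close>)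
  then show "\<exists>W'. open W' \<and> x \<in> W' \<and> smooth_fun M W' (\<lambda>y. V y f)" using o x U by blast
qed

end

section \<open>Bivector powers\<close>

lemma sum_lessThan_double: "(\<Sum>q<2 * n. h q) = (\<Sum>i<n. h (2 * i) + h (2 * i + 1))"
  for h :: "nat \<Rightarrow> 'a::comm_monoid_add"
  by (induction n) (simp_all add: add.assoc)

text \<open>An endomorphism \<open>J\<close> acting as a derivation on the \<open>n\<close>-th power of a bivector multiplies it by
  the trace of \<open>J\<close>.\<close>

lemma bivector_power_derivation:
  fixes P :: "('e::real_vector \<Rightarrow> real) list \<Rightarrow> real" and J :: "nat \<Rightarrow> nat \<Rightarrow> real"
  assumes P: "P \<in> ext_fibre 2 S" and \<xi>: "length \<xi>s = 2 * n" "set \<xi>s \<subseteq> dual_fibre S"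
    and \<eta>: "\<And>m. \<eta> m = (\<Sum>k<2 * n. J m k *\<^sub>R (\<xi>s ! k))"
  defines "R \<equiv> \<lambda>p i. \<Prod>j\<in>{..<n} - {i}. P [\<xi>s ! p (2 * j), \<xi>s ! p (2 * j + 1)]"
  shows "(\<Sum>p | p permutes {..<2 * n}. of_int (sign p) * (\<Sum>i<n.
        (P [\<eta> (p (2 * i)), \<xi>s ! p (2 * i + 1)] + P [\<xi>s ! p (2 * i), \<eta> (p (2 * i + 1))]) * R p i))
    = (\<Sum>m<2 * n. J m m) * (\<Sum>p | p permutes {..<2 * n}. of_int (sign p) *
        (\<Prod>i<n. P [\<xi>s ! p (2 * i), \<xi>s ! p (2 * i + 1)]))" (is "?L = _ * ?A")
proof -
  \<comment> \<open>\<open>bivector_power\<close> is stated for bundles. A one-point bundle makes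
    its multilinearity and alternation available for the single form \<open>P\<close>.\<close>
  define E :: "(unit, 'e) vbundle" where "E = \<lparr>fibre = (\<lambda>_. S), frames = {}\<rparr>"
  define w where "w = bivector_power n E (\<lambda>_. P) ()"
  have w: "w \<in> ext_fibre (2 * n) S"
    using bivector_power_in_ext_fibre[of "\<lambda>_. P" "()" E n] P by (simp add: w_def E_def)
  define G where "G \<zeta>s p = (\<Prod>i<n. P [\<zeta>s ! p (2 * i), \<zeta>s ! p (2 * i + 1)])" for \<zeta>s and p :: "nat \<Rightarrow> nat"
  have wG: "w \<zeta>s * 2 ^ n = (\<Sum>p | p permutes {..<2 * n}. of_int (sign p) * G \<zeta>s p)"
    if "length \<zeta>s = 2 * n" "set \<zeta>s \<subseteq> dual_fibre S" for \<zeta>s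
    using that by (simp add: w_def bivector_power_def fibre_dual E_def G_def)
  have \<eta>d: "\<eta> m \<in> dual_fibre S" for m
    unfolding \<eta> by (rule dual_fibre_sum) (use \<xi> in auto)
  have up: "set (\<xi>s[m := \<eta> m]) \<subseteq> dual_fibre S" for m
    using \<xi>(2) \<eta>d[of m] set_update_subset_insert by fastforce
  \<comment> \<open>By \<open>ext_fibre_comb\<close>, replacing the m-th argument by \<eta> m
    multiplies the top form \<open>w\<close> by J m m. Summing over m produces the trace.\<close>
  have "(\<Sum>m<2 * n. J m m) * ?A = (\<Sum>m<2 * n. J m m * w \<xi>s) * 2 ^ n"
    using wG[OF \<xi>] by (simp add: G_def sum_distrib_right mult.assoc)
  also have "\<dots> = (\<Sum>m<2 * n. w (\<xi>s[m := \<eta> m]) * 2 ^ n)"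
    unfolding sum_distrib_right
  proof (rule sum.cong[OF refl])
    fix m assume "m \<in> {..<2 * n}"
    then show "J m m * w \<xi>s * 2 ^ n = w (\<xi>s[m := \<eta> m]) * 2 ^ n"
      unfolding \<eta> using ext_fibre_comb[OF w \<xi>, of m "J m"] by simp
  qed
  also have "\<dots> = (\<Sum>m<2 * n. \<Sum>p | p permutes {..<2 * n}. of_int (sign p) * G (\<xi>s[m := \<eta> m]) p)"
    by (intro sum.cong refl wG up) (simp add: \<xi>)
  also have "\<dots> = (\<Sum>p | p permutes {..<2 * n}. of_int (sign p) * (\<Sum>m<2 * n. G (\<xi>s[m := \<eta> m]) p))"
    unfolding sum_distrib_left by (rule sum.swap)
  also have "\<dots> = ?L"
  proof (rule sum.cong[OF refl], clarify)
    fix p assume p: "p permutes {..<2 * n}"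
    have pl: "p q < 2 * n" if "q < 2 * n" for q using permutes_in_image[OF p, of q] that by simp
    have pe: "p q = p q' \<longleftrightarrow> q = q'" for q q' using permutes_inj[OF p] by (auto dest: injD)
    have nu: "\<xi>s[p q := a] ! p q' = (if q = q' then a else \<xi>s ! p q')" if "q < 2 * n" for q q' a
      using pl[OF that] \<xi>(1) pe[of q q'] by (auto simp: nth_list_update)
    \<comment> \<open>Reindexed by m = p q, the replaced argument stands in slot q. Grouping the
      slots 2i and 2i + 1 collects exactly the two terms that change the i-th factor.\<close>
    have "(\<Sum>m<2 * n. G (\<xi>s[m := \<eta> m]) p) = (\<Sum>q<2 * n. G (\<xi>s[p q := \<eta> (p q)]) p)"
      using sum.permute[OF p, of "\<lambda>m. G (\<xi>s[m := \<eta> m]) p"] by (simp add: o_def)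
    also have "\<dots> = (\<Sum>i<n. G (\<xi>s[p (2 * i) := \<eta> (p (2 * i))]) p + G (\<xi>s[p (2 * i + 1) := \<eta> (p (2 * i + 1))]) p)"
      by (rule sum_lessThan_double)
    also have "\<dots> = (\<Sum>i<n. (P [\<eta> (p (2 * i)), \<xi>s ! p (2 * i + 1)] + P [\<xi>s ! p (2 * i), \<eta> (p (2 * i + 1))]) * R p i)"
    proof (rule sum.cong[OF refl])
      fix i assume "i \<in> {..<n}"
      then have i: "i < n" by simp
      have "G (\<xi>s[p (2 * i) := \<eta> (p (2 * i))]) p = P [\<eta> (p (2 * i)), \<xi>s ! p (2 * i + 1)] * R p i"
      proof -
        have "G (\<xi>s[p (2 * i) := \<eta> (p (2 * i))]) p = P [\<eta> (p (2 * i)), \<xi>s ! p (2 * i + 1)] *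
            (\<Prod>j\<in>{..<n} - {i}. P [\<xi>s[p (2 * i) := \<eta> (p (2 * i))] ! p (2 * j), \<xi>s[p (2 * i) := \<eta> (p (2 * i))] ! p (2 * j + 1)])"
          unfolding G_def using i nu[where q="2 * i" and q'="2 * i"] nu[where q="2 * i" and q'="2 * i + 1"]
          by (subst prod.remove[of _ i]) auto
        also have "(\<Prod>j\<in>{..<n} - {i}. P [\<xi>s[p (2 * i) := \<eta> (p (2 * i))] ! p (2 * j), \<xi>s[p (2 * i) := \<eta> (p (2 * i))] ! p (2 * j + 1)]) = R p i"
          unfolding R_def
        proof (rule prod.cong[OF refl])
          fix j assume "j \<in> {..<n} - {i}"
          then have "i \<noteq> j" by simp
          then have "2 * i \<noteq> 2 * j \<and> 2 * i \<noteq> 2 * j + 1" by presburger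
          then show "P [\<xi>s[p (2 * i) := \<eta> (p (2 * i))] ! p (2 * j), \<xi>s[p (2 * i) := \<eta> (p (2 * i))] ! p (2 * j + 1)]
              = P [\<xi>s ! p (2 * j), \<xi>s ! p (2 * j + 1)]"
            using nu[where q="2 * i" and q'="2 * j"] nu[where q="2 * i" and q'="2 * j + 1"] i by simp
        qed
        finally show ?thesis .
      qed
      moreover have "G (\<xi>s[p (2 * i + 1) := \<eta> (p (2 * i + 1))]) p = P [\<xi>s ! p (2 * i), \<eta> (p (2 * i + 1))] * R p i"
      proof -
        have "G (\<xi>s[p (2 * i + 1) := \<eta> (p (2 * i + 1))]) p = P [\<xi>s ! p (2 * i), \<eta> (p (2 * i + 1))] *
            (\<Prod>j\<in>{..<n} - {i}. P [\<xi>s[p (2 * i + 1) := \<eta> (p (2 * i + 1))] ! p (2 * j), \<xi>s[p (2 * i + 1) := \<eta> (p (2 * i + 1))] ! p (2 * j + 1)])"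
          unfolding G_def using i nu[where q="2 * i + 1" and q'="2 * i"] nu[where q="2 * i + 1" and q'="2 * i + 1"]
          by (subst prod.remove[of _ i]) auto
        also have "(\<Prod>j\<in>{..<n} - {i}. P [\<xi>s[p (2 * i + 1) := \<eta> (p (2 * i + 1))] ! p (2 * j), \<xi>s[p (2 * i + 1) := \<eta> (p (2 * i + 1))] ! p (2 * j + 1)]) = R p i"
          unfolding R_def
        proof (rule prod.cong[OF refl])
          fix j assume "j \<in> {..<n} - {i}"
          then have "i \<noteq> j" by simp
          then have "2 * i + 1 \<noteq> 2 * j \<and> 2 * i + 1 \<noteq> 2 * j + 1" by presburger
          then show "P [\<xi>s[p (2 * i + 1) := \<eta> (p (2 * i + 1))] ! p (2 * j), \<xi>s[p (2 * i + 1) := \<eta> (p (2 * i + 1))] ! p (2 * j + 1)]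
              = P [\<xi>s ! p (2 * j), \<xi>s ! p (2 * j + 1)]"
            using nu[where q="2 * i + 1" and q'="2 * j"] nu[where q="2 * i + 1" and q'="2 * j + 1"] i by simp
        qed
        finally show ?thesis .
      qed
      ultimately show "G (\<xi>s[p (2 * i) := \<eta> (p (2 * i))]) p + G (\<xi>s[p (2 * i + 1) := \<eta> (p (2 * i + 1))]) p
          = (P [\<eta> (p (2 * i)), \<xi>s ! p (2 * i + 1)] + P [\<xi>s ! p (2 * i), \<eta> (p (2 * i + 1))]) * R p i"
        by (simp add: distrib_right)
    qed
    finally show "of_int (sign p) * (\<Sum>m<2 * n. G (\<xi>s[m := \<eta> m]) p) = of_int (sign p) * (\<Sum>i<n.
        (P [\<eta> (p (2 * i)), \<xi>s ! p (2 * i + 1)] + P [\<xi>s ! p (2 * i), \<eta> (p (2 * i + 1))]) * R p i)" by simp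
  qed
  finally show ?thesis by simp
qed

lemma (in smooth_bundle) smooth_bivector_power:
  assumes U: "open U" and P: "P \<in> sections M (ext_power 2 E) U"
    and a: "\<And>\<alpha>. \<alpha> \<in> set \<alpha>s \<Longrightarrow> \<alpha> \<in> sections M (dual_bundle E) U" and l: "length \<alpha>s = 2 * n"
  shows "smooth_fun M U (\<lambda>x. bivector_power n E P x (map (\<lambda>\<alpha>. \<alpha> x) \<alpha>s))"
proof -
  have "smooth_fun M U (\<lambda>x. (\<Sum>p | p permutes {..<2 * n}. of_int (sign p) *
      (\<Prod>i<n. P x [(\<alpha>s ! p (2 * i)) x, (\<alpha>s ! p (2 * i + 1)) x])) * (1 / 2 ^ n))"
  proof (intro smooth_fun_sum smooth_fun_mult smooth_fun_prod smooth_fun_const U smooth_bivector[OF U P])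
    fix p i assume p: "p \<in> {p. p permutes {..<2 * n}}" and i: "i \<in> {..<n}"
    then have "p (2 * i) < 2 * n" "p (2 * i + 1) < 2 * n"
      using permutes_in_image[of p "{..<2 * n}" "2 * i"] permutes_in_image[of p "{..<2 * n}" "2 * i + 1"] by auto
    then show "\<alpha>s ! p (2 * i) \<in> sections M (dual_bundle E) U" "\<alpha>s ! p (2 * i + 1) \<in> sections M (dual_bundle E) U"
      using a l by auto
  qed
  then show ?thesis
  proof (rule smooth_fun_cong[OF U, rotated])
    fix x assume x: "x \<in> U"
    have "(\<Prod>i<n. P x [(\<alpha>s ! p (2 * i)) x, (\<alpha>s ! p (2 * i + 1)) x])
        = (\<Prod>i<n. P x [map (\<lambda>\<alpha>. \<alpha> x) \<alpha>s ! p (2 * i), map (\<lambda>\<alpha>. \<alpha> x) \<alpha>s ! p (2 * i + 1)])"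
      if p: "p permutes {..<2 * n}" for p
    proof (rule prod.cong[OF refl])
      fix i assume "i \<in> {..<n}"
      then have "p (2 * i) < length \<alpha>s" "p (2 * i + 1) < length \<alpha>s"
        using permutes_in_image[OF p, of "2 * i"] permutes_in_image[OF p, of "2 * i + 1"] l by auto
      then show "P x [(\<alpha>s ! p (2 * i)) x, (\<alpha>s ! p (2 * i + 1)) x]
          = P x [map (\<lambda>\<alpha>. \<alpha> x) \<alpha>s ! p (2 * i), map (\<lambda>\<alpha>. \<alpha> x) \<alpha>s ! p (2 * i + 1)]" by simp
    qed
    moreover have "set (map (\<lambda>\<alpha>. \<alpha> x) \<alpha>s) \<subseteq> dual_fibre (fibre E x)"
      using dual_section_fibre[OF a x] by auto
    ultimately show "(\<Sum>p | p permutes {..<2 * n}. of_int (sign p) *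
        (\<Prod>i<n. P x [(\<alpha>s ! p (2 * i)) x, (\<alpha>s ! p (2 * i + 1)) x])) * (1 / 2 ^ n)
        = bivector_power n E P x (map (\<lambda>\<alpha>. \<alpha> x) \<alpha>s)"
      using l by (simp add: bivector_power_def fibre_dual)
  qed
qed

section \<open>Lie brackets and closed one-forms\<close>

lemma dual_tangent_algebroid: "dual_bundle (tangent_algebroid M) = dual_bundle (tangent_bundle M)"
  and wedge_tangent_algebroid: "wedge (tangent_algebroid M) = wedge (tangent_bundle M)"
  and ext_power_tangent_algebroid: "ext_power k (tangent_algebroid M) = ext_power k (tangent_bundle M)"
  and sharp_tangent_algebroid: "sharp (tangent_algebroid M) = sharp (tangent_bundle M)"
  and anchor_tangent_algebroid: "v \<in> tangent_space M x \<Longrightarrow> anchor (tangent_algebroid M) x v = v"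
  and bracket_tangent_algebroid: "bracket (tangent_algebroid M) = lie_bracket M"
proof -
  show d: "dual_bundle (tangent_algebroid M) = dual_bundle (tangent_bundle M)"
    by (simp add: dual_bundle_def hom_bundle_def tangent_algebroid_def)
  show w: "wedge (tangent_algebroid M) = wedge (tangent_bundle M)"
    by (intro ext) (simp add: wedge_def d)
  show "ext_power k (tangent_algebroid M) = ext_power k (tangent_bundle M)"
    unfolding ext_power_def w by (simp add: tangent_algebroid_def)
  show "sharp (tangent_algebroid M) = sharp (tangent_bundle M)"
    unfolding sharp_def d by (intro ext) (simp add: tangent_algebroid_def)
qed (simp_all add: sections_def tangent_algebroid_def)

context tangent_manifold
begin

lemma field_tangent: "V \<in> sections M (tangent_bundle M) W \<Longrightarrow> x \<in> W \<Longrightarrow> V x \<in> tangent_space M x"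
  using T.sections_fibre by (fastforce simp: fibre_tangent)

lemma smooth_near_field:
  assumes "open W" "V \<in> sections M (tangent_bundle M) W" "x \<in> W" "smooth_near M x f"
  shows "smooth_near M x (\<lambda>y. V y f)"
proof -
  obtain W' where W': "open W'" "x \<in> W'" "W' \<subseteq> W" "smooth_fun M W' f"
    by (rule smooth_nearE[OF assms(4,1,3)])
  show ?thesis
    by (rule smooth_nearI[OF W'(1) smooth_vector_field[OF W'(1) T.sections_subset[OF assms(2,1) W'(1,3)] W'(4)] W'(2)])
qed

text \<open>In the second formula the cross terms V f a g + a f V g are symmetric in the two
  directions, so they cancel in a commutator. This is why the Lie bracket is again a
  derivation.\<close>

lemma iterated_field:
  assumes W: "open W" and V: "V \<in> sections M (tangent_bundle M) W" and a: "a \<in> tangent_space M x" and x: "x \<in> W"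
    and f: "smooth_near M x f" and g: "smooth_near M x g"
  shows "a (\<lambda>y. V y (\<lambda>z. r * f z + s * g z)) = r * a (\<lambda>y. V y f) + s * a (\<lambda>y. V y g)"
    and "a (\<lambda>y. V y (\<lambda>z. f z * g z)) = a (\<lambda>y. V y f) * g x + V x f * a g + a f * V x g + f x * a (\<lambda>y. V y g)"
proof -
  obtain W1 where W1: "open W1" "x \<in> W1" "W1 \<subseteq> W" "smooth_fun M W1 f" by (rule smooth_nearE[OF f W x])
  obtain W2 where W2: "open W2" "x \<in> W2" "W2 \<subseteq> W1" "smooth_fun M W2 g" by (rule smooth_nearE[OF g W1(1,2)])
  have n: "smooth_near M y f" "smooth_near M y g" "V y \<in> tangent_space M y" if "y \<in> W2" for y
    using that W1 W2 smooth_nearI field_tangent[OF V] by blast+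
  note sf = smooth_near_field[OF W V x f] and sg = smooth_near_field[OF W V x g]
  have "a (\<lambda>y. r * V y f + s * V y g) = a (\<lambda>y. V y (\<lambda>z. r * f z + s * g z))"
    by (rule tangent_cong[OF a _ W2(1,2)])
      (use sf sg tangent_linear[OF n(3) n(1,2)] in \<open>auto intro!: smooth_near_add smooth_near_mult smooth_near_const\<close>)
  then show "a (\<lambda>y. V y (\<lambda>z. r * f z + s * g z)) = r * a (\<lambda>y. V y f) + s * a (\<lambda>y. V y g)"
    using tangent_linear[OF a sf sg, of r s] by simp
  have "a (\<lambda>y. V y f * g y + f y * V y g) = a (\<lambda>y. V y (\<lambda>z. f z * g z))"
    by (rule tangent_cong[OF a _ W2(1,2)])
      (use f g sf sg tangent_mult[OF n(3) n(1,2)] in \<open>auto intro!: smooth_near_add smooth_near_mult\<close>)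
  then show "a (\<lambda>y. V y (\<lambda>z. f z * g z)) = a (\<lambda>y. V y f) * g x + V x f * a g + a f * V x g + f x * a (\<lambda>y. V y g)"
    using tangent_add[OF a smooth_near_mult[OF sf g] smooth_near_mult[OF f sg]] tangent_mult[OF a sf g] tangent_mult[OF a f sg]
    by simp
qed

lemma lie_bracket_tangent:
  assumes W: "open W" and a: "a \<in> sections M (tangent_bundle M) W" and b: "b \<in> sections M (tangent_bundle M) W" and x: "x \<in> W"
  shows "lie_bracket M a b x \<in> tangent_space M x"
  unfolding tangent_space_def
proof (intro CollectI conjI allI impI; (elim conjE)?)
  fix f g :: "'p \<Rightarrow> real" and r s assume f: "smooth_near M x f" and g: "smooth_near M x g"
  have "smooth_near M x (\<lambda>y. r * f y + s * g y)"
    by (intro smooth_near_add smooth_near_mult smooth_near_const f g)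
  then show "lie_bracket M a b x (\<lambda>y. r * f y + s * g y) = r * lie_bracket M a b x f + s * lie_bracket M a b x g"
    using iterated_field(1)[OF W b field_tangent[OF a x] x f g] iterated_field(1)[OF W a field_tangent[OF b x] x f g] f g
    by (simp add: lie_bracket_def algebra_simps)
next
  fix f g :: "'p \<Rightarrow> real" assume f: "smooth_near M x f" and g: "smooth_near M x g"
  show "lie_bracket M a b x (\<lambda>y. f y * g y) = lie_bracket M a b x f * g x + f x * lie_bracket M a b x g"
    using iterated_field(2)[OF W b field_tangent[OF a x] x f g] iterated_field(2)[OF W a field_tangent[OF b x] x f g] f g
    by (simp add: lie_bracket_def smooth_near_mult algebra_simps)
qed (simp add: lie_bracket_def)

lemma lie_bracket_cong:
  assumes W: "open W" and x: "x \<in> W"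
    and a: "a \<in> sections M (tangent_bundle M) W" and b: "b \<in> sections M (tangent_bundle M) W"
    and eq: "\<And>y. y \<in> W \<Longrightarrow> a y = a' y" "\<And>y. y \<in> W \<Longrightarrow> b y = b' y"
  shows "lie_bracket M a b x = lie_bracket M a' b' x"
proof
  fix f
  show "lie_bracket M a b x f = lie_bracket M a' b' x f"
  proof (cases "smooth_near M x f")
    case True
    have "a x (\<lambda>y. b y f) = a x (\<lambda>y. b' y f)"
      by (rule tangent_cong[OF field_tangent[OF a x] smooth_near_field[OF W b x True] W x]) (simp add: eq)
    moreover have "b x (\<lambda>y. a y f) = b x (\<lambda>y. a' y f)"
      by (rule tangent_cong[OF field_tangent[OF b x] smooth_near_field[OF W a x True] W x]) (simp add: eq)
    ultimately show ?thesis using eq x by (simp add: lie_bracket_def)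
  qed (simp add: lie_bracket_def)
qed

text \<open>No symmetry of second derivatives is needed: the bracket is a tangent vector, and it kills the
  coordinate functions.\<close>

lemma lie_bracket_frame:
  assumes U: "(U, es) \<in> frames (tangent_bundle M)" and i: "i < length es" "j < length es" and x: "x \<in> U"
  shows "lie_bracket M (es ! i) (es ! j) x = 0"
proof -
  obtain xs where xs: "length es = CARD('d)" "\<And>i. i < length es \<Longrightarrow> smooth_fun M U (xs i)"
    "\<And>i y v. i < length es \<Longrightarrow> y \<in> U \<Longrightarrow> v \<in> tangent_space M y \<Longrightarrow> coframe es i y v = v (xs i)"
    using tangent_frame_coords[OF U] by metis
  note o = T.frame_open[OF U]
  have t: "(es ! i) y \<in> tangent_space M y" if "i < length es" "y \<in> U" for i y
    using field_tangent[OF T.frame_section[OF U that(1)] that(2)] .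
  note lb = lie_bracket_tangent[OF o T.frame_section[OF U i(1)] T.frame_section[OF U i(2)] x]
  have const: "(es ! m) y (xs k) = (if k = m then 1 else 0)" if "m < length es" "k < length es" "y \<in> U" for m k y
    using T.coframe_nth[OF U that(3,2,1)] xs(3)[OF that(2,3) t[OF that(1,3)]] by simp
  have z: "(es ! m) x (\<lambda>y. (es ! m') y (xs k)) = 0" if "m < length es" "m' < length es" "k < length es" for m m' k
  proof -
    have "(es ! m) x (\<lambda>y. if k = m' then 1 else 0) = (es ! m) x (\<lambda>y. (es ! m') y (xs k))"
      by (rule tangent_cong[OF t[OF that(1) x] smooth_near_const o x]) (simp add: const that)
    then show ?thesis using tangent_const[OF t[OF that(1) x]] by simp
  qed
  have "coframe es k x (lie_bracket M (es ! i) (es ! j) x) = 0" if k: "k < length es" for k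
    using xs(3)[OF k x lb] z i k smooth_nearI[OF o xs(2)[OF k] x] by (simp add: lie_bracket_def)
  then show ?thesis
    using T.coframe_expand[OF U x, of "lie_bracket M (es ! i) (es ! j) x"] lb by (simp add: fibre_tangent)
qed

text \<open>For \<Theta> = \<Sum>j \<theta>_j dx_j the terms in which a field differentiates a
  component of the other field cancel against \<Theta> of the bracket. What remains are the
  derivatives of \<theta>_j antisymmetrised in a and b, which vanish by \<open>cl\<close>;
  closedness at the single point x suffices.\<close>

lemma closed_form_d_zero:
  assumes U: "(U, es) \<in> frames (tangent_bundle M)" and W: "open W" "x \<in> W" "W \<subseteq> U"
    and th: "\<And>i. i < length es \<Longrightarrow> smooth_fun M W (\<theta> i)"
    and \<Theta>: "\<And>y. y \<in> W \<Longrightarrow> \<Theta> y = (\<Sum>i<length es. \<theta> i y *\<^sub>R coframe es i y)"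
    and cl: "\<And>i j. i < length es \<Longrightarrow> j < length es \<Longrightarrow> (es ! i) x (\<theta> j) = (es ! j) x (\<theta> i)"
    and a: "a \<in> sections M (tangent_bundle M) W" and b: "b \<in> sections M (tangent_bundle M) W"
  shows "algebroid_d (tangent_algebroid M) \<Theta> a b x = 0"
proof -
  obtain xs where xs: "length es = CARD('d)" "\<And>i. i < length es \<Longrightarrow> smooth_fun M U (xs i)"
    "\<And>i y v. i < length es \<Longrightarrow> y \<in> U \<Longrightarrow> v \<in> tangent_space M y \<Longrightarrow> coframe es i y v = v (xs i)"
    using tangent_frame_coords[OF U] by metis
  have xsW: "smooth_fun M W (xs i)" if "i < length es" for i using xs(2)[OF that] W(3) smooth_fun_subset by blast
  have xU: "x \<in> U" using W by blast
  have th': "\<Theta> y v = (\<Sum>i<length es. \<theta> i y * v (xs i))" if "y \<in> W" "v \<in> tangent_space M y" for y v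
    using that W xs(3) by (auto simp: \<Theta> sum_fun_apply scaleR_fun_def intro!: sum.cong)
  have half: "c x (\<lambda>y. \<Theta> y (e y)) = (\<Sum>j<length es. c x (\<theta> j) * e x (xs j) + \<theta> j x * c x (\<lambda>y. e y (xs j)))"
    if c: "c \<in> sections M (tangent_bundle M) W" and e: "e \<in> sections M (tangent_bundle M) W" for c e
  proof -
    have s: "smooth_near M x (\<theta> j)" "smooth_near M x (\<lambda>y. e y (xs j))" if "j < length es" for j
      using smooth_nearI[OF W(1) th[OF that] W(2)] smooth_nearI[OF W(1) smooth_vector_field[OF W(1) e xsW[OF that]] W(2)] by auto
    note ct = field_tangent[OF c W(2)]
    have "c x (\<lambda>y. \<Sum>j<length es. \<theta> j y * e y (xs j)) = c x (\<lambda>y. \<Theta> y (e y))"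
      by (rule tangent_cong[OF ct _ W(1,2)])
        (use s th' field_tangent[OF e] in \<open>auto intro!: smooth_near_sum smooth_near_mult\<close>)
    moreover have "c x (\<lambda>y. \<Sum>j<length es. \<theta> j y * e y (xs j)) = (\<Sum>j<length es. c x (\<lambda>y. \<theta> j y * e y (xs j)))"
      by (rule tangent_sum[OF ct]) (use s in \<open>auto intro!: smooth_near_mult\<close>)
    moreover have "\<dots> = (\<Sum>j<length es. c x (\<theta> j) * e x (xs j) + \<theta> j x * c x (\<lambda>y. e y (xs j)))"
      by (rule sum.cong) (use tangent_mult[OF ct s] in auto)
    ultimately show ?thesis by simp
  qed
  note lb = lie_bracket_tangent[OF W(1) a b W(2)]
  have br: "\<Theta> x (lie_bracket M a b x) = (\<Sum>j<length es. \<theta> j x * (a x (\<lambda>y. b y (xs j)) - b x (\<lambda>y. a y (xs j))))"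
    unfolding th'[OF W(2) lb]
    by (rule sum.cong) (use smooth_nearI[OF W(1) xsW W(2)] in \<open>auto simp: lie_bracket_def\<close>)
  have dir: "c x (\<theta> j) = (\<Sum>i<length es. c x (xs i) * (es ! i) x (\<theta> j))"
    if "c \<in> sections M (tangent_bundle M) W" for c j
    unfolding vector_field_expand[OF U xU field_tangent[OF that W(2)], of "\<theta> j"]
    by (rule sum.cong) (use xs(3)[OF _ xU field_tangent[OF that W(2)]] in auto)
  have "(\<Sum>j<length es. a x (\<theta> j) * b x (xs j)) = (\<Sum>j<length es. \<Sum>i<length es. a x (xs i) * (es ! i) x (\<theta> j) * b x (xs j))"
    unfolding dir[OF a] by (simp add: sum_distrib_right)
  also have "\<dots> = (\<Sum>j<length es. \<Sum>i<length es. b x (xs j) * (es ! j) x (\<theta> i) * a x (xs i))"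
    by (intro sum.cong refl) (use cl in \<open>auto simp: mult_ac\<close>)
  also have "\<dots> = (\<Sum>i<length es. \<Sum>j<length es. b x (xs j) * (es ! j) x (\<theta> i) * a x (xs i))"
    by (rule sum.swap)
  also have "\<dots> = (\<Sum>j<length es. b x (\<theta> j) * a x (xs j))"
    unfolding dir[OF b] by (simp add: sum_distrib_right)
  finally have "(\<Sum>j<length es. a x (\<theta> j) * b x (xs j)) = (\<Sum>j<length es. b x (\<theta> j) * a x (xs j))" .
  then show ?thesis
    unfolding algebroid_d_def bracket_tangent_algebroid anchor_tangent_algebroid[OF field_tangent[OF a W(2)]]
      anchor_tangent_algebroid[OF field_tangent[OF b W(2)]] half[OF a b] half[OF b a] br
    by (simp add: sum.distrib sum_subtractf algebra_simps)
qed

lemma tangent_prod: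
  assumes v: "v \<in> tangent_space M x" and h: "\<And>i. i \<in> J \<Longrightarrow> smooth_near M x (h i)" and J: "finite J"
  shows "v (\<lambda>y. \<Prod>i\<in>J. h i y) = (\<Sum>i\<in>J. v (h i) * (\<Prod>j\<in>J - {i}. h j x))"
  using J h
proof (induction J)
  case empty
  then show ?case using tangent_const[OF v] by simp
next
  case (insert i J)
  have "smooth_near M x (\<lambda>y. \<Prod>i\<in>J. h i y)"
    if "\<And>i. i \<in> J \<Longrightarrow> smooth_near M x (h i)"
    using insert.hyps(1) that
    by (induction J rule: finite_induct) (auto intro: smooth_near_const smooth_near_mult)
  then have pn: "smooth_near M x (\<lambda>y. \<Prod>i\<in>J. h i y)" using insert.prems by blast
  have "v (\<lambda>y. \<Prod>i\<in>insert i J. h i y) = v (h i) * (\<Prod>i\<in>J. h i x) + h i x * (\<Sum>k\<in>J. v (h k) * (\<Prod>j\<in>J - {k}. h j x))"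
    using tangent_mult[OF v _ pn, of "h i"] insert by simp
  also have "h i x * (\<Sum>k\<in>J. v (h k) * (\<Prod>j\<in>J - {k}. h j x)) = (\<Sum>k\<in>J. v (h k) * (\<Prod>j\<in>insert i J - {k}. h j x))"
    unfolding sum_distrib_left
  proof (rule sum.cong[OF refl])
    fix k assume k: "k \<in> J"
    then have "insert i J - {k} = insert i (J - {k})" using insert.hyps by auto
    then show "h i x * (v (h k) * (\<Prod>j\<in>J - {k}. h j x)) = v (h k) * (\<Prod>j\<in>insert i J - {k}. h j x)"
      using insert.hyps by simp
  qed
  finally show ?case using insert.hyps by simp
qed

end

section \<open>Determinant bundles and divisor ideals\<close>

context smooth_bundle
begin

lemma frames_det: "(V, ws) \<in> frames (det_bundle E) \<longleftrightarrow> (\<exists>es. (V, es) \<in> frames E \<and> ws = [wedge E es])"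
  by (auto simp: det_bundle_def)

lemma fibre_det: "(V, es) \<in> frames E \<Longrightarrow> x \<in> V \<Longrightarrow> fibre (det_bundle E) x = ext_fibre (length es) (fibre E x)"
  using basis_of_dim[OF frame_basis] by (simp add: det_bundle_def)

lemma frame_wedge_in_fibre:
  assumes "(V, es) \<in> frames E" "x \<in> V"
  shows "wedge E es x \<in> fibre (det_bundle E) x"
  unfolding fibre_det[OF assms] by (rule wedge_in_ext_fibre) (use frame_fibre[OF assms] in \<open>auto simp: in_set_conv_nth\<close>)

lemma det_expand:
  assumes "(V, es) \<in> frames E" "x \<in> V" "w \<in> fibre (det_bundle E) x"
  shows "w = w (map (\<lambda>i. coframe es i x) [0..<length es]) *\<^sub>R wedge E es x"
  using ext_top_eq_wedge[OF frame_basis[OF assms(1,2)], of w] assms(3) fibre_det[OF assms(1,2)] by (simp add: coframe_def)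

lemma wedge_coframe:
  "(V, es) \<in> frames E \<Longrightarrow> x \<in> V \<Longrightarrow> wedge E es x (map (\<lambda>i. coframe es i x) [0..<length es]) = 1"
  using wedge_coord[OF frame_basis, of V es x] by (simp add: coframe_def)

lemma basis_of_singleton:
  assumes "w \<noteq> 0" "w \<in> S" "subspace S" "\<And>v. v \<in> S \<Longrightarrow> \<exists>c. v = c *\<^sub>R w"
  shows "basis_of [w] S"
proof -
  have "independent {w}"
    by (rule real_vector.independent_insertI[OF _ real_vector.independent_empty]) (use assms(1) in simp)
  moreover have "span {w} \<subseteq> S" by (rule span_minimal) (use assms in auto)
  moreover have "S \<subseteq> span {w}"
  proof
    fix v assume "v \<in> S"
    then obtain c where "v = c *\<^sub>R w" using assms(4) by blast
    then show "v \<in> span {w}" by (simp only: span_scale[OF span_base[OF insertI1]])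
  qed
  ultimately show ?thesis by (simp add: basis_of_def)
qed

lemma vector_bundle_det: "vector_bundle M (det_bundle E)"
  unfolding vector_bundle_def
proof (intro conjI ballI; clarify?)
  have "\<exists>V ws. (V, ws) \<in> frames (det_bundle E) \<and> x \<in> V" for x
    by (rule frame_exists[of x]) (auto simp: frames_det)
  then show "(\<Union>(U, es)\<in>frames (det_bundle E). U) = UNIV" by fastforce
  fix V ws assume "(V, ws) \<in> frames (det_bundle E)"
  then obtain es where V: "(V, es) \<in> frames E" and ws: "ws = [wedge E es]" by (auto simp: frames_det)
  note o = frame_open[OF V]
  have "basis_of [wedge E es x] (fibre (det_bundle E) x)" if x: "x \<in> V" for x
  proof (rule basis_of_singleton)
    show "wedge E es x \<noteq> 0" using wedge_coframe[OF V x] by auto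
    show "subspace (fibre (det_bundle E) x)" unfolding fibre_det[OF V x] by (rule subspace_ext_fibre)
    show "\<exists>c. v = c *\<^sub>R wedge E es x" if "v \<in> fibre (det_bundle E) x" for v
      using det_expand[OF V x that] by blast
  qed (rule frame_wedge_in_fibre[OF V x])
  moreover have "wedge E es \<in> sections M (det_bundle E) V"
    unfolding sections_def
  proof (intro CollectI conjI ballI; clarify?)
    show "wedge E es x \<in> fibre (det_bundle E) x" if "x \<in> V" for x by (rule frame_wedge_in_fibre[OF V that])
    fix V' ws' assume "(V', ws') \<in> frames (det_bundle E)"
    then obtain es' where V': "(V', es') \<in> frames E" and ws': "ws' = [wedge E es']" by (auto simp: frames_det)
    have o': "open (V \<inter> V')" using o frame_open[OF V'] by blast
    let ?c = "\<lambda>x. wedge E es x (map (\<lambda>i. coframe es' i x) [0..<length es'])"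
    have "smooth_fun M (V \<inter> V') ?c"
    \<comment> \<open>Over disjoint domains the two frames may have different lengths; a common
      point forces equal rank.\<close>
    proof (cases "V \<inter> V' = {}")
      case True
      then show ?thesis using smooth_fun_local[of "{}" ?c] by simp
    next
      case False
      then obtain x where x: "x \<in> V" "x \<in> V'" by blast
      have len: "length es' = length es"
        using basis_of_dim[OF frame_basis[OF V x(1)]] basis_of_dim[OF frame_basis[OF V' x(2)]] by simp
      have "smooth_fun M (V \<inter> V') (\<lambda>x. wedge E es x (map (\<lambda>\<alpha>. \<alpha> x) (map (coframe es') [0..<length es'])))"
      proof (rule smooth_wedge[OF o'])
        show "\<alpha> \<in> sections M (dual_bundle E) (V \<inter> V')" if "\<alpha> \<in> set (map (coframe es') [0..<length es'])" for \<alpha>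
          using that smooth_bundle.sections_subset[OF bundle_dual coframe_dual_section[OF V'] frame_open[OF V'] o' Int_lower2] by auto
        show "s \<in> sections M E (V \<inter> V')" if "s \<in> set es" for s
          using that sections_subset[OF frame_section[OF V] o o' Int_lower1] by (auto simp: in_set_conv_nth)
      qed (simp add: len)
      then show ?thesis by (simp add: o_def)
    qed
    moreover have "wedge E es x = ?c x *\<^sub>R wedge E es' x" if "x \<in> V \<inter> V'" for x
      using det_expand[OF V' _ frame_wedge_in_fibre[OF V]] that by blast
    ultimately show "\<exists>c. (\<forall>i<length ws'. smooth_fun M (V \<inter> V') (c i)) \<and>
        (\<forall>x\<in>V \<inter> V'. wedge E es x = (\<Sum>i<length ws'. c i x *\<^sub>R (ws' ! i) x))"
      unfolding ws' by (intro exI[of _ "\<lambda>_. ?c"]) auto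
  qed
  ultimately show "open V \<and> (\<forall>x\<in>V. basis_of (map (\<lambda>e. e x) ws) (fibre (det_bundle E) x)) \<and> set ws \<subseteq> sections M (det_bundle E) V"
    using o by (simp add: ws)
qed

lemma bundle_det: "smooth_bundle M (det_bundle E)"
  by (intro smooth_bundle.intro manifold_axioms smooth_bundle_axioms.intro vector_bundle_det)

lemma det_coframe:
  assumes V: "(V, es) \<in> frames E" "x \<in> V" and w: "w \<in> fibre (det_bundle E) x"
  shows "coframe [wedge E es] 0 x w = w (map (\<lambda>i. coframe es i x) [0..<length es])"
proof -
  interpret d: smooth_bundle M "det_bundle E" by (rule bundle_det)
  have V': "(V, [wedge E es]) \<in> frames (det_bundle E)" using V by (auto simp: frames_det)
  have "coframe [wedge E es] 0 x (w (map (\<lambda>i. coframe es i x) [0..<length es]) *\<^sub>R wedge E es x)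
      = w (map (\<lambda>i. coframe es i x) [0..<length es]) *\<^sub>R coframe [wedge E es] 0 x (wedge E es x)"
    by (rule hom_fibre_scale[OF d.coframe_dual[OF V' V(2)] frame_wedge_in_fibre[OF V]])
  then show ?thesis using det_expand[OF V w] d.coframe_nth[OF V' V(2), of 0 0] by simp
qed

end

section \<open>Line bundles and divisor ideals in local frames\<close>

locale smooth_line_bundle = smooth_bundle M E
  for M :: "('p::{t2_space, second_countable_topology}, 'd::finite) atlas"
    and E :: "('p, 'e::real_vector, 'z) vbundle_scheme" +
  assumes frame_length: "(V, es) \<in> frames E \<Longrightarrow> length es = 1"
begin

lemma line_expand: "(V, es) \<in> frames E \<Longrightarrow> x \<in> V \<Longrightarrow> v \<in> fibre E x \<Longrightarrow> v = coframe es 0 x v *\<^sub>R (es ! 0) x"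
  using coframe_expand[of V es x v] frame_length[of V es] by simp

lemma line_pairing:
  assumes V: "(V, es) \<in> frames E" "x \<in> V" and t: "\<tau> \<in> dual_fibre (fibre E x)" and v: "v \<in> fibre E x"
  shows "\<tau> v = \<tau> ((es ! 0) x) * coframe es 0 x v"
proof -
  have "\<tau> (coframe es 0 x v *\<^sub>R (es ! 0) x) = coframe es 0 x v *\<^sub>R \<tau> ((es ! 0) x)"
    by (rule hom_fibre_scale[OF t frame_fibre[OF V]]) (simp add: frame_length[OF V(1)])
  then show ?thesis using line_expand[OF V v] by simp
qed

context
  fixes \<sigma>
  assumes \<sigma>: "\<sigma> \<in> sections M E UNIV"
begin

text \<open>In a frame the section has a single coordinate, and a covector pairs with it by
  multiplication: that coordinate is the local generator of the ideal.\<close>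

lemma divisor_ideal_local:
  assumes V: "(V, es) \<in> frames E" and a: "a \<in> divisor_ideal M E \<sigma>"
  obtains k where "smooth_fun M V k" "\<And>y. y \<in> V \<Longrightarrow> a y = k y * coframe es 0 y (\<sigma> y)"
proof -
  obtain \<tau> where t: "\<tau> \<in> sections M (dual_bundle E) UNIV" "a = (\<lambda>x. \<tau> x (\<sigma> x))"
    using a by (auto simp: divisor_ideal_def)
  have "smooth_fun M (UNIV \<inter> V) (\<lambda>x. \<tau> x ((es ! 0) x))"
    using t(1) V frame_length[OF V] unfolding dual_sections_iff[OF open_UNIV] by fastforce
  moreover have "a y = \<tau> y ((es ! 0) y) * coframe es 0 y (\<sigma> y)" if "y \<in> V" for y
    using line_pairing[OF V that dual_section_fibre[OF t(1)] sections_fibre[OF \<sigma>]] by (simp add: t(2))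
  ultimately show thesis using that[of "\<lambda>x. \<tau> x ((es ! 0) x)"] by simp
qed

text \<open>The ideal consists of global functions, so a local multiple of the generator is realised
  only as a germ, by extending the local section of the dual line bundle.\<close>

lemma divisor_ideal_generate:
  assumes V: "(V, es) \<in> frames E" and W: "open W" "x \<in> W" "W \<subseteq> V" and k: "smooth_fun M W k"
  obtains a W' where "a \<in> divisor_ideal M E \<sigma>" "open W'" "x \<in> W'" "W' \<subseteq> W"
    "\<And>y. y \<in> W' \<Longrightarrow> a y = k y * coframe es 0 y (\<sigma> y)"
proof -
  interpret d: smooth_bundle M "dual_bundle E" by (rule bundle_dual)
  have "coframe es 0 \<in> sections M (dual_bundle E) W"
    by (rule d.sections_subset[OF coframe_dual_section[OF V] frame_open[OF V] W(1,3)]) (simp add: frame_length[OF V])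
  then have "(\<lambda>y. k y *\<^sub>R coframe es 0 y) \<in> sections M (dual_bundle E) W" by (rule d.sections_scale[OF W(1) k])
  then obtain \<tau> W' where t: "\<tau> \<in> sections M (dual_bundle E) UNIV" "open W'" "x \<in> W'" "W' \<subseteq> W"
    "\<And>y. y \<in> W' \<Longrightarrow> \<tau> y = k y *\<^sub>R coframe es 0 y" by (rule d.section_extension[OF W(1,2)]) blast
  then show thesis using that[of "\<lambda>x. \<tau> x (\<sigma> x)" W'] by (auto simp: divisor_ideal_def scaleR_fun_def)
qed

text \<open>A covector on a line is determined by its value on a nonzero vector. Over
  \<open>D\<close> the covector with \<tau>(\<sigma>) = a is therefore unique, so the local
  quotients glue to one global section \<tau>, and \<tau>(\<sigma>) = a extends by density.\<close>

lemma divisor_ideal_localI: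
  assumes D: "closure D = UNIV" "\<And>x. x \<in> D \<Longrightarrow> \<sigma> x \<noteq> 0"
    and loc: "\<And>x. \<exists>V es W k. (V, es) \<in> frames E \<and> open W \<and> x \<in> W \<and> W \<subseteq> V \<and> smooth_fun M W k \<and>
      (\<forall>y\<in>W. a y = k y * coframe es 0 y (\<sigma> y))"
  shows "a \<in> divisor_ideal M E \<sigma>"
proof -
  interpret d: smooth_bundle M "dual_bundle E" by (rule bundle_dual)
  let ?Q = "\<lambda>y \<tau>. \<tau> \<in> dual_fibre (fibre E y) \<and> \<tau> (\<sigma> y) = a y"
  have sec: "\<exists>W s. open W \<and> x \<in> W \<and> s \<in> sections M (dual_bundle E) W \<and> (\<forall>y\<in>W \<inter> D. ?Q y (s y))" for x
  proof -
    obtain V es W k where V: "(V, es) \<in> frames E" and W: "open W" "x \<in> W" "W \<subseteq> V" and k: "smooth_fun M W k"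
      "\<forall>y\<in>W. a y = k y * coframe es 0 y (\<sigma> y)" using loc[of x] by blast
    have "coframe es 0 \<in> sections M (dual_bundle E) W"
      by (rule d.sections_subset[OF coframe_dual_section[OF V] frame_open[OF V] W(1,3)]) (simp add: frame_length[OF V])
    then have s: "(\<lambda>y. k y *\<^sub>R coframe es 0 y) \<in> sections M (dual_bundle E) W" by (rule d.sections_scale[OF W(1) k(1)])
    have "?Q y (k y *\<^sub>R coframe es 0 y)" if "y \<in> W" for y
      using dual_section_fibre[OF s that] k(2) that by (simp add: scaleR_fun_def)
    then show ?thesis using W s by blast
  qed
  have uniq: "\<tau> = \<tau>'" if y: "y \<in> D" and t: "?Q y \<tau>" "?Q y \<tau>'" for y \<tau> \<tau>'
  proof -
    obtain V es where V: "(V, es) \<in> frames E" "y \<in> V" by (rule frame_exists)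
    have sy: "\<sigma> y \<in> fibre E y" by (rule sections_fibre[OF \<sigma> UNIV_I])
    have "coframe es 0 y (\<sigma> y) \<noteq> 0"
    proof
      assume "coframe es 0 y (\<sigma> y) = 0"
      then have "\<sigma> y = 0" using line_expand[OF V sy] by simp
      then show False using D(2)[OF y] by blast
    qed
    moreover have "\<tau> ((es ! 0) y) * coframe es 0 y (\<sigma> y) = \<tau>' ((es ! 0) y) * coframe es 0 y (\<sigma> y)"
      using line_pairing[OF V conjunct1[OF t(1)] sy] line_pairing[OF V conjunct1[OF t(2)] sy] t by simp
    ultimately have "\<tau> ((es ! 0) y) = \<tau>' ((es ! 0) y)" by simp
    then show ?thesis
      using dual_expand_frame[OF V conjunct1[OF t(1)]] dual_expand_frame[OF V conjunct1[OF t(2)]] frame_length[OF V(1)] by simp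
  qed
  obtain \<tau> where t: "\<tau> \<in> sections M (dual_bundle E) UNIV" "\<And>y. y \<in> D \<Longrightarrow> ?Q y (\<tau> y)"
    by (rule d.sections_glue[OF D(1), of ?Q, OF sec uniq]) blast+
  have ts: "smooth_fun M UNIV (\<lambda>y. \<tau> y (\<sigma> y))" by (rule smooth_pairing[OF open_UNIV t(1) \<sigma>])
  have as: "smooth_fun M UNIV a"
  proof (rule smooth_fun_local[OF open_UNIV])
    fix x
    obtain V es W k where V: "(V, es) \<in> frames E" and W: "open W" "x \<in> W" "W \<subseteq> V" and k: "smooth_fun M W k"
      "\<forall>y\<in>W. a y = k y * coframe es 0 y (\<sigma> y)" using loc[of x] by blast
    have "smooth_fun M W (\<lambda>y. coframe es 0 y (\<sigma> y))"
      by (rule smooth_fun_subset[OF sections_coframe[OF open_UNIV \<sigma> V]]) (use W frame_length[OF V] in auto)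
    then have "smooth_fun M W (\<lambda>y. k y * coframe es 0 y (\<sigma> y))" by (intro smooth_fun_mult W(1) k(1))
    then have "smooth_fun M W a" by (rule smooth_fun_cong[OF W(1), rotated]) (use k(2) in auto)
    then show "\<exists>W'. open W' \<and> x \<in> W' \<and> smooth_fun M W' a" using W by blast
  qed
  have "a x = \<tau> x (\<sigma> x)" for x
    by (rule smooth_fun_eq_dense[OF open_UNIV as ts D(1) _ UNIV_I]) (use t(2) in auto)
  then have "a = (\<lambda>x. \<tau> x (\<sigma> x))" by auto
  then show ?thesis using t(1) by (auto simp: divisor_ideal_def)
qed

end

end

lemma (in smooth_bundle) line_bundle_det: "smooth_line_bundle M (det_bundle E)"
  by (intro smooth_line_bundle.intro bundle_det smooth_line_bundle_axioms.intro) (auto simp: frames_det)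

section \<open>Homomorphisms between line bundles\<close>

locale line_bundle_pair = E: smooth_line_bundle M E + F: smooth_line_bundle M F
  for M :: "('p::{t2_space, second_countable_topology}, 'd::finite) atlas"
    and E :: "('p, 'e::real_vector, 'y) vbundle_scheme" and F :: "('p, 'f::real_vector, 'z) vbundle_scheme"
begin

definition hom_frame :: "('p \<Rightarrow> 'e) list \<Rightarrow> ('p \<Rightarrow> 'f) list \<Rightarrow> 'p \<Rightarrow> 'e \<Rightarrow> 'f"
  where "hom_frame es fs x v = coframe es 0 x v *\<^sub>R (fs ! 0) x"

lemma frames_hom:
  "(W, hs) \<in> frames (hom_bundle E F) \<longleftrightarrow>
    (\<exists>U V es fs. (U, es) \<in> frames E \<and> (V, fs) \<in> frames F \<and> W = U \<inter> V \<and> hs = [hom_frame es fs])"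
proof -
  let ?Q = "\<lambda>es fs. [\<lambda>x v. representation (set (map (\<lambda>e'. e' x) es)) v (e x) *\<^sub>R f x. e \<leftarrow> es, f \<leftarrow> fs]"
  have key: "?Q es fs = [hom_frame es fs]" if UV: "(U, es) \<in> frames E" "(V, fs) \<in> frames F" for U V es fs
  proof -
    have l: "length es = 1" "length fs = 1" using E.frame_length F.frame_length UV by blast+
    obtain e f where "es = [e]" "fs = [f]" using l by (auto simp: length_Suc_conv)
    then show ?thesis by (simp add: hom_frame_def coframe_def coord_def fun_eq_iff)
  qed
  have "(W, hs) \<in> frames (hom_bundle E F) \<longleftrightarrow>
      (\<exists>U V es fs. (W, hs) = (U \<inter> V, ?Q es fs) \<and> (U, es) \<in> frames E \<and> (V, fs) \<in> frames F)"
    unfolding hom_bundle_def vbundle.select_convs mem_Collect_eq ..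
  also have "\<dots> \<longleftrightarrow> (\<exists>U V es fs. (W, hs) = (U \<inter> V, [hom_frame es fs]) \<and> (U, es) \<in> frames E \<and> (V, fs) \<in> frames F)"
    proof (intro ex_cong1)
    fix U V es fs
    show "(W, hs) = (U \<inter> V, ?Q es fs) \<and> (U, es) \<in> frames E \<and> (V, fs) \<in> frames F \<longleftrightarrow>
        (W, hs) = (U \<inter> V, [hom_frame es fs]) \<and> (U, es) \<in> frames E \<and> (V, fs) \<in> frames F"
    proof (cases "(U, es) \<in> frames E \<and> (V, fs) \<in> frames F")
      case True
      show ?thesis by (simp only: key[OF conjunct1[OF True] conjunct2[OF True]])
    qed blast
  qed
  finally show ?thesis by blast
qed

lemma fibre_hom: "fibre (hom_bundle E F) x = hom_fibre (fibre E x) (fibre F x)"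
  by (simp add: hom_bundle_def)

lemma hom_frame_in_fibre:
  assumes U: "(U, es) \<in> frames E" "x \<in> U" and V: "(V, fs) \<in> frames F" "x \<in> V"
  shows "hom_frame es fs x \<in> hom_fibre (fibre E x) (fibre F x)"
proof -
  have c: "coframe es 0 x \<in> dual_fibre (fibre E x)" by (rule E.coframe_dual[OF U])
  have f: "(fs ! 0) x \<in> fibre F x" by (rule F.frame_fibre[OF V]) (simp add: F.frame_length[OF V(1)])
  show ?thesis
    using hom_fibre_outside[OF c] hom_fibre_lin[OF c] subspace_scale[OF F.fibre_subspace f]
    by (simp add: hom_fibre_def hom_frame_def scaleR_add_left)
qed

lemma hom_expand:
  assumes U: "(U, es) \<in> frames E" "x \<in> U" and V: "(V, fs) \<in> frames F" "x \<in> V"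
    and l: "l \<in> hom_fibre (fibre E x) (fibre F x)"
  shows "l = coframe fs 0 x (l ((es ! 0) x)) *\<^sub>R hom_frame es fs x"
proof
  fix v
  have e: "(es ! 0) x \<in> fibre E x" by (rule E.frame_fibre[OF U]) (simp add: E.frame_length[OF U(1)])
  show "l v = (coframe fs 0 x (l ((es ! 0) x)) *\<^sub>R hom_frame es fs x) v"
  proof (cases "v \<in> fibre E x")
    case True
    have "l v = l (coframe es 0 x v *\<^sub>R (es ! 0) x)" using E.line_expand[OF U True] by simp
    also have "\<dots> = coframe es 0 x v *\<^sub>R l ((es ! 0) x)" by (rule hom_fibre_scale[OF l e])
    also have "l ((es ! 0) x) = coframe fs 0 x (l ((es ! 0) x)) *\<^sub>R (fs ! 0) x"
      by (rule F.line_expand[OF V hom_fibre_in[OF l e]])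
    finally show ?thesis by (simp add: scaleR_fun_def hom_frame_def mult.commute)
  next
    case False
    then show ?thesis
      using hom_fibre_outside[OF l False] hom_fibre_outside[OF E.coframe_dual[OF U] False]
      by (simp add: scaleR_fun_def hom_frame_def)
  qed
qed

lemma hom_frame_nth:
  assumes U: "(U, es) \<in> frames E" "x \<in> U"
  shows "hom_frame es fs x ((es ! 0) x) = (fs ! 0) x"
  using E.coframe_nth[OF U, of 0 0] E.frame_length[OF U(1)] by (simp add: hom_frame_def)

lemma vector_bundle_hom: "vector_bundle M (hom_bundle E F)"
  unfolding vector_bundle_def
proof (intro conjI ballI; clarify?)
  have "\<exists>W hs. (W, hs) \<in> frames (hom_bundle E F) \<and> x \<in> W" for x
  proof -
    obtain U es where "(U, es) \<in> frames E" "x \<in> U" by (rule E.frame_exists)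
    moreover obtain V fs where "(V, fs) \<in> frames F" "x \<in> V" by (rule F.frame_exists)
    ultimately show ?thesis unfolding frames_hom by blast
  qed
  then show "(\<Union>(U, es)\<in>frames (hom_bundle E F). U) = UNIV" by fastforce
  fix W hs assume "(W, hs) \<in> frames (hom_bundle E F)"
  then obtain U V es fs where U: "(U, es) \<in> frames E" and V: "(V, fs) \<in> frames F" and W: "W = U \<inter> V" "hs = [hom_frame es fs]"
    unfolding frames_hom by blast
  have o: "open W" using E.frame_open[OF U] F.frame_open[OF V] W by blast
  have "basis_of [hom_frame es fs x] (fibre (hom_bundle E F) x)" if x: "x \<in> W" for x
    unfolding fibre_hom
  proof (rule E.basis_of_singleton)
    have xUV: "x \<in> U" "x \<in> V" using x W by auto
    have "(fs ! 0) x \<noteq> 0"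
      using F.coframe_nth[OF V xUV(2), of 0 0] F.frame_length[OF V] hom_fibre_zero[OF F.coframe_dual[OF V xUV(2)] F.fibre_subspace]
      by auto
    then show "hom_frame es fs x \<noteq> 0" using hom_frame_nth[OF U xUV(1), of fs] by auto
    show "hom_frame es fs x \<in> hom_fibre (fibre E x) (fibre F x)" by (rule hom_frame_in_fibre[OF U xUV(1) V xUV(2)])
    show "subspace (hom_fibre (fibre E x) (fibre F x))" by (rule subspace_hom_fibre[OF F.fibre_subspace])
    show "\<exists>c. l = c *\<^sub>R hom_frame es fs x" if "l \<in> hom_fibre (fibre E x) (fibre F x)" for l
      using hom_expand[OF U xUV(1) V xUV(2) that] by blast
  qed
  moreover have "hom_frame es fs \<in> sections M (hom_bundle E F) W"
    unfolding sections_def fibre_hom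
  proof (intro CollectI conjI ballI; clarify?)
    show "hom_frame es fs x \<in> hom_fibre (fibre E x) (fibre F x)" if "x \<in> W" for x
      using that W hom_frame_in_fibre[OF U _ V] by blast
    fix W' hs' assume "(W', hs') \<in> frames (hom_bundle E F)"
    then obtain U' V' es' fs' where U': "(U', es') \<in> frames E" and V': "(V', fs') \<in> frames F"
      and W': "W' = U' \<inter> V'" "hs' = [hom_frame es' fs']"
      unfolding frames_hom by blast
    have o': "open (W \<inter> W')" using o E.frame_open[OF U'] F.frame_open[OF V'] W' by blast
    \<comment> \<open>Transition function of Hom: contravariant in \<open>E\<close> (old coframe on
      the new frame vector), covariant in \<open>F\<close> (new coframe on the old frame
      vector).\<close>
    let ?c = "\<lambda>x. coframe es 0 x ((es' ! 0) x) * coframe fs' 0 x ((fs ! 0) x)"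
    have "smooth_fun M (W \<inter> W') ?c"
    proof (intro E.smooth_fun_mult[OF o'])
      show "smooth_fun M (W \<inter> W') (\<lambda>x. coframe es 0 x ((es' ! 0) x))"
        by (rule E.smooth_fun_subset[OF E.sections_coframe[OF E.frame_open[OF U'] E.frame_section[OF U'] U]])
          (use W W' E.frame_length[OF U] E.frame_length[OF U'] in auto)
      show "smooth_fun M (W \<inter> W') (\<lambda>x. coframe fs' 0 x ((fs ! 0) x))"
        by (rule E.smooth_fun_subset[OF F.sections_coframe[OF F.frame_open[OF V] F.frame_section[OF V] V']])
          (use W W' F.frame_length[OF V] F.frame_length[OF V'] in auto)
    qed
    moreover have "hom_frame es fs x = ?c x *\<^sub>R hom_frame es' fs' x" if x: "x \<in> W \<inter> W'" for x
    proof -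
      have xx: "x \<in> U" "x \<in> V" "x \<in> U'" "x \<in> V'" using x W W' by auto
      have f: "(fs ! 0) x \<in> fibre F x" by (rule F.frame_fibre[OF V xx(2)]) (simp add: F.frame_length[OF V])
      have "coframe fs' 0 x (coframe es 0 x ((es' ! 0) x) *\<^sub>R (fs ! 0) x) = coframe es 0 x ((es' ! 0) x) *\<^sub>R coframe fs' 0 x ((fs ! 0) x)"
        by (rule hom_fibre_scale[OF F.coframe_dual[OF V' xx(4)] f])
      then show ?thesis
        using hom_expand[OF U' xx(3) V' xx(4) hom_frame_in_fibre[OF U xx(1) V xx(2)]] by (simp add: hom_frame_def[of es])
    qed
    ultimately show "\<exists>c. (\<forall>i<length hs'. smooth_fun M (W \<inter> W') (c i)) \<and>
        (\<forall>x\<in>W \<inter> W'. hom_frame es fs x = (\<Sum>i<length hs'. c i x *\<^sub>R (hs' ! i) x))"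
      unfolding W' by (intro exI[of _ "\<lambda>_. ?c"]) auto
  qed
  ultimately show "open W \<and> (\<forall>x\<in>W. basis_of (map (\<lambda>e. e x) hs) (fibre (hom_bundle E F) x)) \<and> set hs \<subseteq> sections M (hom_bundle E F) W"
    using o by (simp add: W(2))
qed

lemma line_bundle_hom: "smooth_line_bundle M (hom_bundle E F)"
  by (intro smooth_line_bundle.intro smooth_bundle.intro E.manifold_axioms smooth_bundle_axioms.intro vector_bundle_hom
      smooth_line_bundle_axioms.intro) (auto simp: frames_hom)

lemma hom_coframe:
  assumes U: "(U, es) \<in> frames E" "x \<in> U" and V: "(V, fs) \<in> frames F" "x \<in> V"
    and l: "l \<in> hom_fibre (fibre E x) (fibre F x)"
  shows "coframe [hom_frame es fs] 0 x l = coframe fs 0 x (l ((es ! 0) x))"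
proof -
  interpret h: smooth_line_bundle M "hom_bundle E F" by (rule line_bundle_hom)
  have W: "(U \<inter> V, [hom_frame es fs]) \<in> frames (hom_bundle E F)" "x \<in> U \<inter> V" using U V unfolding frames_hom by blast+
  have "coframe [hom_frame es fs] 0 x (coframe fs 0 x (l ((es ! 0) x)) *\<^sub>R hom_frame es fs x)
      = coframe fs 0 x (l ((es ! 0) x)) *\<^sub>R coframe [hom_frame es fs] 0 x (hom_frame es fs x)"
    by (rule hom_fibre_scale[OF h.coframe_dual[OF W]]) (simp only: fibre_hom hom_frame_in_fibre[OF U V])
  then show ?thesis using hom_expand[OF U V l] h.coframe_nth[OF W, of 0 0] by simp
qed

end

section \<open>Vector fields preserving the divisor ideal of a Poisson structure\<close>

locale poisson_divisor = tangent_manifold M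
  for M :: "('p::{t2_space, second_countable_topology}, 'd::finite) atlas" +
  fixes n :: nat and I :: "('p \<Rightarrow> real) set"
    and \<pi> :: "'p \<Rightarrow> ((('p \<Rightarrow> real) \<Rightarrow> real) \<Rightarrow> real) list \<Rightarrow> real"
  assumes card_dim: "CARD('d) = 2 * n"
    and poisson: "poisson M (tangent_algebroid M) \<pi>"
    and of_divisor_type: "of_divisor_type M n I \<pi>"
begin

abbreviation "TM \<equiv> tangent_bundle M"

sublocale L: smooth_line_bundle M "det_bundle (tangent_bundle M)"
  by (rule T.line_bundle_det)

definition pi_top :: "'p \<Rightarrow> ((('p \<Rightarrow> real) \<Rightarrow> real) \<Rightarrow> real) list \<Rightarrow> real"
  where "pi_top = bivector_power n TM \<pi>"

text \<open>Removing the closure of the zero set makes openness immediate, and density is then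
  literally the nowhere-density condition in \<open>divisor\<close>.\<close>

definition D :: "'p set"
  where "D = - closure {x. pi_top x = 0}"

text \<open>The local generator f of the overview. Explicitly it is n! times the Pfaffian of the
  coordinate matrix of \<pi>.\<close>

definition pf :: "('p \<Rightarrow> ('p \<Rightarrow> real) \<Rightarrow> real) list \<Rightarrow> 'p \<Rightarrow> real"
  where "pf es x = pi_top x (map (\<lambda>i. coframe es i x) [0..<2 * n])"

lemma pi_section: "\<pi> \<in> sections M (ext_power 2 TM) UNIV"
  using poisson by (simp add: poisson_def ext_power_tangent_algebroid)

lemma pi_fibre: "\<pi> x \<in> ext_fibre 2 (tangent_space M x)"
  using T.bivector_fibre[OF pi_section] by (simp add: fibre_tangent)

lemma pi_top_fibre: "pi_top x \<in> ext_fibre (2 * n) (tangent_space M x)"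
  using bivector_power_in_ext_fibre[of \<pi> x TM n] pi_fibre by (simp add: pi_top_def fibre_tangent)

lemma pi_top_section: "pi_top \<in> sections M (det_bundle TM) UNIV"
  using of_divisor_type by (simp add: of_divisor_type_def divisor_def pi_top_def)

lemma I_divisor_ideal: "I = divisor_ideal M (det_bundle TM) pi_top"
  using of_divisor_type by (simp add: of_divisor_type_def pi_top_def)

lemma open_D: "open D"
  by (simp add: D_def open_Compl)

lemma dense_D: "closure D = UNIV"
  using of_divisor_type
  by (simp add: D_def of_divisor_type_def divisor_def pi_top_def closure_complement)

lemma D_pi_top: "x \<in> D \<Longrightarrow> pi_top x \<noteq> 0"
  unfolding D_def using closure_subset[of "{x. pi_top x = 0}"] by blast

lemma D_meets: "open W \<Longrightarrow> x \<in> W \<Longrightarrow> W \<inter> D \<noteq> {}"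
  using open_Int_closure_eq_empty[of W D] dense_D by auto

lemma tangent_rank: "(U, es) \<in> frames TM \<Longrightarrow> length es = 2 * n"
  using tangent_frame_coords card_dim by metis

lemma frame_tangent: "(U, es) \<in> frames TM \<Longrightarrow> i < length es \<Longrightarrow> y \<in> U \<Longrightarrow> (es ! i) y \<in> tangent_space M y"
  using T.frame_fibre by (fastforce simp: fibre_tangent)

lemma pi_top_pf:
  assumes "(U, es) \<in> frames TM" "x \<in> U"
  shows "pi_top x = pf es x *\<^sub>R wedge TM es x"
  using ext_top_eq_wedge[OF T.frame_basis[OF assms], of "pi_top x"] pi_top_fibre[of x] tangent_rank[OF assms(1)]
  by (simp add: pf_def fibre_tangent coframe_def)

lemma pf_nonzero: "(U, es) \<in> frames TM \<Longrightarrow> x \<in> U \<Longrightarrow> x \<in> D \<Longrightarrow> pf es x \<noteq> 0"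
  using pi_top_pf D_pi_top by fastforce

lemma pi_restrict: "\<pi> \<in> sections M (ext_power 2 TM) W"
  using T.bivector_restrict[OF pi_section] by simp

lemma coframe_section:
  assumes "(U, es) \<in> frames TM" "i < length es" "open W" "W \<subseteq> U"
  shows "coframe es i \<in> sections M (dual_bundle TM) W"
  using smooth_bundle.sections_subset[OF T.bundle_dual T.coframe_dual_section[OF assms(1,2)] T.frame_open[OF assms(1)] assms(3,4)] .

lemma smooth_pf:
  assumes U: "(U, es) \<in> frames TM"
  shows "smooth_fun M U (pf es)"
proof -
  have "smooth_fun M U (\<lambda>x. bivector_power n TM \<pi> x (map (\<lambda>\<alpha>. \<alpha> x) (map (coframe es) [0..<2 * n])))"
    by (rule T.smooth_bivector_power[OF T.frame_open[OF U] pi_restrict])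
      (use T.coframe_dual_section[OF U] tangent_rank[OF U] in auto)
  then show ?thesis by (simp add: pf_def[abs_def] pi_top_def o_def)
qed

lemma det_frame: "(U, es) \<in> frames TM \<Longrightarrow> (U, [wedge TM es]) \<in> frames (det_bundle TM)"
  by (auto simp: T.frames_det)

lemma pf_coframe:
  assumes "(U, es) \<in> frames TM" "y \<in> U"
  shows "coframe [wedge TM es] 0 y (pi_top y) = pf es y"
  using T.det_coframe[OF assms L.sections_fibre[OF pi_top_section UNIV_I]] tangent_rank[OF assms(1)] by (simp add: pf_def)

lemma I_local:
  assumes U: "(U, es) \<in> frames TM" and g: "g \<in> I"
  obtains k where "smooth_fun M U k" "\<And>y. y \<in> U \<Longrightarrow> g y = k y * pf es y"
  using L.divisor_ideal_local[OF pi_top_section det_frame[OF U] g[unfolded I_divisor_ideal]] pf_coframe[OF U] by metis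

lemma I_generate:
  assumes U: "(U, es) \<in> frames TM" and W: "open W" "x \<in> W" "W \<subseteq> U" and k: "smooth_fun M W k"
  obtains g W' where "g \<in> I" "open W'" "x \<in> W'" "W' \<subseteq> W" "\<And>y. y \<in> W' \<Longrightarrow> g y = k y * pf es y"
proof -
  obtain g W' where g: "g \<in> I" "open W'" "x \<in> W'" "W' \<subseteq> W"
    "\<And>y. y \<in> W' \<Longrightarrow> g y = k y * coframe [wedge TM es] 0 y (pi_top y)"
    unfolding I_divisor_ideal by (rule L.divisor_ideal_generate[OF pi_top_section det_frame[OF U] W k]) blast
  have "g y = k y * pf es y" if "y \<in> W'" for y using g(5)[OF that] pf_coframe[OF U, of y] that g(4) W(3) by auto
  then show thesis using that g by blast
qed

text \<open>It is enough that \<open>V\<close> preserves the generator: if V f = k f, then V(h f) =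
  (V h + h k) f for every multiple h f.\<close>

lemma ideal_fieldI:
  assumes W: "open W" and V: "V \<in> sections M TM W"
    and loc: "\<And>x. x \<in> W \<Longrightarrow> \<exists>U es W' k. (U, es) \<in> frames TM \<and> open W' \<and> x \<in> W' \<and> W' \<subseteq> W \<inter> U \<and>
      smooth_fun M W' k \<and> (\<forall>y\<in>W'. V y (pf es) = k y * pf es y)"
  shows "V \<in> ideal_vector_fields M I W"
  unfolding ideal_vector_fields_def
proof (intro CollectI conjI V allI impI; elim conjE)
  fix W0 f assume W0: "open W0" "W0 \<subseteq> W" and f: "f \<in> ideal_sheaf M I W0"
  have fs: "smooth_fun M W0 f" using f by (simp add: ideal_sheaf_def)
  show "(\<lambda>x. V x f) \<in> ideal_sheaf M I W0"
    unfolding ideal_sheaf_def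
  proof (intro CollectI conjI ballI)
    show "smooth_fun M W0 (\<lambda>x. V x f)"
      by (rule smooth_vector_field[OF W0(1) T.sections_subset[OF V W W0] fs])
    fix x assume x: "x \<in> W0"
    obtain W1 g where g: "open W1" "x \<in> W1" "g \<in> I" "\<forall>y\<in>W1. f y = g y"
      using f x unfolding ideal_sheaf_def by blast
    obtain U es W2 k where U: "(U, es) \<in> frames TM" and W2: "open W2" "x \<in> W2" "W2 \<subseteq> W \<inter> U"
      and k: "smooth_fun M W2 k" "\<forall>y\<in>W2. V y (pf es) = k y * pf es y" using loc x W0 by blast
    obtain h where h: "smooth_fun M U h" "\<And>y. y \<in> U \<Longrightarrow> g y = h y * pf es y" by (rule I_local[OF U g(3)]) blast
    define W3 where "W3 = W0 \<inter> W1 \<inter> W2"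
    have W3: "open W3" "x \<in> W3" "W3 \<subseteq> U" "W3 \<subseteq> W" using W0 W2 g x by (auto simp: W3_def)
    have V3: "V \<in> sections M TM W3" by (rule T.sections_subset[OF V W W3(1,4)])
    have h3: "smooth_fun M W3 h" "smooth_fun M W3 (pf es)"
      using h(1) smooth_pf[OF U] W3(3) smooth_fun_subset by blast+
    have k3: "smooth_fun M W3 k" by (rule smooth_fun_subset[OF k(1)]) (auto simp: W3_def)
    have "smooth_fun M W3 (\<lambda>y. V y h + h y * k y)"
      by (intro smooth_fun_add smooth_fun_mult W3(1) smooth_vector_field[OF W3(1) V3 h3(1)] h3 k3)
    then obtain g' W' where g': "g' \<in> I" "open W'" "x \<in> W'" "W' \<subseteq> W3"
      "\<And>y. y \<in> W' \<Longrightarrow> g' y = (V y h + h y * k y) * pf es y"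
      by (rule I_generate[OF U W3(1,2,3)]) blast
    have "V y f = g' y" if y: "y \<in> W'" for y
    proof -
      have y3: "y \<in> W3" using y g' by blast
      note s = smooth_nearI[OF W3(1) h3(1) y3] smooth_nearI[OF W3(1) h3(2) y3]
      note t = field_tangent[OF V3 y3]
      have "V y (\<lambda>z. h z * pf es z) = V y f"
        by (rule tangent_cong[OF t smooth_near_mult[OF s] W3(1) y3]) (use g(4) h(2) W3(3) in \<open>auto simp: W3_def\<close>)
      then show ?thesis
        using tangent_mult[OF t s] k(2) g'(5)[OF y] y3 by (auto simp: W3_def algebra_simps)
    qed
    then show "\<exists>W g. open W \<and> x \<in> W \<and> g \<in> I \<and> (\<forall>y\<in>W. V y f = g y)" using g' by blast
  qed
qed

lemma ideal_field_section: "V \<in> ideal_vector_fields M I W \<Longrightarrow> V \<in> sections M TM W"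
  by (simp add: ideal_vector_fields_def)

text \<open>Over \<open>D\<close> the generator is invertible, so k = V f / f serves for any field:
  the ideal imposes no condition there. This is what makes the anchor invertible over
  \<open>D\<close>.\<close>

lemma ideal_field_D:
  assumes W: "open W" "W \<subseteq> D" and V: "V \<in> sections M TM W"
  shows "V \<in> ideal_vector_fields M I W"
proof (rule ideal_fieldI[OF W(1) V])
  fix x assume x: "x \<in> W"
  obtain U es where U: "(U, es) \<in> frames TM" "x \<in> U" by (rule T.frame_exists)
  have o: "open (W \<inter> U)" using W T.frame_open[OF U(1)] by blast
  have p: "smooth_fun M (W \<inter> U) (pf es)" by (rule smooth_fun_subset[OF smooth_pf[OF U(1)]]) simp
  have nz: "pf es y \<noteq> 0" if "y \<in> W \<inter> U" for y using pf_nonzero[OF U(1)] that W(2) by blast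
  have "smooth_fun M (W \<inter> U) (\<lambda>y. V y (pf es) / pf es y)"
    by (rule smooth_fun_divide[OF o smooth_vector_field[OF o T.sections_subset[OF V W(1) o] p] p nz]) simp
  then show "\<exists>U es W' k. (U, es) \<in> frames TM \<and> open W' \<and> x \<in> W' \<and> W' \<subseteq> W \<inter> U \<and>
      smooth_fun M W' k \<and> (\<forall>y\<in>W'. V y (pf es) = k y * pf es y)"
    using U o x nz by (intro exI[of _ U] exI[of _ es] exI[of _ "W \<inter> U"] exI[of _ "\<lambda>y. V y (pf es) / pf es y"]) auto
qed

section \<open>The coordinate matrix of \<pi> and the fields preserving it\<close>

definition comp :: "('p \<Rightarrow> ('p \<Rightarrow> real) \<Rightarrow> real) list \<Rightarrow> nat \<Rightarrow> nat \<Rightarrow> 'p \<Rightarrow> real"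
  where "comp es i j y = \<pi> y [coframe es i y, coframe es j y]"

lemma smooth_comp:
  assumes "(U, es) \<in> frames TM" "i < length es" "j < length es"
  shows "smooth_fun M U (comp es i j)"
  unfolding comp_def[abs_def]
  by (rule T.smooth_bivector[OF T.frame_open[OF assms(1)] pi_restrict T.coframe_dual_section[OF assms(1,2)] T.coframe_dual_section[OF assms(1,3)]])

lemma comp_skew: "comp es i j y = - comp es j i y"
  unfolding comp_def by (rule ext2_skew[OF pi_fibre])

text \<open>Evaluating the Jacobi identity on a closed one-form \<open>\<theta>\<close> and two coordinate differentials gives
  \<open>\<L>\<^sub>V \<pi> = 0\<close> for \<open>V = \<pi>\<^sup>\<sharp> \<theta>\<close>, in coordinates.\<close>

lemma hamiltonian_preserves_pi:
  assumes U: "(U, es) \<in> frames TM" and W: "open W" "W \<subseteq> U"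
    and th: "\<And>k. k < length es \<Longrightarrow> smooth_fun M W (\<theta> k)"
    and cl: "\<And>y i j. y \<in> W \<Longrightarrow> i < length es \<Longrightarrow> j < length es \<Longrightarrow> (es ! i) y (\<theta> j) = (es ! j) y (\<theta> i)"
    and x: "x \<in> W" and ij: "i < length es" "j < length es"
    and V: "\<And>m y. V m y = (\<Sum>k<length es. \<theta> k y * comp es k m y)"
  shows "(\<Sum>k<length es. V k x * (es ! k) x (comp es i j))
    = (\<Sum>k<length es. comp es i k x * (es ! k) x (V j) + comp es k j x * (es ! k) x (V i))"
proof -
  interpret Td: smooth_bundle M "dual_bundle TM" by (rule T.bundle_dual)
  let ?\<Theta> = "\<lambda>y. \<Sum>k<length es. \<theta> k y *\<^sub>R coframe es k y"
  have cs: "coframe es k \<in> sections M (dual_bundle TM) W" if "k < length es" for k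
    by (rule coframe_section[OF U that W])
  have "?\<Theta> \<in> sections M (dual_bundle TM) W"
    by (intro Td.sections_sum Td.sections_scale W(1)) (use th cs in auto)
  then obtain \<Theta> W1 where \<Theta>: "\<Theta> \<in> sections M (dual_bundle TM) UNIV" "open W1" "x \<in> W1" "W1 \<subseteq> W"
    "\<And>y. y \<in> W1 \<Longrightarrow> \<Theta> y = ?\<Theta> y" by (rule Td.section_extension[OF W(1) x]) blast
  obtain \<alpha> W2 where \<alpha>: "\<alpha> \<in> sections M (dual_bundle TM) UNIV" "open W2" "x \<in> W2" "W2 \<subseteq> W"
    "\<And>y. y \<in> W2 \<Longrightarrow> \<alpha> y = coframe es i y" by (rule Td.section_extension[OF W(1) x cs[OF ij(1)]]) blast
  obtain \<beta> W3 where \<beta>: "\<beta> \<in> sections M (dual_bundle TM) UNIV" "open W3" "x \<in> W3" "W3 \<subseteq> W"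
    "\<And>y. y \<in> W3 \<Longrightarrow> \<beta> y = coframe es j y" by (rule Td.section_extension[OF W(1) x cs[OF ij(2)]]) blast
  define W0 where "W0 = W1 \<inter> W2 \<inter> W3"
  have W0: "open W0" "x \<in> W0" "W0 \<subseteq> W" "W0 \<subseteq> U" using \<Theta> \<alpha> \<beta> W by (auto simp: W0_def)
  have xU: "x \<in> U" using W0 by blast
  have cd: "coframe es k y \<in> dual_fibre (tangent_space M y)" if "y \<in> U" for k y
    using T.coframe_dual[OF U that] by (simp add: fibre_tangent)
  have sharp_sec: "(\<lambda>y. sharp TM \<pi> y (\<xi> y)) \<in> sections M TM W0" if "\<xi> \<in> sections M (dual_bundle TM) UNIV" for \<xi>
    by (rule T.sections_subset[OF T.sharp_section[OF open_UNIV pi_section that] open_UNIV W0(1)]) simp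
  \<comment> \<open>The forms entered into the Jacobi identity are closed near x, so its terms with
    \<open>algebroid_d\<close> drop out and only derivatives of values of \<pi> remain. \<Theta>,
    \<alpha> and \<beta> are global extensions of \<theta> and of two coordinate differentials, as
    the Poisson condition requires.\<close>
  have closed: "algebroid_d (tangent_algebroid M) \<xi> (\<lambda>y. sharp TM \<pi> y (\<mu> y)) (\<lambda>y. sharp TM \<pi> y (\<nu> y)) x = 0"
    if "\<mu> \<in> sections M (dual_bundle TM) UNIV" "\<nu> \<in> sections M (dual_bundle TM) UNIV"
      and "\<And>k. k < length es \<Longrightarrow> smooth_fun M W0 (t k)" "\<And>y. y \<in> W0 \<Longrightarrow> \<xi> y = (\<Sum>k<length es. t k y *\<^sub>R coframe es k y)"
      "\<And>i j. i < length es \<Longrightarrow> j < length es \<Longrightarrow> (es ! i) x (t j) = (es ! j) x (t i)" for \<xi> \<mu> \<nu> t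
    by (rule closed_form_d_zero[OF U W0(1,2,4) that(3-5) sharp_sec[OF that(1)] sharp_sec[OF that(2)]])
  have d\<Theta>: "algebroid_d (tangent_algebroid M) \<Theta> (\<lambda>y. sharp TM \<pi> y (\<mu> y)) (\<lambda>y. sharp TM \<pi> y (\<nu> y)) x = 0"
    if "\<mu> \<in> sections M (dual_bundle TM) UNIV" "\<nu> \<in> sections M (dual_bundle TM) UNIV" for \<mu> \<nu>
    by (rule closed[OF that, of \<theta>]) (use th cl x \<Theta>(5) W0 in \<open>auto simp: W0_def intro: smooth_fun_subset\<close>)
  have dx: "algebroid_d (tangent_algebroid M) \<xi> (\<lambda>y. sharp TM \<pi> y (\<mu> y)) (\<lambda>y. sharp TM \<pi> y (\<nu> y)) x = 0"
    if "\<mu> \<in> sections M (dual_bundle TM) UNIV" "\<nu> \<in> sections M (dual_bundle TM) UNIV"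
      and m: "m < length es" and "\<And>y. y \<in> W0 \<Longrightarrow> \<xi> y = coframe es m y" for \<mu> \<nu> \<xi> m
  proof (rule closed[OF that(1,2), of "\<lambda>k y. if k = m then 1 else 0"])
    show "smooth_fun M W0 (\<lambda>y. if k = m then 1 else 0)" for k by (rule smooth_fun_const[OF W0(1)])
    show "\<xi> y = (\<Sum>k<length es. (if k = m then 1 else 0) *\<^sub>R coframe es k y)" if "y \<in> W0" for y
    proof -
      have "(\<Sum>k<length es. (if k = m then 1 else 0) *\<^sub>R coframe es k y) = (\<Sum>k<length es. if k = m then coframe es m y else 0)"
        by (rule sum.cong) auto
      then show ?thesis using \<open>m < length es\<close> that(1) \<open>\<And>y. y \<in> W0 \<Longrightarrow> \<xi> y = coframe es m y\<close> by simp
    qed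
    show "(es ! i) x (\<lambda>y. if j = m then 1 else 0) = (es ! j) x (\<lambda>y. if i = m then 1 else 0)"
      if "i < length es" "j < length es" for i j
      using tangent_const[OF frame_tangent[OF U that(1) xU]] tangent_const[OF frame_tangent[OF U that(2) xU]] by simp
  qed
  have sh: "sharp TM \<pi> x \<xi> \<in> tangent_space M x" "sharp TM \<pi> x \<xi> f = (\<Sum>k<length es. \<pi> x [\<xi>, coframe es k x] * (es ! k) x f)"
    if "\<xi> \<in> dual_fibre (tangent_space M x)" for \<xi> f
  proof -
    have d: "\<xi> \<in> dual_fibre (fibre TM x)" "\<pi> x \<in> ext_fibre 2 (fibre TM x)" using that pi_fibre by (simp_all add: fibre_tangent)
    show t: "sharp TM \<pi> x \<xi> \<in> tangent_space M x" using T.sharp_fibre[where P=\<pi> and x=x, OF d(2,1)] by (simp add: fibre_tangent)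
    show "sharp TM \<pi> x \<xi> f = (\<Sum>k<length es. \<pi> x [\<xi>, coframe es k x] * (es ! k) x f)"
      unfolding vector_field_expand[OF U xU t, of f]
      by (rule sum.cong) (use T.sharp_pairing[where P=\<pi> and x=x, OF d(2,1) T.coframe_dual[OF U xU]] in auto)
  qed
  have fib: "\<xi> y \<in> dual_fibre (tangent_space M y)" if "\<xi> \<in> sections M (dual_bundle TM) UNIV" for \<xi> y
    using T.dual_section_fibre[OF that] by (simp add: fibre_tangent)
  have half: "schouten_half (tangent_algebroid M) \<pi> \<pi> \<xi> \<mu> \<nu> x = (\<Sum>k<length es. \<pi> x [\<xi> x, coframe es k x] * (es ! k) x (\<lambda>y. \<pi> y [\<mu> y, \<nu> y]))"
    if "\<xi> \<in> sections M (dual_bundle TM) UNIV"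
      "algebroid_d (tangent_algebroid M) \<xi> (\<lambda>y. sharp TM \<pi> y (\<mu> y)) (\<lambda>y. sharp TM \<pi> y (\<nu> y)) x = 0" for \<xi> \<mu> \<nu>
    using that sh[OF fib[OF that(1)]] by (simp add: schouten_half_def sharp_tangent_algebroid anchor_tangent_algebroid)
  have "schouten (tangent_algebroid M) \<pi> \<pi> \<Theta> \<alpha> \<beta> x = 0"
    using poisson \<Theta>(1) \<alpha>(1) \<beta>(1) by (simp add: poisson_def dual_tangent_algebroid)
  \<comment> \<open>For equal bivectors the six halves of \<open>schouten\<close> coincide in pairs,
    so the cyclic sum of three already vanishes.\<close>
  then have "schouten_half (tangent_algebroid M) \<pi> \<pi> \<Theta> \<alpha> \<beta> x + schouten_half (tangent_algebroid M) \<pi> \<pi> \<alpha> \<beta> \<Theta> x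
      + schouten_half (tangent_algebroid M) \<pi> \<pi> \<beta> \<Theta> \<alpha> x = 0"
    by (simp add: schouten_def)
  moreover have "schouten_half (tangent_algebroid M) \<pi> \<pi> \<Theta> \<alpha> \<beta> x
      = (\<Sum>k<length es. \<pi> x [\<Theta> x, coframe es k x] * (es ! k) x (\<lambda>y. \<pi> y [\<alpha> y, \<beta> y]))"
    by (rule half[OF \<Theta>(1) d\<Theta>[OF \<alpha>(1) \<beta>(1)]])
  moreover have "schouten_half (tangent_algebroid M) \<pi> \<pi> \<alpha> \<beta> \<Theta> x
      = (\<Sum>k<length es. \<pi> x [\<alpha> x, coframe es k x] * (es ! k) x (\<lambda>y. \<pi> y [\<beta> y, \<Theta> y]))"
    by (rule half[OF \<alpha>(1) dx[OF \<beta>(1) \<Theta>(1) ij(1)]]) (use \<alpha>(5) in \<open>auto simp: W0_def\<close>)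
  moreover have "schouten_half (tangent_algebroid M) \<pi> \<pi> \<beta> \<Theta> \<alpha> x
      = (\<Sum>k<length es. \<pi> x [\<beta> x, coframe es k x] * (es ! k) x (\<lambda>y. \<pi> y [\<Theta> y, \<alpha> y]))"
    by (rule half[OF \<beta>(1) dx[OF \<Theta>(1) \<alpha>(1) ij(2)]]) (use \<beta>(5) in \<open>auto simp: W0_def\<close>)
  \<comment> \<open>\<open>V m\<close> is the m-th component of the sharp of \<Theta>. From here on
    only these components are differentiated, so \<theta> disappears from the resulting
    identity.\<close>
  moreover have \<Theta>c: "\<pi> y [\<Theta> y, coframe es m y] = V m y" if "y \<in> W0" for m y
    using ext2_sum(1)[where J="{..<length es}" and c="\<lambda>k. \<theta> k y", OF pi_fibre[of y] cd cd[of y m]] that W0(4) \<Theta>(5)[of y]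
    by (auto simp: W0_def V comp_def)
  have sV: "smooth_near M x (V m)" if "m < length es" for m
  proof (rule smooth_nearI[OF W(1) _ x])
    show "smooth_fun M W (V m)"
      unfolding V using smooth_fun_subset[OF smooth_comp[OF U _ that] W(2)] th
      by (intro smooth_fun_sum smooth_fun_mult W(1)) auto
  qed
  have sc: "smooth_near M x (comp es i j)"
    using smooth_nearI[OF T.frame_open[OF U] smooth_comp[OF U ij] xU] .
  have e1: "(es ! k) x (\<lambda>y. \<pi> y [\<alpha> y, \<beta> y]) = (es ! k) x (comp es i j)" if "k < length es" for k
    by (rule tangent_cong[OF frame_tangent[OF U that xU] sc W0(1,2), symmetric])
      (use \<alpha>(5) \<beta>(5) in \<open>auto simp: W0_def comp_def\<close>)
  have e2: "(es ! k) x (\<lambda>y. \<pi> y [\<Theta> y, \<alpha> y]) = (es ! k) x (V i)" if "k < length es" for k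
    by (rule tangent_cong[OF frame_tangent[OF U that xU] sV[OF ij(1)] W0(1,2), symmetric])
      (use \<alpha>(5) \<Theta>c in \<open>auto simp: W0_def\<close>)
  have e3: "(es ! k) x (\<lambda>y. \<pi> y [\<beta> y, \<Theta> y]) = - (es ! k) x (V j)" if "k < length es" for k
  proof -
    have sm: "smooth_near M x (\<lambda>y. - V j y)" using smooth_near_mult[OF smooth_near_const sV[OF ij(2)], of "-1"] by simp
    have "(es ! k) x (\<lambda>y. - V j y) = (es ! k) x (\<lambda>y. \<pi> y [\<beta> y, \<Theta> y])"
    proof (rule tangent_cong[OF frame_tangent[OF U that xU] sm W0(1,2)])
      fix y assume y: "y \<in> W0"
      have "\<pi> y [\<beta> y, \<Theta> y] = - \<pi> y [\<Theta> y, \<beta> y]" by (rule ext2_skew[OF pi_fibre])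
      then show "- V j y = \<pi> y [\<beta> y, \<Theta> y]" using \<beta>(5)[of y] \<Theta>c[OF y, of j] y by (simp add: W0_def)
    qed
    then show ?thesis using tangent_minus[OF frame_tangent[OF U that xU] sV[OF ij(2)]] by simp
  qed
  have "\<alpha> x = coframe es i x" "\<beta> x = coframe es j x" using \<alpha> \<beta> by auto
  ultimately have "(\<Sum>k<length es. V k x * (es ! k) x (comp es i j)) + (\<Sum>k<length es. comp es i k x * - (es ! k) x (V j))
      + (\<Sum>k<length es. comp es j k x * (es ! k) x (V i)) = 0"
    using \<Theta>c[OF W0(2)] by (simp add: e1 e2 e3 comp_def cong: sum.cong_simp)
  moreover have "(\<Sum>k<length es. comp es j k x * (es ! k) x (V i)) = - (\<Sum>k<length es. comp es k j x * (es ! k) x (V i))"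
    by (subst comp_skew) (simp add: sum_negf)
  ultimately show ?thesis by (simp add: sum.distrib sum_negf)
qed

text \<open>By the product rule \<open>v\<close> hits each factor of the power once, where
  \<open>J\<close> acts as a derivation, so \<open>bivector_power_derivation\<close> yields the
  trace. When \<open>J i k\<close> is the k-th derivative of the i-th component of a field, this
  trace is its coordinate divergence.\<close>

lemma preserves_pi_preserves_pf:
  assumes U: "(U, es) \<in> frames TM" and x: "x \<in> U" and v: "v \<in> tangent_space M x"
    and J: "\<And>i j. i < length es \<Longrightarrow> j < length es \<Longrightarrow>
      v (comp es i j) = (\<Sum>k<length es. comp es i k x * J j k + comp es k j x * J i k)"
  shows "v (pf es) = (\<Sum>k<length es. J k k) * pf es x"
proof -
  note len = tangent_rank[OF U]
  define \<xi>s where "\<xi>s = map (\<lambda>i. coframe es i x) [0..<2 * n]"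
  define \<eta> where "\<eta> m = (\<Sum>k<2 * n. J m k *\<^sub>R (\<xi>s ! k))" for m
  have cd: "coframe es k x \<in> dual_fibre (tangent_space M x)" for k
    using T.coframe_dual[OF U x] by (simp add: fibre_tangent)
  have \<xi>: "length \<xi>s = 2 * n" "set \<xi>s \<subseteq> dual_fibre (tangent_space M x)" using cd by (auto simp: \<xi>s_def)
  have \<xi>n: "\<xi>s ! k = coframe es k x" if "k < 2 * n" for k using that by (simp add: \<xi>s_def)
  have vc: "v (comp es i j) = \<pi> x [\<eta> i, \<xi>s ! j] + \<pi> x [\<xi>s ! i, \<eta> j]" if ij: "i < 2 * n" "j < 2 * n" for i j
  proof -
    have "\<pi> x [\<eta> i, \<xi>s ! j] = (\<Sum>k<2 * n. J i k * \<pi> x [\<xi>s ! k, \<xi>s ! j])"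
      "\<pi> x [\<xi>s ! i, \<eta> j] = (\<Sum>k<2 * n. J j k * \<pi> x [\<xi>s ! i, \<xi>s ! k])"
      unfolding \<eta>_def by (rule ext2_sum[OF pi_fibre]; use \<xi> ij in auto)+
    then show ?thesis using J[of i j] ij by (simp add: len \<xi>n comp_def sum.distrib mult.commute)
  qed
  have pfx: "pf es y = (\<Sum>p | p permutes {..<2 * n}. of_int (sign p) * (\<Prod>i<n. comp es (p (2 * i)) (p (2 * i + 1)) y)) * (1 / 2 ^ n)"
    if y: "y \<in> U" for y
  proof -
    have "(\<Prod>i<n. \<pi> y [map (\<lambda>i. coframe es i y) [0..<2 * n] ! p (2 * i), map (\<lambda>i. coframe es i y) [0..<2 * n] ! p (2 * i + 1)])
        = (\<Prod>i<n. comp es (p (2 * i)) (p (2 * i + 1)) y)" if p: "p permutes {..<2 * n}" for p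
    proof (rule prod.cong[OF refl])
      fix i assume "i \<in> {..<n}"
      then have "p (2 * i) < 2 * n" "p (2 * i + 1) < 2 * n"
        using permutes_in_image[OF p, of "2 * i"] permutes_in_image[OF p, of "2 * i + 1"] by auto
      then show "\<pi> y [map (\<lambda>i. coframe es i y) [0..<2 * n] ! p (2 * i), map (\<lambda>i. coframe es i y) [0..<2 * n] ! p (2 * i + 1)]
          = comp es (p (2 * i)) (p (2 * i + 1)) y" by (simp add: comp_def)
    qed
    moreover have "set (map (\<lambda>i. coframe es i y) [0..<2 * n]) \<subseteq> dual_fibre (fibre TM y)" using T.coframe_dual[OF U y] by auto
    ultimately show ?thesis by (simp add: pf_def pi_top_def bivector_power_def fibre_dual)
  qed
  have sn: "smooth_near M x (comp es i j)" if "i < 2 * n" "j < 2 * n" for i j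
    using smooth_nearI[OF T.frame_open[OF U] smooth_comp[OF U] x] that len by simp
  have pl: "p (2 * i) < 2 * n" "p (2 * i + 1) < 2 * n" if "p permutes {..<2 * n}" "i < n" for p i
    using permutes_in_image[OF that(1), of "2 * i"] permutes_in_image[OF that(1), of "2 * i + 1"] that(2) by auto
  have sp: "smooth_near M x (\<lambda>y. \<Prod>i<n. comp es (p (2 * i)) (p (2 * i + 1)) y)" if "p permutes {..<2 * n}" for p
  proof (rule smooth_nearI[OF T.frame_open[OF U] _ x])
    show "smooth_fun M U (\<lambda>y. \<Prod>i<n. comp es (p (2 * i)) (p (2 * i + 1)) y)"
      by (intro smooth_fun_prod T.frame_open[OF U] smooth_comp[OF U]) (use pl[OF that] len in auto)
  qed
  have "v (\<lambda>y. (\<Sum>p | p permutes {..<2 * n}. of_int (sign p) * (\<Prod>i<n. comp es (p (2 * i)) (p (2 * i + 1)) y)) * (1 / 2 ^ n)) = v (pf es)"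
  proof (rule tangent_cong[OF v _ T.frame_open[OF U] x])
    show "smooth_near M x (\<lambda>y. (\<Sum>p | p permutes {..<2 * n}. of_int (sign p) * (\<Prod>i<n. comp es (p (2 * i)) (p (2 * i + 1)) y)) * (1 / 2 ^ n))"
      by (intro smooth_near_mult smooth_near_sum smooth_near_const sp) simp
  qed (use pfx in simp)
  then have "v (pf es) = v (\<lambda>y. (1 / 2 ^ n) * (\<Sum>p | p permutes {..<2 * n}. of_int (sign p) * (\<Prod>i<n. comp es (p (2 * i)) (p (2 * i + 1)) y)))"
    by (simp add: mult.commute)
  also have "\<dots> = (1 / 2 ^ n) * v (\<lambda>y. \<Sum>p | p permutes {..<2 * n}. of_int (sign p) * (\<Prod>i<n. comp es (p (2 * i)) (p (2 * i + 1)) y))"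
    by (rule tangent_scale[OF v]) (use sp in \<open>auto intro!: smooth_near_mult smooth_near_sum smooth_near_const\<close>)
  also have "v (\<lambda>y. \<Sum>p | p permutes {..<2 * n}. of_int (sign p) * (\<Prod>i<n. comp es (p (2 * i)) (p (2 * i + 1)) y))
      = (\<Sum>p | p permutes {..<2 * n}. v (\<lambda>y. of_int (sign p) * (\<Prod>i<n. comp es (p (2 * i)) (p (2 * i + 1)) y)))"
    by (rule tangent_sum[OF v]) (use sp in \<open>auto intro!: smooth_near_mult smooth_near_const\<close>)
  also have "\<dots> = (\<Sum>p | p permutes {..<2 * n}. of_int (sign p) * (\<Sum>i<n.
        (\<pi> x [\<eta> (p (2 * i)), \<xi>s ! p (2 * i + 1)] + \<pi> x [\<xi>s ! p (2 * i), \<eta> (p (2 * i + 1))]) *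
        (\<Prod>j\<in>{..<n} - {i}. \<pi> x [\<xi>s ! p (2 * j), \<xi>s ! p (2 * j + 1)])))"
  proof (rule sum.cong[OF refl], clarify)
    fix p assume p: "p permutes {..<2 * n}"
    have "v (\<lambda>y. of_int (sign p) * (\<Prod>i<n. comp es (p (2 * i)) (p (2 * i + 1)) y))
        = of_int (sign p) * (\<Sum>i<n. v (comp es (p (2 * i)) (p (2 * i + 1))) * (\<Prod>j\<in>{..<n} - {i}. comp es (p (2 * j)) (p (2 * j + 1)) x))"
      unfolding tangent_scale[OF v sp[OF p]]
      by (subst tangent_prod[OF v]) (use sn pl[OF p] in auto)
    also have "(\<Sum>i<n. v (comp es (p (2 * i)) (p (2 * i + 1))) * (\<Prod>j\<in>{..<n} - {i}. comp es (p (2 * j)) (p (2 * j + 1)) x))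
        = (\<Sum>i<n. (\<pi> x [\<eta> (p (2 * i)), \<xi>s ! p (2 * i + 1)] + \<pi> x [\<xi>s ! p (2 * i), \<eta> (p (2 * i + 1))]) *
        (\<Prod>j\<in>{..<n} - {i}. \<pi> x [\<xi>s ! p (2 * j), \<xi>s ! p (2 * j + 1)]))"
      by (intro sum.cong refl arg_cong2[of _ _ _ _ "(*)"] prod.cong) (use vc pl[OF p] in \<open>auto simp: \<xi>n comp_def\<close>)
    finally show "v (\<lambda>y. of_int (sign p) * (\<Prod>i<n. comp es (p (2 * i)) (p (2 * i + 1)) y)) = of_int (sign p) * (\<Sum>i<n.
        (\<pi> x [\<eta> (p (2 * i)), \<xi>s ! p (2 * i + 1)] + \<pi> x [\<xi>s ! p (2 * i), \<eta> (p (2 * i + 1))]) *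
        (\<Prod>j\<in>{..<n} - {i}. \<pi> x [\<xi>s ! p (2 * j), \<xi>s ! p (2 * j + 1)]))" .
  qed
  also have "\<dots> = (\<Sum>m<2 * n. J m m) * (\<Sum>p | p permutes {..<2 * n}. of_int (sign p) *
        (\<Prod>i<n. \<pi> x [\<xi>s ! p (2 * i), \<xi>s ! p (2 * i + 1)]))"
    by (rule bivector_power_derivation[OF pi_fibre \<xi> \<eta>_def])
  also have "(\<Sum>p | p permutes {..<2 * n}. of_int (sign p) * (\<Prod>i<n. \<pi> x [\<xi>s ! p (2 * i), \<xi>s ! p (2 * i + 1)])) = pf es x * 2 ^ n"
    using \<xi> by (simp add: pf_def pi_top_def bivector_power_def fibre_dual fibre_tangent flip: \<xi>s_def)
  finally show ?thesis by (simp add: len)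
qed

end

section \<open>The anchor of the ideal Lie algebroid\<close>

locale ideal_algebroid = poisson_divisor M n I \<pi>
  for M :: "('p::{t2_space, second_countable_topology}, 'd::finite) atlas" and n I \<pi> +
  fixes A :: "('p, 'e::real_vector) lie_algebroid"
  assumes ideal_lie_algebroid: "ideal_lie_algebroid M I A"
    and closed_frames: "\<And>x. \<exists>U \<alpha>s. open U \<and> x \<in> U \<and> local_frame M (dual_bundle A) U \<alpha>s \<and>
      (\<forall>\<alpha>\<in>set \<alpha>s. closed_on M A U \<alpha>)"
begin

lemma is_lie_algebroid: "is_lie_algebroid M A"
  using ideal_lie_algebroid by (simp add: ideal_lie_algebroid_def)

sublocale A: smooth_bundle M A
  by unfold_locales (use is_lie_algebroid in \<open>simp add: is_lie_algebroid_def\<close>)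

abbreviation "\<rho> \<equiv> anchor A"

lemma anchor_hom: "\<rho> x \<in> hom_fibre (fibre A x) (tangent_space M x)"
  using is_lie_algebroid unfolding is_lie_algebroid_def sections_def
  by (simp add: hom_bundle_def fibre_tangent)

lemma anchor_tangent: "v \<in> fibre A x \<Longrightarrow> \<rho> x v \<in> tangent_space M x"
  using hom_fibre_in[OF anchor_hom] .

lemma anchor_zero: "\<rho> x 0 = 0"
  by (rule hom_fibre_zero[OF anchor_hom A.fibre_subspace])

lemma anchor_ideal: "open U \<Longrightarrow> a \<in> sections M A U \<Longrightarrow> (\<lambda>x. \<rho> x (a x)) \<in> ideal_vector_fields M I U"
  using ideal_lie_algebroid by (simp add: ideal_lie_algebroid_def)

lemma anchor_inj:
  assumes "open U" "a \<in> sections M A U" "b \<in> sections M A U"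
    and "\<And>x. x \<in> U \<Longrightarrow> \<rho> x (a x) = \<rho> x (b x)" "x \<in> U"
  shows "a x = b x"
proof -
  have "(\<forall>x\<in>U. \<rho> x (a x) = \<rho> x (b x)) \<longrightarrow> (\<forall>x\<in>U. a x = b x)"
    using ideal_lie_algebroid assms(1,2,3) by (simp add: ideal_lie_algebroid_def)
  then show ?thesis using assms(4,5) by simp
qed

lemma anchor_surj: "open U \<Longrightarrow> V \<in> ideal_vector_fields M I U \<Longrightarrow> \<exists>a\<in>sections M A U. \<forall>x\<in>U. \<rho> x (a x) = V x"
  using ideal_lie_algebroid by (simp add: ideal_lie_algebroid_def)

lemma anchor_bracket: "a \<in> sections M A UNIV \<Longrightarrow> b \<in> sections M A UNIV \<Longrightarrow>
    \<rho> x (bracket A a b x) = lie_bracket M (\<lambda>y. \<rho> y (a y)) (\<lambda>y. \<rho> y (b y)) x"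
  using ideal_lie_algebroid by (simp add: ideal_lie_algebroid_def)

lemma bracket_section: "a \<in> sections M A UNIV \<Longrightarrow> b \<in> sections M A UNIV \<Longrightarrow> bracket A a b \<in> sections M A UNIV"
  using is_lie_algebroid unfolding is_lie_algebroid_def by blast

lemma anchor_section: "open U \<Longrightarrow> a \<in> sections M A U \<Longrightarrow> (\<lambda>x. \<rho> x (a x)) \<in> sections M TM U"
  using anchor_ideal ideal_field_section by blast

lemma frame_lifts:
  assumes U: "(U, es) \<in> frames TM"
  obtains a where "\<And>i. i < length es \<Longrightarrow> a i \<in> sections M A (D \<inter> U)"
    "\<And>i x. i < length es \<Longrightarrow> x \<in> D \<inter> U \<Longrightarrow> \<rho> x (a i x) = (es ! i) x"
proof -
  have o: "open (D \<inter> U)" using open_D T.frame_open[OF U] by blast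
  have "\<exists>a\<in>sections M A (D \<inter> U). \<forall>x\<in>D \<inter> U. \<rho> x (a x) = (es ! i) x" if "i < length es" for i
    by (rule anchor_surj[OF o ideal_field_D[OF o _ T.sections_subset[OF T.frame_section[OF U that] T.frame_open[OF U] o]]]) auto
  then show thesis using that by metis
qed

text \<open>\<open>ideal_lie_algebroid\<close> gives injectivity on sections only. A kernel vector v
  at x is extended to a section s; the field \<rho>(s) is lifted again through the lifts of a
  coordinate frame, with its own coordinates as coefficients. Injectivity on sections makes this
  second lift equal to s, and at x its coefficients vanish, so v = 0.\<close>

lemma anchor_bij:
  assumes x: "x \<in> D"
  shows "bij_betw (\<rho> x) (fibre A x) (tangent_space M x)"
proof -
  obtain U es where U: "(U, es) \<in> frames TM" "x \<in> U" by (rule T.frame_exists)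
  have o: "open (D \<inter> U)" using open_D T.frame_open[OF U(1)] by blast
  have xDU: "x \<in> D \<inter> U" using x U by blast
  obtain a where a: "\<And>i. i < length es \<Longrightarrow> a i \<in> sections M A (D \<inter> U)"
    "\<And>i x. i < length es \<Longrightarrow> x \<in> D \<inter> U \<Longrightarrow> \<rho> x (a i x) = (es ! i) x"
    by (rule frame_lifts[OF U(1)]) blast
  have ra: "\<rho> y (\<Sum>i<length es. c i *\<^sub>R a i y) = (\<Sum>i<length es. c i *\<^sub>R (es ! i) y)" if "y \<in> D \<inter> U" for c y
  proof -
    have "\<rho> y (\<Sum>i<length es. c i *\<^sub>R a i y) = (\<Sum>i<length es. c i *\<^sub>R \<rho> y (a i y))"
      by (rule hom_fibre_sum[OF anchor_hom A.fibre_subspace]) (use a(1) that A.sections_fibre in blast)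
    then show ?thesis using a(2) that by simp
  qed
  have aA: "(\<Sum>i<length es. c i *\<^sub>R a i y) \<in> fibre A y" if "y \<in> D \<inter> U" for c y
    by (intro subspace_sum subspace_scale A.fibre_subspace) (use a(1) that A.sections_fibre in blast)
  have ker: "v = 0" if v: "v \<in> fibre A x" "\<rho> x v = 0" for v
  proof -
    obtain s where s: "s \<in> sections M A UNIV" "s x = v" by (rule A.section_through[OF v(1)])
    have sD: "s \<in> sections M A (D \<inter> U)" by (rule A.sections_subset[OF s(1) open_UNIV o]) simp
    note rs = anchor_section[OF o sD]
    let ?t = "\<lambda>y. \<Sum>i<length es. coframe es i y (\<rho> y (s y)) *\<^sub>R a i y"
    have "?t \<in> sections M A (D \<inter> U)"
    proof (intro A.sections_sum A.sections_scale o)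
      fix i assume "i \<in> {..<length es}"
      then show "smooth_fun M (D \<inter> U) (\<lambda>y. coframe es i y (\<rho> y (s y)))" "a i \<in> sections M A (D \<inter> U)"
        using T.sections_coframe[OF o rs U(1), of i] a(1) by (simp_all add: Int_assoc)
    qed
    moreover have "\<rho> y (?t y) = \<rho> y (s y)" if "y \<in> D \<inter> U" for y
      using ra[OF that] T.coframe_expand[OF U(1), of y "\<rho> y (s y)"] T.sections_fibre[OF rs that] that by simp
    ultimately have "?t x = s x" using anchor_inj[OF o _ sD] xDU by blast
    moreover have "?t x = 0" using s(2) v(2) hom_fibre_zero[OF T.coframe_dual[OF U] T.fibre_subspace] by simp
    ultimately show "v = 0" using s(2) by simp
  qed
  show ?thesis
    unfolding bij_betw_def
  proof
    show "inj_on (\<rho> x) (fibre A x)"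
    proof (rule inj_onI)
      fix v w assume vw: "v \<in> fibre A x" "w \<in> fibre A x" "\<rho> x v = \<rho> x w"
      have "\<rho> x (1 *\<^sub>R v + (-1) *\<^sub>R w) = 0" using hom_fibre_lin[OF anchor_hom vw(1,2), of 1 "-1"] vw(3) by simp
      moreover have "1 *\<^sub>R v + (-1) *\<^sub>R w \<in> fibre A x"
        by (intro subspace_add subspace_scale A.fibre_subspace vw)
      ultimately have "1 *\<^sub>R v + (-1) *\<^sub>R w = 0" using ker by blast
      then show "v = w" by simp
    qed
    show "\<rho> x ` fibre A x = tangent_space M x"
    proof
      show "\<rho> x ` fibre A x \<subseteq> tangent_space M x" using anchor_tangent by blast
      show "tangent_space M x \<subseteq> \<rho> x ` fibre A x"
      proof
        fix v assume "v \<in> tangent_space M x"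
        then have e: "v = \<rho> x (\<Sum>i<length es. coframe es i x v *\<^sub>R a i x)"
          using ra[OF xDU] T.coframe_expand[OF U, of v] by (simp add: fibre_tangent)
        show "v \<in> \<rho> x ` fibre A x" by (rule image_eqI[where f="\<rho> x", OF e aA[OF xDU]])
      qed
    qed
  qed
qed

lemma anchor_injD: "x \<in> D \<Longrightarrow> v \<in> fibre A x \<Longrightarrow> w \<in> fibre A x \<Longrightarrow> \<rho> x v = \<rho> x w \<Longrightarrow> v = w"
  using anchor_bij unfolding bij_betw_def inj_on_def by blast

text \<open>The rank is constant on a frame domain, and every nonempty frame domain meets
  \<open>D\<close>, where the anchor identifies the fibres of \<open>A\<close> and of the tangent
  bundle.\<close>

lemma rank_A:
  assumes V: "(V, fs) \<in> frames A" "x \<in> V"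
  shows "length fs = 2 * n"
proof -
  obtain y where y: "y \<in> V" "y \<in> D" using D_meets[OF A.frame_open[OF V(1)] V(2)] by blast
  obtain U es where U: "(U, es) \<in> frames TM" "y \<in> U" by (rule T.frame_exists)
  let ?vs = "map (\<lambda>e. e y) fs"
  note b = A.frame_basis[OF V(1) y(1)]
  have bi: "independent (set ?vs)" "span (set ?vs) = fibre A y" "distinct ?vs" using b by (auto simp: basis_of_def)
  \<comment> \<open>The anchor is linear on the fibre only and 0 outside it. A globally linear
    \<open>g\<close> agreeing with it on the fibre makes the standard dimension arguments
    applicable.\<close>
  obtain g where g: "linear g" "\<forall>v\<in>set ?vs. g v = \<rho> y v"
    using linear_independent_extend[OF bi(1), of "\<rho> y"] by blast
  have gr: "g v = \<rho> y v" if v: "v \<in> fibre A y" for v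
  proof -
    have e: "(\<Sum>i<length ?vs. coord ?vs i v *\<^sub>R ?vs ! i) = v" by (rule coord_expand[OF b v])
    have "g (\<Sum>i<length ?vs. coord ?vs i v *\<^sub>R ?vs ! i) = (\<Sum>i<length ?vs. coord ?vs i v *\<^sub>R \<rho> y (?vs ! i))"
      using g by (simp add: linear_sum linear_cmul)
    also have "\<dots> = \<rho> y (\<Sum>i<length ?vs. coord ?vs i v *\<^sub>R ?vs ! i)"
      by (rule hom_fibre_sum[OF anchor_hom A.fibre_subspace, symmetric]) (use basis_of_nth[OF b] in auto)
    finally show ?thesis unfolding e .
  qed
  have inj: "inj_on g (span (set ?vs))"
    unfolding bi(2) using anchor_injD[OF y(2)] gr by (auto intro!: inj_onI)
  have ind: "independent (g ` set ?vs)"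
    by (rule linear_independent_injective_image[OF g(1) bi(1) inj])
  have sp: "tangent_space M y = span (g ` set ?vs)"
    unfolding linear_span_image[OF g(1)] bi(2)
    using anchor_bij[OF y(2)] gr unfolding bij_betw_def by (metis image_cong)
  have "dim (tangent_space M y) = card (g ` set ?vs)"
    unfolding sp dim_span by (rule dim_eq_card_independent[OF ind])
  moreover have "card (g ` set ?vs) = card (set ?vs)"
    by (rule card_image[OF inj_on_subset[OF inj span_superset]])
  moreover have "dim (tangent_space M y) = 2 * n"
    using basis_of_dim[OF T.frame_basis[OF U]] tangent_rank[OF U(1)] by (simp add: fibre_tangent)
  moreover have "card (set ?vs) = length fs" using distinct_card[OF bi(3)] by simp
  ultimately show ?thesis by simp
qed

subsection \<open>Transport of covectors along the anchor\<close>

lemma pull_dual: "\<xi> \<in> dual_fibre (tangent_space M x) \<Longrightarrow> \<xi> \<circ> \<rho> x \<in> dual_fibre (fibre A x)"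
  using anchor_hom[of x] hom_fibre_zero[OF _ tangent_subspace, where L=\<xi> and T=UNIV]
  unfolding hom_fibre_def by auto

definition push :: "'p \<Rightarrow> ('e \<Rightarrow> real) \<Rightarrow> (('p \<Rightarrow> real) \<Rightarrow> real) \<Rightarrow> real"
  where "push x \<alpha> w = (if w \<in> tangent_space M x then \<alpha> (inv_into (fibre A x) (\<rho> x) w) else 0)"

lemma push_anchor:
  assumes "x \<in> D" "v \<in> fibre A x"
  shows "push x \<alpha> (\<rho> x v) = \<alpha> v"
  using anchor_bij[OF assms(1)] assms(2) anchor_tangent[OF assms(2)]
  by (simp add: push_def bij_betw_def inv_into_f_f)

lemma anchor_preimage:
  assumes "x \<in> D" "w \<in> tangent_space M x"
  obtains v where "v \<in> fibre A x" "w = \<rho> x v"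
  using anchor_bij[OF assms(1)] assms(2) unfolding bij_betw_def by blast

lemma push_dual:
  assumes x: "x \<in> D" and a: "\<alpha> \<in> dual_fibre (fibre A x)"
  shows "push x \<alpha> \<in> dual_fibre (tangent_space M x)"
proof -
  have "push x \<alpha> (r *\<^sub>R v + s *\<^sub>R w) = r *\<^sub>R push x \<alpha> v + s *\<^sub>R push x \<alpha> w"
    if vw: "v \<in> tangent_space M x" "w \<in> tangent_space M x" for v w r s
  proof -
    obtain v' where v: "v' \<in> fibre A x" "v = \<rho> x v'" by (rule anchor_preimage[OF x vw(1)])
    obtain w' where w: "w' \<in> fibre A x" "w = \<rho> x w'" by (rule anchor_preimage[OF x vw(2)])
    have m: "r *\<^sub>R v' + s *\<^sub>R w' \<in> fibre A x" by (intro subspace_add subspace_scale A.fibre_subspace v w)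
    have "r *\<^sub>R v + s *\<^sub>R w = \<rho> x (r *\<^sub>R v' + s *\<^sub>R w')" using hom_fibre_lin[OF anchor_hom v(1) w(1), of r s] v w by simp
    then show ?thesis
      using push_anchor[OF x m, of \<alpha>] push_anchor[OF x v(1), of \<alpha>] push_anchor[OF x w(1), of \<alpha>] v w
        hom_fibre_lin[OF a v(1) w(1), of r s] by simp
  qed
  then show ?thesis by (simp add: hom_fibre_def push_def)
qed

lemma push_pull:
  assumes "x \<in> D" "\<xi> \<in> dual_fibre (tangent_space M x)"
  shows "push x (\<xi> \<circ> \<rho> x) = \<xi>"
proof
  fix w show "push x (\<xi> \<circ> \<rho> x) w = \<xi> w"
  proof (cases "w \<in> tangent_space M x")
    case True
    obtain v where "v \<in> fibre A x" "w = \<rho> x v" by (rule anchor_preimage[OF assms(1) True])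
    then show ?thesis using push_anchor[OF assms(1)] by simp
  qed (use hom_fibre_outside[OF assms(2)] in \<open>simp add: push_def\<close>)
qed

lemma pull_push:
  assumes x: "x \<in> D" and a: "\<alpha> \<in> dual_fibre (fibre A x)"
  shows "push x \<alpha> \<circ> \<rho> x = \<alpha>"
proof
  fix v show "(push x \<alpha> \<circ> \<rho> x) v = \<alpha> v"
  proof (cases "v \<in> fibre A x")
    case False
    then show ?thesis
      using hom_fibre_outside[OF anchor_hom False] hom_fibre_outside[OF a False]
        hom_fibre_zero[OF push_dual[OF x a] tangent_subspace] by simp
  qed (use push_anchor[OF x] in simp)
qed

lemma push_section:
  assumes W: "open W" and a: "\<alpha> \<in> sections M (dual_bundle A) W"
  shows "(\<lambda>x. push x (\<alpha> x)) \<in> sections M (dual_bundle TM) (W \<inter> D)"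
proof (rule T.dual_sectionsI_local)
  show "open (W \<inter> D)" using W open_D by blast
  show "push x (\<alpha> x) \<in> dual_fibre (fibre TM x)" if "x \<in> W \<inter> D" for x
    using push_dual[OF _ A.dual_section_fibre[OF a]] that by (simp add: fibre_tangent)
  fix x assume x: "x \<in> W \<inter> D"
  obtain U es where U: "(U, es) \<in> frames TM" "x \<in> U" by (rule T.frame_exists)
  obtain a where a': "\<And>i. i < length es \<Longrightarrow> a i \<in> sections M A (D \<inter> U)"
    "\<And>i x. i < length es \<Longrightarrow> x \<in> D \<inter> U \<Longrightarrow> \<rho> x (a i x) = (es ! i) x"
    by (rule frame_lifts[OF U(1)]) blast
  let ?W = "W \<inter> D \<inter> U"
  have o: "open ?W" "open (D \<inter> U)" using W open_D T.frame_open[OF U(1)] by blast+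
  have "smooth_fun M ?W (\<lambda>y. push y (\<alpha> y) ((es ! i) y))" if i: "i < length es" for i
  proof (rule smooth_fun_cong[OF o(1)])
    show "smooth_fun M ?W (\<lambda>y. \<alpha> y (a i y))"
      by (rule A.smooth_pairing[OF o(1) smooth_bundle.sections_subset[OF A.bundle_dual a W o(1)]
            A.sections_subset[OF a'(1)[OF i] o(2,1)]]) auto
    show "\<alpha> y (a i y) = push y (\<alpha> y) ((es ! i) y)" if y: "y \<in> ?W" for y
      using push_anchor[of y "a i y" "\<alpha> y"] A.sections_fibre[OF a'(1)[OF i], of y] a'(2)[OF i, of y] y by auto
  qed
  then show "\<exists>V es W'. (V, es) \<in> frames TM \<and> open W' \<and> x \<in> W' \<and> W' \<subseteq> V \<and>
      (\<forall>i<length es. smooth_fun M W' (\<lambda>y. push y (\<alpha> y) ((es ! i) y)))"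
    using U x o by (intro exI[of _ U] exI[of _ es] exI[of _ ?W]) auto
qed

text \<open>Evaluate d\<alpha> = 0 on lifts of two coordinate fields, extended to global sections
  near x. Coordinate fields commute and the anchor is injective over \<open>D\<close>, so the
  bracket of the lifts vanishes at x and only the two derivative terms are left.\<close>

lemma closed_push:
  assumes U: "(U, es) \<in> frames TM" and W: "open W" and a: "\<alpha> \<in> sections M (dual_bundle A) W"
    and cl: "closed_on M A W \<alpha>" and x: "x \<in> W \<inter> D \<inter> U" and ij: "i < length es" "j < length es"
  shows "(es ! i) x (\<lambda>y. push y (\<alpha> y) ((es ! j) y)) = (es ! j) x (\<lambda>y. push y (\<alpha> y) ((es ! i) y))"
proof -
  obtain a where a': "\<And>i. i < length es \<Longrightarrow> a i \<in> sections M A (D \<inter> U)"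
    "\<And>i x. i < length es \<Longrightarrow> x \<in> D \<inter> U \<Longrightarrow> \<rho> x (a i x) = (es ! i) x"
    by (rule frame_lifts[OF U]) blast
  have o: "open (D \<inter> U)" using open_D T.frame_open[OF U] by blast
  have xDU: "x \<in> D \<inter> U" using x by blast
  obtain s Ws where s: "s \<in> sections M A UNIV" "open Ws" "x \<in> Ws" "Ws \<subseteq> D \<inter> U" "\<And>y. y \<in> Ws \<Longrightarrow> s y = a i y"
    by (rule A.section_extension[OF o xDU a'(1)[OF ij(1)]]) blast
  obtain t Wt where t: "t \<in> sections M A UNIV" "open Wt" "x \<in> Wt" "Wt \<subseteq> D \<inter> U" "\<And>y. y \<in> Wt \<Longrightarrow> t y = a j y"
    by (rule A.section_extension[OF o xDU a'(1)[OF ij(2)]]) blast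
  define W0 where "W0 = Ws \<inter> Wt \<inter> W"
  have W0: "open W0" "x \<in> W0" "W0 \<subseteq> D \<inter> U" "W0 \<subseteq> W" using s t W x by (auto simp: W0_def)
  have rs: "\<rho> y (s y) = (es ! i) y" "\<rho> y (t y) = (es ! j) y" if "y \<in> W0" for y
    using that s(5)[of y] t(5)[of y] a'(2)[OF ij(1), of y] a'(2)[OF ij(2), of y] subsetD[OF W0(3) that] by (simp_all add: W0_def)
  have sub: "r \<in> sections M A W0" if "r \<in> sections M A UNIV" for r
    by (rule A.sections_subset[OF that open_UNIV W0(1)]) simp
  have es0: "es ! k \<in> sections M TM W0" if "k < length es" for k
    by (rule T.sections_subset[OF T.frame_section[OF U that] T.frame_open[OF U] W0(1)]) (use W0 in blast)
  have "\<rho> x (bracket A s t x) = lie_bracket M (es ! i) (es ! j) x"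
    unfolding anchor_bracket[OF s(1) t(1)]
    by (rule lie_bracket_cong[OF W0(1,2) es0[OF ij(1)] es0[OF ij(2)], symmetric]) (use rs in auto)
  also have "\<dots> = 0" by (rule lie_bracket_frame[OF U ij]) (use x in blast)
  finally have "\<rho> x (bracket A s t x) = \<rho> x 0" by (simp add: anchor_zero)
  then have b0: "bracket A s t x = 0"
    using anchor_injD[of x "bracket A s t x" 0] x A.sections_fibre[OF bracket_section[OF s(1) t(1)]] subspace_0[OF A.fibre_subspace] by blast
  have a0: "\<alpha> x 0 = 0" by (rule hom_fibre_zero[OF A.dual_section_fibre[OF a] A.fibre_subspace]) (use x in blast)
  have aW: "\<alpha> \<in> sections M (dual_bundle A) W0" by (rule smooth_bundle.sections_subset[OF A.bundle_dual a W W0(1,4)])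
  have fibs: "s y \<in> fibre A y" "t y \<in> fibre A y" for y using A.sections_fibre s(1) t(1) by auto
  have xU: "x \<in> U" using x by blast
  have "(es ! i) x (\<lambda>y. \<alpha> y (t y)) = (es ! i) x (\<lambda>y. push y (\<alpha> y) ((es ! j) y))"
    by (rule tangent_cong[OF frame_tangent[OF U ij(1) xU] smooth_nearI[OF W0(1) A.smooth_pairing[OF W0(1) aW sub[OF t(1)]] W0(2)] W0(1,2)])
      (use push_anchor[OF _ fibs(2)] rs W0(3) in \<open>metis IntD1 subsetD\<close>)
  moreover have "(es ! j) x (\<lambda>y. \<alpha> y (s y)) = (es ! j) x (\<lambda>y. push y (\<alpha> y) ((es ! i) y))"
    by (rule tangent_cong[OF frame_tangent[OF U ij(2) xU] smooth_nearI[OF W0(1) A.smooth_pairing[OF W0(1) aW sub[OF s(1)]] W0(2)] W0(1,2)])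
      (use push_anchor[OF _ fibs(1)] rs W0(3) in \<open>metis IntD1 subsetD\<close>)
  moreover have "algebroid_d A \<alpha> s t x = 0" using cl s(1) t(1) x unfolding closed_on_def by blast
  ultimately show ?thesis by (simp add: algebroid_d_def rs[OF W0(2)] b0 a0)
qed

section \<open>Lifting the Poisson structure\<close>

text \<open>The identity \<open>id\<close> involves only the components of the field and the matrix
  of \<pi>, all smooth on \<open>W\<close>. It therefore extends from \<open>D\<close> to all of
  \<open>W\<close>, even if the one-form that produced it does not. The factor obtained is the
  coordinate divergence.\<close>

lemma ideal_from_identity:
  assumes U: "(U, es) \<in> frames TM" and W: "open W" "W \<subseteq> U"
    and V: "\<And>m. m < length es \<Longrightarrow> smooth_fun M W (V m)"
    and X: "\<And>y. y \<in> W \<Longrightarrow> X y = (\<Sum>m<length es. V m y *\<^sub>R (es ! m) y)"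
    and id: "\<And>y i j. y \<in> W \<Longrightarrow> y \<in> D \<Longrightarrow> i < length es \<Longrightarrow> j < length es \<Longrightarrow>
      (\<Sum>k<length es. V k y * (es ! k) y (comp es i j))
      = (\<Sum>k<length es. comp es i k y * (es ! k) y (V j) + comp es k j y * (es ! k) y (V i))"
  shows "\<And>y. y \<in> W \<Longrightarrow> X y (pf es) = (\<Sum>k<length es. (es ! k) y (V k)) * pf es y"
    and "smooth_fun M W (\<lambda>y. \<Sum>k<length es. (es ! k) y (V k))"
proof -
  have sV: "smooth_fun M W (\<lambda>y. (es ! k) y (V m))" if "k < length es" "m < length es" for k m
    by (rule smooth_frame_field[OF U that(1) W V[OF that(2)]])
  have sc: "smooth_fun M W (comp es i j)" if "i < length es" "j < length es" for i j
    by (rule smooth_fun_subset[OF smooth_comp[OF U that] W(2)])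
  have sdc: "smooth_fun M W (\<lambda>y. (es ! k) y (comp es i j))" if "k < length es" "i < length es" "j < length es" for i j k
    by (rule smooth_frame_field[OF U that(1) W sc[OF that(2,3)]])
  show "smooth_fun M W (\<lambda>y. \<Sum>k<length es. (es ! k) y (V k))"
    by (intro smooth_fun_sum W(1) sV) auto
  fix y assume y: "y \<in> W"
  have id': "(\<Sum>k<length es. V k y * (es ! k) y (comp es i j))
      = (\<Sum>k<length es. comp es i k y * (es ! k) y (V j) + comp es k j y * (es ! k) y (V i))"
    if "i < length es" "j < length es" for i j
    by (rule smooth_fun_eq_dense[OF W(1) _ _ dense_D id[OF _ _ that] y])
      (use that in \<open>auto intro!: smooth_fun_sum smooth_fun_add smooth_fun_mult W(1) sV sc sdc V\<close>)
  have Xt: "X y \<in> tangent_space M y"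
    unfolding X[OF y] by (intro subspace_sum subspace_scale tangent_subspace frame_tangent[OF U]) (use y W in auto)
  show "X y (pf es) = (\<Sum>k<length es. (es ! k) y (V k)) * pf es y"
  proof (rule preserves_pi_preserves_pf[OF U _ Xt, where J="\<lambda>i k. (es ! k) y (V i)"])
    show "y \<in> U" using y W by blast
    show "X y (comp es i j) = (\<Sum>k<length es. comp es i k y * (es ! k) y (V j) + comp es k j y * (es ! k) y (V i))"
      if "i < length es" "j < length es" for i j
      using id'[OF that] by (simp add: X[OF y] sum_fun_apply scaleR_fun_def)
  qed
qed

text \<open>The case \<theta> = dx_j, whose coefficients are the constants 0 and 1, so closedness is
  trivial on all of \<open>U\<close>. The field \<pi>(dx_j, -) then preserves the ideal, with its
  divergence as factor, and lifts.\<close>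

lemma hamiltonian_lift:
  assumes U: "(U, es) \<in> frames TM" and j: "j < length es"
  obtains a where "a \<in> sections M A U" "\<And>y. y \<in> U \<Longrightarrow> \<rho> y (a y) = (\<Sum>m<length es. comp es j m y *\<^sub>R (es ! m) y)"
proof -
  note o = T.frame_open[OF U]
  let ?X = "\<lambda>y. \<Sum>m<length es. comp es j m y *\<^sub>R (es ! m) y"
  have Xs: "?X \<in> sections M TM U"
    by (intro T.sections_sum T.sections_scale o smooth_comp[OF U j] T.frame_section[OF U]) auto
  have id: "(\<Sum>k<length es. comp es j k y * (es ! k) y (comp es i i'))
      = (\<Sum>k<length es. comp es i k y * (es ! k) y (comp es j i') + comp es k i' y * (es ! k) y (comp es j i))"
    if y: "y \<in> U" and "i < length es" "i' < length es" for y i i'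
  proof (rule hamiltonian_preserves_pi[OF U o order_refl, of "\<lambda>k y. if k = j then 1 else 0"])
    show "smooth_fun M U (\<lambda>y. if k = j then 1 else 0)" for k by (rule smooth_fun_const[OF o])
    show "(es ! a) y (\<lambda>y. if b = j then 1 else 0) = (es ! b) y (\<lambda>y. if a = j then 1 else 0)"
      if "y \<in> U" "a < length es" "b < length es" for y a b
      using tangent_const[OF frame_tangent[OF U that(2,1)]] tangent_const[OF frame_tangent[OF U that(3,1)]] by simp
    show "comp es j m y = (\<Sum>k<length es. (if k = j then 1 else 0) * comp es k m y)" for m y
      using j by (simp add: if_distrib[of "\<lambda>c. c * _"] cong: if_cong)
  qed (use that in auto)
  have "?X \<in> ideal_vector_fields M I U"
  proof (rule ideal_fieldI[OF o Xs])
    fix x assume x: "x \<in> U"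
    show "\<exists>U' es' W' k. (U', es') \<in> frames TM \<and> open W' \<and> x \<in> W' \<and> W' \<subseteq> U \<inter> U' \<and>
        smooth_fun M W' k \<and> (\<forall>y\<in>W'. ?X y (pf es') = k y * pf es' y)"
      using ideal_from_identity[OF U o order_refl smooth_comp[OF U j] refl id] U o x
      by (intro exI[of _ U] exI[of _ es] exI[of _ U] exI[of _ "\<lambda>y. \<Sum>k<length es. (es ! k) y (comp es j k)"]) auto
  qed
  then show thesis using anchor_surj[OF o] that by blast
qed

text \<open>With v m lifting the Hamiltonian field of x_m, one has \<alpha>(v m) = \<pi>(dx_m, push
  \<alpha>); skew-symmetry produces the minus sign. The gain is that \<alpha>(v m) remains smooth
  across the degeneracy locus, although \<open>push\<close> does not make sense there.\<close>

lemma sharp_push: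
  assumes U: "(U, es) \<in> frames TM" and y: "y \<in> U" "y \<in> D" and \<alpha>: "\<alpha> \<in> dual_fibre (fibre A y)"
    and v: "\<And>m. m < length es \<Longrightarrow> v m \<in> fibre A y \<and> \<rho> y (v m) = (\<Sum>k<length es. comp es m k y *\<^sub>R (es ! k) y)"
  shows "sharp TM \<pi> y (push y \<alpha>) = (\<Sum>m<length es. - \<alpha> (v m) *\<^sub>R (es ! m) y)"
    and "m < length es \<Longrightarrow> - \<alpha> (v m) = (\<Sum>k<length es. push y \<alpha> ((es ! k) y) * comp es k m y)"
proof -
  note pd = push_dual[OF y(2) \<alpha>]
  have pi: "\<pi> y \<in> ext_fibre 2 (fibre TM y)" and pd': "push y \<alpha> \<in> dual_fibre (fibre TM y)"
    using pi_fibre pd by (simp_all add: fibre_tangent)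
  have cd: "coframe es k y \<in> dual_fibre (tangent_space M y)" for k
    using T.coframe_dual[OF U y(1)] by (simp add: fibre_tangent)
  have *: "- \<alpha> (v m) = (\<Sum>k<length es. push y \<alpha> ((es ! k) y) * comp es k m y)" if m: "m < length es" for m
  proof -
    have "\<alpha> (v m) = push y \<alpha> (\<rho> y (v m))" using push_anchor[OF y(2) conjunct1[OF v[OF m]], of \<alpha>] by (rule sym)
    also have "\<dots> = (\<Sum>k<length es. comp es m k y *\<^sub>R push y \<alpha> ((es ! k) y))"
      unfolding conjunct2[OF v[OF m]]
      by (rule hom_fibre_sum[OF pd tangent_subspace]) (use frame_tangent[OF U _ y(1)] in auto)
    also have "\<dots> = (\<Sum>k<length es. - (push y \<alpha> ((es ! k) y) * comp es k m y))"
      by (intro sum.cong refl) (subst comp_skew, simp)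
    finally show ?thesis by (simp add: sum_negf)
  qed
  show "m < length es \<Longrightarrow> - \<alpha> (v m) = (\<Sum>k<length es. push y \<alpha> ((es ! k) y) * comp es k m y)" by (rule *)
  have "\<pi> y [push y \<alpha>, coframe es m y] = - \<alpha> (v m)" if m: "m < length es" for m
  proof -
    have "\<pi> y [\<Sum>k<length es. push y \<alpha> ((es ! k) y) *\<^sub>R coframe es k y, coframe es m y]
        = (\<Sum>k<length es. push y \<alpha> ((es ! k) y) * comp es k m y)"
      unfolding comp_def by (rule ext2_sum(1)[OF pi_fibre cd cd])
    then show ?thesis using *[OF m] T.dual_expand_frame[OF U y(1) pd'] by simp
  qed
  then show "sharp TM \<pi> y (push y \<alpha>) = (\<Sum>m<length es. - \<alpha> (v m) *\<^sub>R (es ! m) y)"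
    unfolding T.sharp_frame[where P=\<pi> and x=y, OF pi pd' U y(1)] by simp
qed

lemma local_lift:
  assumes \<alpha>: "\<alpha> \<in> sections M (dual_bundle A) UNIV"
  shows "\<exists>W b. open W \<and> x \<in> W \<and> b \<in> sections M A W \<and> (\<forall>y\<in>W \<inter> D. \<rho> y (b y) = sharp TM \<pi> y (push y (\<alpha> y)))"
proof -
  obtain U es where U: "(U, es) \<in> frames TM" "x \<in> U" by (rule T.frame_exists)
  obtain W0 \<alpha>s where W0: "open W0" "x \<in> W0" and fr: "local_frame M (dual_bundle A) W0 \<alpha>s"
    and cl: "\<And>\<beta>. \<beta> \<in> set \<alpha>s \<Longrightarrow> closed_on M A W0 \<beta>" using closed_frames[of x] by blast
  have "\<alpha> \<in> sections M (dual_bundle A) W0" by (rule smooth_bundle.sections_subset[OF A.bundle_dual \<alpha> open_UNIV W0(1)]) simp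
  then obtain c where c: "\<And>i. i < length \<alpha>s \<Longrightarrow> smooth_fun M W0 (c i)"
    "\<And>y. y \<in> W0 \<Longrightarrow> \<alpha> y = (\<Sum>i<length \<alpha>s. c i y *\<^sub>R (\<alpha>s ! i) y)"
    by (rule A.dual_local_frame_coeffs[OF W0(1) fr]) blast
  have ex: "\<exists>a. a \<in> sections M A U \<and> (\<forall>y\<in>U. \<rho> y (a y) = (\<Sum>m<length es. comp es j m y *\<^sub>R (es ! m) y))"
    if "j < length es" for j
    by (rule hamiltonian_lift[OF U(1) that]) blast
  define h where "h j = (SOME a. a \<in> sections M A U \<and>
    (\<forall>y\<in>U. \<rho> y (a y) = (\<Sum>m<length es. comp es j m y *\<^sub>R (es ! m) y)))" for j
  have h: "h j \<in> sections M A U"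
    "y \<in> U \<Longrightarrow> \<rho> y (h j y) = (\<Sum>m<length es. comp es j m y *\<^sub>R (es ! m) y)" if "j < length es" for j y
    using someI_ex[OF ex[OF that]] unfolding h_def by blast+
  define W where "W = W0 \<inter> U"
  have W: "open W" "x \<in> W" "W \<subseteq> U" "W \<subseteq> W0" using W0 U T.frame_open[OF U(1)] by (auto simp: W_def)
  have hW: "h j \<in> sections M A W" if "j < length es" for j
    by (rule A.sections_subset[OF h(1)[OF that] T.frame_open[OF U(1)] W(1,3)])
  have h': "h m y \<in> fibre A y \<and> \<rho> y (h m y) = (\<Sum>k<length es. comp es m k y *\<^sub>R (es ! k) y)"
    if "m < length es" "y \<in> U" for m y using that h A.sections_fibre by blast
  \<comment> \<open>The field V_\<beta> of the overview, obtained by dualising the lifts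
    \<open>h m\<close>. It is defined and smooth on all of \<open>W\<close>, and over
    \<open>D\<close> it is the sharp of \<open>push\<close> \<beta>.\<close>
  define X where "X \<beta> y = (\<Sum>m<length es. - \<beta> y (h m y) *\<^sub>R (es ! m) y)" for \<beta> :: "'p \<Rightarrow> 'e \<Rightarrow> real" and y
  have esW: "es ! m \<in> sections M TM W" if "m < length es" for m
    by (rule T.sections_subset[OF T.frame_section[OF U(1) that] T.frame_open[OF U(1)] W(1,3)])
  have sm: "smooth_fun M W (\<lambda>y. - \<beta> y (h m y))" if "\<beta> \<in> sections M (dual_bundle A) W" "m < length es" for \<beta> m
    by (rule smooth_fun_minus[OF W(1) A.smooth_pairing[OF W(1) that(1) hW[OF that(2)]]])
  have XW: "X \<beta> \<in> sections M TM W" if "\<beta> \<in> sections M (dual_bundle A) W" for \<beta>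
    unfolding X_def by (intro T.sections_sum T.sections_scale W(1) sm[OF that] esW) auto
  define k where "k i y = (\<Sum>m<length es. (es ! m) y (\<lambda>z. - (\<alpha>s ! i) z (h m z)))" for i y
  have k: "smooth_fun M W (k i)" "\<And>y. y \<in> W \<Longrightarrow> X (\<alpha>s ! i) y (pf es) = k i y * pf es y" if i: "i < length \<alpha>s" for i
  proof -
    let ?\<beta> = "\<alpha>s ! i"
    have \<beta>0: "?\<beta> \<in> sections M (dual_bundle A) W0" using fr i by (auto simp: local_frame_def)
    then have \<beta>W: "?\<beta> \<in> sections M (dual_bundle A) W" by (rule smooth_bundle.sections_subset[OF A.bundle_dual _ W0(1) W(1,4)])
    have id: "(\<Sum>k<length es. - ?\<beta> y (h k y) * (es ! k) y (comp es a b))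
      = (\<Sum>k<length es. comp es a k y * (es ! k) y (\<lambda>y. - ?\<beta> y (h b y)) + comp es k b y * (es ! k) y (\<lambda>y. - ?\<beta> y (h a y)))"
      if y: "y \<in> W" "y \<in> D" and ab: "a < length es" "b < length es" for y a b
    proof -
      \<comment> \<open>The Jacobi argument runs over \<open>W \<inter> D\<close> only, where the
        pushed form exists and is closed. The components of \<open>X\<close> agree there with those
        of its Hamiltonian field; \<open>ideal_from_identity\<close> then leaves
        \<open>D\<close>.\<close>
      define \<theta> where "\<theta> k z = push z (?\<beta> z) ((es ! k) z)" for k z
      define V where "V m z = (\<Sum>k<length es. \<theta> k z * comp es k m z)" for m z
      have oD: "open (W \<inter> D)" using W open_D by blast
      have WD: "W \<inter> D \<subseteq> U" using W by blast
      have yD: "y \<in> W \<inter> D" using y by blast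
      have st: "smooth_fun M (W \<inter> D) (\<theta> k)" if "k < length es" for k
        unfolding \<theta>_def
        by (rule T.smooth_pairing[OF oD push_section[OF W(1) \<beta>W] T.sections_subset[OF esW[OF that] W(1) oD]]) simp
      have Veq: "- ?\<beta> z (h m z) = V m z" if "z \<in> W \<inter> D" "m < length es" for z m
        unfolding V_def \<theta>_def
        by (rule sharp_push(2)[OF U(1) _ _ A.dual_section_fibre[OF \<beta>W] h' that(2)]) (use that W in auto)
      have m: "(\<Sum>k<length es. V k y * (es ! k) y (comp es a b))
          = (\<Sum>k<length es. comp es a k y * (es ! k) y (V b) + comp es k b y * (es ! k) y (V a))"
      proof (rule hamiltonian_preserves_pi[OF U(1) oD WD st _ yD ab])
        show "(es ! i) z (\<theta> j) = (es ! j) z (\<theta> i)" if "z \<in> W \<inter> D" "i < length es" "j < length es" for z i j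
          unfolding \<theta>_def by (rule closed_push[OF U(1) W0(1) \<beta>0 cl[OF nth_mem[OF i]]]) (use that W in auto)
      qed (auto simp: V_def)
      have d: "(es ! k) y (\<lambda>z. - ?\<beta> z (h m z)) = (es ! k) y (V m)" if "k < length es" "m < length es" for k m
        by (rule tangent_cong[OF frame_tangent[OF U(1) that(1)] smooth_nearI[OF W(1) sm[OF \<beta>W that(2)] y(1)] oD yD Veq])
          (use y W that in auto)
      show ?thesis using m d ab Veq[OF yD] by (simp cong: sum.cong_simp)
    qed
    note ii = ideal_from_identity[OF U(1) W(1,3) sm[OF \<beta>W] _ id, of "X ?\<beta>"]
    show "smooth_fun M W (k i)" unfolding k_def by (rule ii(2)) (auto simp: X_def)
    show "X ?\<beta> y (pf es) = k i y * pf es y" if "y \<in> W" for y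
      unfolding k_def by (rule ii(1)) (auto simp: X_def that)
  qed
  have \<alpha>W: "\<alpha> \<in> sections M (dual_bundle A) W" by (rule smooth_bundle.sections_subset[OF A.bundle_dual \<alpha> open_UNIV W(1)]) simp
  have "X \<alpha> \<in> ideal_vector_fields M I W"
  proof (rule ideal_fieldI[OF W(1) XW[OF \<alpha>W]])
    fix z assume z: "z \<in> W"
    \<comment> \<open>\<open>X \<beta>\<close> depends on \<beta> linearly over functions, so the
      equations X f = k f for the closed frame combine to one for \<alpha>. Coefficients are not
      differentiated, since a field acts on f as a derivation at each point.\<close>
    have Xc: "X \<alpha> y (pf es) = (\<Sum>i<length \<alpha>s. c i y * k i y) * pf es y" if y: "y \<in> W" for y
    proof -
      have "X \<alpha> y (pf es) = (\<Sum>m<length es. \<Sum>i<length \<alpha>s. c i y * (- (\<alpha>s ! i) y (h m y) * (es ! m) y (pf es)))"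
        using c(2)[of y] y W
        by (auto simp: X_def sum_fun_apply scaleR_fun_def sum_negf sum_distrib_right sum_distrib_left mult.assoc subset_iff
            intro!: sum.cong)
      also have "\<dots> = (\<Sum>i<length \<alpha>s. c i y * X (\<alpha>s ! i) y (pf es))"
        by (subst sum.swap) (simp add: X_def sum_fun_apply scaleR_fun_def sum_distrib_left)
      also have "\<dots> = (\<Sum>i<length \<alpha>s. c i y * k i y) * pf es y"
        using k(2) y by (simp add: sum_distrib_right mult.assoc)
      finally show ?thesis .
    qed
    have "smooth_fun M W (\<lambda>y. \<Sum>i<length \<alpha>s. c i y * k i y)"
      by (intro smooth_fun_sum smooth_fun_mult W(1) k smooth_fun_subset[OF c(1) W(4)]) auto
    then show "\<exists>U' es' W' k. (U', es') \<in> frames TM \<and> open W' \<and> z \<in> W' \<and> W' \<subseteq> W \<inter> U' \<and>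
        smooth_fun M W' k \<and> (\<forall>y\<in>W'. X \<alpha> y (pf es') = k y * pf es' y)"
      using U(1) W z Xc by (intro exI[of _ U] exI[of _ es] exI[of _ W] exI[of _ "\<lambda>y. \<Sum>i<length \<alpha>s. c i y * k i y"]) auto
  qed
  then obtain b where b: "b \<in> sections M A W" "\<forall>y\<in>W. \<rho> y (b y) = X \<alpha> y" using anchor_surj[OF W(1)] by blast
  have "\<rho> y (b y) = sharp TM \<pi> y (push y (\<alpha> y))" if y: "y \<in> W \<inter> D" for y
    using b(2) y sharp_push(1)[OF U(1) _ _ A.dual_section_fibre[OF \<alpha>W] h', of y] W(3) by (auto simp: X_def)
  then show ?thesis using W b by blast
qed

end

section \<open>The lifted sharp map and the bivector on \<open>A\<close>\<close>

context ideal_algebroid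
begin

text \<open>Injectivity of the anchor over \<open>D\<close> makes the local lifts unique there,
  which is the uniqueness that \<open>sections_glue\<close> asks for.\<close>

lemma lift_exists:
  assumes \<alpha>: "\<alpha> \<in> sections M (dual_bundle A) UNIV"
  shows "\<exists>b. b \<in> sections M A UNIV \<and> (\<forall>y\<in>D. \<rho> y (b y) = sharp TM \<pi> y (push y (\<alpha> y)))"
proof -
  let ?Q = "\<lambda>y v. v \<in> fibre A y \<and> \<rho> y v = sharp TM \<pi> y (push y (\<alpha> y))"
  have loc: "\<exists>W s. open W \<and> x \<in> W \<and> s \<in> sections M A W \<and> (\<forall>y\<in>W \<inter> D. ?Q y (s y))" for x
  proof -
    obtain W b where "open W" "x \<in> W" "b \<in> sections M A W" "\<forall>y\<in>W \<inter> D. \<rho> y (b y) = sharp TM \<pi> y (push y (\<alpha> y))"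
      using local_lift[OF \<alpha>, of x] by blast
    then show ?thesis using A.sections_fibre by blast
  qed
  have uniq: "v = w" if "y \<in> D" "?Q y v" "?Q y w" for y v w using anchor_injD[of y v w] that by simp
  obtain s where "s \<in> sections M A UNIV" "\<And>y. y \<in> D \<Longrightarrow> ?Q y (s y)"
    by (rule A.sections_glue[OF dense_D, of ?Q, OF loc uniq]) blast+
  then show ?thesis by blast
qed

definition lifted_sharp :: "('p \<Rightarrow> 'e \<Rightarrow> real) \<Rightarrow> 'p \<Rightarrow> 'e"
  where "lifted_sharp \<alpha> = (SOME b. b \<in> sections M A UNIV \<and> (\<forall>y\<in>D. \<rho> y (b y) = sharp TM \<pi> y (push y (\<alpha> y))))"

lemma
  assumes "\<alpha> \<in> sections M (dual_bundle A) UNIV"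
  shows lifted_sharp_section: "lifted_sharp \<alpha> \<in> sections M A UNIV"
    and lifted_sharp_anchor: "y \<in> D \<Longrightarrow> \<rho> y (lifted_sharp \<alpha> y) = sharp TM \<pi> y (push y (\<alpha> y))"
  using someI_ex[OF lift_exists[OF assms]] unfolding lifted_sharp_def by blast+

lemma lifted_sharp_D:
  assumes \<alpha>: "\<alpha> \<in> sections M (dual_bundle A) UNIV" and \<beta>: "\<beta> \<in> dual_fibre (fibre A y)" and y: "y \<in> D"
  shows "\<beta> (lifted_sharp \<alpha> y) = \<pi> y [push y (\<alpha> y), push y \<beta>]"
proof -
  have "\<beta> (lifted_sharp \<alpha> y) = push y \<beta> (\<rho> y (lifted_sharp \<alpha> y))"
    by (rule push_anchor[OF y A.sections_fibre[OF lifted_sharp_section[OF \<alpha>] UNIV_I], symmetric])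
  also have "\<dots> = push y \<beta> (sharp TM \<pi> y (push y (\<alpha> y)))" by (simp only: lifted_sharp_anchor[OF \<alpha> y])
  also have "\<dots> = \<pi> y [push y (\<alpha> y), push y \<beta>]"
    by (rule T.sharp_pairing[where P=\<pi> and x=y])
      (use pi_fibre push_dual[OF y] A.dual_section_fibre[OF \<alpha>] \<beta> in \<open>simp_all add: fibre_tangent\<close>)
  finally show ?thesis .
qed

text \<open>Over \<open>D\<close> both sides are values of \<pi> on pushed covectors, so the
  skew-symmetry of \<pi> carries over; both sides are smooth, so density does the rest.\<close>

lemma lifted_sharp_skew:
  assumes \<alpha>: "\<alpha> \<in> sections M (dual_bundle A) UNIV" and \<beta>: "\<beta> \<in> sections M (dual_bundle A) UNIV"
  shows "\<beta> x (lifted_sharp \<alpha> x) = - \<alpha> x (lifted_sharp \<beta> x)"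
proof (rule smooth_fun_eq_dense[OF open_UNIV _ _ dense_D _ UNIV_I])
  show "smooth_fun M UNIV (\<lambda>x. \<beta> x (lifted_sharp \<alpha> x))" "smooth_fun M UNIV (\<lambda>x. - \<alpha> x (lifted_sharp \<beta> x))"
    by (intro smooth_fun_minus open_UNIV A.smooth_pairing \<alpha> \<beta> lifted_sharp_section)+
  show "\<beta> y (lifted_sharp \<alpha> y) = - \<alpha> y (lifted_sharp \<beta> y)" if "y \<in> D" for y
    using lifted_sharp_D[OF \<alpha> A.dual_section_fibre[OF \<beta>] that] lifted_sharp_D[OF \<beta> A.dual_section_fibre[OF \<alpha>] that]
      ext2_skew[OF pi_fibre, of y "push y (\<alpha> y)" "push y (\<beta> y)"] by simp
qed

text \<open>\<open>lifted_sharp\<close> takes global sections, whereas a bivector at x takes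
  covectors at x; an arbitrary extension mediates between the two.\<close>

definition ext_covector :: "'p \<Rightarrow> ('e \<Rightarrow> real) \<Rightarrow> 'p \<Rightarrow> 'e \<Rightarrow> real"
  where "ext_covector x \<xi> = (SOME \<alpha>. \<alpha> \<in> sections M (dual_bundle A) UNIV \<and> \<alpha> x = \<xi>)"

lemma
  assumes "\<xi> \<in> dual_fibre (fibre A x)"
  shows ext_covector_section: "ext_covector x \<xi> \<in> sections M (dual_bundle A) UNIV"
    and ext_covector_at: "ext_covector x \<xi> x = \<xi>"
proof -
  have "\<exists>\<alpha>. \<alpha> \<in> sections M (dual_bundle A) UNIV \<and> \<alpha> x = \<xi>"
    by (rule smooth_bundle.section_through[OF A.bundle_dual, of \<xi> x]) (use assms in \<open>auto simp: fibre_dual\<close>)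
  from someI_ex[OF this]
  show "ext_covector x \<xi> \<in> sections M (dual_bundle A) UNIV" "ext_covector x \<xi> x = \<xi>"
    unfolding ext_covector_def by blast+
qed

definition piA :: "'p \<Rightarrow> ('e \<Rightarrow> real) list \<Rightarrow> real"
  where "piA x \<xi>s = (if length \<xi>s = 2 \<and> set \<xi>s \<subseteq> dual_fibre (fibre A x)
    then (\<xi>s ! 1) (lifted_sharp (ext_covector x (\<xi>s ! 0)) x) else 0)"

text \<open>Skew-symmetry shows that \<open>lifted_sharp\<close> is tensorial, so that the choice of the extension is
  irrelevant.\<close>

lemma piA_eq:
  assumes \<alpha>: "\<alpha> \<in> sections M (dual_bundle A) UNIV" and \<eta>: "\<eta> \<in> dual_fibre (fibre A x)"
  shows "piA x [\<alpha> x, \<eta>] = \<eta> (lifted_sharp \<alpha> x)"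
proof -
  have a: "\<alpha> x \<in> dual_fibre (fibre A x)" by (rule A.dual_section_fibre[OF \<alpha> UNIV_I])
  let ?a = "ext_covector x (\<alpha> x)" and ?b = "ext_covector x \<eta>"
  note as = ext_covector_section[OF a] and bs = ext_covector_section[OF \<eta>]
  have "piA x [\<alpha> x, \<eta>] = ?b x (lifted_sharp ?a x)" using a \<eta> by (simp add: piA_def ext_covector_at)
  also have "\<dots> = - ?a x (lifted_sharp ?b x)" by (rule lifted_sharp_skew[OF as bs])
  also have "\<dots> = - \<alpha> x (lifted_sharp ?b x)" by (simp add: ext_covector_at[OF a])
  also have "\<dots> = ?b x (lifted_sharp \<alpha> x)" by (rule lifted_sharp_skew[OF \<alpha> bs, symmetric])
  finally show ?thesis by (simp add: ext_covector_at[OF \<eta>])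
qed

lemma piA_fibre: "piA x \<in> ext_fibre 2 (fibre A x)"
proof (rule ext2I)
  show "piA x \<xi>s = 0" if "\<not> (length \<xi>s = 2 \<and> set \<xi>s \<subseteq> dual_fibre (fibre A x))" for \<xi>s
    using that by (auto simp: piA_def)
  fix \<alpha> \<beta> assume a: "\<alpha> \<in> dual_fibre (fibre A x)" and b: "\<beta> \<in> dual_fibre (fibre A x)"
  show "piA x [\<alpha>, \<beta>] = - piA x [\<beta>, \<alpha>]"
    using piA_eq[OF ext_covector_section[OF a] b] piA_eq[OF ext_covector_section[OF b] a]
      lifted_sharp_skew[OF ext_covector_section[OF a] ext_covector_section[OF b], of x]
    by (simp add: ext_covector_at[OF a] ext_covector_at[OF b])
  fix \<gamma> and r s :: real assume c: "\<gamma> \<in> dual_fibre (fibre A x)"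
  show "piA x [\<gamma>, r *\<^sub>R \<alpha> + s *\<^sub>R \<beta>] = r * piA x [\<gamma>, \<alpha>] + s * piA x [\<gamma>, \<beta>]"
    using piA_eq[OF ext_covector_section[OF c] a] piA_eq[OF ext_covector_section[OF c] b]
      piA_eq[OF ext_covector_section[OF c] dual_fibre_lin[OF a b, of r s]]
    by (simp add: ext_covector_at[OF c] scaleR_fun_def)
qed

lemma piA_section: "piA \<in> sections M (ext_power 2 A) UNIV"
proof (rule A.bivector_sectionsI[OF piA_fibre])
  fix V fs and i j :: nat assume V: "(V, fs) \<in> frames A" and ij: "i < length fs" "j < length fs"
  interpret Ad: smooth_bundle M "dual_bundle A" by (rule A.bundle_dual)
  note o = A.frame_open[OF V]
  show "smooth_fun M (UNIV \<inter> V) (\<lambda>x. piA x [coframe fs i x, coframe fs j x])"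
    unfolding Int_UNIV_left
  proof (rule smooth_fun_local[OF o])
    fix x assume x: "x \<in> V"
    obtain \<alpha> W where \<alpha>: "\<alpha> \<in> sections M (dual_bundle A) UNIV" "open W" "x \<in> W" "W \<subseteq> V" "\<And>y. y \<in> W \<Longrightarrow> \<alpha> y = coframe fs i y"
      by (rule Ad.section_extension[OF o x A.coframe_dual_section[OF V ij(1)]]) blast
    have "coframe fs j \<in> sections M (dual_bundle A) W"
      by (rule Ad.sections_subset[OF A.coframe_dual_section[OF V ij(2)] o \<alpha>(2,4)])
    then have "smooth_fun M W (\<lambda>y. coframe fs j y (lifted_sharp \<alpha> y))"
      using A.smooth_pairing[OF \<alpha>(2) _ A.sections_subset[OF lifted_sharp_section[OF \<alpha>(1)] open_UNIV \<alpha>(2)]] by simp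
    then have "smooth_fun M W (\<lambda>x. piA x [coframe fs i x, coframe fs j x])"
    proof (rule smooth_fun_cong[OF \<alpha>(2), rotated])
      fix y assume y: "y \<in> W"
      have "piA y [\<alpha> y, coframe fs j y] = coframe fs j y (lifted_sharp \<alpha> y)"
        by (rule piA_eq[OF \<alpha>(1) A.coframe_dual[OF V]]) (use y \<alpha>(4) in blast)
      then show "coframe fs j y (lifted_sharp \<alpha> y) = piA y [coframe fs i y, coframe fs j y]"
        using \<alpha>(5)[OF y] by simp
    qed
    then show "\<exists>W. open W \<and> x \<in> W \<and> smooth_fun M W (\<lambda>x. piA x [coframe fs i x, coframe fs j x])"
      using \<alpha> by blast
  qed
qed

lemma pull_section:
  assumes U: "open U" and \<xi>: "\<xi> \<in> sections M (dual_bundle TM) U"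
  shows "(\<lambda>x. \<xi> x \<circ> \<rho> x) \<in> sections M (dual_bundle A) U"
proof (rule A.dual_sectionsI_local[OF U])
  show "\<xi> x \<circ> \<rho> x \<in> dual_fibre (fibre A x)" if "x \<in> U" for x
    using pull_dual T.dual_section_fibre[OF \<xi> that] by (simp add: fibre_tangent)
  fix x assume x: "x \<in> U"
  obtain V fs where V: "(V, fs) \<in> frames A" "x \<in> V" by (rule A.frame_exists)
  have o: "open (U \<inter> V)" using U A.frame_open[OF V(1)] by blast
  have "smooth_fun M (U \<inter> V) (\<lambda>y. (\<xi> y \<circ> \<rho> y) ((fs ! i) y))" if "i < length fs" for i
    using T.smooth_pairing[OF o smooth_bundle.sections_subset[OF T.bundle_dual \<xi> U o Int_lower1]
        anchor_section[OF o A.sections_subset[OF A.frame_section[OF V(1) that] A.frame_open[OF V(1)] o Int_lower2]]]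
    by simp
  then show "\<exists>V es W. (V, es) \<in> frames A \<and> open W \<and> x \<in> W \<and> W \<subseteq> V \<and>
      (\<forall>i<length es. smooth_fun M W (\<lambda>y. (\<xi> y \<circ> \<rho> y) ((es ! i) y)))"
    using V o x by (intro exI[of _ V] exI[of _ fs] exI[of _ "U \<inter> V"]) auto
qed

text \<open>Over \<open>D\<close>, pushing undoes pulling back along the anchor, so both sides agree
  there. To pass to all points the two covectors are first extended to global forms.\<close>

lemma piA_lifts: "ext_map TM \<rho> x (piA x) = \<pi> x"
proof
  fix \<xi>s
  show "ext_map TM \<rho> x (piA x) \<xi>s = \<pi> x \<xi>s"
  proof (cases "length \<xi>s = 2 \<and> set \<xi>s \<subseteq> dual_fibre (tangent_space M x)")
    case True
    then obtain \<xi> \<eta> where x: "\<xi>s = [\<xi>, \<eta>]" "\<xi> \<in> dual_fibre (tangent_space M x)" "\<eta> \<in> dual_fibre (tangent_space M x)"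
      by (auto simp: numeral_2_eq_2 length_Suc_conv)
    interpret Td: smooth_bundle M "dual_bundle TM" by (rule T.bundle_dual)
    obtain \<Xi> where \<Xi>: "\<Xi> \<in> sections M (dual_bundle TM) UNIV" "\<Xi> x = \<xi>"
      by (rule Td.section_through[of \<xi> x]) (use x in \<open>auto simp: fibre_dual fibre_tangent\<close>)
    obtain H where H: "H \<in> sections M (dual_bundle TM) UNIV" "H x = \<eta>"
      by (rule Td.section_through[of \<eta> x]) (use x in \<open>auto simp: fibre_dual fibre_tangent\<close>)
    let ?p = "\<lambda>\<Xi> y. \<Xi> y \<circ> \<rho> y"
    have eq: "?p H y (lifted_sharp (?p \<Xi>) y) = \<pi> y [\<Xi> y, H y]" for y
    proof (rule smooth_fun_eq_dense[OF open_UNIV _ _ dense_D _ UNIV_I])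
      show "smooth_fun M UNIV (\<lambda>y. ?p H y (lifted_sharp (?p \<Xi>) y))"
        by (rule A.smooth_pairing[OF open_UNIV pull_section[OF open_UNIV H(1)] lifted_sharp_section[OF pull_section[OF open_UNIV \<Xi>(1)]]])
      show "smooth_fun M UNIV (\<lambda>y. \<pi> y [\<Xi> y, H y])"
        by (rule T.smooth_bivector[OF open_UNIV pi_section \<Xi>(1) H(1)])
      fix y assume y: "y \<in> D"
      have d: "\<Xi> y \<in> dual_fibre (tangent_space M y)" "H y \<in> dual_fibre (tangent_space M y)"
        using T.dual_section_fibre[OF \<Xi>(1)] T.dual_section_fibre[OF H(1)] by (simp_all add: fibre_tangent)
      show "?p H y (lifted_sharp (?p \<Xi>) y) = \<pi> y [\<Xi> y, H y]"
        using lifted_sharp_D[OF pull_section[OF open_UNIV \<Xi>(1)] pull_dual[OF d(2)] y] push_pull[OF y d(1)] push_pull[OF y d(2)] by simp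
    qed
    show ?thesis
      using eq[of x] piA_eq[OF pull_section[OF open_UNIV \<Xi>(1)] pull_dual[OF x(3)]] x \<Xi> H
      by (simp add: ext_map_def fibre_dual fibre_tangent)
  next
    case False
    then show ?thesis
      using ext_fibre_outside[OF pi_fibre False] by (auto simp: ext_map_def fibre_dual fibre_tangent piA_def)
  qed
qed

subsection \<open>Lifts are Poisson\<close>

context
  fixes P
  assumes P: "P \<in> sections M (ext_power 2 A) UNIV" and lifts: "\<And>x. ext_map TM \<rho> x (P x) = \<pi> x"
begin

lemma lift_fibre: "P x \<in> ext_fibre 2 (fibre A x)"
  using A.bivector_fibre[OF P] by simp

lemma lift_eval:
  assumes "\<xi> \<in> dual_fibre (tangent_space M x)" "\<eta> \<in> dual_fibre (tangent_space M x)"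
  shows "P x [\<xi> \<circ> \<rho> x, \<eta> \<circ> \<rho> x] = \<pi> x [\<xi>, \<eta>]"
  using lifts[of x] assms by (auto simp: ext_map_def fibre_dual fibre_tangent dest!: fun_cong[where x="[\<xi>, \<eta>]"])

text \<open>Over \<open>D\<close> a lift is determined by \<pi>. Together with density this
  transfers every identity of \<pi> to any lift, not just to \<open>piA\<close>.\<close>

lemma lift_push:
  assumes x: "x \<in> D" and "\<alpha> \<in> dual_fibre (fibre A x)" "\<beta> \<in> dual_fibre (fibre A x)"
  shows "P x [\<alpha>, \<beta>] = \<pi> x [push x \<alpha>, push x \<beta>]"
  using lift_eval[OF push_dual[OF x assms(2)] push_dual[OF x assms(3)]] pull_push[OF x] assms by simp

text \<open>Covectors on the tangent space separate points, and pairing with one of them is pairing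
  in \<open>A\<close> with its pullback, which \<open>push\<close> undoes.\<close>

lemma anchor_sharp_lift:
  assumes x: "x \<in> D" and a: "\<alpha> \<in> dual_fibre (fibre A x)"
  shows "\<rho> x (sharp A P x \<alpha>) = sharp TM \<pi> x (push x \<alpha>)"
proof (rule T.sharp_eqI[where P=\<pi> and x=x, symmetric])
  have s: "sharp A P x \<alpha> \<in> fibre A x" by (rule A.sharp_fibre[where P=P and x=x, OF lift_fibre a])
  show "\<rho> x (sharp A P x \<alpha>) \<in> fibre TM x" using anchor_tangent[OF s] by (simp add: fibre_tangent)
  fix \<beta> assume "\<beta> \<in> dual_fibre (fibre TM x)"
  then have b: "\<beta> \<in> dual_fibre (tangent_space M x)" by (simp add: fibre_tangent)
  have "(\<beta> \<circ> \<rho> x) (sharp A P x \<alpha>) = P x [\<alpha>, \<beta> \<circ> \<rho> x]"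
    by (rule A.sharp_pairing[where P=P and x=x, OF lift_fibre a pull_dual[OF b]])
  also have "\<dots> = \<pi> x [push x \<alpha>, \<beta>]"
    using lift_push[OF x a pull_dual[OF b]] push_pull[OF x b] by simp
  finally show "\<beta> (\<rho> x (sharp A P x \<alpha>)) = \<pi> x [push x \<alpha>, \<beta>]" by simp
qed

lemma smooth_schouten_half:
  assumes \<alpha>: "\<alpha> \<in> sections M (dual_bundle A) UNIV" and \<beta>: "\<beta> \<in> sections M (dual_bundle A) UNIV"
    and \<gamma>: "\<gamma> \<in> sections M (dual_bundle A) UNIV"
  shows "smooth_fun M UNIV (schouten_half A P P \<alpha> \<beta> \<gamma>)"
proof -
  note s = A.sharp_section[OF open_UNIV P]
  have an: "smooth_fun M UNIV (\<lambda>x. \<rho> x (a x) f)" if "a \<in> sections M A UNIV" "smooth_fun M UNIV f" for a f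
    by (rule smooth_vector_field[OF open_UNIV anchor_section[OF open_UNIV that(1)] that(2)])
  show ?thesis
    unfolding schouten_half_def[abs_def] algebroid_d_def
    by (intro smooth_fun_diff open_UNIV an s A.smooth_bivector[OF open_UNIV P] A.smooth_pairing[OF open_UNIV]
        bracket_section \<alpha> \<beta> \<gamma>)
qed

text \<open>Over \<open>D\<close> the anchor intertwines sharp maps, pairings and brackets, so the
  two expressions match term by term. The pushed forms live over \<open>D\<close> only, while the
  Poisson condition for \<pi> tests global forms; hence the primed forms agree with them just near
  x, which suffices since all operations are local.\<close>

lemma schouten_half_push:
  assumes x: "x \<in> D"
    and \<alpha>: "\<alpha> \<in> sections M (dual_bundle A) UNIV" and \<beta>: "\<beta> \<in> sections M (dual_bundle A) UNIV"
    and \<gamma>: "\<gamma> \<in> sections M (dual_bundle A) UNIV"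
    and \<alpha>': "\<alpha>' \<in> sections M (dual_bundle TM) UNIV" and \<beta>': "\<beta>' \<in> sections M (dual_bundle TM) UNIV"
    and \<gamma>': "\<gamma>' \<in> sections M (dual_bundle TM) UNIV"
    and W: "open W" "x \<in> W" "W \<subseteq> D"
    and eq: "\<And>y. y \<in> W \<Longrightarrow> \<alpha>' y = push y (\<alpha> y)" "\<And>y. y \<in> W \<Longrightarrow> \<beta>' y = push y (\<beta> y)"
      "\<And>y. y \<in> W \<Longrightarrow> \<gamma>' y = push y (\<gamma> y)"
  shows "schouten_half A P P \<alpha> \<beta> \<gamma> x = schouten_half (tangent_algebroid M) \<pi> \<pi> \<alpha>' \<beta>' \<gamma>' x"
proof -
  have f: "\<delta> y \<in> dual_fibre (fibre A y)" if "\<delta> \<in> sections M (dual_bundle A) UNIV" for \<delta> y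
    using A.dual_section_fibre[OF that] by simp
  have sA: "(\<lambda>y. sharp A P y (\<delta> y)) \<in> sections M A UNIV" if "\<delta> \<in> sections M (dual_bundle A) UNIV" for \<delta>
    by (rule A.sharp_section[OF open_UNIV P that])
  have sT: "(\<lambda>y. sharp TM \<pi> y (\<delta> y)) \<in> sections M TM W" if "\<delta> \<in> sections M (dual_bundle TM) UNIV" for \<delta>
    by (rule T.sections_subset[OF T.sharp_section[OF open_UNIV pi_section that] open_UNIV W(1)]) simp
  have an: "\<rho> y (sharp A P y (\<delta> y)) = sharp TM \<pi> y (\<delta>' y)"
    if "\<delta> \<in> sections M (dual_bundle A) UNIV" "\<delta>' y = push y (\<delta> y)" "y \<in> W" for \<delta> \<delta>' y
    using anchor_sharp_lift[OF _ f[OF that(1)], of y] that W(3) by auto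
  have tan: "sharp TM \<pi> x (\<delta> x) \<in> tangent_space M x" if "\<delta> \<in> sections M (dual_bundle TM) UNIV" for \<delta>
    using field_tangent[OF sT[OF that] W(2)] .
  have sub: "\<delta> \<in> sections M (dual_bundle TM) W" if "\<delta> \<in> sections M (dual_bundle TM) UNIV" for \<delta>
    by (rule smooth_bundle.sections_subset[OF T.bundle_dual that open_UNIV W(1)]) simp
  have pair: "smooth_near M x (\<lambda>y. \<delta> y (sharp TM \<pi> y (\<epsilon> y)))"
    if "\<delta> \<in> sections M (dual_bundle TM) UNIV" "\<epsilon> \<in> sections M (dual_bundle TM) UNIV" for \<delta> \<epsilon>
    by (rule smooth_nearI[OF W(1) T.smooth_pairing[OF W(1) sub[OF that(1)] sT[OF that(2)]] W(2)])
  have t1: "sharp TM \<pi> x (\<alpha>' x) (\<lambda>y. \<pi> y [\<beta>' y, \<gamma>' y]) = sharp TM \<pi> x (\<alpha>' x) (\<lambda>y. P y [\<beta> y, \<gamma> y])"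
  proof (rule tangent_cong[OF tan[OF \<alpha>'] _ W(1,2)])
    show "smooth_near M x (\<lambda>y. \<pi> y [\<beta>' y, \<gamma>' y])"
      by (rule smooth_nearI[OF open_UNIV T.smooth_bivector[OF open_UNIV pi_section \<beta>' \<gamma>'] UNIV_I])
    show "\<pi> y [\<beta>' y, \<gamma>' y] = P y [\<beta> y, \<gamma> y]" if "y \<in> W" for y
      using lift_push[OF _ f[OF \<beta>] f[OF \<gamma>]] eq[OF that] that W(3) by auto
  qed
  have pe: "\<alpha>' y (sharp TM \<pi> y (\<delta>' y)) = \<alpha> y (sharp A P y (\<delta> y))"
    if "y \<in> W" "\<delta> \<in> sections M (dual_bundle A) UNIV" "\<delta>' y = push y (\<delta> y)" for \<delta> \<delta>' y
  proof -
    have "push y (\<alpha> y) (\<rho> y (sharp A P y (\<delta> y))) = \<alpha> y (sharp A P y (\<delta> y))"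
      by (rule push_anchor) (use that(1) W(3) A.sections_fibre[OF sA[OF that(2)]] in auto)
    then show ?thesis using an[of \<delta> \<delta>' y] that eq(1)[of y] by simp
  qed
  have t2: "sharp TM \<pi> x (\<beta>' x) (\<lambda>y. \<alpha>' y (sharp TM \<pi> y (\<gamma>' y))) = sharp TM \<pi> x (\<beta>' x) (\<lambda>y. \<alpha> y (sharp A P y (\<gamma> y)))"
    by (rule tangent_cong[OF tan[OF \<beta>'] pair[OF \<alpha>' \<gamma>'] W(1,2)]) (use pe \<gamma> eq in blast)
  have t3: "sharp TM \<pi> x (\<gamma>' x) (\<lambda>y. \<alpha>' y (sharp TM \<pi> y (\<beta>' y))) = sharp TM \<pi> x (\<gamma>' x) (\<lambda>y. \<alpha> y (sharp A P y (\<beta> y)))"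
    by (rule tangent_cong[OF tan[OF \<gamma>'] pair[OF \<alpha>' \<beta>'] W(1,2)]) (use pe \<beta> eq in blast)
  let ?b = "\<lambda>y. sharp A P y (\<beta> y)" and ?c = "\<lambda>y. sharp A P y (\<gamma> y)"
  let ?b' = "\<lambda>y. sharp TM \<pi> y (\<beta>' y)" and ?c' = "\<lambda>y. sharp TM \<pi> y (\<gamma>' y)"
  have "\<alpha> x (bracket A ?b ?c x) = push x (\<alpha> x) (\<rho> x (bracket A ?b ?c x))"
    by (rule push_anchor[OF x A.sections_fibre[OF bracket_section[OF sA[OF \<beta>] sA[OF \<gamma>]] UNIV_I], symmetric])
  also have "\<rho> x (bracket A ?b ?c x) = lie_bracket M (\<lambda>y. \<rho> y (?b y)) (\<lambda>y. \<rho> y (?c y)) x"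
    by (rule anchor_bracket[OF sA[OF \<beta>] sA[OF \<gamma>]])
  also have "\<dots> = lie_bracket M ?b' ?c' x"
    by (rule lie_bracket_cong[OF W(1,2) sT[OF \<beta>'] sT[OF \<gamma>'], symmetric]) (use an \<beta> \<gamma> eq in auto)
  finally have t4: "\<alpha> x (bracket A ?b ?c x) = \<alpha>' x (lie_bracket M ?b' ?c' x)" by (simp add: eq(1)[OF W(2)])
  show ?thesis
    unfolding schouten_half_def algebroid_d_def sharp_tangent_algebroid bracket_tangent_algebroid
      anchor_tangent_algebroid[OF tan[OF \<alpha>']] anchor_tangent_algebroid[OF tan[OF \<beta>']] anchor_tangent_algebroid[OF tan[OF \<gamma>']]
    by (simp only: t1 t2 t3 t4 an[of \<alpha> \<alpha>' x, OF \<alpha> eq(1)[OF W(2)] W(2)] an[of \<beta> \<beta>' x, OF \<beta> eq(2)[OF W(2)] W(2)]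
        an[of \<gamma> \<gamma>' x, OF \<gamma> eq(3)[OF W(2)] W(2)])
qed

text \<open>Vanishing over \<open>D\<close> is the Poisson condition for \<pi>, transported by the
  anchor; the Schouten expression is smooth, so it vanishes everywhere.\<close>

lemma lift_poisson: "poisson M A P"
  unfolding poisson_def
proof (intro conjI P ballI allI)
  fix \<alpha> \<beta> \<gamma> x
  assume \<alpha>: "\<alpha> \<in> sections M (dual_bundle A) UNIV" and \<beta>: "\<beta> \<in> sections M (dual_bundle A) UNIV"
    and \<gamma>: "\<gamma> \<in> sections M (dual_bundle A) UNIV"
  show "schouten A P P \<alpha> \<beta> \<gamma> x = 0"
  proof (rule smooth_fun_eq_dense[OF open_UNIV _ smooth_fun_const[OF open_UNIV] dense_D _ UNIV_I])
    show "smooth_fun M UNIV (schouten A P P \<alpha> \<beta> \<gamma>)"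
      unfolding schouten_def[abs_def]
      by (intro smooth_fun_add open_UNIV smooth_schouten_half \<alpha> \<beta> \<gamma>)
    fix y assume y: "y \<in> D"
    interpret Td: smooth_bundle M "dual_bundle TM" by (rule T.bundle_dual)
    have ex: "\<exists>\<delta>' W. \<delta>' \<in> sections M (dual_bundle TM) UNIV \<and> open W \<and> y \<in> W \<and> W \<subseteq> D \<and> (\<forall>z\<in>W. \<delta>' z = push z (\<delta> z))"
      if "\<delta> \<in> sections M (dual_bundle A) UNIV" for \<delta>
      by (rule Td.section_extension[OF open_D y, of "\<lambda>z. push z (\<delta> z)"])
        (use push_section[OF open_UNIV that] in auto)
    obtain \<alpha>' W1 where 1: "\<alpha>' \<in> sections M (dual_bundle TM) UNIV" "open W1" "y \<in> W1" "W1 \<subseteq> D" "\<forall>z\<in>W1. \<alpha>' z = push z (\<alpha> z)"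
      using ex[OF \<alpha>] by blast
    obtain \<beta>' W2 where 2: "\<beta>' \<in> sections M (dual_bundle TM) UNIV" "open W2" "y \<in> W2" "\<forall>z\<in>W2. \<beta>' z = push z (\<beta> z)"
      using ex[OF \<beta>] by blast
    obtain \<gamma>' W3 where 3: "\<gamma>' \<in> sections M (dual_bundle TM) UNIV" "open W3" "y \<in> W3" "\<forall>z\<in>W3. \<gamma>' z = push z (\<gamma> z)"
      using ex[OF \<gamma>] by blast
    define W where "W = W1 \<inter> W2 \<inter> W3"
    have W: "open W" "y \<in> W" "W \<subseteq> D" using 1 2 3 by (auto simp: W_def)
    have e: "\<alpha>' z = push z (\<alpha> z)" "\<beta>' z = push z (\<beta> z)" "\<gamma>' z = push z (\<gamma> z)" if "z \<in> W" for z
      using that 1 2 3 by (auto simp: W_def)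
    have "schouten (tangent_algebroid M) \<pi> \<pi> \<alpha>' \<beta>' \<gamma>' y = 0"
      using poisson 1(1) 2(1) 3(1) by (simp add: poisson_def dual_tangent_algebroid)
    moreover have "schouten_half A P P \<alpha> \<beta> \<gamma> y = schouten_half (tangent_algebroid M) \<pi> \<pi> \<alpha>' \<beta>' \<gamma>' y"
      by (rule schouten_half_push[OF y \<alpha> \<beta> \<gamma> 1(1) 2(1) 3(1) W]) (use e in auto)
    moreover have "schouten_half A P P \<beta> \<gamma> \<alpha> y = schouten_half (tangent_algebroid M) \<pi> \<pi> \<beta>' \<gamma>' \<alpha>' y"
      by (rule schouten_half_push[OF y \<beta> \<gamma> \<alpha> 2(1) 3(1) 1(1) W]) (use e in auto)
    moreover have "schouten_half A P P \<gamma> \<alpha> \<beta> y = schouten_half (tangent_algebroid M) \<pi> \<pi> \<gamma>' \<alpha>' \<beta>' y"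
      by (rule schouten_half_push[OF y \<gamma> \<alpha> \<beta> 3(1) 1(1) 2(1) W]) (use e in auto)
    ultimately show "schouten A P P \<alpha> \<beta> \<gamma> y = 0" unfolding schouten_def by simp
  qed
qed

end

lemma piA_is_lift: "is_lift M A piA \<pi>"
  unfolding is_lift_def using lift_poisson[OF piA_section piA_lifts] piA_lifts by blast

end

section \<open>Nondegenerate bivectors\<close>

text \<open>The standard symplectic matrix with 2 by 2 blocks on the index pairs (2i, 2i + 1). This
  pairing matches the one in \<open>bivector_power\<close>.\<close>

definition gram_std :: "nat \<Rightarrow> nat \<Rightarrow> real"
  where "gram_std i j = (if even i \<and> j = i + 1 then 1 else if odd i \<and> i = j + 1 then - 1 else 0)"

text \<open>The other index of the same block: the only row in which column j of
  \<open>gram_std\<close> is nonzero.\<close>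

definition partner :: "nat \<Rightarrow> nat"
  where "partner j = (if even j then j + 1 else j - 1)"

lemma partner_partner: "partner (partner j) = j"
  by (cases j) (auto simp: partner_def)

lemma even_partner: "even (partner j) \<longleftrightarrow> odd j"
  by (auto simp: partner_def)

lemma partner_less: "j < 2 * n \<Longrightarrow> partner j < 2 * n"
  unfolding partner_def by presburger

lemma gram_std_partner: "gram_std k j = (if k = partner j then if even j then - 1 else 1 else 0)"
proof (cases "even j")
  case True
  then have "\<not> (even k \<and> j = k + 1)" "odd k \<and> k = j + 1 \<longleftrightarrow> k = j + 1" by auto
  then show ?thesis using True by (auto simp: gram_std_def partner_def)
next
  case False
  then have "even k \<and> j = k + 1 \<longleftrightarrow> k = j - 1" "\<not> (odd k \<and> k = j + 1)" by (presburger, auto)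
  then show ?thesis using False by (auto simp: gram_std_def partner_def)
qed

text \<open>A trivial kernel is the form of nondegeneracy that the symplectic Gram-Schmidt process
  consumes; \<open>sharp_bij_iff_nondegenerate\<close> translates it.\<close>

definition nondegenerate :: "'e::real_vector set \<Rightarrow> (('e \<Rightarrow> real) list \<Rightarrow> real) \<Rightarrow> bool"
  where "nondegenerate S Q \<longleftrightarrow> (\<forall>\<xi>\<in>dual_fibre S. (\<forall>\<eta>\<in>dual_fibre S. Q [\<xi>, \<eta>] = 0) \<longrightarrow> \<xi> = 0)"

context
  fixes S :: "'e::real_vector set" and Q :: "('e \<Rightarrow> real) list \<Rightarrow> real" and vs :: "'e list" and n :: nat
  assumes vs: "basis_of vs S" "length vs = 2 * n" and Q: "Q \<in> ext_fibre 2 S"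
begin

lemma dim_dual: "dim (dual_fibre S) = 2 * n"
  using basis_of_dim[OF coord_basis_dual[OF vs(1)]] vs(2) by simp

lemma orthogonal_correction:
  assumes us: "length us = 2 * m" "set us \<subseteq> dual_fibre S"
    and G: "\<And>i j. i < 2 * m \<Longrightarrow> j < 2 * m \<Longrightarrow> Q [us ! i, us ! j] = gram_std i j"
    and w: "w \<in> dual_fibre S"
  obtains c where "\<And>j. j < 2 * m \<Longrightarrow> Q [w + (\<Sum>k<2 * m. c k *\<^sub>R (us ! k)), us ! j] = 0"
proof -
  \<comment> \<open>Chosen so that the sum pairs with us ! j to - Q(w, us ! j): only the partner of
    j contributes, and the sign inverts that entry of \<open>gram_std\<close>.\<close>
  define c where "c k = (if even k then - 1 else 1) * Q [w, us ! partner k]" for k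
  have ud: "us ! k \<in> dual_fibre S" if "k < 2 * m" for k using us that by auto
  have sd: "(\<Sum>k<2 * m. c k *\<^sub>R (us ! k)) \<in> dual_fibre S" by (rule dual_fibre_sum) (use ud in auto)
  have "Q [w + (\<Sum>k<2 * m. c k *\<^sub>R (us ! k)), us ! j] = 0" if j: "j < 2 * m" for j
  proof -
    have "(\<Sum>k<2 * m. c k * gram_std k j) = (\<Sum>k<2 * m. if k = partner j then - Q [w, us ! j] else 0)"
      by (rule sum.cong) (auto simp: gram_std_partner c_def partner_partner even_partner)
    then have s: "(\<Sum>k<2 * m. c k * gram_std k j) = - Q [w, us ! j]" using partner_less[OF j] by simp
    have "Q [1 *\<^sub>R w + 1 *\<^sub>R (\<Sum>k<2 * m. c k *\<^sub>R (us ! k)), us ! j] = Q [w, us ! j] + (\<Sum>k<2 * m. c k * Q [us ! k, us ! j])"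
      unfolding ext2_lin(1)[OF Q w sd ud[OF j]]
      by (subst ext2_sum(1)[OF Q _ ud[OF j]]; use ud in auto)
    moreover have "(\<Sum>k<2 * m. c k * Q [us ! k, us ! j]) = (\<Sum>k<2 * m. c k * gram_std k j)"
      by (rule sum.cong) (use G j in auto)
    ultimately show ?thesis using s by (simp only: scaleR_one)
  qed
  then show thesis by (rule that)
qed

text \<open>Symplectic Gram-Schmidt on the dual space. Each step takes a vector outside the current
  span, makes it orthogonal to the previous ones, finds a vector pairing nontrivially with it by
  nondegeneracy, normalises that one and makes it orthogonal as well.\<close>

lemma symplectic_basis:
  assumes nd: "nondegenerate S Q"
  obtains us where "length us = 2 * n" "set us \<subseteq> dual_fibre S"
    "\<And>i j. i < 2 * n \<Longrightarrow> j < 2 * n \<Longrightarrow> Q [us ! i, us ! j] = gram_std i j"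
proof -
  have "\<exists>us. length us = 2 * m \<and> set us \<subseteq> dual_fibre S \<and> (\<forall>i<2 * m. \<forall>j<2 * m. Q [us ! i, us ! j] = gram_std i j)"
    if "m \<le> n" for m
    using that
  proof (induction m)
    case 0
    show ?case by (rule exI[of _ "[]"]) simp
  next
    case (Suc m)
    then obtain us where us: "length us = 2 * m" "set us \<subseteq> dual_fibre S"
      and G: "\<And>i j. i < 2 * m \<Longrightarrow> j < 2 * m \<Longrightarrow> Q [us ! i, us ! j] = gram_std i j" by auto
    have ud: "us ! k \<in> dual_fibre S" if "k < 2 * m" for k using us that by auto
    have "\<not> dual_fibre S \<subseteq> span (set us)"
    proof
      assume "dual_fibre S \<subseteq> span (set us)"
      then have "dim (dual_fibre S) \<le> card (set us)" by (rule dim_le_card) simp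
      also have "\<dots> \<le> 2 * m" using card_length[of us] us(1) by simp
      finally show False using dim_dual Suc.prems by simp
    qed
    then obtain v where v: "v \<in> dual_fibre S" "v \<notin> span (set us)" by blast
    obtain c where c: "\<And>j. j < 2 * m \<Longrightarrow> Q [v + (\<Sum>k<2 * m. c k *\<^sub>R (us ! k)), us ! j] = 0"
      by (rule orthogonal_correction[OF us G v(1)]) blast+
    define a where "a = v + (\<Sum>k<2 * m. c k *\<^sub>R (us ! k))"
    have sp: "(\<Sum>k<2 * m. c k *\<^sub>R (us ! k)) \<in> span (set us)"
      by (intro span_sum span_scale span_base) (use us in auto)
    have a: "a \<in> dual_fibre S" unfolding a_def
      by (intro subspace_add[OF subspace_dual_fibre] v(1) dual_fibre_sum ud) simp
    have "a \<noteq> 0"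
    proof
      assume "a = 0"
      then have "v = - (\<Sum>k<2 * m. c k *\<^sub>R (us ! k))" unfolding a_def by (rule eq_neg_iff_add_eq_0[THEN iffD2])
      then have "v \<in> span (set us)" by (simp only: span_neg[OF sp])
      then show False using v(2) by blast
    qed
    then obtain t where t: "t \<in> dual_fibre S" "Q [a, t] \<noteq> 0" using nd a unfolding nondegenerate_def by blast
    define t' where "t' = (1 / Q [a, t]) *\<^sub>R t"
    have t': "t' \<in> dual_fibre S" unfolding t'_def by (rule subspace_scale[OF subspace_dual_fibre t(1)])
    have at': "Q [a, t'] = 1"
      using ext2_lin(2)[OF Q t(1) t(1) a, of "1 / Q [a, t]" 0] t(2) by (simp add: t'_def)
    obtain d where d: "\<And>j. j < 2 * m \<Longrightarrow> Q [t' + (\<Sum>k<2 * m. d k *\<^sub>R (us ! k)), us ! j] = 0"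
      by (rule orthogonal_correction[OF us G t']) blast+
    define b where "b = t' + (\<Sum>k<2 * m. d k *\<^sub>R (us ! k))"
    have sd: "(\<Sum>k<2 * m. d k *\<^sub>R (us ! k)) \<in> dual_fibre S" by (rule dual_fibre_sum) (use ud in auto)
    have b: "b \<in> dual_fibre S" unfolding b_def by (rule subspace_add[OF subspace_dual_fibre t' sd])
    have au: "Q [a, us ! j] = 0" "Q [us ! j, a] = 0" if "j < 2 * m" for j
      using c[OF that] ext2_skew[OF Q, of "us ! j" a] by (simp_all only: a_def[symmetric] minus_zero)
    have bu: "Q [b, us ! j] = 0" "Q [us ! j, b] = 0" if "j < 2 * m" for j
      using d[OF that] ext2_skew[OF Q, of "us ! j" b] by (simp_all only: b_def[symmetric] minus_zero)
    have "Q [a, 1 *\<^sub>R t' + 1 *\<^sub>R (\<Sum>k<2 * m. d k *\<^sub>R (us ! k))] = 1 * Q [a, t'] + 1 * Q [a, \<Sum>k<2 * m. d k *\<^sub>R (us ! k)]"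
      by (rule ext2_lin(2)[OF Q t' sd a])
    \<comment> \<open>Correcting \<open>t'\<close> changes it by a combination of the earlier
      vectors, to which \<open>a\<close> is already orthogonal; so the pairing with \<open>a\<close>
      stays 1.\<close>
    moreover have "Q [a, \<Sum>k<2 * m. d k *\<^sub>R (us ! k)] = (\<Sum>k<2 * m. d k * Q [a, us ! k])"
      by (rule ext2_sum(2)[OF Q _ a]) (use ud in auto)
    moreover have "\<dots> = 0" using au(1) by simp
    ultimately have ab: "Q [a, b] = 1" unfolding b_def using at' by (simp only: scaleR_one)
    have ba: "Q [b, a] = - 1" using ext2_skew[OF Q, of b a] ab by simp
    let ?us = "us @ [a, b]"
    have nth: "?us ! k = (if k < 2 * m then us ! k else if k = 2 * m then a else b)" if "k < 2 * Suc m" for k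
      using that us(1) by (auto simp: nth_append nth_Cons' less_Suc_eq)
    have "Q [?us ! i, ?us ! j] = gram_std i j" if ij: "i < 2 * Suc m" "j < 2 * Suc m" for i j
    proof -
      consider "i < 2 * m" "j < 2 * m" | "i < 2 * m" "j = 2 * m" | "i < 2 * m" "j = 2 * m + 1"
        | "i = 2 * m" "j < 2 * m" | "i = 2 * m + 1" "j < 2 * m" | "i = 2 * m" "j = 2 * m" | "i = 2 * m" "j = 2 * m + 1"
        | "i = 2 * m + 1" "j = 2 * m" | "i = 2 * m + 1" "j = 2 * m + 1"
      proof -
        have "i < 2 * m \<or> i = 2 * m \<or> i = 2 * m + 1" "j < 2 * m \<or> j = 2 * m \<or> j = 2 * m + 1" using ij by auto
        then show thesis using that by blast
      qed
      then show ?thesis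
      proof cases
        case 2
        then have "\<not> (even i \<and> j = i + 1)" "i \<noteq> j + 1" by (presburger, simp)
        then show ?thesis using 2 nth[OF ij(1)] nth[OF ij(2)] au by (auto simp: gram_std_def)
      next
        case 5
        then have "\<not> (odd i \<and> i = j + 1)" "j \<noteq> i + 1" by (simp_all)
        then show ?thesis using 5 nth[OF ij(1)] nth[OF ij(2)] bu by (auto simp: gram_std_def)
      qed (use nth[OF ij(1)] nth[OF ij(2)] G au bu ab ba ext2_self[OF Q] in \<open>auto simp: gram_std_def\<close>)
    qed
    moreover have "length ?us = 2 * Suc m" "set ?us \<subseteq> dual_fibre S" using us a b by auto
    ultimately show ?case by blast
  qed
  from this[of n] show thesis using that by auto
qed

lemma gram_std_row: "i < 2 * n \<Longrightarrow> \<exists>j<2 * n. gram_std i j \<noteq> 0 \<and> (\<forall>k. k \<noteq> i \<longrightarrow> gram_std k j = 0)"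
  by (intro exI[of _ "partner i"]) (auto simp: gram_std_partner partner_partner partner_less)

text \<open>Pairing a linear relation with the partner of us ! i isolates the i-th coefficient, so
  the 2n vectors are independent; the dual space has dimension 2n, so they span it.\<close>

lemma symplectic_spans:
  assumes us: "length us = 2 * n" "set us \<subseteq> dual_fibre S"
    and G: "\<And>i j. i < 2 * n \<Longrightarrow> j < 2 * n \<Longrightarrow> Q [us ! i, us ! j] = gram_std i j"
  shows "dual_fibre S \<subseteq> span (set us)"
proof
  have ud: "us ! k \<in> dual_fibre S" if "k < 2 * n" for k using us that by auto
  have zero: "c i = 0" if c: "(\<Sum>k<2 * n. c k *\<^sub>R (us ! k)) = 0" and i: "i < 2 * n" for c i
  proof -
    obtain j where j: "j < 2 * n" "gram_std i j \<noteq> 0" "\<forall>k. k \<noteq> i \<longrightarrow> gram_std k j = 0" using gram_std_row[OF i] by blast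
    have "0 = Q [0 *\<^sub>R us ! j + 0 *\<^sub>R us ! j, us ! j]"
      unfolding ext2_lin(1)[OF Q ud[OF j(1)] ud[OF j(1)] ud[OF j(1)]] by simp
    also have "\<dots> = Q [\<Sum>k<2 * n. c k *\<^sub>R (us ! k), us ! j]" unfolding c by (simp only: scaleR_zero_left add_0_left)
    also have "\<dots> = (\<Sum>k<2 * n. c k * Q [us ! k, us ! j])"
      by (rule ext2_sum(1)[OF Q _ ud[OF j(1)]]) (use ud in auto)
    also have "\<dots> = (\<Sum>k<2 * n. if k = i then c i * gram_std i j else 0)"
      by (rule sum.cong) (use G j in auto)
    finally show "c i = 0" using i j(2) by simp
  qed
  have dist: "distinct us"
    unfolding distinct_conv_nth
  proof (intro allI impI notI)
    fix i j assume ij: "i < length us" "j < length us" "i \<noteq> j" "us ! i = us ! j"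
    then obtain k where k: "k < 2 * n" "gram_std i k \<noteq> 0" "\<forall>l. l \<noteq> i \<longrightarrow> gram_std l k = 0"
      using gram_std_row[of i] us(1) by auto
    then show False using G[of i k] G[of j k] ij us(1) by auto
  qed
  have ind: "independent (set us)"
  proof
    assume "dependent (set us)"
    then obtain f v where f: "(\<Sum>v\<in>set us. f v *\<^sub>R v) = 0" "v \<in> set us" "f v \<noteq> 0"
      using real_vector.dependent_finite[of "set us"] by auto
    have "(\<Sum>v\<in>set us. f v *\<^sub>R v) = (\<Sum>k<2 * n. f (us ! k) *\<^sub>R (us ! k))"
      by (rule sum.reindex_bij_betw[symmetric]) (use dist us(1) in \<open>simp add: bij_betw_nth lessThan_atLeast0\<close>)
    then have "(\<Sum>k<2 * n. f (us ! k) *\<^sub>R (us ! k)) = 0" using f(1) by (simp only:)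
    moreover obtain i where "i < 2 * n" "v = us ! i" using f(2) us(1) by (auto simp: in_set_conv_nth)
    ultimately show False using zero[of "\<lambda>k. f (us ! k)" i] f(3) by simp
  qed
  fix v assume v: "v \<in> dual_fibre S"
  show "v \<in> span (set us)"
  proof (rule ccontr)
    assume nv: "v \<notin> span (set us)"
    let ?B = "set (map (coord vs) [0..<length vs])"
    have B: "independent ?B" "span ?B = dual_fibre S" "card ?B = 2 * n"
      using coord_basis_dual[OF vs(1)] vs(2) unfolding basis_of_def by (auto simp del: set_map simp: distinct_card)
    have "independent (insert v (set us))" by (rule real_vector.independent_insertI[OF nv ind])
    moreover have "insert v (set us) \<subseteq> span ?B" unfolding B(2) using v us(2) by simp
    ultimately have "card (insert v (set us)) \<le> card ?B"
      by (rule conjunct2[OF real_vector.independent_span_bound[OF finite_set]])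
    moreover have "v \<notin> set us" by (rule notI) (rule notE[OF nv span_base])
    ultimately show False using B(3) distinct_card[OF dist] us(1) by simp
  qed
qed

end

text \<open>Put a nonzero kernel covector into a slot m of the dual basis where its coordinate is
  nonzero. Every product in the power then contains a factor involving it, so the value is 0; by
  \<open>ext_fibre_comb\<close> that value is a nonzero multiple of the one on the dual basis, and
  the power vanishes altogether.\<close>

lemma bivector_power_kernel:
  assumes b: "basis_of vs (fibre E x)" "length vs = 2 * n" and P: "P x \<in> ext_fibre 2 (fibre E x)"
    and nz: "bivector_power n E P x \<noteq> 0"
  shows "nondegenerate (fibre E x) (P x)"
  unfolding nondegenerate_def
proof (intro ballI impI, rule ccontr)
  fix \<xi> assume \<xi>: "\<xi> \<in> dual_fibre (fibre E x)" "\<forall>\<eta>\<in>dual_fibre (fibre E x). P x [\<xi>, \<eta>] = 0" "\<xi> \<noteq> 0"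
  let ?w = "bivector_power n E P x"
  note w = bivector_power_in_ext_fibre[where P=P and x=x, OF P, of n]
  define \<epsilon>s where "\<epsilon>s = map (coord vs) [0..<2 * n]"
  have \<epsilon>: "length \<epsilon>s = 2 * n" "set \<epsilon>s \<subseteq> dual_fibre (fibre E x)" "dual_fibre (fibre E x) \<subseteq> span (set \<epsilon>s)"
    using coord_dual[OF b(1)] coord_basis_dual[OF b(1)] b(2) by (auto simp: \<epsilon>s_def basis_of_def)
  have ex: "\<xi> = (\<Sum>i<2 * n. \<xi> (vs ! i) *\<^sub>R (\<epsilon>s ! i))"
    using dual_expand[OF b(1) \<xi>(1)] b(2) by (simp add: \<epsilon>s_def)
  have "\<exists>m<2 * n. \<xi> (vs ! m) \<noteq> 0"
  proof (rule ccontr)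
    assume "\<not> (\<exists>m<2 * n. \<xi> (vs ! m) \<noteq> 0)"
    then have "(\<Sum>i<2 * n. \<xi> (vs ! i) *\<^sub>R (\<epsilon>s ! i)) = 0" by simp
    then show False using ex \<xi>(3) by (simp only:)
  qed
  then obtain m where m: "m < 2 * n" "\<xi> (vs ! m) \<noteq> 0" by blast
  have comb: "?w (\<epsilon>s[m := \<Sum>i<2 * n. \<xi> (vs ! i) *\<^sub>R (\<epsilon>s ! i)]) = \<xi> (vs ! m) * ?w \<epsilon>s"
    by (rule ext_fibre_comb[OF w \<epsilon>(1,2) m(1)])
  define \<zeta>s where "\<zeta>s = \<epsilon>s[m := \<xi>]"
  have \<zeta>: "length \<zeta>s = 2 * n" "set \<zeta>s \<subseteq> dual_fibre (fibre E x)" "\<zeta>s ! m = \<xi>"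
    using \<epsilon> m(1) \<xi>(1) set_update_subset_insert[of \<epsilon>s m \<xi>] by (auto simp: \<zeta>s_def)
  have z: "(\<Prod>i<n. P x [\<zeta>s ! p (2 * i), \<zeta>s ! p (2 * i + 1)]) = 0" if p: "p permutes {..<2 * n}" for p
  proof -
    define q where "q = inv p m"
    have q: "p q = m" "q < 2 * n"
      using permutes_inverses[OF p] permutes_in_image[OF permutes_inv[OF p], of m] m(1) by (auto simp: q_def)
    define i where "i = q div 2"
    have i: "i < n" using q(2) by (auto simp: i_def)
    have "p (2 * i) < 2 * n" "p (2 * i + 1) < 2 * n"
      using permutes_in_image[OF p, of "2 * i"] permutes_in_image[OF p, of "2 * i + 1"] i by auto
    then have d: "\<zeta>s ! p (2 * i) \<in> dual_fibre (fibre E x)" "\<zeta>s ! p (2 * i + 1) \<in> dual_fibre (fibre E x)"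
      using \<zeta> by auto
    have "q = 2 * i \<or> q = 2 * i + 1" by (auto simp: i_def)
    then have "P x [\<zeta>s ! p (2 * i), \<zeta>s ! p (2 * i + 1)] = 0"
    proof
      assume "q = 2 * i"
      then show ?thesis using \<xi>(2) d(2) q(1) \<zeta>(3) by auto
    next
      assume "q = 2 * i + 1"
      then show ?thesis using \<xi>(2) d(1) q(1) \<zeta>(3) ext2_skew[OF P, of "\<zeta>s ! p (2 * i)" \<xi>] by auto
    qed
    then show ?thesis using i by (auto intro!: prod_zero)
  qed
  have "(\<Sum>p | p permutes {..<2 * n}. of_int (sign p) * (\<Prod>i<n. P x [\<zeta>s ! p (2 * i), \<zeta>s ! p (2 * i + 1)])) = 0"
  proof (rule sum.neutral, rule ballI)
    fix p assume "p \<in> {p. p permutes {..<2 * n}}"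
    then have "(\<Prod>i<n. P x [\<zeta>s ! p (2 * i), \<zeta>s ! p (2 * i + 1)]) = 0" by (intro z) simp
    then show "of_int (sign p) * (\<Prod>i<n. P x [\<zeta>s ! p (2 * i), \<zeta>s ! p (2 * i + 1)]) = 0" by (simp only: mult_zero_right)
  qed
  then have "?w \<zeta>s = 0" by (simp only: bivector_power_def div_0 if_cancel)
  then have "?w \<epsilon>s = 0" using comb m(2) ex by (simp add: \<zeta>s_def)
  then show False using ext_fibre_vanish[OF w \<epsilon>] nz by blast
qed

text \<open>In symplectic bases both bivectors have the same matrix, so their powers take the same
  value there. On the first bundle that value is nonzero, because a top form vanishing on a spanning
  list is 0.\<close>

lemma bivector_power_nonzero_transfer:
  assumes E: "basis_of vs (fibre E x)" "length vs = 2 * n" "P x \<in> ext_fibre 2 (fibre E x)"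
    and nz: "bivector_power n E P x \<noteq> 0"
    and F: "basis_of us (fibre F y)" "length us = 2 * n" "R y \<in> ext_fibre 2 (fibre F y)" "nondegenerate (fibre F y) (R y)"
  shows "bivector_power n F R y \<noteq> 0"
proof -
  obtain es where es: "length es = 2 * n" "set es \<subseteq> dual_fibre (fibre E x)"
    "\<And>i j. i < 2 * n \<Longrightarrow> j < 2 * n \<Longrightarrow> P x [es ! i, es ! j] = gram_std i j"
    by (rule symplectic_basis[OF E bivector_power_kernel[OF E nz]]) blast+
  obtain fs where fs: "length fs = 2 * n" "set fs \<subseteq> dual_fibre (fibre F y)"
    "\<And>i j. i < 2 * n \<Longrightarrow> j < 2 * n \<Longrightarrow> R y [fs ! i, fs ! j] = gram_std i j"
    by (rule symplectic_basis[OF F]) blast+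
  have "bivector_power n E P x es \<noteq> 0"
    using ext_fibre_vanish[OF bivector_power_in_ext_fibre[where P=P and x=x, OF E(3)] es(1,2) symplectic_spans[OF E es]] nz by blast
  moreover have "bivector_power n E P x es = bivector_power n F R y fs"
  proof -
    have "(\<Prod>i<n. P x [es ! p (2 * i), es ! p (2 * i + 1)]) = (\<Prod>i<n. R y [fs ! p (2 * i), fs ! p (2 * i + 1)])"
      if p: "p permutes {..<2 * n}" for p
    proof (rule prod.cong[OF refl])
      fix i assume "i \<in> {..<n}"
      then have "p (2 * i) < 2 * n" "p (2 * i + 1) < 2 * n"
        using permutes_in_image[OF p, of "2 * i"] permutes_in_image[OF p, of "2 * i + 1"] by auto
      then show "P x [es ! p (2 * i), es ! p (2 * i + 1)] = R y [fs ! p (2 * i), fs ! p (2 * i + 1)]"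
        using es(3) fs(3) by simp
    qed
    then show ?thesis using es fs by (simp add: bivector_power_def fibre_dual)
  qed
  ultimately show ?thesis by auto
qed

lemma (in smooth_bundle) sharp_bij_iff_nondegenerate:
  assumes V: "(V, fs) \<in> frames E" "x \<in> V" "length fs = 2 * n" and P: "P x \<in> ext_fibre 2 (fibre E x)"
  shows "bij_betw (sharp E P x) (dual_fibre (fibre E x)) (fibre E x) \<longleftrightarrow> nondegenerate (fibre E x) (P x)"
proof
  assume bij: "bij_betw (sharp E P x) (dual_fibre (fibre E x)) (fibre E x)"
  have "sharp E P x \<xi> = 0" if "\<forall>\<eta>\<in>dual_fibre (fibre E x). P x [\<xi>, \<eta>] = 0" for \<xi>
    by (rule sharp_eqI[where P=P and x=x])
      (use that subspace_0[OF fibre_subspace] hom_fibre_zero[OF _ fibre_subspace] in auto)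
  moreover have "0 \<in> dual_fibre (fibre E x)" by (rule subspace_0[OF subspace_dual_fibre])
  moreover have "P x [0, \<eta>] = 0" if "\<eta> \<in> dual_fibre (fibre E x)" for \<eta>
    using ext2_lin(1)[OF P that that that, of 0 0] by simp
  ultimately show "nondegenerate (fibre E x) (P x)"
    using bij unfolding nondegenerate_def bij_betw_def inj_on_def by metis
next
  assume nd: "nondegenerate (fibre E x) (P x)"
  let ?vs = "map (\<lambda>e. e x) fs"
  have vs: "basis_of ?vs (fibre E x)" "length ?vs = 2 * n" using frame_basis[OF V(1,2)] V(3) by simp_all
  obtain us where us: "length us = 2 * n" "set us \<subseteq> dual_fibre (fibre E x)"
    "\<And>i j. i < 2 * n \<Longrightarrow> j < 2 * n \<Longrightarrow> P x [us ! i, us ! j] = gram_std i j"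
    by (rule symplectic_basis[OF vs P nd]) blast+
  have ud: "us ! k \<in> dual_fibre (fibre E x)" if "k < 2 * n" for k using us that by auto
  show "bij_betw (sharp E P x) (dual_fibre (fibre E x)) (fibre E x)"
    unfolding bij_betw_def
  proof
    show "inj_on (sharp E P x) (dual_fibre (fibre E x))"
    proof (rule inj_onI)
      fix \<xi> \<mu> assume *: "\<xi> \<in> dual_fibre (fibre E x)" "\<mu> \<in> dual_fibre (fibre E x)" "sharp E P x \<xi> = sharp E P x \<mu>"
      have "P x [1 *\<^sub>R \<xi> + (-1) *\<^sub>R \<mu>, \<eta>] = 0" if \<eta>: "\<eta> \<in> dual_fibre (fibre E x)" for \<eta>
        using ext2_lin(1)[OF P *(1,2) \<eta>, of 1 "-1"] sharp_pairing[where P=P and x=x, OF P *(1) \<eta>]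
          sharp_pairing[where P=P and x=x, OF P *(2) \<eta>] *(3) by simp
      then have "1 *\<^sub>R \<xi> + (-1) *\<^sub>R \<mu> = 0" using nd dual_fibre_lin[OF *(1,2)] unfolding nondegenerate_def by blast
      then have "\<xi> - \<mu> = 0" by (simp only: scaleR_one scaleR_minus_left diff_conv_add_uminus)
      then show "\<xi> = \<mu>" by (simp only: right_minus_eq)
    qed
    show "sharp E P x ` dual_fibre (fibre E x) = fibre E x"
    proof
      show "sharp E P x ` dual_fibre (fibre E x) \<subseteq> fibre E x" using sharp_fibre[where P=P and x=x, OF P] by blast
      show "fibre E x \<subseteq> sharp E P x ` dual_fibre (fibre E x)"
      proof
        fix v assume v: "v \<in> fibre E x"
        \<comment> \<open>Coefficients of the preimage of v in the symplectic basis.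
          \<open>gram_std\<close> is an orthogonal matrix, so its transpose inverts it;
          \<open>gg\<close> states this.\<close>
        define c where "c k = (\<Sum>l<2 * n. gram_std k l * (us ! l) v)" for k
        define \<xi> where "\<xi> = (\<Sum>k<2 * n. c k *\<^sub>R (us ! k))"
        have \<xi>d: "\<xi> \<in> dual_fibre (fibre E x)" unfolding \<xi>_def by (rule dual_fibre_sum) (use ud in auto)
        have gg: "(\<Sum>k<2 * n. gram_std k l * gram_std k j) = (if l = j then 1 else 0)" if "l < 2 * n" "j < 2 * n" for l j
        proof -
          have "(\<Sum>k<2 * n. gram_std k l * gram_std k j) = (\<Sum>k<2 * n. if k = partner j then (if l = j then 1 else 0) else 0)"
            by (rule sum.cong) (auto simp: gram_std_partner, metis partner_partner)
          then show ?thesis using partner_less[OF that(2)] by simp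
        qed
        have uj: "(us ! j) v = P x [\<xi>, us ! j]" if j: "j < 2 * n" for j
        proof -
          have "P x [\<xi>, us ! j] = (\<Sum>k<2 * n. c k * P x [us ! k, us ! j])"
            unfolding \<xi>_def by (rule ext2_sum(1)[OF P _ ud[OF j]]) (use ud in auto)
          also have "\<dots> = (\<Sum>k<2 * n. \<Sum>l<2 * n. (us ! l) v * (gram_std k l * gram_std k j))"
            using us(3) j by (simp add: c_def sum_distrib_right sum_distrib_left mult_ac)
          also have "\<dots> = (\<Sum>l<2 * n. (us ! l) v * (\<Sum>k<2 * n. gram_std k l * gram_std k j))"
            by (subst sum.swap) (simp add: sum_distrib_left)
          also have "\<dots> = (\<Sum>l<2 * n. if l = j then (us ! j) v else 0)"
            by (rule sum.cong) (use gg j in auto)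
          finally show ?thesis using j by simp
        qed
        have "\<beta> v = P x [\<xi>, \<beta>]" if \<beta>: "\<beta> \<in> dual_fibre (fibre E x)" for \<beta>
        proof -
          have "\<beta> \<in> span (set us)" using symplectic_spans[OF vs P us] \<beta> by blast
          then have "\<beta> v = P x [\<xi>, \<beta>] \<and> \<beta> \<in> dual_fibre (fibre E x)"
          proof (induction rule: span_induct_alt)
            case base
            have "P x [\<xi>, 0] = 0" using ext2_lin(2)[OF P \<xi>d \<xi>d \<xi>d, of 0 0] by simp
            then show ?case using subspace_0[OF subspace_dual_fibre] by (simp add: zero_fun_def)
          next
            case (step r u \<gamma>)
            then obtain j where j: "j < 2 * n" "u = us ! j" using us(1) by (auto simp: in_set_conv_nth)
            have "P x [\<xi>, r *\<^sub>R u + 1 *\<^sub>R \<gamma>] = r * P x [\<xi>, u] + 1 * P x [\<xi>, \<gamma>]"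
              by (rule ext2_lin(2)[OF P]) (use step ud j \<xi>d in auto)
            moreover have "r *\<^sub>R u + 1 *\<^sub>R \<gamma> \<in> dual_fibre (fibre E x)"
              by (rule dual_fibre_lin) (use step ud j in auto)
            ultimately show ?case using step uj[OF j(1)] j(2)
              by (simp only: scaleR_one) (simp add: scaleR_fun_def plus_fun_def)
          qed
          then show ?thesis by blast
        qed
        then have "sharp E P x \<xi> = v" by (intro sharp_eqI[where P=P and x=x] v) auto
        then show "v \<in> sharp E P x ` dual_fibre (fibre E x)" using \<xi>d by blast
      qed
    qed
  qed
qed

section \<open>Nondegenerate lifts and standard ideals\<close>

sublocale ideal_algebroid \<subseteq> LA: smooth_line_bundle M "det_bundle A"
  by (rule A.line_bundle_det)

sublocale ideal_algebroid \<subseteq> H: line_bundle_pair M "det_bundle A" "det_bundle (tangent_bundle M)"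
  by (intro line_bundle_pair.intro A.line_bundle_det T.line_bundle_det)

sublocale ideal_algebroid \<subseteq> HL: smooth_line_bundle M "hom_bundle (det_bundle A) (det_bundle (tangent_bundle M))"
  by (rule H.line_bundle_hom)

context ideal_algebroid
begin

abbreviation "det_anchor \<equiv> det_map A TM \<rho>"

lemma fibre_det_A: "fibre (det_bundle A) x = ext_fibre (2 * n) (fibre A x)"
  by (rule A.frame_exists[of x]) (simp add: A.fibre_det rank_A)

lemma fibre_det_TM: "fibre (det_bundle TM) x = ext_fibre (2 * n) (tangent_space M x)"
  by (rule T.frame_exists[of x]) (simp add: T.fibre_det tangent_rank fibre_tangent)

lemma ext_map_anchor:
  assumes w: "w \<in> ext_fibre k (fibre A x)"
  shows "ext_map TM \<rho> x w \<in> ext_fibre k (tangent_space M x)"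
  unfolding ext_fibre_def
proof (intro CollectI conjI allI impI; (elim conjE)?)
  fix \<xi>s :: "((('p \<Rightarrow> real) \<Rightarrow> real) \<Rightarrow> real) list"
  show "ext_map TM \<rho> x w \<xi>s = 0" if "\<not> (length \<xi>s = k \<and> set \<xi>s \<subseteq> dual_fibre (tangent_space M x))"
    using that ext_fibre_outside[OF w, of "map (\<lambda>\<xi>. \<xi> \<circ> \<rho> x) \<xi>s"] by (auto simp: ext_map_def fibre_dual fibre_tangent)
  show "ext_map TM \<rho> x w \<xi>s = 0" if "\<not> distinct \<xi>s"
    using that ext_fibre_distinct[OF w, of "map (\<lambda>\<xi>. \<xi> \<circ> \<rho> x) \<xi>s"] by (auto simp: ext_map_def distinct_map)
next
  fix \<xi>s and i :: nat and \<alpha> \<beta> and a b :: real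
  assume l: "length \<xi>s = k" "set \<xi>s \<subseteq> dual_fibre (tangent_space M x)" "i < k"
    and ab: "\<alpha> \<in> dual_fibre (tangent_space M x)" "\<beta> \<in> dual_fibre (tangent_space M x)"
  have s: "set (\<xi>s[i := \<gamma>]) \<subseteq> dual_fibre (tangent_space M x)" if "\<gamma> \<in> dual_fibre (tangent_space M x)" for \<gamma>
    using l(2) that set_update_subset_insert by fastforce
  have c: "(a *\<^sub>R \<alpha> + b *\<^sub>R \<beta>) \<circ> \<rho> x = a *\<^sub>R (\<alpha> \<circ> \<rho> x) + b *\<^sub>R (\<beta> \<circ> \<rho> x)"
    by (auto simp: scaleR_fun_def)
  have "w ((map (\<lambda>\<xi>. \<xi> \<circ> \<rho> x) \<xi>s)[i := a *\<^sub>R (\<alpha> \<circ> \<rho> x) + b *\<^sub>R (\<beta> \<circ> \<rho> x)])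
      = a * w ((map (\<lambda>\<xi>. \<xi> \<circ> \<rho> x) \<xi>s)[i := \<alpha> \<circ> \<rho> x]) + b * w ((map (\<lambda>\<xi>. \<xi> \<circ> \<rho> x) \<xi>s)[i := \<beta> \<circ> \<rho> x])"
    by (rule ext_fibre_lin[OF w]) (use l pull_dual ab in auto)
  then show "ext_map TM \<rho> x w (\<xi>s[i := a *\<^sub>R \<alpha> + b *\<^sub>R \<beta>]) = a * ext_map TM \<rho> x w (\<xi>s[i := \<alpha>]) + b * ext_map TM \<rho> x w (\<xi>s[i := \<beta>])"
    using s[OF ab(1)] s[OF ab(2)] s[OF dual_fibre_lin[OF ab, of a b]]
    by (simp only: ext_map_def fibre_dual fibre_tangent map_update c if_True)
qed

lemma det_anchor_hom: "det_anchor x \<in> hom_fibre (fibre (det_bundle A) x) (fibre (det_bundle TM) x)"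
proof -
  have "a *\<^sub>R v + b *\<^sub>R w \<in> fibre (det_bundle A) x" if "v \<in> fibre (det_bundle A) x" "w \<in> fibre (det_bundle A) x" for v w a b
    by (intro subspace_add subspace_scale LA.fibre_subspace that)
  then show ?thesis
    using ext_map_anchor[of _ "2 * n" x]
    by (auto simp: hom_fibre_def det_map_def ext_map_def fibre_det_A fibre_det_TM scaleR_fun_def)
qed

text \<open>The determinant of the anchor in the two frames: the generator g of the
  overview.\<close>

definition det_coeff :: "('p \<Rightarrow> 'e) list \<Rightarrow> ('p \<Rightarrow> ('p \<Rightarrow> real) \<Rightarrow> real) list \<Rightarrow> 'p \<Rightarrow> real"
  where "det_coeff fs es y = wedge A fs y (map (\<lambda>i. coframe es i y \<circ> \<rho> y) [0..<2 * n])"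

lemma det_coeff:
  assumes V: "(V, fs) \<in> frames A" "y \<in> V" and U: "(U, es) \<in> frames TM" "y \<in> U"
  shows "det_anchor y (wedge A fs y) (map (\<lambda>i. coframe es i y) [0..<2 * n]) = det_coeff fs es y"
    and "coframe [H.hom_frame [wedge A fs] [wedge TM es]] 0 y (det_anchor y) = det_coeff fs es y"
proof -
  have V': "(V, [wedge A fs]) \<in> frames (det_bundle A)" and U': "(U, [wedge TM es]) \<in> frames (det_bundle TM)"
    using V U by (auto simp: A.frames_det T.frames_det)
  note w = A.frame_wedge_in_fibre[OF V]
  show *: "det_anchor y (wedge A fs y) (map (\<lambda>i. coframe es i y) [0..<2 * n]) = det_coeff fs es y"
    using w T.coframe_dual[OF U] by (auto simp: det_map_def ext_map_def det_coeff_def fibre_dual o_def)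
  show "coframe [H.hom_frame [wedge A fs] [wedge TM es]] 0 y (det_anchor y) = det_coeff fs es y"
    using H.hom_coframe[OF V' V(2) U' U(2) det_anchor_hom]
      T.det_coframe[OF U hom_fibre_in[OF det_anchor_hom w]] * tangent_rank[OF U(1)] by simp
qed

lemma smooth_det_coeff:
  assumes V: "(V, fs) \<in> frames A" and U: "(U, es) \<in> frames TM"
  shows "smooth_fun M (V \<inter> U) (det_coeff fs es)"
\<comment> \<open>\<open>rank_A\<close> needs a point of the frame domain; on an empty domain the
  length of \<open>fs\<close> is not determined.\<close>
proof (cases "V = {}")
  case True
  then show ?thesis using smooth_fun_local[of "{}" "det_coeff fs es"] by simp
next
  case False
  then have len: "length fs = 2 * n" using rank_A[OF V] by blast
  have o: "open (V \<inter> U)" using A.frame_open[OF V] T.frame_open[OF U] by blast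
  have "smooth_fun M (V \<inter> U) (\<lambda>y. wedge A fs y (map (\<lambda>\<alpha>. \<alpha> y) (map (\<lambda>i y. coframe es i y \<circ> \<rho> y) [0..<2 * n])))"
  proof (rule A.smooth_wedge[OF o])
    show "\<alpha> \<in> sections M (dual_bundle A) (V \<inter> U)" if "\<alpha> \<in> set (map (\<lambda>i y. coframe es i y \<circ> \<rho> y) [0..<2 * n])" for \<alpha>
      using that pull_section[OF o coframe_section[OF U _ o Int_lower2]] tangent_rank[OF U] by auto
    show "s \<in> sections M A (V \<inter> U)" if "s \<in> set fs" for s
      using that A.sections_subset[OF A.frame_section[OF V] A.frame_open[OF V] o Int_lower1] by (auto simp: in_set_conv_nth)
  qed (simp add: len)
  then show ?thesis by (simp add: det_coeff_def[abs_def] o_def)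
qed

lemma det_anchor_section: "det_anchor \<in> sections M (hom_bundle (det_bundle A) (det_bundle TM)) UNIV"
proof (rule HL.sectionsI_local[OF open_UNIV])
  show "det_anchor x \<in> fibre (hom_bundle (det_bundle A) (det_bundle TM)) x" for x
    using det_anchor_hom by (simp add: H.fibre_hom)
  fix x
  obtain V fs where V: "(V, fs) \<in> frames A" "x \<in> V" by (rule A.frame_exists)
  obtain U es where U: "(U, es) \<in> frames TM" "x \<in> U" by (rule T.frame_exists)
  have o: "open (V \<inter> U)" using A.frame_open[OF V(1)] T.frame_open[OF U(1)] by blast
  have fr: "(V \<inter> U, [H.hom_frame [wedge A fs] [wedge TM es]]) \<in> frames (hom_bundle (det_bundle A) (det_bundle TM))"
    using V U unfolding H.frames_hom A.frames_det T.frames_det by blast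
  have "smooth_fun M (V \<inter> U) (\<lambda>y. coframe [H.hom_frame [wedge A fs] [wedge TM es]] 0 y (det_anchor y))"
    by (rule smooth_fun_cong[OF o _ smooth_det_coeff[OF V(1) U(1)]]) (use det_coeff(2)[OF V(1) _ U(1)] in auto)
  then show "\<exists>W hs W'. (W, hs) \<in> frames (hom_bundle (det_bundle A) (det_bundle TM)) \<and> open W' \<and> x \<in> W' \<and> W' \<subseteq> W \<and>
      (\<forall>i<length hs. smooth_fun M W' (\<lambda>y. coframe hs i y (det_anchor y)))"
    using fr o V U by (intro exI[of _ "V \<inter> U"] exI[of _ "[H.hom_frame [wedge A fs] [wedge TM es]]"]) auto
qed

section \<open>The top power of an arbitrary lift and the factorisation f = h g\<close>

context
  fixes P
  assumes P: "P \<in> sections M (ext_power 2 A) UNIV" and lifts: "\<And>x. ext_map TM \<rho> x (P x) = \<pi> x"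
begin

abbreviation "powA \<equiv> bivector_power n A P"

lemma powA_fibre: "powA x \<in> fibre (det_bundle A) x"
  unfolding fibre_det_A by (rule bivector_power_in_ext_fibre[where P=P and x=x, OF lift_fibre[OF P lifts]])

text \<open>Naturality of the power: \<pi> on two covectors is \<open>P\<close> on their pullbacks,
  factor by factor.\<close>

lemma pi_top_det_anchor: "pi_top x = det_anchor x (powA x)"
proof
  fix \<xi>s
  have "det_anchor x (powA x) \<xi>s = ext_map TM \<rho> x (powA x) \<xi>s" using powA_fibre by (simp add: det_map_def)
  also have "\<dots> = pi_top x \<xi>s"
  proof (cases "length \<xi>s = 2 * n \<and> set \<xi>s \<subseteq> dual_fibre (tangent_space M x)")
    case True
    have "(\<Prod>i<n. P x [map (\<lambda>\<xi>. \<xi> \<circ> \<rho> x) \<xi>s ! p (2 * i), map (\<lambda>\<xi>. \<xi> \<circ> \<rho> x) \<xi>s ! p (2 * i + 1)])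
        = (\<Prod>i<n. \<pi> x [\<xi>s ! p (2 * i), \<xi>s ! p (2 * i + 1)])" if p: "p permutes {..<2 * n}" for p
    proof (rule prod.cong[OF refl])
      fix i assume "i \<in> {..<n}"
      then have "p (2 * i) < length \<xi>s" "p (2 * i + 1) < length \<xi>s"
        using permutes_in_image[OF p, of "2 * i"] permutes_in_image[OF p, of "2 * i + 1"] True by auto
      moreover from this have "\<xi>s ! p (2 * i) \<in> dual_fibre (tangent_space M x)" "\<xi>s ! p (2 * i + 1) \<in> dual_fibre (tangent_space M x)"
        using True nth_mem by blast+
      ultimately show "P x [map (\<lambda>\<xi>. \<xi> \<circ> \<rho> x) \<xi>s ! p (2 * i), map (\<lambda>\<xi>. \<xi> \<circ> \<rho> x) \<xi>s ! p (2 * i + 1)]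
          = \<pi> x [\<xi>s ! p (2 * i), \<xi>s ! p (2 * i + 1)]" using lift_eval[OF P lifts] by simp
    qed
    moreover have "set (map (\<lambda>\<xi>. \<xi> \<circ> \<rho> x) \<xi>s) \<subseteq> dual_fibre (fibre A x)" using True pull_dual by auto
    ultimately show ?thesis using True
      by (simp add: ext_map_def pi_top_def bivector_power_def fibre_dual fibre_tangent)
  next
    case False
    then show ?thesis by (auto simp: ext_map_def pi_top_def bivector_power_def fibre_dual fibre_tangent)
  qed
  finally show "pi_top x \<xi>s = det_anchor x (powA x) \<xi>s" by simp
qed

lemma det_anchor_nonzero: "x \<in> D \<Longrightarrow> det_anchor x \<noteq> 0"
  using pi_top_det_anchor[of x] D_pi_top[of x] by auto

text \<open>The factor h of the overview: the coordinate of the n-th power of the lift in the frame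
  \<open>fs\<close>.\<close>

definition lift_coeff :: "('p \<Rightarrow> 'e) list \<Rightarrow> 'p \<Rightarrow> real"
  where "lift_coeff fs y = powA y (map (\<lambda>i. coframe fs i y) [0..<2 * n])"

lemma powA_expand: "(V, fs) \<in> frames A \<Longrightarrow> y \<in> V \<Longrightarrow> powA y = lift_coeff fs y *\<^sub>R wedge A fs y"
  using A.det_expand[of V fs y "powA y"] powA_fibre rank_A by (simp add: lift_coeff_def)

lemma smooth_lift_coeff:
  assumes V: "(V, fs) \<in> frames A"
  shows "smooth_fun M V (lift_coeff fs)"
proof (cases "V = {}")
  case True
  then show ?thesis using smooth_fun_local[of "{}" "lift_coeff fs"] by simp
next
  case False
  then have len: "length fs = 2 * n" using rank_A[OF V] by blast
  have "smooth_fun M V (\<lambda>y. powA y (map (\<lambda>\<alpha>. \<alpha> y) (map (coframe fs) [0..<2 * n])))"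
    by (rule A.smooth_bivector_power[OF A.frame_open[OF V] A.bivector_restrict[OF P]])
      (use A.coframe_dual_section[OF V] len in auto)
  then show ?thesis by (simp add: lift_coeff_def[abs_def] o_def)
qed

lemma pf_factor:
  assumes V: "(V, fs) \<in> frames A" "y \<in> V" and U: "(U, es) \<in> frames TM" "y \<in> U"
  shows "pf es y = lift_coeff fs y * det_coeff fs es y"
proof -
  have "pi_top y = lift_coeff fs y *\<^sub>R det_anchor y (wedge A fs y)"
    unfolding pi_top_det_anchor powA_expand[OF V]
    by (rule hom_fibre_scale[OF det_anchor_hom A.frame_wedge_in_fibre[OF V]])
  then show ?thesis using det_coeff(1)[OF V U] by (simp add: pf_def scaleR_fun_def)
qed

text \<open>When h is invertible, multiples of g = f / h and of f are the same locally.
  \<open>divisor_ideal_localI\<close> upgrades both local inclusions to global ones; its dense set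
  is \<open>D\<close>, where f = h g is nonzero and hence so is g.\<close>

lemma nonvanishing_imp_standard:
  assumes nz: "\<And>x. powA x \<noteq> 0"
  shows "standard_ideal M I A"
proof -
  have lc: "lift_coeff fs y \<noteq> 0" if "(V, fs) \<in> frames A" "y \<in> V" for V fs y
    using powA_expand[OF that] nz[of y] by auto
  have "a \<in> I" if a: "a \<in> algebroid_divisor_ideal M A" for a
    unfolding I_divisor_ideal
  proof (rule L.divisor_ideal_localI[OF pi_top_section dense_D D_pi_top])
    fix x
    obtain V fs where V: "(V, fs) \<in> frames A" "x \<in> V" by (rule A.frame_exists)
    obtain U es where U: "(U, es) \<in> frames TM" "x \<in> U" by (rule T.frame_exists)
    have o: "open (V \<inter> U)" using A.frame_open[OF V(1)] T.frame_open[OF U(1)] by blast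
    have fr: "(V \<inter> U, [H.hom_frame [wedge A fs] [wedge TM es]]) \<in> frames (hom_bundle (det_bundle A) (det_bundle TM))"
      using V U unfolding H.frames_hom A.frames_det T.frames_det by blast
    obtain k where k: "smooth_fun M (V \<inter> U) k"
      "\<And>y. y \<in> V \<inter> U \<Longrightarrow> a y = k y * coframe [H.hom_frame [wedge A fs] [wedge TM es]] 0 y (det_anchor y)"
      by (rule HL.divisor_ideal_local[OF det_anchor_section fr a[unfolded algebroid_divisor_ideal_def]]) blast
    have s: "smooth_fun M (V \<inter> U) (\<lambda>y. k y / lift_coeff fs y)"
      by (rule smooth_fun_divide[OF o k(1) smooth_fun_subset[OF smooth_lift_coeff[OF V(1)]]]) (use lc V in auto)
    have "a y = k y / lift_coeff fs y * coframe [wedge TM es] 0 y (pi_top y)" if y: "y \<in> V \<inter> U" for y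
      using k(2)[OF y] det_coeff(2)[OF V(1) _ U(1), of y] pf_factor[OF V(1) _ U(1), of y] pf_coframe[OF U(1), of y]
        lc[OF V(1), of y] y by simp
    then show "\<exists>V' ws W k. (V', ws) \<in> frames (det_bundle TM) \<and> open W \<and> x \<in> W \<and> W \<subseteq> V' \<and> smooth_fun M W k \<and>
        (\<forall>y\<in>W. a y = k y * coframe ws 0 y (pi_top y))"
      using det_frame[OF U(1)] o V U s
      by (intro exI[of _ U] exI[of _ "[wedge TM es]"] exI[of _ "V \<inter> U"] exI[of _ "\<lambda>y. k y / lift_coeff fs y"]) auto
  qed
  moreover have "a \<in> algebroid_divisor_ideal M A" if a: "a \<in> I" for a
    unfolding algebroid_divisor_ideal_def
  proof (rule HL.divisor_ideal_localI[OF det_anchor_section dense_D det_anchor_nonzero])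
    fix x
    obtain V fs where V: "(V, fs) \<in> frames A" "x \<in> V" by (rule A.frame_exists)
    obtain U es where U: "(U, es) \<in> frames TM" "x \<in> U" by (rule T.frame_exists)
    have o: "open (V \<inter> U)" using A.frame_open[OF V(1)] T.frame_open[OF U(1)] by blast
    have fr: "(V \<inter> U, [H.hom_frame [wedge A fs] [wedge TM es]]) \<in> frames (hom_bundle (det_bundle A) (det_bundle TM))"
      using V U unfolding H.frames_hom A.frames_det T.frames_det by blast
    obtain k where k: "smooth_fun M U k" "\<And>y. y \<in> U \<Longrightarrow> a y = k y * pf es y" by (rule I_local[OF U(1) a]) blast
    have s: "smooth_fun M (V \<inter> U) (\<lambda>y. k y * lift_coeff fs y)"
      by (intro smooth_fun_mult o smooth_fun_subset[OF k(1)] smooth_fun_subset[OF smooth_lift_coeff[OF V(1)]]) auto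
    have "a y = k y * lift_coeff fs y * coframe [H.hom_frame [wedge A fs] [wedge TM es]] 0 y (det_anchor y)" if y: "y \<in> V \<inter> U" for y
      using k(2)[of y] det_coeff(2)[OF V(1) _ U(1), of y] pf_factor[OF V(1) _ U(1), of y] y by simp
    then show "\<exists>V' hs W k. (V', hs) \<in> frames (hom_bundle (det_bundle A) (det_bundle TM)) \<and> open W \<and> x \<in> W \<and> W \<subseteq> V' \<and>
        smooth_fun M W k \<and> (\<forall>y\<in>W. a y = k y * coframe hs 0 y (det_anchor y))"
      using fr o V U s by (intro exI[of _ "V \<inter> U"] exI[of _ "[H.hom_frame [wedge A fs] [wedge TM es]]"]
          exI[of _ "\<lambda>y. k y * lift_coeff fs y"]) auto
  qed
  ultimately show ?thesis unfolding standard_ideal_def by blast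
qed

text \<open>Near x the function g is the germ of an element of the ideal, so g = k f = k h g. Over
  \<open>D\<close> the factor g cancels, and by density k h = 1 also at x, which contradicts h(x) =
  0.\<close>

lemma standard_imp_nonvanishing:
  assumes std: "standard_ideal M I A"
  shows "powA x \<noteq> 0"
proof
  assume z: "powA x = 0"
  obtain V fs where V: "(V, fs) \<in> frames A" "x \<in> V" by (rule A.frame_exists)
  obtain U es where U: "(U, es) \<in> frames TM" "x \<in> U" by (rule T.frame_exists)
  have o: "open (V \<inter> U)" "x \<in> V \<inter> U" using A.frame_open[OF V(1)] T.frame_open[OF U(1)] V U by auto
  have fr: "(V \<inter> U, [H.hom_frame [wedge A fs] [wedge TM es]]) \<in> frames (hom_bundle (det_bundle A) (det_bundle TM))"
    using V U unfolding H.frames_hom A.frames_det T.frames_det by blast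
  obtain a W where a: "a \<in> divisor_ideal M (hom_bundle (det_bundle A) (det_bundle TM)) det_anchor"
    and W: "open W" "x \<in> W" "W \<subseteq> V \<inter> U"
    and aW: "\<And>y. y \<in> W \<Longrightarrow> a y = 1 * coframe [H.hom_frame [wedge A fs] [wedge TM es]] 0 y (det_anchor y)"
    by (rule HL.divisor_ideal_generate[OF det_anchor_section fr o order_refl smooth_fun_const[OF o(1), of 1]]) blast
  have "a \<in> I" using a std by (simp add: standard_ideal_def algebroid_divisor_ideal_def)
  then obtain k where k: "smooth_fun M U k" "\<And>y. y \<in> U \<Longrightarrow> a y = k y * pf es y" by (rule I_local[OF U(1)]) blast
  have eq: "k y * lift_coeff fs y = 1" if y: "y \<in> W" "y \<in> D" for y
  proof -
    have yy: "y \<in> V" "y \<in> U" using y W by auto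
    have "det_coeff fs es y = k y * (lift_coeff fs y * det_coeff fs es y)"
      using aW[OF y(1)] k(2)[OF yy(2)] det_coeff(2)[OF V(1) yy(1) U(1) yy(2)] pf_factor[OF V(1) yy(1) U(1) yy(2)] by simp
    moreover have "det_coeff fs es y \<noteq> 0"
      using pf_factor[OF V(1) yy(1) U(1) yy(2)] pf_nonzero[OF U(1) yy(2) y(2)] by auto
    ultimately show ?thesis by simp
  qed
  have "k x * lift_coeff fs x = 1"
  proof (rule smooth_fun_eq_dense[OF W(1) _ smooth_fun_const[OF W(1)] dense_D eq W(2)])
    show "smooth_fun M W (\<lambda>y. k y * lift_coeff fs y)"
      by (intro smooth_fun_mult W(1) smooth_fun_subset[OF k(1)] smooth_fun_subset[OF smooth_lift_coeff[OF V(1)]]) (use W in auto)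
  qed
  moreover have "lift_coeff fs x = 0" by (simp add: lift_coeff_def z)
  ultimately show False by simp
qed

lemma sharp_bij_iff_nonvanishing:
  "bij_betw (sharp A P x) (fibre (dual_bundle A) x) (fibre A x) \<longleftrightarrow> powA x \<noteq> 0"
proof -
  obtain V fs where V: "(V, fs) \<in> frames A" "x \<in> V" by (rule A.frame_exists)
  note len = rank_A[OF V] and Px = lift_fibre[OF P lifts, of x]
  have bA: "basis_of (map (\<lambda>e. e x) fs) (fibre A x)" "length (map (\<lambda>e. e x) fs) = 2 * n"
    using A.frame_basis[OF V] len by simp_all
  \<comment> \<open>At a point of \<open>D\<close> the power of \<pi> is known to be nonzero; it
    serves as the reference for the comparison with \<open>P\<close> at x.\<close>
  obtain y where y: "y \<in> D" using D_meets[OF open_UNIV UNIV_I] by blast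
  obtain U es where U: "(U, es) \<in> frames TM" "y \<in> U" by (rule T.frame_exists)
  have bT: "basis_of (map (\<lambda>e. e y) es) (fibre TM y)" "length (map (\<lambda>e. e y) es) = 2 * n"
    using T.frame_basis[OF U] tangent_rank[OF U(1)] by simp_all
  have piy: "\<pi> y \<in> ext_fibre 2 (fibre TM y)" using pi_fibre by (simp add: fibre_tangent)
  have nzy: "bivector_power n TM \<pi> y \<noteq> 0" using D_pi_top[OF y] by (simp add: pi_top_def)
  have "powA x \<noteq> 0 \<longleftrightarrow> nondegenerate (fibre A x) (P x)"
    using bivector_power_kernel[where P=P and x=x, OF bA Px]
      bivector_power_nonzero_transfer[where P=\<pi> and x=y and R=P and y=x, OF bT piy nzy bA Px] by blast
  then show ?thesis
    using A.sharp_bij_iff_nondegenerate[where P=P and x=x, OF V len Px] by (simp add: fibre_dual)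
qed

end

text \<open>The preceding equivalences hold for any lift: the given nondegenerate one is used in one
  direction, \<open>piA\<close> in the other.\<close>

lemma nondegenerate_iff_standard: "of_nondegenerate_algebroid_type M A \<pi> \<longleftrightarrow> standard_ideal M I A"
proof
  assume "of_nondegenerate_algebroid_type M A \<pi>"
  then obtain P where P: "is_lift M A P \<pi>" "\<forall>x. bij_betw (sharp A P x) (fibre (dual_bundle A) x) (fibre A x)"
    unfolding of_nondegenerate_algebroid_type_def by blast
  then have "P \<in> sections M (ext_power 2 A) UNIV" "\<And>x. ext_map TM \<rho> x (P x) = \<pi> x"
    by (auto simp: is_lift_def poisson_def)
  then show "standard_ideal M I A"
    using nonvanishing_imp_standard sharp_bij_iff_nonvanishing P(2) by blast
next
  assume "standard_ideal M I A"
  then have "bij_betw (sharp A piA x) (fibre (dual_bundle A) x) (fibre A x)" for x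
    using standard_imp_nonvanishing[OF piA_section piA_lifts] sharp_bij_iff_nonvanishing[OF piA_section piA_lifts] by blast
  then show "of_nondegenerate_algebroid_type M A \<pi>"
    unfolding of_nondegenerate_algebroid_type_def using piA_is_lift by blast
qed

end

theorem theorem1:
  fixes M :: "('p::{t2_space, second_countable_topology}, 'd::finite) atlas"
    and n :: nat
    and I :: "('p \<Rightarrow> real) set"
    and \<pi> :: "'p \<Rightarrow> ((('p \<Rightarrow> real) \<Rightarrow> real) \<Rightarrow> real) list \<Rightarrow> real"
    and A :: "('p, 'e::real_vector) lie_algebroid"
  assumes "smooth_manifold M"
    and "CARD('d) = 2 * n"
    and "is_divisor_ideal TYPE('l::real_vector) M I"
    and "projective_ideal TYPE('e) M I"
    and "poisson M (tangent_algebroid M) \<pi>"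
    and "of_divisor_type M n I \<pi>"
    and "ideal_lie_algebroid M I A"
    and "\<forall>x. \<exists>U \<alpha>s. open U \<and> x \<in> U \<and> local_frame M (dual_bundle A) U \<alpha>s \<and>
           (\<forall>\<alpha>\<in>set \<alpha>s. closed_on M A U \<alpha>)"
  shows "of_algebroid_type M A \<pi> \<and>
    (of_nondegenerate_algebroid_type M A \<pi> \<longleftrightarrow> standard_ideal M I A)"
proof -
  \<comment> \<open>Being of divisor type includes that the determinant of the tangent bundle is a
    line bundle. This is the assumption of \<open>tangent_manifold\<close>, from which the dimension
    of the tangent spaces is read off.\<close>
  have "vector_bundle M (det_bundle (tangent_bundle M))"
    using assms(6) by (simp add: of_divisor_type_def divisor_def line_bundle_def)
  then interpret ideal_algebroid M n I \<pi> A
    using assms by unfold_locales auto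
  show ?thesis
    using piA_is_lift nondegenerate_iff_standard by (auto simp: of_algebroid_type_def)
qed

end
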